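(* Let $n\ge 1$, $\alpha>-1$, $0<p\le 1$, let $\Phi\in\mathscr{L}_p$ and set $\rho(t)=\frac{1}{t\Phi^{-1}(1/t)}$. Then the topological dual space $\left(\mathcal A_\alpha^\Phi(\mathbb B^n)\right)^*$ of $\mathcal A_\alpha^\Phi(\mathbb B^n)$ identifies with $\Gamma_{\alpha,\rho}(\mathbb B^n)$ under the duality pairing $$\langle f,g\rangle_\alpha:=\lim_{r\to 1}\int_{\mathbb B^n} f(rz)\overline{g(z)}\,d\nu_\alpha(z),\qquad f\in\mathcal A_\alpha^\Phi(\mathbb B^n),\ g\in\Gamma_{\alpha,\rho}(\mathbb B^n).$$ That is, every $g\in\Gamma_{\alpha,\rho}(\mathbb B^n)$ defines a bounded linear functional $f\mapsto\langle f,g\rangle_\alpha$ on $\mathcal A_\alpha^\Phi(\mathbb B^n)$, and every bounded linear functional on $\mathcal A_\alpha^\Phi(\mathbb B^n)$ is of this form for a unique $g\in\Gamma_{\alpha,\rho}(\mathbb B^n)$.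
   Context: $\mathbb B^n$ is the unit ball of $\mathbb C^n$, $d\nu$ is Lebesgue measure on it, and $d\nu_\alpha(z)=c_\alpha(1-|z|^2)^\alpha d\nu(z)$ with $c_\alpha$ chosen so that $\nu_\alpha(\mathbb B^n)=1$. A growth function is a continuous non-decreasing function from $[0,\infty)$ onto itself. $\mathscr{L}_p$ ($0<p\le1$) is the set of growth functions $\Phi$ of lower type $p$ (there is $C>0$ with $\Phi(st)\le Ct^p\Phi(s)$ for all $s>0$, $0<t\le 1$) such that $t\mapsto\Phi(t)/t$ is non-increasing. Two growth functions are equivalent if $c\Phi_1(ct)\le\Phi_2(t)\le c^{-1}\Phi_1(c^{-1}t)$ for some constant $c>0$; equivalent functions define the same spaces, and by convention (replacing $\Phi$ by an equivalent function) any $\Phi\in\mathscr{L}_p$ is supposed concave and $C^1$ with $\Phi'(t)\simeq\Phi(t)/t$. $\mathcal A_\alpha^\Phi(\mathbb B^n)$ is the space of holomorphic $f$ on $\mathbb B^n$ with $\int_{\mathbb B^n}\Phi(|f|)\,d\nu_\alpha<\infty$, with the (quasi-)norm $\|f\|^{lux}_{\alpha,\Phi}=\inf\{\lambda>0:\int_{\mathbb B^n}\Phi(|f|/\lambda)\,d\nu_\alpha\le1\}$. $Rf(z)=\sum_{j=1}^n z_j\frac{\partial f}{\partial z_j}(z)$ is the radial derivative. A positive function $\rho$ is of upper type $\gamma$ on $[0,1]$ if there is $C$ with $\rho(st)\le Cs^\gamma\rho(t)$ for $s>1$, $st\le1$; for $\Phi\in\mathscr L_p$ the function $\rho(t)=\frac1{t\Phi^{-1}(1/t)}$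 is of upper type $\gamma=\frac1p-1$. For $\rho$ of upper type $\gamma$, $\Gamma_{\alpha,\rho}(\mathbb B^n)$ is the space of holomorphic $f$ on $\mathbb B^n$ such that for some integer $k>\gamma(n+1+\alpha)$ and some $C>0$, $|R^kf(z)|\le C(1-|z|^2)^{-k}\rho\big((1-|z|^2)^{n+1+\alpha}\big)$ for all $z\in\mathbb B^n$. The space does not depend on the choice of such $k$, and it is normed by $|f(0)|+\sup_z\frac{|R^kf(z)|(1-|z|^2)^k}{\rho((1-|z|^2)^{n+1+\alpha})}$. (For $\Phi(t)=t$, $\rho\equiv1$, $\gamma=0$, this is the Bloch space.) *)

theory Defs
  imports "HOL-Analysis.Analysis"
begin

text \<open>The unit ball of \<open>\<complex>\<^sup>n\<close> is \<open>ball 0 1 :: (complex^'n) set\<close>, with \<open>n = CARD('n)\<close>; the norm of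
  \<^typ>\<open>complex^'n\<close> is the Euclidean (Hermitian) one.  A function on the ball is represented by its
  extension by zero to the whole space.\<close>

definition holomorphic_Cn_on :: "(complex^'n \<Rightarrow> complex) \<Rightarrow> (complex^'n) set \<Rightarrow> bool" where
  "holomorphic_Cn_on f S \<longleftrightarrow>
     (\<forall>z\<in>S. \<exists>D. (f has_derivative D) (at z) \<and> (\<forall>c v. D (c *s v) = c * D v))"

definition hol_ball :: "(complex^'n \<Rightarrow> complex) set" where
  "hol_ball = {f. holomorphic_Cn_on f (ball 0 1) \<and> (\<forall>z. z \<notin> ball 0 1 \<longrightarrow> f z = 0)}"

definition complex_partial :: "'n \<Rightarrow> (complex^'n \<Rightarrow> complex) \<Rightarrow> complex^'n \<Rightarrow> complex" where
  "complex_partial j f z = deriv (\<lambda>w. f (z + w *s axis j 1)) 0"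

definition radial_deriv :: "(complex^'n \<Rightarrow> complex) \<Rightarrow> complex^'n \<Rightarrow> complex" where
  "radial_deriv f z = (\<Sum>j\<in>UNIV. z $ j * complex_partial j f z)"

text \<open>A measure on the whole space that is concentrated on the ball; \<open>c\<close> makes its total mass 1
  when \<open>\<alpha> > -1\<close>.\<close>

definition nu :: "real \<Rightarrow> (complex^'n) measure" where
  "nu \<alpha> =
     (let c = 1 / (LINT z:ball (0 :: complex^'n) 1|lborel. (1 - (norm z)\<^sup>2) powr \<alpha>)
      in density lborel
           (\<lambda>z. indicator (ball 0 1) z * ennreal (c * (1 - (norm z)\<^sup>2) powr \<alpha>)))"

text \<open>Only the values of a growth function on \<open>{0..}\<close> are meaningful.\<close>

definition growth_function :: "(real \<Rightarrow> real) \<Rightarrow> bool" where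
  "growth_function \<Phi> \<longleftrightarrow>
     continuous_on {0..} \<Phi> \<and> mono_on {0..} \<Phi> \<and> \<Phi> ` {0..} = {0..}"

definition lower_type :: "real \<Rightarrow> (real \<Rightarrow> real) \<Rightarrow> bool" where
  "lower_type p \<Phi> \<longleftrightarrow>
     (\<exists>C>0. \<forall>s>0. \<forall>t. 0 < t \<and> t \<le> 1 \<longrightarrow> \<Phi> (s * t) \<le> C * t powr p * \<Phi> s)"

definition growth_class :: "real \<Rightarrow> (real \<Rightarrow> real) set" where
  "growth_class p =
     {\<Phi>. growth_function \<Phi> \<and> lower_type p \<Phi> \<and> antimono_on {0<..} (\<lambda>t. \<Phi> t / t)}"

text \<open>For strictly increasing \<open>\<Phi>\<close> (in particular for concave \<open>\<Phi>\<close>) \<open>inv_into {0..} \<Phi>\<close> is the inverse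
  of \<open>\<Phi>\<close>.  A general member of the class may have plateaus, where a preimage is chosen; by the
  lower type condition all choices agree up to a constant factor, so \<open>\<rho>\<close> is determined
  up to constants, which do not affect the space \<open>Gamma_space\<close>.\<close>

definition rho_of :: "(real \<Rightarrow> real) \<Rightarrow> real \<Rightarrow> real" where
  "rho_of \<Phi> t = 1 / (t * inv_into {0..} \<Phi> (1 / t))"

definition bergman_orlicz :: "real \<Rightarrow> (real \<Rightarrow> real) \<Rightarrow> (complex^'n \<Rightarrow> complex) set" where
  "bergman_orlicz \<alpha> \<Phi> =
     {f \<in> hol_ball. (\<integral>\<^sup>+ z. ennreal (\<Phi> (norm (f z))) \<partial>nu \<alpha>) < \<infinity>}"

definition lux_norm :: "real \<Rightarrow> (real \<Rightarrow> real) \<Rightarrow> (complex^'n \<Rightarrow> complex) \<Rightarrow> real" where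
  "lux_norm \<alpha> \<Phi> f =
     Inf {l. l > 0 \<and> (\<integral>\<^sup>+ z. ennreal (\<Phi> (norm (f z) / l)) \<partial>nu \<alpha>) \<le> 1}"

text \<open>The parameter \<open>\<gamma>\<close> is an upper type of \<open>\<rho>\<close>.\<close>

definition Gamma_space ::
  "real \<Rightarrow> real \<Rightarrow> (real \<Rightarrow> real) \<Rightarrow> (complex^'n \<Rightarrow> complex) set" where
  "Gamma_space \<alpha> \<gamma> \<rho> =
     {g \<in> hol_ball. \<exists>k::nat. real k > \<gamma> * (real CARD('n) + 1 + \<alpha>) \<and>
        (\<exists>C>0. \<forall>z\<in>ball 0 1.
           norm ((radial_deriv ^^ k) g z)
             \<le> C * (1 - (norm z)\<^sup>2) powr (- real k)
                 * \<rho> ((1 - (norm z)\<^sup>2) powr (real CARD('n) + 1 + \<alpha>)))}"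

definition dilated_pairing ::
  "real \<Rightarrow> (complex^'n \<Rightarrow> complex) \<Rightarrow> (complex^'n \<Rightarrow> complex) \<Rightarrow> real \<Rightarrow> complex" where
  "dilated_pairing \<alpha> f g r = (\<integral>z. f (r *\<^sub>R z) * cnj (g z) \<partial>nu \<alpha>)"

definition pairing ::
  "real \<Rightarrow> (complex^'n \<Rightarrow> complex) \<Rightarrow> (complex^'n \<Rightarrow> complex) \<Rightarrow> complex" where
  "pairing \<alpha> f g = Lim (at_left 1) (dilated_pairing \<alpha> f g)"

text \<open>\<^const>\<open>lebesgue_integral\<close> and \<^const>\<open>Lim\<close> are total; this says that the integrals and the limit
  in \<^const>\<open>pairing\<close> really exist.\<close>

definition pairing_exists ::
  "real \<Rightarrow> (complex^'n \<Rightarrow> complex) \<Rightarrow> (complex^'n \<Rightarrow> complex) \<Rightarrow> bool" where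
  "pairing_exists \<alpha> f g \<longleftrightarrow>
     (\<forall>r\<in>{0<..<1}. integrable (nu \<alpha>) (\<lambda>z. f (r *\<^sub>R z) * cnj (g z))) \<and>
     (\<exists>L. (dilated_pairing \<alpha> f g \<longlongrightarrow> L) (at_left 1))"

text \<open>Only the values of \<open>T\<close> on the space matter.\<close>

definition bounded_functional ::
  "real \<Rightarrow> (real \<Rightarrow> real) \<Rightarrow> ((complex^'n \<Rightarrow> complex) \<Rightarrow> complex) \<Rightarrow> bool" where
  "bounded_functional \<alpha> \<Phi> T \<longleftrightarrow>
     (\<forall>f\<in>bergman_orlicz \<alpha> \<Phi>. \<forall>h\<in>bergman_orlicz \<alpha> \<Phi>. T (\<lambda>z. f z + h z) = T f + T h) \<and>
     (\<forall>c. \<forall>f\<in>bergman_orlicz \<alpha> \<Phi>. T (\<lambda>z. c * f z) = c * T f) \<and>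
     (\<exists>C. \<forall>f\<in>bergman_orlicz \<alpha> \<Phi>. norm (T f) \<le> C * lux_norm \<alpha> \<Phi> f)"

end

theory Submission
  imports Defs "HOL-Complex_Analysis.Cauchy_Integral_Formula" "HOL-Real_Asymp.Real_Asymp"
begin

text \<open>Put \<open>N = n + 1 + \<alpha>\<close> and \<open>K\<^sub>w z = (1 - \<langle>z, w\<rangle>) powr (- N)\<close>. The symbol of a functional \<open>T\<close> is
  \<open>g w = cnj (T K\<^sub>w)\<close>. Since \<open>R\<^sup>k g\<close> is a combination of the functions
  \<open>cnj (T ((1 - \<langle>z, w\<rangle>) powr (- N - i)))\<close> with \<open>i \<le> k\<close>, the Forelli-Rudin estimate for the
  Luxemburg norm of these kernels places \<open>g\<close> in \<open>\<Gamma>\<close>. The reproducing formula writes a dilate of \<open>f\<close>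
  as an integral of kernels, whence \<open>T f = \<langle>f, g\<rangle>\<close> because dilates converge to \<open>f\<close>. That in turn
  holds as \<open>\<Phi> |f|\<close> is dominated by a positive kernel operator applied to itself, which replaces the
  subharmonicity of \<open>\<Phi> |f|\<close> (\<open>\<Phi>\<close> is concave).

  Conversely, for \<open>g\<close> in \<open>\<Gamma>\<close> and \<open>D = (R + N) \<dots> (R + N + k - 1)\<close>, the functional
  \<open>f \<mapsto> \<integral> f cnj (D g)\<close> with weight \<open>\<alpha> + k\<close> is bounded, because the pointwise growth of \<open>f\<close> gives
  \<open>\<integral> |f| \<rho> ((1 - |z|\<^sup>2) powr N) d\<nu> \<le> C \<parallel>f\<parallel>\<close>. Its symbol has the same image under \<open>D\<close> as \<open>g\<close>, and \<open>D\<close>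
  is injective on holomorphic functions.\<close>

section \<open>The Hermitian product and isometries\<close>

text \<open>The condition \<open>k > (1 / p - 1) * N\<close> enters as
  \<open>p * (N + k) > N\<close>: lower type raises the modulus of the kernel of exponent
  \<open>N + k\<close> to the power \<open>p\<close>, and this is the range of the Forelli-Rudin
  estimate. \<open>N\<close> is the reproducing exponent because \<open>herm z u ^ j\<close>, for a
  unit vector \<open>u\<close>, has squared norm \<open>fact j / pochhammer N j\<close>, the
  reciprocal of a Taylor coefficient of \<open>kern N\<close>. The shape of \<open>D\<close> comes
  from the identity that \<open>R + s\<close> sends the kernel of exponent \<open>s\<close> to
  \<open>s\<close> times the kernel of exponent \<open>s + 1\<close>; so \<open>D\<close> carries
  the reproducing kernel of weight \<alpha> to a multiple of that of weight \<alpha> + k. The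
  estimates for \<Phi> rest on monotonicity, on the decrease of \<Phi>(t)/t and on lower type; the
  inverse of \<Phi> is only a right inverse. A finite supremum \<open>M\<close> is available a
  priori for dilates only, so the pointwise bound is proved uniformly in the dilation and then
  passed to the limit. A functional is first studied on bounded functions, where it is continuous
  for the supremum norm: kernels can then be differentiated and integrated under it by uniform
  approximation.\<close>

definition herm :: "complex^'n \<Rightarrow> complex^'n \<Rightarrow> complex" where
  "herm z w = (\<Sum>i\<in>UNIV. z $ i * cnj (w $ i))"

lemma herm_add_left: "herm (x + y) w = herm x w + herm y w"
  and herm_add_right: "herm w (x + y) = herm w x + herm w y"
  and herm_diff_left: "herm (x - y) w = herm x w - herm y w"
  and herm_diff_right: "herm w (x - y) = herm w x - herm w y"
  and herm_scale_left: "herm (c *s x) w = c * herm x w"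
  and herm_scale_right: "herm w (c *s x) = cnj c * herm w x"
  and herm_zero_left [simp]: "herm 0 w = 0"
  and herm_zero_right [simp]: "herm w 0 = 0"
  by (simp_all add: herm_def algebra_simps sum.distrib sum_distrib_left sum_subtractf)

lemma scaleR_eq_vscale: "r *\<^sub>R x = complex_of_real r *s (x :: complex^'n)"
  by (simp add: vec_eq_iff scaleR_conv_of_real[symmetric])

lemma herm_scaleR_left: "herm (r *\<^sub>R x) w = of_real r * herm x w"
  and herm_scaleR_right: "herm w (r *\<^sub>R x) = of_real r * herm w x"
  by (simp_all add: scaleR_eq_vscale herm_scale_left herm_scale_right)

lemma cnj_herm: "cnj (herm x y) = herm y x"
  by (simp add: herm_def mult.commute)

lemma Re_herm: "Re (herm x y) = x \<bullet> y"
  by (simp add: herm_def inner_vec_def inner_complex_def)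

lemma herm_self: "herm x x = of_real ((norm x)\<^sup>2)"
  using cnj_herm[of x x] by (simp add: complex_eq_iff Re_herm dot_square_norm)

lemma norm_vscale: "norm (c *s x) = norm c * norm (x :: complex^'n)"
proof -
  have "complex_of_real ((norm (c *s x))\<^sup>2) = of_real ((norm c * norm x)\<^sup>2)"
    unfolding herm_self[symmetric] herm_scale_left herm_scale_right
    by (simp only: herm_self power_mult_distrib mult.assoc[symmetric] mult.commute[of "cnj c" c]
        complex_norm_square[of c] of_real_mult)
  hence "(norm (c *s x))\<^sup>2 = (norm c * norm x)\<^sup>2" by (simp only: of_real_eq_iff)
  thus ?thesis by (simp add: power2_eq_iff_nonneg)
qed

lemma cnj_sgn_mult: "cnj (sgn h) * h = complex_of_real (norm h)"
proof (cases "h = 0")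
  case False
  have "cnj (sgn h) * h = h * cnj h / of_real (norm h)"
    by (simp add: sgn_eq mult.commute)
  also have "h * cnj h = of_real (norm h) * of_real (norm h)"
    by (simp add: complex_norm_square[symmetric] power2_eq_square)
  finally show ?thesis using False by simp
qed simp

text \<open>Multiplying \<open>x\<close> by a unimodular scalar makes the product real and
  non-negative; there it is the real inner product, and the real Cauchy-Schwarz inequality
  applies.\<close>

lemma norm_herm_le: "norm (herm x y) \<le> norm x * norm (y :: complex^'n)"
proof (cases "herm x y = 0")
  case False
  define c where "c = cnj (sgn (herm x y))"
  have c: "norm c = 1" using False by (simp add: c_def norm_sgn)
  have "herm (c *s x) y = of_real (norm (herm x y))"
    by (simp add: herm_scale_left c_def cnj_sgn_mult)
  hence "norm (herm x y) = (c *s x) \<bullet> y" by (metis Re_herm Re_complex_of_real)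
  also have "\<dots> \<le> norm (c *s x) * norm y" by (rule norm_cauchy_schwarz)
  finally show ?thesis using c by (simp add: norm_vscale)
qed simp

lemma bounded_linear_herm_left: "bounded_linear (\<lambda>z. herm z (w :: complex^'n))"
  by (rule bounded_linear_intro[where K = "norm w"])
     (auto simp: herm_add_left herm_scaleR_left scaleR_conv_of_real[where 'a=complex] norm_herm_le)

lemma continuous_on_herm [continuous_intros]:
  "continuous_on S f \<Longrightarrow> continuous_on S g \<Longrightarrow> continuous_on S (\<lambda>x. herm (f x) (g x))"
  unfolding herm_def by (intro continuous_intros)

lemma continuous_on_vscale [continuous_intros]:
  "continuous_on S f \<Longrightarrow> continuous_on S g \<Longrightarrow> continuous_on S (\<lambda>x. f x *s (g x :: complex^'n))"
  unfolding vector_scalar_mult_def by (intro continuous_intros)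

lemma pred_mem_ball [measurable]: "Measurable.pred borel (\<lambda>x. x \<in> ball (c :: 'a::euclidean_space) r)"
  by (simp add: pred_def)

section \<open>Invariance of Lebesgue measure under linear isometries\<close>

lemma nn_integral_lborel_affine:
  fixes t :: "'a::euclidean_space"
  assumes [measurable]: "f \<in> borel_measurable borel" and "c \<noteq> 0"
  shows "(\<integral>\<^sup>+x. f x \<partial>lborel) = ennreal (\<bar>c\<bar> ^ DIM('a)) * (\<integral>\<^sup>+x. f (t + c *\<^sub>R x) \<partial>lborel)"
  by (subst lborel_affine[OF \<open>c \<noteq> 0\<close>, of t])
     (simp add: nn_integral_density nn_integral_distr nn_integral_cmult)

text \<open>The argument for the uniqueness of Haar measure: evaluate the integral of
  \<open>1\<^sub>A (H x) 1\<^sub>B (y + H x)\<close> in both orders.\<close>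

lemma lborel_isometry:
  fixes H :: "'a::euclidean_space \<Rightarrow> 'a"
  assumes lin: "linear H" and iso: "\<And>z. norm (H z) = norm z"
  shows "distr lborel borel H = lborel"
proof -
  have [measurable]: "H \<in> borel_measurable borel"
    by (intro borel_measurable_continuous_onI linear_continuous_on linear_conv_bounded_linear[THEN iffD1] lin)
  have "inj H"
    using lin iso by (metis linear_injective_0 norm_eq_zero)
  hence "surj H" using lin linear_injective_imp_surjective by blast
  have shift: "(\<integral>\<^sup>+x. f (t + x) \<partial>lborel) = (\<integral>\<^sup>+x. f x \<partial>lborel)"
    if [measurable]: "f \<in> borel_measurable borel" for f :: "'a \<Rightarrow> ennreal" and t
    using nn_integral_lborel_affine[OF that, of 1 t] by simp
  have flip: "(\<integral>\<^sup>+x. f (t - x) \<partial>lborel) = (\<integral>\<^sup>+x. f x \<partial>lborel)"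
    if [measurable]: "f \<in> borel_measurable borel" for f :: "'a \<Rightarrow> ennreal" and t
    using nn_integral_lborel_affine[OF that, of "-1" t] by simp
  have main: "emeasure lborel (H -` A) * emeasure lborel B = emeasure lborel A * emeasure lborel (H -` B)"
    if [measurable]: "A \<in> sets borel" "B \<in> sets borel" for A B
  proof -
    have mHA [measurable]: "H -` A \<in> sets borel" "H -` B \<in> sets borel"
      using measurable_sets[OF \<open>H \<in> borel_measurable borel\<close>, of A]
        measurable_sets[OF \<open>H \<in> borel_measurable borel\<close>, of B] that by auto
    have "emeasure lborel (H -` A) * emeasure lborel B
        = (\<integral>\<^sup>+x. indicator (H -` A) x * (\<integral>\<^sup>+y. indicator B y \<partial>lborel) \<partial>lborel)"
      by (simp add: nn_integral_multc)
    also have "\<dots> = (\<integral>\<^sup>+x. indicator (H -` A) x * (\<integral>\<^sup>+y. indicator B (H x + y) \<partial>lborel) \<partial>lborel)"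
      by (rule nn_integral_cong) (subst shift, auto)
    also have "\<dots> = (\<integral>\<^sup>+x. \<integral>\<^sup>+y. indicator A (H x) * indicator B (H x + y) \<partial>lborel \<partial>lborel)"
      by (subst nn_integral_cmult[symmetric]) (auto simp: indicator_def)
    also have "\<dots> = (\<integral>\<^sup>+y. \<integral>\<^sup>+x. indicator A (H x) * indicator B (H x + y) \<partial>lborel \<partial>lborel)"
      by (rule lborel_pair.Fubini'[symmetric]) measurable
    also have "\<dots> = (\<integral>\<^sup>+y. \<integral>\<^sup>+x. indicator A (H x - y) * indicator B (H x) \<partial>lborel \<partial>lborel)"
    proof (rule nn_integral_cong)
      fix y
      \<comment> \<open>With \<open>y = H y'\<close>, translating \<open>x\<close> by
        \<open>- y'\<close> moves the shift by \<open>y\<close> from \<open>B\<close> to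
        \<open>A\<close>, so that the integral over \<open>y\<close> afterwards meets
        \<open>A\<close> alone.\<close>
      obtain y' where y: "y = H y'" using \<open>surj H\<close> by blast
      have "(\<integral>\<^sup>+x. indicator A (H x) * indicator B (H x + y) \<partial>lborel)
        = (\<integral>\<^sup>+x. indicator A (H (-y' + x)) * indicator B (H (-y' + x) + y) \<partial>lborel)"
        by (rule shift[symmetric]) measurable
      also have "\<dots> = (\<integral>\<^sup>+x. indicator A (H x - y) * indicator B (H x) \<partial>lborel)"
        by (simp add: y linear_diff[OF lin])
      finally show "(\<integral>\<^sup>+x. indicator A (H x) * indicator B (H x + y) \<partial>lborel)
        = (\<integral>\<^sup>+x. (indicator A (H x - y) * indicator B (H x) :: ennreal) \<partial>lborel)" .
    qed
    also have "\<dots> = (\<integral>\<^sup>+x. \<integral>\<^sup>+y. indicator A (H x - y) * indicator B (H x) \<partial>lborel \<partial>lborel)"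
      by (rule lborel_pair.Fubini') measurable
    also have "\<dots> = (\<integral>\<^sup>+x. (\<integral>\<^sup>+y. indicator A (H x - y) \<partial>lborel) * indicator B (H x) \<partial>lborel)"
      by (subst nn_integral_multc) auto
    also have "\<dots> = (\<integral>\<^sup>+x. emeasure lborel A * indicator (H -` B) x \<partial>lborel)"
      by (subst flip) (auto simp: indicator_def)
    also have "\<dots> = emeasure lborel A * emeasure lborel (H -` B)"
      by (simp add: nn_integral_cmult)
    finally show ?thesis .
  qed
  \<comment> \<open>The unit ball is its own preimage and has positive finite measure; taken for
    \<open>B\<close> in \<open>main\<close> it cancels.\<close>
  have ball: "H -` ball 0 1 = ball 0 1" using iso by auto
  have pos: "emeasure lborel (ball (0::'a) 1) \<noteq> 0"
    using content_ball_pos[of 1 "0::'a"]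
    by (metis emeasure_lborel_ball_finite measure_def enn2real_0 less_irrefl measure_completion sets_lborel
        borel_open open_ball zero_less_one)
  show ?thesis
  proof (rule measure_eqI)
    fix A assume "A \<in> sets (distr lborel borel H)"
    hence A [measurable]: "A \<in> sets borel" by simp
    have "emeasure lborel (H -` A) = emeasure lborel A"
      using main[OF A, of "ball 0 1"] pos less_imp_neq[OF emeasure_lborel_ball_finite[of "0::'a" 1]]
      by (simp add: ball ennreal_mult_cancel_left mult.commute[of _ "emeasure lborel (ball 0 1)"])
    thus "emeasure (distr lborel borel H) A = emeasure lborel A"
      by (simp add: emeasure_distr)
  qed simp
qed

lemma nn_integral_lborel_isometry:
  fixes H :: "'a::euclidean_space \<Rightarrow> 'a"
  assumes "linear H" "\<And>z. norm (H z) = norm z" and [measurable]: "f \<in> borel_measurable borel"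
  shows "(\<integral>\<^sup>+x. f (H x) \<partial>lborel) = (\<integral>\<^sup>+x. f x \<partial>lborel)"
proof -
  have [measurable]: "H \<in> borel_measurable borel"
    by (intro borel_measurable_continuous_onI linear_continuous_on linear_conv_bounded_linear[THEN iffD1] assms)
  show ?thesis
    by (subst (2) lborel_isometry[OF assms(1,2), symmetric]) (simp add: nn_integral_distr)
qed

section \<open>Unitary maps that fix or move a unit vector\<close>

lemma linear_vscale: "linear (\<lambda>z. c *s (z :: complex^'n))"
  by (rule linearI) (simp_all add: vec_eq_iff algebra_simps scaleR_conv_of_real[where 'a=complex])

text \<open>For a unit vector \<open>u\<close>: the identity on the complex line of \<open>u\<close>
  and multiplication by \<open>c\<close> on its orthogonal complement. It is unitary for unimodular
  \<open>c\<close>; other values of \<open>c\<close> occur because \<open>c\<close> later serves as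
  a complex variable, with \<open>c = 0\<close> giving the projection onto the line.\<close>

definition twist :: "complex^'n \<Rightarrow> complex \<Rightarrow> complex^'n \<Rightarrow> complex^'n" where
  "twist u c z = herm z u *s u + c *s (z - herm z u *s u)"

lemma norm_twist_sq:
  assumes "norm u = 1"
  shows "(norm (twist u c z))\<^sup>2 = (norm (herm z u))\<^sup>2 + (norm c)\<^sup>2 * ((norm z)\<^sup>2 - (norm (herm z u))\<^sup>2)"
proof -
  define p where "p = herm z u *s u"
  define q where "q = z - p"
  have "herm q u = 0" using assms by (simp add: q_def p_def herm_diff_left herm_scale_left herm_self)
  hence qp: "herm q p = 0" by (simp add: p_def herm_scale_right)
  hence 1: "orthogonal p (d *s q)" for d
  proof -
    have "herm (d *s q) p = 0" by (simp add: herm_scale_left qp)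
    thus ?thesis by (metis Re_herm orthogonal_def inner_commute zero_complex.simps(1))
  qed
  have p: "norm p = norm (herm z u)" using assms by (simp add: p_def norm_vscale)
  have "(norm z)\<^sup>2 = (norm p)\<^sup>2 + (norm q)\<^sup>2"
    using norm_add_Pythagorean[OF 1[of 1]] by (simp add: q_def)
  moreover have "(norm (twist u c z))\<^sup>2 = (norm p)\<^sup>2 + (norm (c *s q))\<^sup>2"
    using norm_add_Pythagorean[OF 1[of c]] by (simp add: twist_def q_def p_def)
  ultimately show ?thesis by (simp add: p norm_vscale power_mult_distrib)
qed

lemma norm_twist: "norm u = 1 \<Longrightarrow> norm c = 1 \<Longrightarrow> norm (twist u c z) = norm z"
  using norm_twist_sq[of u c z] by (simp add: power2_eq_iff_nonneg)

lemma linear_twist: "linear (twist u c)"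
  by (rule linearI) (simp_all add: twist_def herm_add_left herm_scaleR_left vec_eq_iff algebra_simps scaleR_conv_of_real[where 'a=complex])

lemma herm_twist: "norm u = 1 \<Longrightarrow> herm (twist u c z) u = herm z u"
  by (simp add: twist_def herm_add_left herm_diff_left herm_scale_left herm_self)

text \<open>A Householder reflection along \<open>v = u - e'\<close> exchanges the unit vectors
  \<open>u\<close> and \<open>e'\<close> only if their Hermitian product is real. Hence
  \<open>e\<close> is first multiplied by a unimodular scalar to give such an \<open>e'\<close>,
  which does not affect the modulus of \<open>herm z e\<close>.\<close>

lemma isometry_between_unit_vectors:
  fixes u e :: "complex^'n"
  assumes u: "norm u = 1" and e: "norm e = 1"
  obtains H where "linear H" "\<And>z. norm (H z) = norm z" "\<And>z. norm (herm (H z) u) = norm (herm z e)"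
proof -
  define c where "c = (if herm u e = 0 then 1 else sgn (herm u e))"
  define e' where "e' = c *s e"
  have c: "norm c = 1" by (simp add: c_def norm_sgn)
  have e': "norm e' = 1" by (simp add: e'_def norm_vscale c e)
  have im: "Im (herm u e') = 0"
  proof (cases "herm u e = 0")
    case False
    have "cnj (sgn (herm u e)) * herm u e = of_real (norm (herm u e))"
      by (rule cnj_sgn_mult)
    thus ?thesis using False by (simp add: e'_def herm_scale_right c_def)
  qed (simp add: e'_def herm_scale_right)
  have sym: "herm e' u = herm u e'" using cnj_herm[of u e'] im by (simp add: complex_eq_iff)
  define v where "v = u - e'"
  show ?thesis
  proof (cases "v = 0")
    case True
    hence "u = e'" by (simp add: v_def)
    hence "norm (herm z u) = norm (herm z e)" for z
      using c by (simp add: e'_def herm_scale_right norm_mult)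
    thus ?thesis using that[of "\<lambda>z. z"] by (simp add: linear_iff)
  next
    case False
    define m where "m = (norm v)\<^sup>2"
    have m: "m \<noteq> 0" using False by (simp add: m_def)
    have m2: "complex_of_real m = 2 * herm u v"
    proof -
      have "complex_of_real m = herm v v" by (simp only: m_def herm_self)
      also have "\<dots> = herm u u + herm e' e' - 2 * herm u e'"
        by (simp only: v_def herm_diff_left herm_diff_right sym) simp
      also have "\<dots> = 2 - 2 * herm u e'" by (simp add: herm_self u e')
      also have "\<dots> = 2 * herm u v" by (simp add: v_def herm_diff_right herm_self u)
      finally show ?thesis .
    qed
    define H where "H = (\<lambda>z. z - (2 * herm z v / of_real m) *s v)"
    have lin: "linear H"
      by (rule linearI) (simp_all add: H_def herm_add_left herm_scaleR_left vec_eq_iff algebra_simps add_divide_distrib scaleR_conv_of_real[where 'a=complex])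
    have vv: "herm v v = of_real m" by (simp add: herm_self m_def)
    have HH: "herm (H x) (H y) = herm x y" for x y
    proof -
      have "herm (H x) (H y) = herm x y - 2 * herm x v * cnj (herm y v) / of_real m
         - 2 * herm x v / of_real m * herm v y + 2 * herm x v / of_real m * (2 * cnj (herm y v) / of_real m * of_real m)"
        by (simp add: H_def herm_diff_left herm_diff_right herm_scale_left herm_scale_right vv algebra_simps)
      also have "\<dots> = herm x y" using m by (simp add: cnj_herm field_simps)
      finally show ?thesis .
    qed
    have nH: "norm (H z) = norm z" for z
    proof -
      have "complex_of_real ((norm (H z))\<^sup>2) = of_real ((norm z)\<^sup>2)"
        using HH[of z z] by (simp only: herm_self)
      hence "(norm (H z))\<^sup>2 = (norm z)\<^sup>2" by (simp only: of_real_eq_iff)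
      thus ?thesis by (simp add: power2_eq_iff_nonneg)
    qed
    have Hu: "H u = e'"
    proof -
      have "2 * herm u v / of_real m = 1" using m by (simp add: m2[symmetric])
      thus ?thesis by (simp add: H_def v_def)
    qed
    have HHz: "H (H z) = z" for z
    proof -
      have "herm (H z) v = - herm z v"
        using m by (simp add: H_def herm_diff_left herm_scale_left vv)
      hence "H (H z) = H z + (2 * herm z v / of_real m) *s v" by (simp add: H_def vec_eq_iff)
      thus ?thesis by (simp add: H_def)
    qed
    have "norm (herm (H z) u) = norm (herm z e)" for z
    proof -
      have "herm (H z) u = herm (H (H z)) (H u)" by (simp add: HH)
      also have "\<dots> = herm z e'" by (simp add: HHz Hu)
      finally show ?thesis using c by (simp add: e'_def herm_scale_right norm_mult)
    qed
    thus ?thesis using that lin nH by blast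
  qed
qed

section \<open>Moments of the weighted measures\<close>

lemma DIM_cvec: "DIM(complex^'n) = 2 * CARD('n)"
  by simp

section \<open>Gaussian moments of one coordinate\<close>

definition gauss_moment :: "'n::finite \<Rightarrow> nat \<Rightarrow> ennreal" where
  "gauss_moment i j = (\<integral>\<^sup>+z. ennreal (norm ((z::complex^'n) $ i) ^ (2 * j) * exp (- (norm z)\<^sup>2)) \<partial>lborel)"

definition stretch :: "'n::finite \<Rightarrow> real \<Rightarrow> complex^'n \<Rightarrow> complex^'n" where
  "stretch i s z = (\<chi> l. if l = i then of_real s * z $ l else z $ l)"

text \<open>One complex coordinate is two real ones, the basis directions singled out by
  \<open>c\<close>; both are scaled by \<open>s\<close>, whence the Jacobian
  \<open>s\<^sup>2\<close>.\<close>

lemma nn_integral_stretch: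
  fixes i :: "'n::finite"
  assumes [measurable]: "f \<in> borel_measurable borel" and s: "s > 0"
  shows "(\<integral>\<^sup>+z. f z \<partial>lborel) = ennreal (s\<^sup>2) * (\<integral>\<^sup>+z. f (stretch i s z) \<partial>lborel)"
proof -
  define c where "c = (\<lambda>b::complex^'n. if b = axis i 1 \<or> b = axis i \<i> then s else 1)"
  have eq: "(\<Sum>b\<in>Basis. (c b * (z \<bullet> b)) *\<^sub>R b) = stretch i s z" for z
  proof (rule euclidean_eqI)
    fix b :: "complex^'n" assume b: "b \<in> Basis"
    then obtain l u where lu: "b = axis l u" "u \<in> Basis" by (auto simp: Basis_vec_def)
    have "(\<Sum>b\<in>Basis. (c b * (z \<bullet> b)) *\<^sub>R b) \<bullet> b = c b * (z \<bullet> b)"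
      using b by (simp add: inner_sum_left inner_Basis if_distrib sum.delta cong: if_cong)
    also have "\<dots> = stretch i s z \<bullet> b"
      using lu by (auto simp: c_def stretch_def inner_axis axis_eq_axis Basis_complex_def inner_complex_def)
    finally show "(\<Sum>b\<in>Basis. (c b * (z \<bullet> b)) *\<^sub>R b) \<bullet> b = stretch i s z \<bullet> b" .
  qed
  have "(\<Prod>b\<in>Basis. \<bar>c b\<bar>) = (\<Prod>b\<in>{axis i 1, axis i \<i>}. \<bar>c b\<bar>)"
    by (rule prod.mono_neutral_right) (auto simp: c_def Basis_vec_def Basis_complex_def)
  also have "\<dots> = s\<^sup>2" using s by (simp add: c_def axis_eq_axis power2_eq_square)
  finally have pr: "(\<Prod>b\<in>Basis. \<bar>c b\<bar>) = s\<^sup>2" .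
  have [measurable]: "stretch i s \<in> borel_measurable borel"
    unfolding eq[symmetric, abs_def] by measurable
  have "lborel = density (distr lborel borel (stretch i s)) (\<lambda>_. ennreal (s\<^sup>2))"
    using lborel_affine_euclidean[of c 0] s unfolding pr
    by (simp add: eq c_def[abs_def] cong: if_cong) (simp add: c_def eq[unfolded c_def])
  hence "(\<integral>\<^sup>+z. f z \<partial>lborel) = (\<integral>\<^sup>+z. f z \<partial>density (distr lborel borel (stretch i s)) (\<lambda>_. ennreal (s\<^sup>2)))"
    by simp
  thus ?thesis by (simp add: nn_integral_density nn_integral_distr nn_integral_cmult)
qed

lemma norm_stretch_sq: "(norm (stretch i s z))\<^sup>2 = (norm z)\<^sup>2 + (s\<^sup>2 - 1) * (norm (z $ i))\<^sup>2"
proof -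
  have "(norm (stretch i s z))\<^sup>2 = (\<Sum>l\<in>UNIV. (norm (stretch i s z $ l))\<^sup>2)"
    by (simp add: norm_vec_def L2_set_def sum_nonneg)
  also have "\<dots> = (\<Sum>l\<in>UNIV. (norm (z $ l))\<^sup>2 + (if l = i then (s\<^sup>2 - 1) * (norm (z $ l))\<^sup>2 else 0))"
    by (rule sum.cong) (auto simp: stretch_def norm_mult power_mult_distrib algebra_simps)
  also have "\<dots> = (norm z)\<^sup>2 + (s\<^sup>2 - 1) * (norm (z $ i))\<^sup>2"
    by (simp add: sum.distrib norm_vec_def L2_set_def sum_nonneg)
  finally show ?thesis .
qed

lemma AE_nth_nonzero: "AE z in lborel. (z::complex^'n) $ i \<noteq> 0"
proof -
  have b: "axis i 1 \<in> (Basis :: (complex^'n) set)"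
    by (auto simp: Basis_vec_def Basis_complex_def)
  have "negligible {z :: complex^'n. z \<bullet> axis i 1 = 0}"
    by (rule negligible_standard_hyperplane[OF b])
  hence "AE z in lebesgue. z \<notin> {z :: complex^'n. z \<bullet> axis i 1 = 0}"
    by (intro AE_not_in) (simp add: negligible_iff_null_sets[symmetric])
  hence "AE z in lebesgue. (z::complex^'n) $ i \<noteq> 0"
    by (rule eventually_mono) (auto simp: inner_axis)
  thus ?thesis by (simp add: AE_completion_iff)
qed

lemma nn_integral_exp_atLeast_1:
  assumes "u > (0::real)"
  shows "(\<integral>\<^sup>+q. ennreal (exp (- (q * u))) * indicator {1..} q \<partial>lborel) = ennreal (exp (- u) / u)"
proof -
  have "(\<integral>\<^sup>+q. ennreal (exp (- (q * u))) * indicator {1..} q \<partial>lborel)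
      = ennreal (0 - (- exp (- (1 * u)) / u))"
  proof (rule nn_integral_FTC_atLeast[where F = "\<lambda>q. - exp (- (q * u)) / u"])
    show "DERIV (\<lambda>q. - exp (- (q * u)) / u) x :> exp (- (x * u))" for x
      using assms by (auto intro!: derivative_eq_intros simp: field_simps)
    show "((\<lambda>q. - exp (- (q * u)) / u) \<longlongrightarrow> 0) at_top"
      using assms by real_asymp
  qed auto
  thus ?thesis by simp
qed

lemma nn_integral_power_atLeast_1:
  assumes "j > 0"
  shows "(\<integral>\<^sup>+q. ennreal (q powr (- 1 - real j)) * indicator {1..} q \<partial>lborel) = ennreal (1 / real j)"
proof -
  have "(\<integral>\<^sup>+q. ennreal (q powr (- 1 - real j)) * indicator {1..} q \<partial>lborel)
      = ennreal (0 - (- (1 powr (- real j)) / real j))"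
  proof (rule nn_integral_FTC_atLeast[where F = "\<lambda>q. - (q powr (- real j)) / real j"])
    show "DERIV (\<lambda>q. - (q powr (- real j)) / real j) x :> x powr (- 1 - real j)" if "1 \<le> x" for x
    proof -
      have e: "- 1 - real j = - real j - 1" by simp
      show ?thesis unfolding e
        using assms that by (auto intro!: derivative_eq_intros simp: field_simps)
    qed
    have "((\<lambda>q. q powr (- real j)) \<longlongrightarrow> 0) at_top"
      using assms by real_asymp
    from tendsto_divide[OF tendsto_minus[OF this] tendsto_const[of "real j"]]
    show "((\<lambda>q. - (q powr (- real j)) / real j) \<longlongrightarrow> 0) at_top"
      using assms by simp
  qed auto
  thus ?thesis by simp
qed

text \<open>Stretching the \<open>i\<close>-th coordinate by \<open>\<surd>q\<close> replaces the Gaussian by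
  \<open>exp (- |z|\<^sup>2 - (q - 1) |z\<^sub>i|\<^sup>2)\<close>; integrating over \<open>q \<ge> 1\<close> lowers the exponent \<open>j\<close> by one.\<close>

lemma gauss_moment_Suc: "gauss_moment (i::'n::finite) (Suc j) = ennreal (real (Suc j)) * gauss_moment i j"
proof -
  define k where "k = Suc j"
  have k: "k > 0" "real k > 0" by (simp_all add: k_def)
  have m [measurable]: "(\<lambda>z::complex^'n. z $ i) \<in> borel_measurable borel"
    by (intro borel_measurable_continuous_onI continuous_intros)
  have scaled: "(\<integral>\<^sup>+z. ennreal (norm ((z::complex^'n) $ i) ^ (2 * k) * exp (- (norm z)\<^sup>2 + (norm (z $ i))\<^sup>2 - q * (norm (z $ i))\<^sup>2)) \<partial>lborel)
      = ennreal (q powr (- 1 - real k)) * gauss_moment i k" if "q \<ge> 1" for q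
  proof -
    have q: "q > 0" using that by simp
    have "sqrt q ^ (2 * k) = q ^ k" using q by (simp add: power_mult)
    hence sq: "sqrt q ^ (k * 2) = q ^ k" by (simp add: mult.commute)
    let ?I = "\<integral>\<^sup>+z. ennreal (norm ((z::complex^'n) $ i) ^ (2 * k) * exp (- (norm z)\<^sup>2 + (norm (z $ i))\<^sup>2 - q * (norm (z $ i))\<^sup>2)) \<partial>lborel"
    have "gauss_moment i k = ennreal ((sqrt q)\<^sup>2) * (\<integral>\<^sup>+z. ennreal (norm (stretch i (sqrt q) z $ i) ^ (2 * k) * exp (- (norm (stretch i (sqrt q) z))\<^sup>2)) \<partial>lborel)"
      unfolding gauss_moment_def by (rule nn_integral_stretch) (use q in auto)
    also have "\<dots> = ennreal q * (\<integral>\<^sup>+z. ennreal (q ^ k) * ennreal (norm ((z::complex^'n) $ i) ^ (2 * k) * exp (- (norm z)\<^sup>2 + (norm (z $ i))\<^sup>2 - q * (norm (z $ i))\<^sup>2)) \<partial>lborel)"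
      unfolding norm_stretch_sq using q
      by (intro arg_cong2[where f = "(*)"] nn_integral_cong)
         (simp_all add: stretch_def norm_mult power_mult_distrib ennreal_mult'[symmetric] sq algebra_simps)
    also have "\<dots> = ennreal (q powr (1 + real k)) * ?I"
      using q by (subst nn_integral_cmult)
        (simp_all add: mult.assoc[symmetric] ennreal_mult'[symmetric] powr_add powr_realpow[symmetric])
    finally have "ennreal (q powr (- 1 - real k)) * gauss_moment i k
       = ennreal (q powr (- 1 - real k)) * ennreal (q powr (1 + real k)) * ?I"
      by (simp only: mult.assoc)
    also have "ennreal (q powr (- 1 - real k)) * ennreal (q powr (1 + real k)) = 1"
      using q by (simp add: ennreal_mult'[symmetric] powr_add[symmetric])
    finally show ?thesis by simp
  qed
  have "ennreal (1 / real k) * gauss_moment i k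
      = (\<integral>\<^sup>+q. (ennreal (q powr (- 1 - real k)) * gauss_moment i k) * indicator {1..} q \<partial>lborel)"
  proof -
    have "ennreal (1 / real k) * gauss_moment i k
        = (\<integral>\<^sup>+q. (ennreal (q powr (- 1 - real k)) * indicator {1..} q) * gauss_moment i k \<partial>lborel)"
      by (subst nn_integral_multc) (simp_all only: nn_integral_power_atLeast_1[OF k(1)], measurable)
    thus ?thesis by (simp only: mult_ac)
  qed
  also have "\<dots> = (\<integral>\<^sup>+q. (\<integral>\<^sup>+z. ennreal (norm ((z::complex^'n) $ i) ^ (2 * k) * exp (- (norm z)\<^sup>2 + (norm (z $ i))\<^sup>2 - q * (norm (z $ i))\<^sup>2)) * indicator {1..} q \<partial>lborel) \<partial>lborel)"
  proof (rule nn_integral_cong)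
    fix q :: real
    show "ennreal (q powr (- 1 - real k)) * gauss_moment i k * indicator {1..} q =
      (\<integral>\<^sup>+z. ennreal (norm ((z::complex^'n) $ i) ^ (2 * k) * exp (- (norm z)\<^sup>2 + (norm (z $ i))\<^sup>2 - q * (norm (z $ i))\<^sup>2)) * indicator {1..} q \<partial>lborel)"
    proof (cases "q \<ge> 1")
      case True
      hence i: "indicator {1..} q = (1::ennreal)" by simp
      show ?thesis by (simp only: i mult_1_right scaled[OF True])
    qed simp
  qed
  also have "\<dots> = (\<integral>\<^sup>+z. (\<integral>\<^sup>+q. ennreal (norm ((z::complex^'n) $ i) ^ (2 * k) * exp (- (norm z)\<^sup>2 + (norm (z $ i))\<^sup>2 - q * (norm (z $ i))\<^sup>2)) * indicator {1..} q \<partial>lborel) \<partial>lborel)"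
    by (rule lborel_pair.Fubini') measurable
  \<comment> \<open>For fixed \<open>z\<close> and \<open>u = |z_i|^2\<close> the integral of
    \<open>exp (- q u)\<close> over \<open>q \<ge> 1\<close> is \<open>exp (- u) / u\<close>. The
    division by \<open>u\<close> lowers the exponent, and the null set \<open>u = 0\<close> has to
    be left out.\<close>
  also have "\<dots> = gauss_moment i j"
    unfolding gauss_moment_def
  proof (rule nn_integral_cong_AE, rule eventually_mono[OF AE_nth_nonzero[of i]])
    fix z :: "complex^'n" assume z: "z $ i \<noteq> 0"
    define u where "u = (norm (z $ i))\<^sup>2"
    have u: "u > 0" using z by (simp add: u_def)
    have "(\<integral>\<^sup>+q. ennreal (norm (z $ i) ^ (2 * k) * exp (- (norm z)\<^sup>2 + u - q * u)) * indicator {1..} q \<partial>lborel)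
      = (\<integral>\<^sup>+q. ennreal (u ^ k * exp (- (norm z)\<^sup>2 + u)) * (ennreal (exp (- (q * u))) * indicator {1..} q) \<partial>lborel)"
    proof (rule nn_integral_cong)
      fix q :: real
      have p: "norm (z $ i) ^ (2 * k) = u ^ k" by (simp add: u_def power_mult)
      have e: "exp (- (norm z)\<^sup>2 + u - q * u) = exp (- (norm z)\<^sup>2 + u) * exp (- (q * u))"
        by (simp add: exp_add[symmetric])
      show "ennreal (norm (z $ i) ^ (2 * k) * exp (- (norm z)\<^sup>2 + u - q * u)) * indicator {1..} q
        = ennreal (u ^ k * exp (- (norm z)\<^sup>2 + u)) * (ennreal (exp (- (q * u))) * indicator {1..} q)"
        unfolding p e using u by (simp add: ennreal_mult' mult.assoc)
    qed
    also have "\<dots> = ennreal (u ^ k * exp (- (norm z)\<^sup>2 + u)) * ennreal (exp (- u) / u)"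
      by (subst nn_integral_cmult) (auto simp: nn_integral_exp_atLeast_1[OF u])
    also have "\<dots> = ennreal (u ^ j * exp (- (norm z)\<^sup>2))"
      using u by (simp add: ennreal_mult'[symmetric] exp_add exp_diff exp_minus k_def field_simps)
    finally show "(\<integral>\<^sup>+q. ennreal (norm (z $ i) ^ (2 * k) * exp (- (norm z)\<^sup>2 + (norm (z $ i))\<^sup>2 - q * (norm (z $ i))\<^sup>2)) * indicator {1..} q \<partial>lborel)
      = ennreal (norm (z $ i) ^ (2 * j) * exp (- (norm z)\<^sup>2))"
      by (simp add: u_def power_mult)
  qed
  finally have 1: "gauss_moment i j = ennreal (1 / real k) * gauss_moment i k" by simp
  have "ennreal (real k) * gauss_moment i j = ennreal (real k) * ennreal (1 / real k) * gauss_moment i k"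
    unfolding 1 by (simp only: mult.assoc)
  also have "ennreal (real k) * ennreal (1 / real k) = 1"
    using k by (subst ennreal_mult'[symmetric]) simp_all
  finally show ?thesis by (simp add: k_def)
qed

lemma gauss_moment_eq: "gauss_moment (i::'n::finite) j = ennreal (fact j) * gauss_moment i 0"
proof (induction j)
  case (Suc j)
  show ?case
    unfolding gauss_moment_Suc Suc
    by (simp only: mult.assoc[symmetric] ennreal_mult'[symmetric] of_nat_0_le_iff fact_Suc)
qed simp

section \<open>Integrals over the ball against powers of \<open>1 - |z|^2\<close>\<close>

definition ball_integral :: "real \<Rightarrow> (complex^'n \<Rightarrow> real) \<Rightarrow> ennreal" where
  "ball_integral a h = (\<integral>\<^sup>+z. ennreal (h z * (1 - (norm z)\<^sup>2) powr a) * indicator (ball 0 1) z \<partial>lborel)"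

text \<open>Both sides compute the integral of \<open>h z * t powr a * exp (- t - |z|\<^sup>2)\<close> over \<open>t > 0\<close>;
  on the left after the substitution \<open>s = t + |z|\<^sup>2\<close> and a dilation of \<open>z\<close> by \<open>\<surd>s\<close>.\<close>

lemma ball_integral_homogeneous:
  fixes h :: "complex^'n \<Rightarrow> real"
  assumes [measurable]: "h \<in> borel_measurable borel" and h0: "\<And>z. h z \<ge> 0" and a: "a > -1"
    and hom: "\<And>s z. s > 0 \<Longrightarrow> h (s *\<^sub>R z) = s ^ (2 * j) * h z"
  shows "ennreal (Gamma (real CARD('n) + 1 + a + real j)) * ball_integral a h
    = ennreal (Gamma (a + 1)) * (\<integral>\<^sup>+z. ennreal (h z * exp (- (norm z)\<^sup>2)) \<partial>lborel)"
proof -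
  let ?n = "real CARD('n)"
  define F where "F = (\<lambda>s (z::complex^'n). ennreal (h z) * (ennreal (exp (- s)) * ennreal ((s - (norm z)\<^sup>2) powr a)
      * (if (norm z)\<^sup>2 < s then 1 else 0)))"
  have [measurable]: "(\<lambda>(s, z). F s z) \<in> borel_measurable (lborel \<Otimes>\<^sub>M lborel)"
    unfolding F_def by measurable
  have [measurable]: "F s \<in> borel_measurable borel" "(\<lambda>s. F s z) \<in> borel_measurable borel" for s z
    unfolding F_def by measurable
  have inner1: "(\<integral>\<^sup>+z. F s z \<partial>lborel) = ennreal (indicator {0..} s * s powr (?n + real j + a) / exp s) * ball_integral a h"
    if "s \<noteq> 0" for s
  proof (cases "s > 0")
    case True
    have "(\<integral>\<^sup>+z. F s z \<partial>lborel) = ennreal (\<bar>sqrt s\<bar> ^ DIM(complex^'n)) * (\<integral>\<^sup>+z. F s (0 + sqrt s *\<^sub>R z) \<partial>lborel)"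
      by (rule nn_integral_lborel_affine) (use True in \<open>auto simp: F_def\<close>)
    also have "(\<integral>\<^sup>+z. F s (0 + sqrt s *\<^sub>R z) \<partial>lborel)
        = (\<integral>\<^sup>+z. ennreal (s powr (real j + a) * exp (- s)) * (ennreal (h z * (1 - (norm z)\<^sup>2) powr a) * indicator (ball 0 1) z) \<partial>lborel)"
    proof (rule nn_integral_cong)
      fix z :: "complex^'n"
      have iff: "s * (norm z)\<^sup>2 < s \<longleftrightarrow> norm z < 1"
        using True by (simp add: mult_less_cancel_left2 power_less_one_iff abs_square_less_1)
      show "F s (0 + sqrt s *\<^sub>R z) = ennreal (s powr (real j + a) * exp (- s)) * (ennreal (h z * (1 - (norm z)\<^sup>2) powr a) * indicator (ball 0 1) z)"
      proof (cases "norm z < 1")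
        case z: True
        have "0 \<le> 1 - (norm z)\<^sup>2" using z by (simp add: power_le_one)
        hence "(s - s * (norm z)\<^sup>2) powr a = s powr a * (1 - (norm z)\<^sup>2) powr a"
          using True by (simp add: powr_mult[symmetric] right_diff_distrib)
        moreover have "sqrt s ^ (j * 2) = s ^ j"
          using True by (metis power_mult mult.commute real_sqrt_pow2 less_imp_le)
        ultimately show ?thesis using True z iff h0
          by (simp add: F_def hom power_mult_distrib powr_add powr_realpow ennreal_mult'[symmetric] mult_ac)
      next
        case False
        thus ?thesis using True iff by (simp add: F_def power_mult_distrib)
      qed
    qed
    also have "\<dots> = ennreal (s powr (real j + a) * exp (- s)) * ball_integral a h"
      unfolding ball_integral_def by (rule nn_integral_cmult) simp
    also have "ennreal (\<bar>sqrt s\<bar> ^ DIM(complex^'n)) * (ennreal (s powr (real j + a) * exp (- s)) * ball_integral a h)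
      = ennreal (indicator {0..} s * s powr (?n + real j + a) / exp s) * ball_integral a h"
    proof -
      have 1: "\<bar>sqrt s\<bar> ^ DIM(complex^'n) = s powr ?n"
        using True by (simp add: DIM_cvec power_mult powr_realpow del: DIM_cart)
      have 2: "s powr ?n * (s powr (real j + a) * exp (- s)) = indicator {0..} s * s powr (?n + real j + a) / exp s"
        using True by (simp add: powr_add exp_minus divide_inverse mult.assoc)
      show ?thesis
        unfolding 1 mult.assoc[symmetric] 2[symmetric] by (simp add: ennreal_mult' mult.assoc)
    qed
    finally show ?thesis .
  next
    case False
    have "F s z = 0" for z
    proof -
      have "\<not> (norm z)\<^sup>2 < s" using False zero_le_power2[of "norm z"] by linarith
      thus ?thesis by (simp add: F_def)
    qed
    thus ?thesis using False that by simp
  qed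
  have inner2: "(\<integral>\<^sup>+s. F s z \<partial>lborel) = ennreal (Gamma (a + 1)) * ennreal (h z * exp (- (norm z)\<^sup>2))" for z
  proof -
    let ?m = "(norm z)\<^sup>2"
    have "(\<integral>\<^sup>+s. ennreal (exp (- s)) * ennreal ((s - ?m) powr a) * (if ?m < s then 1 else 0) \<partial>lborel)
        = (\<integral>\<^sup>+t. ennreal (exp (- (?m + t))) * ennreal (t powr a) * (if ?m < ?m + t then 1 else 0) \<partial>lborel)"
      using nn_integral_lborel_affine[of "\<lambda>s. ennreal (exp (- s)) * ennreal ((s - ?m) powr a) * (if ?m < s then 1 else 0)" 1 ?m] by simp
    also have "\<dots> = (\<integral>\<^sup>+t. ennreal (exp (- ?m)) * ennreal (indicator {0..} t * t powr (a + 1 - 1) / exp t) \<partial>lborel)"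
    proof (rule nn_integral_cong_AE, rule eventually_mono[OF AE_lborel_singleton[of 0]])
      fix t :: real assume "t \<noteq> 0"
      thus "ennreal (exp (- (?m + t))) * ennreal (t powr a) * (if ?m < ?m + t then 1 else 0)
        = ennreal (exp (- ?m)) * ennreal (indicator {0..} t * t powr (a + 1 - 1) / exp t)"
        by (auto simp: indicator_def ennreal_mult'[symmetric] exp_add exp_diff exp_minus field_simps)
    qed
    also have "\<dots> = ennreal (exp (- ?m)) * ennreal (Gamma (a + 1))"
      using a by (subst nn_integral_cmult) (auto simp: Gamma_conv_nn_integral_real)
    finally have "(\<integral>\<^sup>+s. ennreal (exp (- s)) * ennreal ((s - ?m) powr a) * (if ?m < s then 1 else 0) \<partial>lborel)
       = ennreal (exp (- ?m)) * ennreal (Gamma (a + 1))" .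
    moreover have "(\<integral>\<^sup>+s. F s z \<partial>lborel) = ennreal (h z) * (\<integral>\<^sup>+s. ennreal (exp (- s)) * ennreal ((s - ?m) powr a) * (if ?m < s then 1 else 0) \<partial>lborel)"
      unfolding F_def by (rule nn_integral_cmult) measurable
    ultimately show ?thesis using h0 by (simp add: ennreal_mult' mult_ac)
  qed
  have "ennreal (Gamma (?n + 1 + a + real j)) * ball_integral a h
     = (\<integral>\<^sup>+s. ennreal (indicator {0..} s * s powr (?n + 1 + a + real j - 1) / exp s) \<partial>lborel) * ball_integral a h"
    using a by (subst Gamma_conv_nn_integral_real) (auto simp: add_pos_nonneg)
  also have "\<dots> = (\<integral>\<^sup>+s. ennreal (indicator {0..} s * s powr (?n + real j + a) / exp s) * ball_integral a h \<partial>lborel)"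
    by (subst nn_integral_multc) (auto simp: add_ac)
  also have "\<dots> = (\<integral>\<^sup>+s. (\<integral>\<^sup>+z. F s z \<partial>lborel) \<partial>lborel)"
    by (rule nn_integral_cong_AE, rule eventually_mono[OF AE_lborel_singleton[of 0]]) (simp add: inner1)
  also have "\<dots> = (\<integral>\<^sup>+z. (\<integral>\<^sup>+s. F s z \<partial>lborel) \<partial>lborel)"
    by (rule lborel_pair.Fubini'[symmetric]) measurable
  also have "\<dots> = ennreal (Gamma (a + 1)) * (\<integral>\<^sup>+z. ennreal (h z * exp (- (norm z)\<^sup>2)) \<partial>lborel)"
    unfolding inner2 by (rule nn_integral_cmult) measurable
  finally show ?thesis .
qed

lemma emeasure_ball_pos: "emeasure lborel (ball (0::'a::euclidean_space) 1) > 0"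
  using content_ball_pos[of 1 "0::'a"]
  by (metis emeasure_lborel_ball_finite measure_def enn2real_0 less_irrefl measure_completion sets_lborel
      borel_open open_ball zero_less_one not_gr_zero)

lemma one_minus_norm_sq_pos: "z \<in> ball 0 1 \<Longrightarrow> 0 < 1 - (norm z)\<^sup>2"
  by (simp add: abs_square_less_1)

lemma one_minus_norm_sq_le: "1 - (norm z)\<^sup>2 \<le> 1"
  by simp

text \<open>The homogeneous formula with \<open>h = 1\<close> and \<open>a = 0\<close> expresses the
  full Gaussian integral by the volume of the unit ball, hence it is positive and finite. The value
  \<open>G\<close> later cancels against the normalisation of \<open>nu\<close>.\<close>

lemma gauss_moment_0: "\<exists>G>0. \<forall>i. gauss_moment (i::'n::finite) 0 = ennreal G"
proof -
  let ?G = "\<integral>\<^sup>+z. ennreal (1 * exp (- (norm (z::complex^'n))\<^sup>2)) \<partial>lborel"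
  have b: "ball_integral 0 (\<lambda>_::complex^'n. 1) = emeasure lborel (ball (0::complex^'n) 1)"
  proof -
    have "ball_integral 0 (\<lambda>_::complex^'n. 1) = (\<integral>\<^sup>+z. indicator (ball (0::complex^'n) 1) z \<partial>lborel)"
      unfolding ball_integral_def
    proof (rule nn_integral_cong)
      fix z :: "complex^'n"
      have "1 - (norm z)\<^sup>2 \<noteq> 0" if "z \<in> ball 0 1" using one_minus_norm_sq_pos[OF that] by simp
      thus "ennreal (1 * (1 - (norm z)\<^sup>2) powr 0) * indicator (ball 0 1) z = indicator (ball 0 1) z"
        by (cases "z \<in> ball 0 1") simp_all
    qed
    thus ?thesis by simp
  qed
  have eq: "ennreal (Gamma (real CARD('n) + 1)) * emeasure lborel (ball (0::complex^'n) 1) = ?G"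
    using ball_integral_homogeneous[of "\<lambda>_::complex^'n. 1" 0 0] by (simp add: b Gamma_1)
  have g: "Gamma (real CARD('n) + 1) > 0" by (intro Gamma_real_pos) simp
  have fin: "?G < \<infinity>"
    unfolding eq[symmetric] using emeasure_lborel_ball_finite[of "0::complex^'n" 1]
    by (simp add: ennreal_mult_less_top less_top)
  have pos: "?G > 0"
    unfolding eq[symmetric] using g emeasure_ball_pos[where 'a = "complex^'n"]
    by (simp add: ennreal_zero_less_mult_iff)
  obtain G where G: "?G = ennreal G" "G \<ge> 0" using fin by (cases ?G) auto
  moreover have "G > 0" using pos G by simp
  moreover have "gauss_moment (i::'n) 0 = ?G" for i by (simp add: gauss_moment_def)
  ultimately show ?thesis by auto
qed

lemma ball_integral_isometry:
  fixes H :: "complex^'n \<Rightarrow> complex^'n"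
  assumes "linear H" "\<And>z. norm (H z) = norm z" and [measurable]: "h \<in> borel_measurable borel"
  shows "ball_integral a (\<lambda>z. h (H z)) = ball_integral a h"
proof -
  have "ball_integral a (\<lambda>z. h (H z)) =
    (\<integral>\<^sup>+z. (\<lambda>z. ennreal (h z * (1 - (norm z)\<^sup>2) powr a) * indicator (ball 0 1) z) (H z) \<partial>lborel)"
    unfolding ball_integral_def by (intro nn_integral_cong) (simp add: assms(2) indicator_def)
  also have "\<dots> = ball_integral a h"
    unfolding ball_integral_def by (rule nn_integral_lborel_isometry[OF assms(1,2)]) simp
  finally show ?thesis .
qed

lemma borel_measurable_herm [measurable]: "(\<lambda>z. herm z (w::complex^'n)) \<in> borel_measurable borel"
  by (intro borel_measurable_continuous_onI continuous_intros)

text \<open>An isometry replaces \<open>u\<close> by a coordinate vector; the integrand becomes the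
  homogeneous function \<open>|z_i|^(2j)\<close>, whose Gaussian moment is
  \<open>fact j * G\<close>. The quotient of the two Gamma values is the Pochhammer symbol. That
  \<open>K\<close> depends neither on \<open>u\<close> nor on \<open>j\<close> allows it to be
  identified as the total mass, the case \<open>j = 0\<close>.\<close>

lemma ball_integral_herm_power:
  assumes "\<alpha> > -1"
  obtains K where "K > 0"
    "\<And>(u::complex^'n) j. norm u = 1 \<Longrightarrow> ball_integral \<alpha> (\<lambda>z. norm (herm z u) ^ (2 * j))
       = ennreal (K * fact j / pochhammer (real CARD('n) + 1 + \<alpha>) j)"
proof -
  let ?N = "real CARD('n) + 1 + \<alpha>"
  fix i0 :: 'n
  obtain G where G: "G > 0" "\<And>i::'n. gauss_moment i 0 = ennreal G" using gauss_moment_0 by blast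
  have N: "?N > 0" using assms by (simp add: add_pos_nonneg)
  hence gN: "Gamma ?N > 0" by (rule Gamma_real_pos)
  have ga: "Gamma (\<alpha> + 1) > 0" using assms by (intro Gamma_real_pos) simp
  define K where "K = Gamma (\<alpha> + 1) * G / Gamma ?N"
  have "K > 0" using G ga gN by (simp add: K_def)
  moreover have "ball_integral \<alpha> (\<lambda>z. norm (herm z u) ^ (2 * j)) = ennreal (K * fact j / pochhammer ?N j)"
    if u: "norm u = 1" for u :: "complex^'n" and j
  proof -
    define e where "e = (axis i0 1 :: complex^'n)"
    have he: "herm z e = z $ i0" for z
      by (simp add: herm_def e_def axis_def if_distrib cong: if_cong)
    have e: "norm e = 1" by (simp add: e_def norm_axis_1)
    obtain H where H: "linear H" "\<And>z. norm (H z) = norm z" "\<And>z. norm (herm (H z) u) = norm (herm z e)"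
      using isometry_between_unit_vectors[OF u e] by blast
    have m: "(\<lambda>z::complex^'n. norm (herm z u) ^ (2 * j)) \<in> borel_measurable borel" by measurable
    have me: "(\<lambda>z::complex^'n. norm (herm z e) ^ (2 * j)) \<in> borel_measurable borel" by measurable
    define b where "b = ball_integral \<alpha> (\<lambda>z. norm (herm z e) ^ (2 * j))"
    have ub: "ball_integral \<alpha> (\<lambda>z. norm (herm z u) ^ (2 * j)) = b"
      using ball_integral_isometry[OF H(1,2) m] by (simp add: H(3) b_def)
    have "ennreal (Gamma (?N + real j)) * b
      = ennreal (Gamma (\<alpha> + 1)) * (\<integral>\<^sup>+z. ennreal (norm (herm z e) ^ (2 * j) * exp (- (norm z)\<^sup>2)) \<partial>lborel)"
      unfolding b_def using assms
      by (intro ball_integral_homogeneous me) (auto simp: herm_scaleR_left norm_mult power_mult_distrib)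
    also have "\<dots> = ennreal (Gamma (\<alpha> + 1)) * (ennreal (fact j) * ennreal G)"
      by (simp only: he gauss_moment_def[of i0 j, symmetric] gauss_moment_eq[of i0 j] G(2))
    also have "\<dots> = ennreal (Gamma (\<alpha> + 1) * (fact j * G))"
      using ga G by (simp add: ennreal_mult'[symmetric])
    finally have 1: "ennreal (Gamma (?N + real j)) * b = ennreal (Gamma (\<alpha> + 1) * (fact j * G))" .
    have gj: "Gamma (?N + real j) > 0" using N by (intro Gamma_real_pos) simp
    have "b = ennreal (1 / Gamma (?N + real j)) * (ennreal (Gamma (?N + real j)) * b)"
      using gj by (simp add: mult.assoc[symmetric] ennreal_mult'[symmetric])
    also have "\<dots> = ennreal (1 / Gamma (?N + real j) * (Gamma (\<alpha> + 1) * (fact j * G)))"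
      unfolding 1 using gj by (subst ennreal_mult'[symmetric]) auto
    also have "1 / Gamma (?N + real j) * (Gamma (\<alpha> + 1) * (fact j * G)) = K * fact j / pochhammer ?N j"
    proof -
      have "?N \<notin> \<int>\<^sub>\<le>\<^sub>0" using N by (auto elim!: nonpos_Ints_cases)
      from pochhammer_Gamma[OF this, of j]
      have "pochhammer ?N j * Gamma ?N = Gamma (?N + real j)" using gN by simp
      hence "1 / Gamma (?N + real j) = 1 / (pochhammer ?N j * Gamma ?N)" by simp
      thus ?thesis by (simp add: K_def mult_ac)
    qed
    finally show ?thesis using ub by simp
  qed
  ultimately show ?thesis by (rule that)
qed

lemma ball_integral_1:
  assumes "\<alpha> > -1"
  obtains K where "K > 0" "ball_integral \<alpha> (\<lambda>_::complex^'n. 1) = ennreal K"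
proof -
  fix i0 :: 'n
  obtain K where K: "K > 0" "\<And>(u::complex^'n) j. norm u = 1 \<Longrightarrow> ball_integral \<alpha> (\<lambda>z. norm (herm z u) ^ (2 * j))
       = ennreal (K * fact j / pochhammer (real CARD('n) + 1 + \<alpha>) j)"
    using ball_integral_herm_power[OF assms, where 'n = 'n] by blast
  have "norm (axis i0 1 :: complex^'n) = 1" by (simp add: norm_axis_1)
  from K(2)[OF this, of 0] K(1) show ?thesis by (intro that) simp_all
qed

section \<open>The probability measures \<open>nu\<close>: change of weight and unitary
  invariance\<close>

lemma nu_density:
  assumes "\<alpha> > -1" and K: "K > 0" "ball_integral \<alpha> (\<lambda>_::complex^'n. 1) = ennreal K"
  shows "nu \<alpha> = density lborel (\<lambda>z::complex^'n. indicator (ball 0 1) z * ennreal (1 / K * (1 - (norm z)\<^sup>2) powr \<alpha>))"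
proof -
  have "(LINT z:ball (0 :: complex^'n) 1|lborel. (1 - (norm z)\<^sup>2) powr \<alpha>) = K"
  proof -
    have "(LINT z:ball (0 :: complex^'n) 1|lborel. (1 - (norm z)\<^sup>2) powr \<alpha>)
       = enn2real (\<integral>\<^sup>+z. ennreal (indicator (ball 0 1) z *\<^sub>R (1 - (norm (z::complex^'n))\<^sup>2) powr \<alpha>) \<partial>lborel)"
      unfolding set_lebesgue_integral_def by (rule integral_eq_nn_integral) auto
    also have "(\<integral>\<^sup>+z. ennreal (indicator (ball 0 1) z *\<^sub>R (1 - (norm (z::complex^'n))\<^sup>2) powr \<alpha>) \<partial>lborel) = ennreal K"
      unfolding K(2)[symmetric] ball_integral_def by (intro nn_integral_cong) (simp add: indicator_def)
    finally show ?thesis using K by simp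
  qed
  thus ?thesis by (simp add: nu_def)
qed

lemma sets_nu [simp, measurable_cong]: "sets (nu \<alpha> :: (complex^'n) measure) = sets borel"
  and space_nu [simp]: "space (nu \<alpha> :: (complex^'n) measure) = UNIV"
  by (simp_all add: nu_def Let_def)

lemma nn_integral_nu:
  assumes "\<alpha> > -1"
  obtains K where "K > 0" "ball_integral \<alpha> (\<lambda>_::complex^'n. 1) = ennreal K"
    "\<And>f. f \<in> borel_measurable borel \<Longrightarrow> (\<integral>\<^sup>+z. f z \<partial>nu \<alpha>)
      = ennreal (1 / K) * (\<integral>\<^sup>+z. f z * ennreal ((1 - (norm z)\<^sup>2) powr \<alpha>) * indicator (ball 0 1) (z::complex^'n) \<partial>lborel)"
proof -
  obtain K where K: "K > 0" "ball_integral \<alpha> (\<lambda>_::complex^'n. 1) = ennreal K"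
    using ball_integral_1[OF assms, where 'n = 'n] by blast
  moreover have "(\<integral>\<^sup>+z. f z \<partial>nu \<alpha>)
      = ennreal (1 / K) * (\<integral>\<^sup>+z. f z * ennreal ((1 - (norm z)\<^sup>2) powr \<alpha>) * indicator (ball 0 1) (z::complex^'n) \<partial>lborel)"
    if [measurable]: "f \<in> borel_measurable borel" for f
  proof -
    have "(\<integral>\<^sup>+z. f z \<partial>nu \<alpha>) = (\<integral>\<^sup>+z. indicator (ball 0 1) z * ennreal (1 / K * (1 - (norm z)\<^sup>2) powr \<alpha>) * f (z::complex^'n) \<partial>lborel)"
      unfolding nu_density[OF assms K] by (rule nn_integral_density) measurable
    also have "\<dots> = (\<integral>\<^sup>+z. ennreal (1 / K) * (f z * ennreal ((1 - (norm z)\<^sup>2) powr \<alpha>) * indicator (ball 0 1) (z::complex^'n)) \<partial>lborel)"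
    proof (rule nn_integral_cong)
      fix z :: "complex^'n"
      have "ennreal (1 / K * (1 - (norm z)\<^sup>2) powr \<alpha>) = ennreal (1 / K) * ennreal ((1 - (norm z)\<^sup>2) powr \<alpha>)"
        by (rule ennreal_mult') (use K in simp)
      thus "indicator (ball 0 1) z * ennreal (1 / K * (1 - (norm z)\<^sup>2) powr \<alpha>) * f z
        = ennreal (1 / K) * (f z * ennreal ((1 - (norm z)\<^sup>2) powr \<alpha>) * indicator (ball 0 1) z)"
        by (simp only: mult_ac)
    qed
    also have "\<dots> = ennreal (1 / K) * (\<integral>\<^sup>+z. f z * ennreal ((1 - (norm z)\<^sup>2) powr \<alpha>) * indicator (ball 0 1) (z::complex^'n) \<partial>lborel)"
      by (rule nn_integral_cmult) measurable
    finally show ?thesis .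
  qed
  ultimately show ?thesis using that by blast
qed

lemma emeasure_nu_UNIV: "\<alpha> > -1 \<Longrightarrow> emeasure (nu \<alpha> :: (complex^'n) measure) UNIV = 1"
proof -
  assume a: "\<alpha> > -1"
  obtain K where K: "K > 0" "ball_integral \<alpha> (\<lambda>_::complex^'n. 1) = ennreal K"
    "\<And>f. f \<in> borel_measurable borel \<Longrightarrow> (\<integral>\<^sup>+z. f z \<partial>nu \<alpha>)
      = ennreal (1 / K) * (\<integral>\<^sup>+z. f z * ennreal ((1 - (norm z)\<^sup>2) powr \<alpha>) * indicator (ball 0 1) (z::complex^'n) \<partial>lborel)"
    using nn_integral_nu[OF a, where 'n = 'n] by blast
  have "emeasure (nu \<alpha>) (UNIV :: (complex^'n) set) = (\<integral>\<^sup>+z. 1 \<partial>(nu \<alpha> :: (complex^'n) measure))" by (simp only: nn_integral_const space_nu mult_1)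
  also have "\<dots> = ennreal (1 / K) * ball_integral \<alpha> (\<lambda>_::complex^'n. 1)"
    by (subst K(3)) (simp_all add: ball_integral_def)
  also have "\<dots> = 1" using K by (simp add: ennreal_mult'[symmetric])
  finally show ?thesis .
qed

lemma finite_measure_nu: "\<alpha> > -1 \<Longrightarrow> finite_measure (nu \<alpha> :: (complex^'n) measure)"
  by (rule finite_measureI) (simp add: emeasure_nu_UNIV)

lemma AE_nu_ball: "AE z in nu \<alpha>. z \<in> ball (0::complex^'n) 1"
  unfolding nu_def Let_def
  by (subst AE_density) (auto simp: indicator_def)

lemma nn_integral_nu_herm_power:
  assumes a: "\<alpha> > -1" and u: "norm (u::complex^'n) = 1"
  shows "(\<integral>\<^sup>+z. ennreal (norm (herm z u) ^ (2 * j)) \<partial>nu \<alpha>) = ennreal (fact j / pochhammer (real CARD('n) + 1 + \<alpha>) j)"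
proof -
  let ?N = "real CARD('n) + 1 + \<alpha>"
  obtain K where K: "K > 0" "ball_integral \<alpha> (\<lambda>_::complex^'n. 1) = ennreal K"
    "\<And>f. f \<in> borel_measurable borel \<Longrightarrow> (\<integral>\<^sup>+z. f z \<partial>nu \<alpha>)
      = ennreal (1 / K) * (\<integral>\<^sup>+z. f z * ennreal ((1 - (norm z)\<^sup>2) powr \<alpha>) * indicator (ball 0 1) (z::complex^'n) \<partial>lborel)"
    using nn_integral_nu[OF a, where 'n = 'n] by blast
  obtain L where L: "L > 0" "\<And>(u::complex^'n) j. norm u = 1 \<Longrightarrow> ball_integral \<alpha> (\<lambda>z. norm (herm z u) ^ (2 * j))
       = ennreal (L * fact j / pochhammer ?N j)"
    using ball_integral_herm_power[OF a, where 'n = 'n] by blast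
  have "L = K" using L(2)[OF u, of 0] K L by simp
  have "(\<integral>\<^sup>+z. ennreal (norm (herm z u) ^ (2 * j)) \<partial>nu \<alpha>) = ennreal (1 / K) * ball_integral \<alpha> (\<lambda>z. norm (herm z u) ^ (2 * j))"
    by (subst K(3)) (simp_all add: ball_integral_def ennreal_mult' mult_ac)
  also have "\<dots> = ennreal (1 / K) * ennreal (K * fact j / pochhammer ?N j)"
    using L(2)[OF u] \<open>L = K\<close> by simp
  also have "\<dots> = ennreal (fact j / pochhammer ?N j)"
    using K by (simp add: ennreal_mult'[symmetric])
  finally show ?thesis .
qed

lemma nu_shift:
  assumes a: "\<alpha> > -1" and b: "\<alpha> + s > -1"
  obtains K where "K > 0"
    "nu (\<alpha> + s) = density (nu \<alpha>) (\<lambda>z::complex^'n. ennreal (K * (1 - (norm z)\<^sup>2) powr s))"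
proof -
  obtain K where K: "K > 0" "ball_integral \<alpha> (\<lambda>_::complex^'n. 1) = ennreal K"
    using ball_integral_1[OF a, where 'n = 'n] by blast
  obtain L where L: "L > 0" "ball_integral (\<alpha> + s) (\<lambda>_::complex^'n. 1) = ennreal L"
    using ball_integral_1[OF b, where 'n = 'n] by blast
  have "nu (\<alpha> + s) = density (nu \<alpha>) (\<lambda>z::complex^'n. ennreal (K / L * (1 - (norm z)\<^sup>2) powr s))"
    unfolding nu_density[OF a K] nu_density[OF b L]
    by (subst density_density_eq)
       (use K L in \<open>auto intro!: arg_cong2[where f = density] simp: indicator_def ennreal_mult'[symmetric] powr_add fun_eq_iff\<close>)
  moreover have "K / L > 0" using K L by simp
  ultimately show ?thesis using that by blast
qed

lemma nn_integral_nu_shift: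
  assumes a: "\<alpha> > -1" and b: "\<alpha> + s > -1"
  obtains K where "K > 0"
    "\<And>f. f \<in> borel_measurable borel \<Longrightarrow> (\<integral>\<^sup>+z. f z \<partial>nu (\<alpha> + s))
      = ennreal K * (\<integral>\<^sup>+z. ennreal ((1 - (norm z)\<^sup>2) powr s) * f (z::complex^'n) \<partial>nu \<alpha>)"
proof -
  obtain K where K: "K > 0"
    "nu (\<alpha> + s) = density (nu \<alpha>) (\<lambda>z::complex^'n. ennreal (K * (1 - (norm z)\<^sup>2) powr s))"
    using nu_shift[OF a b] by blast
  have "(\<integral>\<^sup>+z. f z \<partial>nu (\<alpha> + s))
      = ennreal K * (\<integral>\<^sup>+z. ennreal ((1 - (norm z)\<^sup>2) powr s) * f (z::complex^'n) \<partial>nu \<alpha>)"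
    if [measurable]: "f \<in> borel_measurable borel" for f
    unfolding K(2) using K(1)
    by (subst nn_integral_density) (simp_all add: nn_integral_cmult[symmetric] ennreal_mult' mult_ac)
  thus ?thesis using that K by blast
qed

lemma nn_integral_nu_isometry:
  fixes H :: "complex^'n \<Rightarrow> complex^'n"
  assumes a: "\<alpha> > -1" and H: "linear H" "\<And>z. norm (H z) = norm z" and [measurable]: "f \<in> borel_measurable borel"
  shows "(\<integral>\<^sup>+z. f (H z) \<partial>nu \<alpha>) = (\<integral>\<^sup>+z. f z \<partial>nu \<alpha>)"
proof -
  obtain K where K: "\<And>f. f \<in> borel_measurable borel \<Longrightarrow> (\<integral>\<^sup>+z. f z \<partial>nu \<alpha>)
      = ennreal (1 / K) * (\<integral>\<^sup>+z. f z * ennreal ((1 - (norm z)\<^sup>2) powr \<alpha>) * indicator (ball 0 1) (z::complex^'n) \<partial>lborel)"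
    using nn_integral_nu[OF a, where 'n = 'n] by blast
  have [measurable]: "H \<in> borel_measurable borel"
    by (intro borel_measurable_continuous_onI linear_continuous_on linear_conv_bounded_linear[THEN iffD1] H)
  have "(\<integral>\<^sup>+z. f (H z) * ennreal ((1 - (norm z)\<^sup>2) powr \<alpha>) * indicator (ball 0 1) z \<partial>lborel)
     = (\<integral>\<^sup>+z. (\<lambda>z. f z * ennreal ((1 - (norm z)\<^sup>2) powr \<alpha>) * indicator (ball 0 1) z) (H z) \<partial>lborel)"
    by (simp add: H indicator_def)
  also have "\<dots> = (\<integral>\<^sup>+z. f z * ennreal ((1 - (norm z)\<^sup>2) powr \<alpha>) * indicator (ball 0 1) z \<partial>lborel)"
    by (rule nn_integral_lborel_isometry[OF H]) measurable
  finally show ?thesis by (subst (1 2) K) simp_all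
qed

lemma distr_nu_isometry:
  fixes H :: "complex^'n \<Rightarrow> complex^'n"
  assumes a: "\<alpha> > -1" and H: "linear H" "\<And>z. norm (H z) = norm z"
  shows "distr (nu \<alpha>) borel H = nu \<alpha>"
proof (rule measure_eqI)
  have [measurable]: "H \<in> borel_measurable borel"
    by (intro borel_measurable_continuous_onI linear_continuous_on linear_conv_bounded_linear[THEN iffD1] H)
  fix A assume "A \<in> sets (distr (nu \<alpha>) borel H)"
  hence [measurable]: "A \<in> sets borel" by simp
  have "emeasure (distr (nu \<alpha>) borel H) A = (\<integral>\<^sup>+z. indicator A z \<partial>distr (nu \<alpha>) borel H)"
    by simp
  also have "\<dots> = (\<integral>\<^sup>+z. indicator A (H z) \<partial>nu \<alpha>)"
    by (rule nn_integral_distr) simp_all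
  also have "\<dots> = (\<integral>\<^sup>+z. indicator A z \<partial>nu \<alpha>)"
    by (rule nn_integral_nu_isometry[OF a H]) simp
  finally show "emeasure (distr (nu \<alpha>) borel H) A = emeasure (nu \<alpha>) A" by simp
qed simp

lemma integral_nu_isometry:
  fixes H :: "complex^'n \<Rightarrow> complex^'n" and f :: "complex^'n \<Rightarrow> complex"
  assumes a: "\<alpha> > -1" and H: "linear H" "\<And>z. norm (H z) = norm z" and f [measurable]: "f \<in> borel_measurable borel"
  shows "(\<integral>z. f (H z) \<partial>nu \<alpha>) = (\<integral>z. f z \<partial>nu \<alpha>)"
proof -
  have [measurable]: "H \<in> borel_measurable borel"
    by (intro borel_measurable_continuous_onI linear_continuous_on linear_conv_bounded_linear[THEN iffD1] H)
  have "(\<integral>z. f z \<partial>distr (nu \<alpha>) borel H) = (\<integral>z. f (H z) \<partial>nu \<alpha>)"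
    by (rule integral_distr) simp_all
  thus ?thesis by (simp add: distr_nu_isometry[OF a H])
qed

text \<open>Up to a positive constant the integral is the total mass 1 of
  \<open>nu (\<alpha> + s)\<close>.\<close>

lemma nn_integral_nu_powr_finite:
  assumes a: "\<alpha> > -1" and b: "\<alpha> + s > -1"
  shows "(\<integral>\<^sup>+z. ennreal ((1 - (norm (z::complex^'n))\<^sup>2) powr s) \<partial>nu \<alpha>) < \<infinity>"
proof -
  obtain K where K: "K > 0" "\<And>f. f \<in> borel_measurable borel \<Longrightarrow> (\<integral>\<^sup>+z. f z \<partial>nu (\<alpha> + s))
      = ennreal K * (\<integral>\<^sup>+z. ennreal ((1 - (norm z)\<^sup>2) powr s) * f (z::complex^'n) \<partial>nu \<alpha>)"
    using nn_integral_nu_shift[OF a b] by blast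
  have "1 = ennreal K * (\<integral>\<^sup>+z. ennreal ((1 - (norm (z::complex^'n))\<^sup>2) powr s) \<partial>nu \<alpha>)"
    using K(2)[of "\<lambda>_. 1"] emeasure_nu_UNIV[OF b, where 'n = 'n] by simp
  thus ?thesis using K(1)
    by (metis ennreal_mult_eq_top_iff ennreal_one_neq_top ennreal_eq_0_iff infinity_ennreal_def less_top linorder_not_le)
qed

lemma AE_nuI: "(\<And>z. z \<in> ball 0 1 \<Longrightarrow> P z) \<Longrightarrow> AE z in nu \<alpha>. P (z::complex^'n)"
  by (rule eventually_mono[OF AE_nu_ball])

lemma borel_measurable_cnj [measurable]: "cnj \<in> borel_measurable borel"
  by (intro borel_measurable_continuous_onI continuous_intros)

lemma integrable_nu_bounded:
  fixes f :: "complex^'n \<Rightarrow> 'b::{banach, second_countable_topology}"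
  assumes "\<alpha> > -1" "f \<in> borel_measurable borel" "\<And>z. z \<in> ball 0 1 \<Longrightarrow> norm (f z) \<le> B"
  shows "integrable (nu \<alpha>) f"
proof -
  interpret finite_measure "nu \<alpha> :: (complex^'n) measure" by (rule finite_measure_nu[OF assms(1)])
  show ?thesis
    by (rule integrable_const_bound[of _ B], rule AE_nuI) (use assms in auto)
qed

lemma integral_nu_cong:
  fixes f g :: "complex^'n \<Rightarrow> 'b::{banach, second_countable_topology}"
  assumes "f \<in> borel_measurable borel" "g \<in> borel_measurable borel" "\<And>z. z \<in> ball 0 1 \<Longrightarrow> f z = g z"
  shows "(\<integral>z. f z \<partial>nu \<alpha>) = (\<integral>z. g z \<partial>nu \<alpha>)"
  by (rule integral_cong_AE; (rule AE_nuI)?) (use assms in auto)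

lemma nn_integral_nu_mono:
  assumes "\<And>z. z \<in> ball 0 1 \<Longrightarrow> f z \<le> g z"
  shows "(\<integral>\<^sup>+z. f z \<partial>nu \<alpha>) \<le> (\<integral>\<^sup>+z. g (z::complex^'n) \<partial>nu \<alpha>)"
  by (rule nn_integral_mono_AE, rule AE_nuI) (use assms in auto)

section \<open>Orthogonality of the powers of \<open>herm z u\<close> and the Parseval
  identity\<close>

lemma sums_integral_nu:
  fixes f :: "nat \<Rightarrow> complex^'n \<Rightarrow> complex"
  assumes a: "\<alpha> > -1" and m [measurable]: "\<And>j. f j \<in> borel_measurable borel"
    and B: "\<And>j z. z \<in> ball 0 1 \<Longrightarrow> norm (f j z) \<le> B j" "summable B"
  shows "(\<lambda>j. \<integral>z. f j z \<partial>nu \<alpha>) sums (\<integral>z. (\<Sum>j. f j z) \<partial>nu \<alpha>)"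
proof (rule sums_integral)
  interpret finite_measure "nu \<alpha> :: (complex^'n) measure" by (rule finite_measure_nu[OF a])
  show i: "integrable (nu \<alpha>) (f j)" for j by (rule integrable_nu_bounded[OF a m B(1)])
  show "AE z in nu \<alpha>. summable (\<lambda>j. norm (f j z))"
    using AE_nu_ball
  proof (rule eventually_mono)
    fix z :: "complex^'n" assume "z \<in> ball 0 1"
    thus "summable (\<lambda>j. norm (f j z))"
      by (intro summable_comparison_test'[OF B(2), of 0]) (simp add: B(1))
  qed
  have "norm (\<integral>z. norm (f j z) \<partial>nu \<alpha>) \<le> B j" for j
  proof -
    have "(\<integral>z. norm (f j z) \<partial>nu \<alpha>) \<le> (\<integral>z. B j \<partial>(nu \<alpha> :: (complex^'n) measure))"
      by (rule integral_mono_AE; (rule AE_nuI)?) (use i B in auto)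
    also have "\<dots> = B j" by (simp add: measure_def emeasure_nu_UNIV[OF a])
    finally show ?thesis by simp
  qed
  thus "summable (\<lambda>j. \<integral>z. norm (f j z) \<partial>nu \<alpha>)"
    by (intro summable_comparison_test'[OF B(2), of 0]) simp
qed

lemma norm_herm_unit_le: "z \<in> ball 0 1 \<Longrightarrow> norm u = 1 \<Longrightarrow> norm (herm z u) \<le> norm z"
  using norm_herm_le[of z u] by simp

text \<open>For \<open>j \<noteq> k\<close> the rotation by the angle \<open>pi / (j - k)\<close>
  preserves \<open>nu\<close> and changes the sign of the integrand, so the integral equals its own
  negative. The diagonal case is the moment already computed.\<close>

lemma integral_nu_herm_powers:
  assumes a: "\<alpha> > -1" and u: "norm (u::complex^'n) = 1"
  shows "(\<integral>z. herm z u ^ j * cnj (herm z u) ^ k \<partial>nu \<alpha>)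
    = (if j = k then of_real (fact j / pochhammer (real CARD('n) + 1 + \<alpha>) j) else 0)"
proof (cases "j = k")
  case True
  have p: "pochhammer (real CARD('n) + 1 + \<alpha>) j > 0" using a by (intro pochhammer_pos) (simp add: add_pos_nonneg)
  have eq: "herm z u ^ j * cnj (herm z u) ^ j = of_real (norm (herm z u) ^ (2 * j))" for z
    by (simp add: power_mult_distrib[symmetric] complex_norm_square[symmetric] power_mult)
  have "(\<integral>z. norm (herm z u) ^ (2 * j) \<partial>nu \<alpha>) = fact j / pochhammer (real CARD('n) + 1 + \<alpha>) j"
    using p by (subst integral_eq_nn_integral) (simp_all add: nn_integral_nu_herm_power[OF a u])
  thus ?thesis unfolding True[symmetric] by (simp only: eq integral_complex_of_real if_True refl)
next
  case False
  define t where "t = pi / (real j - real k)"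
  define c where "c = cis t"
  have c: "norm c = 1" by (simp add: c_def)
  have "c ^ j * cnj c ^ k = cis ((real j - real k) * t)"
    unfolding c_def cis_cnj Complex.DeMoivre cis_mult by (simp add: algebra_simps)
  also have "\<dots> = - 1" using False by (simp add: t_def)
  finally have cc: "c ^ j * cnj c ^ k = - 1" .
  let ?I = "\<integral>z. herm z u ^ j * cnj (herm z u) ^ k \<partial>nu \<alpha>"
  have "?I = (\<integral>z. herm (c *s z) u ^ j * cnj (herm (c *s z) u) ^ k \<partial>nu \<alpha>)"
    by (rule integral_nu_isometry[OF a linear_vscale, symmetric]) (simp_all add: norm_vscale c)
  also have "\<dots> = (\<integral>z. - (herm z u ^ j * cnj (herm z u) ^ k) \<partial>nu \<alpha>)"
  proof (rule Bochner_Integration.integral_cong)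
    fix z
    have "herm (c *s z) u ^ j * cnj (herm (c *s z) u) ^ k = (c ^ j * cnj c ^ k) * (herm z u ^ j * cnj (herm z u) ^ k)"
      by (simp add: herm_scale_left power_mult_distrib)
    thus "herm (c *s z) u ^ j * cnj (herm (c *s z) u) ^ k = - (herm z u ^ j * cnj (herm z u) ^ k)"
      by (simp add: cc)
  qed simp
  finally have "?I = - ?I" by simp
  thus ?thesis using False by simp
qed

lemma norm_power_series_term_le:
  assumes "z \<in> ball 0 1" "norm u = 1"
  shows "norm (a * herm z u ^ j) \<le> norm a"
proof -
  have "norm (herm z u) \<le> 1" using norm_herm_unit_le[OF assms] assms(1) by simp
  hence "norm (herm z u) ^ j \<le> 1" by (simp add: power_le_one)
  thus ?thesis by (simp add: norm_mult norm_power mult_left_le)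
qed

text \<open>Parseval for functions of \<open>herm z u\<close>. Absolute summability of the
  coefficients dominates the series on the whole ball, so that integration term by term is
  legitimate in each factor in turn.\<close>

lemma integral_nu_power_series_product:
  fixes a b :: "nat \<Rightarrow> complex"
  assumes \<alpha>: "\<alpha> > -1" and u: "norm (u::complex^'n) = 1"
    and sa: "summable (\<lambda>j. norm (a j))" and sb: "summable (\<lambda>j. norm (b j))"
  shows "(\<lambda>j. a j * cnj (b j) * of_real (fact j / pochhammer (real CARD('n) + 1 + \<alpha>) j)) sums
    (\<integral>z. (\<Sum>j. a j * herm z u ^ j) * cnj (\<Sum>j. b j * herm z u ^ j) \<partial>nu \<alpha>)"
proof -
  let ?m = "\<lambda>j. complex_of_real (fact j / pochhammer (real CARD('n) + 1 + \<alpha>) j)"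
  have sz: "summable (\<lambda>j. norm (a j * herm z u ^ j))" if "z \<in> ball 0 1" for z
    by (rule summable_comparison_test'[OF sa, of 0]) (use norm_power_series_term_le[OF that u] in simp)
  have szb: "summable (\<lambda>j. norm (b j * herm z u ^ j))" if "z \<in> ball 0 1" for z
    by (rule summable_comparison_test'[OF sb, of 0]) (use norm_power_series_term_le[OF that u] in simp)
  have bb: "norm (cnj (\<Sum>k. b k * herm z u ^ k)) \<le> (\<Sum>k. norm (b k))" if z: "z \<in> ball 0 1" for z
  proof -
    have "norm (\<Sum>k. b k * herm z u ^ k) \<le> (\<Sum>k. norm (b k * herm z u ^ k))"
      by (rule summable_norm[OF szb[OF z]])
    also have "\<dots> \<le> (\<Sum>k. norm (b k))"
      by (intro suminf_le szb z sb norm_power_series_term_le u)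
    finally show ?thesis by simp
  qed
  have inner: "(\<integral>z. herm z u ^ j * cnj (\<Sum>k. b k * herm z u ^ k) \<partial>nu \<alpha>) = cnj (b j) * ?m j" for j
  proof -
    have "(\<lambda>k. \<integral>z. herm z u ^ j * cnj (b k * herm z u ^ k) \<partial>nu \<alpha>) sums
      (\<integral>z. (\<Sum>k. herm z u ^ j * cnj (b k * herm z u ^ k)) \<partial>nu \<alpha>)"
    proof (rule sums_integral_nu[OF \<alpha> _ _ sb])
      fix k and z :: "complex^'n" assume z: "z \<in> ball 0 1"
      have "norm (1 * herm z u ^ j) * norm (b k * herm z u ^ k) \<le> norm (1::complex) * norm (b k)"
        by (intro mult_mono norm_power_series_term_le z u) auto
      thus "norm (herm z u ^ j * cnj (b k * herm z u ^ k)) \<le> norm (b k)"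
        by (simp add: norm_mult norm_power)
    qed measurable
    also have "(\<lambda>k. \<integral>z. herm z u ^ j * cnj (b k * herm z u ^ k) \<partial>nu \<alpha>)
      = (\<lambda>k. if k = j then cnj (b j) * ?m j else 0)"
    proof
      fix k
      have "(\<integral>z. herm z u ^ j * cnj (b k * herm z u ^ k) \<partial>nu \<alpha>)
        = (\<integral>z. cnj (b k) * (herm z u ^ j * cnj (herm z u) ^ k) \<partial>nu \<alpha>)"
        by (simp add: mult_ac)
      also have "\<dots> = cnj (b k) * (if j = k then ?m j else 0)"
        using integral_nu_herm_powers[OF \<alpha> u, of j k] by simp
      finally show "(\<integral>z. herm z u ^ j * cnj (b k * herm z u ^ k) \<partial>nu \<alpha>) = (if k = j then cnj (b j) * ?m j else 0)"
        by simp
    qed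
    finally have 1: "(\<integral>z. (\<Sum>k. herm z u ^ j * cnj (b k * herm z u ^ k)) \<partial>nu \<alpha>) = cnj (b j) * ?m j"
      using sums_single[of j "\<lambda>k. cnj (b j) * ?m j"] sums_unique2 by (metis (no_types, lifting) ext)
    have "(\<integral>z. herm z u ^ j * cnj (\<Sum>k. b k * herm z u ^ k) \<partial>nu \<alpha>)
       = (\<integral>z. (\<Sum>k. herm z u ^ j * cnj (b k * herm z u ^ k)) \<partial>nu \<alpha>)"
    proof (rule integral_nu_cong)
      fix z :: "complex^'n" assume z: "z \<in> ball 0 1"
      have s: "summable (\<lambda>k. b k * herm z u ^ k)" using szb[OF z] by (rule summable_norm_cancel)
      have "(\<lambda>k. cnj (b k * herm z u ^ k)) sums cnj (\<Sum>k. b k * herm z u ^ k)"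
        unfolding sums_cnj using s by (rule summable_sums)
      hence "(\<lambda>k. herm z u ^ j * cnj (b k * herm z u ^ k)) sums (herm z u ^ j * cnj (\<Sum>k. b k * herm z u ^ k))"
        by (rule sums_mult)
      thus "herm z u ^ j * cnj (\<Sum>k. b k * herm z u ^ k) = (\<Sum>k. herm z u ^ j * cnj (b k * herm z u ^ k))"
        by (rule sums_unique)
    qed measurable
    thus ?thesis using 1 by simp
  qed
  have "(\<lambda>j. \<integral>z. a j * herm z u ^ j * cnj (\<Sum>k. b k * herm z u ^ k) \<partial>nu \<alpha>) sums
      (\<integral>z. (\<Sum>j. a j * herm z u ^ j * cnj (\<Sum>k. b k * herm z u ^ k)) \<partial>nu \<alpha>)"
  proof (rule sums_integral_nu[OF \<alpha>])
    fix j and z :: "complex^'n" assume z: "z \<in> ball 0 1"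
    have "norm (a j * herm z u ^ j) * norm (cnj (\<Sum>k. b k * herm z u ^ k)) \<le> norm (a j) * (\<Sum>k. norm (b k))"
      by (intro mult_mono norm_power_series_term_le z u bb) auto
    thus "norm (a j * herm z u ^ j * cnj (\<Sum>k. b k * herm z u ^ k)) \<le> norm (a j) * (\<Sum>k. norm (b k))"
      by (simp add: norm_mult)
  next
    show "summable (\<lambda>j. norm (a j) * (\<Sum>k. norm (b k)))" using sa by (rule summable_mult2)
  qed measurable
  also have "(\<lambda>j. \<integral>z. a j * herm z u ^ j * cnj (\<Sum>k. b k * herm z u ^ k) \<partial>nu \<alpha>) = (\<lambda>j. a j * cnj (b j) * ?m j)"
  proof
    fix j
    have "(\<integral>z. a j * herm z u ^ j * cnj (\<Sum>k. b k * herm z u ^ k) \<partial>nu \<alpha>)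
      = (\<integral>z. a j * (herm z u ^ j * cnj (\<Sum>k. b k * herm z u ^ k)) \<partial>nu \<alpha>)" by (simp only: mult.assoc)
    also have "\<dots> = a j * (cnj (b j) * ?m j)" unfolding inner[symmetric] by simp
    finally show "(\<integral>z. a j * herm z u ^ j * cnj (\<Sum>k. b k * herm z u ^ k) \<partial>nu \<alpha>) = a j * cnj (b j) * ?m j"
      by (simp only: mult.assoc)
  qed
  also have "(\<integral>z. (\<Sum>j. a j * herm z u ^ j * cnj (\<Sum>k. b k * herm z u ^ k)) \<partial>nu \<alpha>)
    = (\<integral>z. (\<Sum>j. a j * herm z u ^ j) * cnj (\<Sum>j. b j * herm z u ^ j) \<partial>nu \<alpha>)"
    by (rule integral_nu_cong) (use sz[THEN summable_norm_cancel] in \<open>auto intro!: suminf_mult2[symmetric]\<close>)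
  finally show ?thesis .
qed

section \<open>The kernels \<open>(1 - x) powr (- s)\<close>\<close>

text \<open>The principal branch: \<open>1 - x\<close> has positive real part on the unit disc, so
  \<open>kern s\<close> is holomorphic there. With \<open>x = herm z w\<close> and
  \<open>s = n + 1 + \<alpha>\<close> it is the reproducing kernel of weight \<alpha>.\<close>

definition kern :: "real \<Rightarrow> complex \<Rightarrow> complex" where
  "kern s x = (1 - x) powr (- of_real s)"

lemma one_minus_not_nonpos: "norm x < 1 \<Longrightarrow> 1 - (x::complex) \<notin> \<real>\<^sub>\<le>\<^sub>0"
  using abs_Re_le_cmod[of x] by (auto simp: complex_nonpos_Reals_iff)

lemma norm_kern: "norm (kern s x) = norm (1 - x) powr (- s)"
  using norm_powr_real_powr'[of "- of_real s" "1 - x"] by (simp add: kern_def)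

lemma kern_mult: "x \<noteq> 1 \<Longrightarrow> kern s x * kern t x = kern (s + t) x"
  by (simp add: kern_def powr_add[symmetric])

lemma cnj_kern: "norm x < 1 \<Longrightarrow> cnj (kern s x) = kern s (cnj x)"
  unfolding kern_def using one_minus_not_nonpos[of x]
  by (subst cnj_powr) (auto simp: complex_nonpos_Reals_iff)

lemma DERIV_kern:
  assumes "norm x < 1"
  shows "(kern s has_field_derivative (of_real s * kern (s + 1) x)) (at x)"
proof -
  have e: "- of_real s - 1 = - complex_of_real (s + 1)" by simp
  have "(kern s has_field_derivative (- of_real s * (1 - x) powr (- of_real s - 1) * - 1)) (at x)"
    unfolding kern_def[abs_def] using one_minus_not_nonpos[OF assms]
    by (auto intro!: derivative_eq_intros)
  thus ?thesis unfolding e by (simp add: kern_def)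
qed

lemma borel_measurable_kern [measurable]: "kern s \<in> borel_measurable borel"
  unfolding kern_def[abs_def] powr_def by measurable

lemma kern_sums:
  fixes x :: complex and s :: real
  assumes "norm x < 1"
  shows "(\<lambda>j. of_real (pochhammer s j / fact j) * x ^ j) sums kern s x"
proof -
  have "(\<lambda>j. ((- of_real s) gchoose j) * (- x) ^ j) sums (1 + (- x)) powr (- of_real s)"
    by (rule gen_binomial_complex) (use assms in simp)
  moreover have "((- complex_of_real s) gchoose j) * (- x) ^ j = of_real (pochhammer s j / fact j) * x ^ j" for j
  proof -
    have "(- 1) ^ j * (- x) ^ j = x ^ j" by (simp add: power_mult_distrib[symmetric])
    thus ?thesis
      by (simp add: gbinomial_pochhammer pochhammer_of_real mult_ac)
  qed
  ultimately show ?thesis by (simp add: kern_def)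
qed

lemma kern_coeff_summable:
  fixes s \<rho> :: real
  assumes "s > 0" "0 \<le> \<rho>" "\<rho> < 1"
  shows "summable (\<lambda>j. pochhammer s j / fact j * \<rho> ^ j)"
    and "(\<Sum>j. pochhammer s j / fact j * \<rho> ^ j) = (1 - \<rho>) powr (- s)"
proof -
  have "(\<lambda>j. of_real (pochhammer s j / fact j) * of_real \<rho> ^ j) sums kern s (of_real \<rho>)"
    by (rule kern_sums) (use assms in simp)
  also have "kern s (of_real \<rho>) = of_real ((1 - \<rho>) powr (- s))"
    using assms powr_of_real[of "1 - \<rho>" "- s"] by (simp add: kern_def)
  finally have "(\<lambda>j. complex_of_real (pochhammer s j / fact j * \<rho> ^ j)) sums of_real ((1 - \<rho>) powr (- s))"
    by simp
  hence "(\<lambda>j. pochhammer s j / fact j * \<rho> ^ j) sums ((1 - \<rho>) powr (- s))"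
    by (simp only: sums_of_real_iff)
  thus "summable (\<lambda>j. pochhammer s j / fact j * \<rho> ^ j)"
    "(\<Sum>j. pochhammer s j / fact j * \<rho> ^ j) = (1 - \<rho>) powr (- s)"
    by (auto simp: sums_iff)
qed

text \<open>The quotient tends to \<open>Gamma x * Gamma y / Gamma s\<^sup>2\<close>.\<close>

lemma pochhammer_quotient_bounded:
  fixes s x y :: real
  assumes "x > 0" "y > 0" "x + y = 2 * s"
  obtains C where "C > 0" "\<And>j. (pochhammer s j)\<^sup>2 \<le> C * (pochhammer x j * pochhammer y j)"
proof -
  have s: "s > 0" using assms by simp
  define R where "R = (\<lambda>j. (pochhammer s j)\<^sup>2 / (pochhammer x j * pochhammer y j))"
  have gs: "Gamma s \<noteq> 0" using Gamma_real_pos[OF s] by linarith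
  have "(\<lambda>n. Gamma_series x n * Gamma_series y n / (Gamma_series s n)\<^sup>2) \<longlonglongrightarrow> Gamma x * Gamma y / (Gamma s)\<^sup>2"
    using gs by (intro tendsto_intros Gamma_series_LIMSEQ) simp
  \<comment> \<open>\<open>Gamma_series x n\<close> is
    \<open>fact n * n powr x / pochhammer x (Suc n)\<close>. As \<open>x + y = 2 * s\<close>, the
    powers of \<open>n\<close> and the factorials cancel in the quotient.\<close>
  moreover have "eventually (\<lambda>n. Gamma_series x n * Gamma_series y n / (Gamma_series s n)\<^sup>2 = R (Suc n)) sequentially"
    using eventually_gt_at_top[of 0]
  proof (rule eventually_mono)
    fix n :: nat assume "n > 0"
    have "x * ln (real n) + y * ln (real n) = s * ln (real n) + s * ln (real n)"
      using assms(3) by (simp add: distrib_right[symmetric])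
    hence e: "exp (x * ln (real n)) * exp (y * ln (real n)) = exp (s * ln (real n)) * exp (s * ln (real n))"
      by (simp only: exp_add[symmetric])
    have p: "pochhammer x (Suc n) > 0" "pochhammer y (Suc n) > 0" "pochhammer s (Suc n) > 0"
      using assms s by (simp_all add: pochhammer_pos)
    have "Gamma_series x n * Gamma_series y n = (fact n)\<^sup>2 * (exp (s * ln (real n)))\<^sup>2 / (pochhammer x (Suc n) * pochhammer y (Suc n))"
      by (simp add: Gamma_series_def power2_eq_square e)
    moreover have "(Gamma_series s n)\<^sup>2 = (fact n)\<^sup>2 * (exp (s * ln (real n)))\<^sup>2 / (pochhammer s (Suc n))\<^sup>2"
      by (simp add: Gamma_series_def power_divide power_mult_distrib)
    ultimately show "Gamma_series x n * Gamma_series y n / (Gamma_series s n)\<^sup>2 = R (Suc n)"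
      by (simp add: R_def)
  qed
  ultimately have "(\<lambda>n. R (Suc n)) \<longlonglongrightarrow> Gamma x * Gamma y / (Gamma s)\<^sup>2"
    by (rule Lim_transform_eventually)
  hence "convergent R" using convergent_Suc_iff convergent_def by blast
  then obtain C where C: "C > 0" "\<And>j. norm (R j) \<le> C"
    using convergent_imp_Bseq BseqE by metis
  have "(pochhammer s j)\<^sup>2 \<le> C * (pochhammer x j * pochhammer y j)" for j
  proof -
    have "pochhammer x j * pochhammer y j > 0" using assms by (simp add: pochhammer_pos)
    moreover have "R j \<le> C" using C(2)[of j] by simp
    ultimately show ?thesis by (simp add: R_def divide_simps)
  qed
  thus ?thesis using C(1) that by blast
qed

lemma unit_vector_polar:
  fixes a :: "complex^'n"
  obtains u where "norm u = 1" "a = norm a *\<^sub>R u"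
proof (cases "a = 0")
  case True
  fix i0 :: 'n
  show ?thesis by (rule that[of "axis i0 1"]) (use True in \<open>simp_all add: norm_axis_1\<close>)
next
  case False
  show ?thesis by (rule that[of "sgn a"]) (use False in \<open>simp_all add: norm_sgn sgn_div_norm\<close>)
qed

text \<open>Parseval for \<open>kern (b/2)\<close>, followed by a comparison of coefficients with those of
  \<open>kern (b - N)\<close>.\<close>

lemma forelli_rudin:
  assumes \<alpha>: "\<alpha> > -1" and b: "b > real CARD('n) + 1 + \<alpha>"
  obtains C where "C > 0"
    "\<And>w::complex^'n. w \<in> ball 0 1 \<Longrightarrow> (\<integral>\<^sup>+z. ennreal (norm (1 - herm z w) powr (- b)) \<partial>nu \<alpha>)
       \<le> ennreal (C * (1 - (norm w)\<^sup>2) powr (real CARD('n) + 1 + \<alpha> - b))"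
proof -
  let ?N = "real CARD('n) + 1 + \<alpha>"
  have N: "?N > 0" using \<alpha> by (simp add: add_pos_nonneg)
  \<comment> \<open>Half the exponent, so that the squared modulus of \<open>kern s\<close> is the
    integrand. The comparison pair \<open>N\<close> and \<open>b - N\<close> has sum
    \<open>2 * s\<close>, and both are positive because \<open>b > N\<close>.\<close>
  define s where "s = b / 2"
  have s: "s > 0" using N b by (simp add: s_def)
  obtain C where C: "C > 0" "\<And>j. (pochhammer s j)\<^sup>2 \<le> C * (pochhammer ?N j * pochhammer (b - ?N) j)"
    using pochhammer_quotient_bounded[of ?N "b - ?N" s] N b by (auto simp: s_def)
  have "(\<integral>\<^sup>+z. ennreal (norm (1 - herm z w) powr (- b)) \<partial>nu \<alpha>) \<le> ennreal (C * (1 - (norm w)\<^sup>2) powr (?N - b))"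
    if w: "w \<in> ball 0 1" for w :: "complex^'n"
  proof -
    obtain u where u: "norm u = 1" "w = norm w *\<^sub>R u" by (rule unit_vector_polar)
    define \<rho> where "\<rho> = norm w"
    have \<rho>: "0 \<le> \<rho>" "\<rho> < 1" using w by (simp_all add: \<rho>_def)
    have \<rho>2: "0 \<le> \<rho>\<^sup>2" "\<rho>\<^sup>2 < 1" using \<rho> by (simp_all add: abs_square_less_1)
    have hw: "herm z w = of_real \<rho> * herm z u" for z
      by (subst u(2)) (simp add: herm_scaleR_right \<rho>_def)
    define a where "a = (\<lambda>j. complex_of_real (pochhammer s j / fact j * \<rho> ^ j))"
    have pos: "pochhammer s j / fact j * \<rho> ^ j \<ge> 0" for j
      using s \<rho> by (simp add: pochhammer_nonneg)
    have na: "norm (a j) = pochhammer s j / fact j * \<rho> ^ j" for j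
      unfolding a_def norm_of_real by (rule abs_of_nonneg[OF pos])
    have sa: "summable (\<lambda>j. norm (a j))"
      unfolding na by (rule kern_coeff_summable[OF s \<rho>])
    have lt: "norm (herm z w) < 1" if "z \<in> ball 0 1" for z
      using norm_herm_le[of z w] that w mult_strict_mono[of "norm z" 1 "norm w" 1] by auto
    have ser: "(\<Sum>j. a j * herm z u ^ j) = kern s (herm z w)" if "z \<in> ball 0 1" for z
    proof -
      have "(\<lambda>j. of_real (pochhammer s j / fact j) * herm z w ^ j) sums kern s (herm z w)"
        by (rule kern_sums[OF lt[OF that]])
      moreover have "of_real (pochhammer s j / fact j) * herm z w ^ j = a j * herm z u ^ j" for j
        by (simp add: a_def hw power_mult_distrib)
      ultimately show ?thesis by (simp add: sums_iff)
    qed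
    let ?I = "\<integral>z. norm (1 - herm z w) powr (- b) \<partial>nu \<alpha>"
    have sq: "kern s (herm z w) * cnj (kern s (herm z w)) = of_real (norm (1 - herm z w) powr (- b))" for z
    proof -
      have "kern s (herm z w) * cnj (kern s (herm z w)) = of_real ((norm (kern s (herm z w)))\<^sup>2)"
        by (rule complex_norm_square[symmetric])
      also have "(norm (kern s (herm z w)))\<^sup>2 = norm (1 - herm z w) powr (- b)"
        by (simp add: norm_kern power2_eq_square powr_add[symmetric] s_def)
      finally show ?thesis .
    qed
    have "(\<lambda>j. a j * cnj (a j) * of_real (fact j / pochhammer ?N j)) sums
        (\<integral>z. (\<Sum>j. a j * herm z u ^ j) * cnj (\<Sum>j. a j * herm z u ^ j) \<partial>nu \<alpha>)"
      by (rule integral_nu_power_series_product[OF \<alpha> u(1) sa sa])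
    also have "(\<integral>z. (\<Sum>j. a j * herm z u ^ j) * cnj (\<Sum>j. a j * herm z u ^ j) \<partial>nu \<alpha>)
        = (\<integral>z. of_real (norm (1 - herm z w) powr (- b)) \<partial>nu \<alpha>)"
      by (rule integral_nu_cong) (simp_all add: ser sq)
    also have "\<dots> = of_real ?I" by simp
    finally have "(\<lambda>j. complex_of_real ((pochhammer s j / fact j * \<rho> ^ j)\<^sup>2 * (fact j / pochhammer ?N j))) sums of_real ?I"
      by (simp add: a_def power2_eq_square)
    hence sums: "(\<lambda>j. (pochhammer s j / fact j * \<rho> ^ j)\<^sup>2 * (fact j / pochhammer ?N j)) sums ?I"
      by (simp only: sums_of_real_iff)
    have "?I \<le> C * (1 - \<rho>\<^sup>2) powr (- (b - ?N))"
    proof (rule sums_le[OF _ sums])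
      have "(\<lambda>j. pochhammer (b - ?N) j / fact j * (\<rho>\<^sup>2) ^ j) sums ((1 - \<rho>\<^sup>2) powr (- (b - ?N)))"
        using kern_coeff_summable[of "b - ?N" "\<rho>\<^sup>2"] \<rho>2 b by (auto simp: sums_iff)
      thus "(\<lambda>j. C * (pochhammer (b - ?N) j / fact j * (\<rho>\<^sup>2) ^ j)) sums (C * (1 - \<rho>\<^sup>2) powr (- (b - ?N)))"
        by (rule sums_mult)
      fix j
      have p: "pochhammer ?N j > 0" using N by (rule pochhammer_pos)
      have "(pochhammer s j / fact j * \<rho> ^ j)\<^sup>2 * (fact j / pochhammer ?N j)
        = (pochhammer s j)\<^sup>2 * ((\<rho>\<^sup>2) ^ j / (fact j * pochhammer ?N j))"
        using p by (simp add: power2_eq_square power_mult_distrib field_simps)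
      also have "\<dots> \<le> C * (pochhammer ?N j * pochhammer (b - ?N) j) * ((\<rho>\<^sup>2) ^ j / (fact j * pochhammer ?N j))"
        by (intro mult_right_mono C) (use p in auto)
      also have "\<dots> = C * (pochhammer (b - ?N) j / fact j * (\<rho>\<^sup>2) ^ j)"
        using p by (simp add: field_simps)
      finally show "(pochhammer s j / fact j * \<rho> ^ j)\<^sup>2 * (fact j / pochhammer ?N j)
        \<le> C * (pochhammer (b - ?N) j / fact j * (\<rho>\<^sup>2) ^ j)" .
    qed
    moreover have "(\<integral>\<^sup>+z. ennreal (norm (1 - herm z w) powr (- b)) \<partial>nu \<alpha>) = ennreal ?I"
    proof (rule nn_integral_eq_integral)
      show "integrable (nu \<alpha>) (\<lambda>z. norm (1 - herm z w) powr (- b))"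
      proof (rule integrable_nu_bounded[OF \<alpha>])
        fix z :: "complex^'n" assume z: "z \<in> ball 0 1"
        have "norm (herm z w) \<le> norm z * norm w" by (rule norm_herm_le)
        also have "\<dots> \<le> \<rho>" using z \<rho> by (simp add: \<rho>_def mult_left_le_one_le)
        finally have "1 - \<rho> \<le> norm (1 - herm z w)"
          using norm_triangle_ineq2[of 1 "herm z w"] by simp
        hence "norm (1 - herm z w) powr (- b) \<le> (1 - \<rho>) powr (- b)"
          using \<rho> b N by (intro powr_mono2') auto
        thus "norm (norm (1 - herm z w) powr (- b)) \<le> (1 - \<rho>) powr (- b)" by simp
      qed measurable
    qed simp
    ultimately show ?thesis by (simp add: \<rho>_def ennreal_leI)
  qed
  thus ?thesis using C(1) that by blast
qed

section \<open>Holomorphic functions on the ball\<close>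

lemma holomorphic_Cn_on_subset: "holomorphic_Cn_on f S \<Longrightarrow> T \<subseteq> S \<Longrightarrow> holomorphic_Cn_on f T"
  by (auto simp: holomorphic_Cn_on_def)

lemma holomorphic_Cn_on_const: "holomorphic_Cn_on (\<lambda>_. c) S"
  unfolding holomorphic_Cn_on_def by (intro ballI exI[of _ "\<lambda>_. 0"]) simp

lemma holomorphic_Cn_on_add:
  assumes "holomorphic_Cn_on f S" "holomorphic_Cn_on g S"
  shows "holomorphic_Cn_on (\<lambda>z. f z + g z) S"
  unfolding holomorphic_Cn_on_def
proof
  fix z assume "z \<in> S"
  then obtain D E where "(f has_derivative D) (at z)" "\<And>c v. D (c *s v) = c * D v"
    "(g has_derivative E) (at z)" "\<And>c v. E (c *s v) = c * E v"
    using assms unfolding holomorphic_Cn_on_def by meson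
  thus "\<exists>D. ((\<lambda>z. f z + g z) has_derivative D) (at z) \<and> (\<forall>c v. D (c *s v) = c * D v)"
    by (intro exI[of _ "\<lambda>v. D v + E v"]) (auto intro!: derivative_intros simp: algebra_simps)
qed

lemma holomorphic_Cn_on_mult:
  assumes "holomorphic_Cn_on f S" "holomorphic_Cn_on g S"
  shows "holomorphic_Cn_on (\<lambda>z. f z * g z) S"
  unfolding holomorphic_Cn_on_def
proof
  fix z assume "z \<in> S"
  then obtain D E where "(f has_derivative D) (at z)" "\<And>c v. D (c *s v) = c * D v"
    "(g has_derivative E) (at z)" "\<And>c v. E (c *s v) = c * E v"
    using assms unfolding holomorphic_Cn_on_def by meson
  thus "\<exists>D. ((\<lambda>z. f z * g z) has_derivative D) (at z) \<and> (\<forall>c v. D (c *s v) = c * D v)"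
    by (intro exI[of _ "\<lambda>v. f z * E v + D v * g z"] conjI has_derivative_mult) (auto simp: algebra_simps)
qed

lemma holomorphic_Cn_on_cmult: "holomorphic_Cn_on f S \<Longrightarrow> holomorphic_Cn_on (\<lambda>z. c * f z) S"
  by (intro holomorphic_Cn_on_mult holomorphic_Cn_on_const)

lemma holomorphic_Cn_on_diff:
  "holomorphic_Cn_on f S \<Longrightarrow> holomorphic_Cn_on g S \<Longrightarrow> holomorphic_Cn_on (\<lambda>z. f z - g z) S"
  using holomorphic_Cn_on_add[of f S "\<lambda>z. (-1) * g z"] holomorphic_Cn_on_cmult[of g S "-1"] by simp

lemma holomorphic_Cn_on_sum:
  "(\<And>i. i \<in> I \<Longrightarrow> holomorphic_Cn_on (f i) S) \<Longrightarrow> holomorphic_Cn_on (\<lambda>z. \<Sum>i\<in>I. f i z) S"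
  by (induction I rule: infinite_finite_induct)
     (auto intro!: holomorphic_Cn_on_const holomorphic_Cn_on_add)

lemma holomorphic_Cn_on_herm: "holomorphic_Cn_on (\<lambda>z. herm z w) S"
  unfolding holomorphic_Cn_on_def
  by (intro ballI exI[of _ "\<lambda>v. herm v w"])
     (auto intro!: bounded_linear_imp_has_derivative bounded_linear_herm_left simp: herm_scale_left)

lemma holomorphic_Cn_on_compose:
  assumes "holomorphic_Cn_on f S" "\<And>z. z \<in> S \<Longrightarrow> (\<phi> has_field_derivative \<phi>' (f z)) (at (f z))"
  shows "holomorphic_Cn_on (\<lambda>z. \<phi> (f z)) S"
  unfolding holomorphic_Cn_on_def
proof
  fix z assume z: "z \<in> S"
  then obtain D where D: "(f has_derivative D) (at z)" "\<And>c v. D (c *s v) = c * D v"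
    using assms unfolding holomorphic_Cn_on_def by meson
  have "(\<phi> has_derivative (\<lambda>h. \<phi>' (f z) * h)) (at (f z))"
    using assms(2)[OF z] by (simp add: has_field_derivative_def)
  from has_derivative_compose[OF D(1) this] D(2)
  show "\<exists>D. ((\<lambda>z. \<phi> (f z)) has_derivative D) (at z) \<and> (\<forall>c v. D (c *s v) = c * D v)"
    by (intro exI[of _ "\<lambda>v. \<phi>' (f z) * D v"]) simp
qed

lemma holomorphic_Cn_on_cong:
  assumes "holomorphic_Cn_on f S" "open S" "\<And>z. z \<in> S \<Longrightarrow> f z = g z"
  shows "holomorphic_Cn_on g S"
  unfolding holomorphic_Cn_on_def
proof
  fix z assume z: "z \<in> S"
  then obtain D where "(f has_derivative D) (at z)" "\<And>c v. D (c *s v) = c * D v"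
    using assms unfolding holomorphic_Cn_on_def by meson
  thus "\<exists>D. (g has_derivative D) (at z) \<and> (\<forall>c v. D (c *s v) = c * D v)"
    using has_derivative_transform_within_open[OF _ assms(2) z assms(3)] by meson
qed

lemma holomorphic_Cn_on_dilate:
  assumes "holomorphic_Cn_on f S" "\<And>z. z \<in> T \<Longrightarrow> r *\<^sub>R z \<in> S"
  shows "holomorphic_Cn_on (\<lambda>z. f (r *\<^sub>R z)) T"
  unfolding holomorphic_Cn_on_def
proof
  fix z assume "z \<in> T"
  then obtain D where D: "(f has_derivative D) (at (r *\<^sub>R z))" "\<And>c v. D (c *s v) = c * D v"
    using assms unfolding holomorphic_Cn_on_def by meson
  have "((\<lambda>z. r *\<^sub>R z) has_derivative (\<lambda>v. r *\<^sub>R v)) (at z)" by (auto intro!: derivative_eq_intros)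
  from has_derivative_compose[OF this D(1)]
  show "\<exists>D. ((\<lambda>z. f (r *\<^sub>R z)) has_derivative D) (at z) \<and> (\<forall>c v. D (c *s v) = c * D v)"
    by (intro exI[of _ "\<lambda>v. D (r *\<^sub>R v)"]) (auto simp: D(2) scaleR_eq_vscale)
qed

lemma holomorphic_Cn_on_imp_continuous_on: "holomorphic_Cn_on f S \<Longrightarrow> continuous_on S f"
  unfolding holomorphic_Cn_on_def
  by (meson continuous_at_imp_continuous_on has_derivative_continuous)

lemma holomorphic_slice:
  assumes "holomorphic_Cn_on f S" "\<And>t. t \<in> U \<Longrightarrow> p + t *s q \<in> S"
  shows "(\<lambda>t. f (p + t *s q)) holomorphic_on U"
  unfolding holomorphic_on_def
proof
  fix t assume "t \<in> U"
  then obtain D where D: "(f has_derivative D) (at (p + t *s q))" "\<And>c v. D (c *s v) = c * D v"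
    using assms unfolding holomorphic_Cn_on_def by meson
  have "bounded_linear (\<lambda>t. t *s q)"
    by (rule bounded_linear_intro[where K = "norm q"])
       (auto simp: vec_eq_iff algebra_simps scaleR_conv_of_real[where 'a = complex] norm_vscale)
  hence "((\<lambda>t. p + t *s q) has_derivative (\<lambda>h. h *s q)) (at t)"
    by (intro has_derivative_eq_rhs[OF has_derivative_add[OF has_derivative_const bounded_linear_imp_has_derivative]]) auto
  note 1 = has_derivative_compose[OF this D(1)]
  have "(\<lambda>h. D (h *s q)) = (*) (D q)" by (simp add: D(2) fun_eq_iff)
  with 1 have "((\<lambda>t. f (p + t *s q)) has_field_derivative D q) (at t)"
    unfolding has_field_derivative_def by metis
  thus "(\<lambda>t. f (p + t *s q)) field_differentiable at t within U"
    using field_differentiable_def field_differentiable_at_within by blast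
qed

text \<open>By complex linearity of \<open>D\<close> the partial derivatives are the values of
  \<open>D\<close> at the coordinate vectors, and they sum up to the derivative in the direction
  \<open>z\<close>. Every later computation with \<open>radial_deriv\<close> goes through this
  form.\<close>

lemma radial_deriv_eq:
  assumes D: "(f has_derivative D) (at z)" "\<And>c v. D (c *s v) = c * D v"
  shows "radial_deriv f z = D z"
proof -
  have p: "complex_partial j f z = D (axis j 1)" for j
  proof -
    have "bounded_linear (\<lambda>t. t *s (axis j 1 :: complex^'a))"
      by (rule bounded_linear_intro[where K = "norm (axis j 1 :: complex^'a)"])
         (auto simp: vec_eq_iff algebra_simps scaleR_conv_of_real[where 'a = complex] norm_vscale)
    hence "((\<lambda>t. z + t *s axis j 1) has_derivative (\<lambda>h. h *s axis j 1)) (at 0)"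
      by (intro has_derivative_eq_rhs[OF has_derivative_add[OF has_derivative_const bounded_linear_imp_has_derivative]]) auto
    moreover have "(f has_derivative D) (at (z + 0 *s axis j 1))" using D(1) by simp
    moreover have "(\<lambda>h. D (h *s axis j 1)) = (*) (D (axis j 1))" by (simp add: D(2) fun_eq_iff)
    ultimately have "((\<lambda>t. f (z + t *s axis j 1)) has_field_derivative D (axis j 1)) (at 0)"
      using has_derivative_compose unfolding has_field_derivative_def by metis
    thus ?thesis unfolding complex_partial_def by (rule DERIV_imp_deriv)
  qed
  interpret bounded_linear D using D(1) by (rule has_derivative_bounded_linear)
  have "D z = D (\<Sum>j\<in>UNIV. z $ j *s axis j 1)" by (simp only: basis_expansion)
  also have "\<dots> = radial_deriv f z" by (simp add: sum D(2) radial_deriv_def p)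
  finally show ?thesis by simp
qed

lemma radial_deriv_cong:
  assumes "open S" "z \<in> S" "\<And>w. w \<in> S \<Longrightarrow> f w = g w"
  shows "radial_deriv f z = radial_deriv g z"
proof -
  have "complex_partial j f z = complex_partial j g z" for j
    unfolding complex_partial_def
  proof (rule deriv_cong_ev)
    have "continuous_on UNIV (\<lambda>w. z + w *s axis j (1::complex))"
      by (intro continuous_intros)
    hence "open ((\<lambda>w. z + w *s axis j 1) -` S)"
      using assms(1) by (rule open_vimage[OF _ _, rotated])
    hence "\<forall>\<^sub>F w in nhds 0. w \<in> (\<lambda>w. z + w *s axis j 1) -` S"
      by (rule eventually_nhds_in_open) (use assms in simp)
    thus "\<forall>\<^sub>F w in nhds 0. f (z + w *s axis j 1) = g (z + w *s axis j 1)"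
      by (rule eventually_mono) (use assms in simp)
  qed simp
  thus ?thesis by (simp add: radial_deriv_def)
qed

lemma hol_ballD: "f \<in> hol_ball \<Longrightarrow> holomorphic_Cn_on f (ball 0 1)"
  by (simp add: hol_ball_def)

lemma borel_measurable_hol_ball:
  assumes "f \<in> hol_ball"
  shows "f \<in> borel_measurable borel"
proof -
  have "(\<lambda>z. indicator (ball 0 1) z *\<^sub>R f z) \<in> borel_measurable borel"
    by (intro borel_measurable_continuous_on_indicator holomorphic_Cn_on_imp_continuous_on hol_ballD assms) simp
  also have "(\<lambda>z. indicator (ball 0 1) z *\<^sub>R f z) = f"
    using assms by (auto simp: hol_ball_def indicator_def fun_eq_iff)
  finally show ?thesis .
qed

text \<open>Extension by zero: elements of \<open>hol_ball\<close> vanish off the ball, which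
  kernels and dilates do not do by themselves.\<close>

definition cut_ball :: "(complex^'n \<Rightarrow> complex) \<Rightarrow> complex^'n \<Rightarrow> complex" where
  "cut_ball f z = (if z \<in> ball 0 1 then f z else 0)"

lemma cut_ball_in [simp]: "z \<in> ball 0 1 \<Longrightarrow> cut_ball f z = f z"
  by (simp add: cut_ball_def)

lemma cut_ball_hol: "holomorphic_Cn_on f (ball 0 1) \<Longrightarrow> cut_ball f \<in> hol_ball"
  unfolding hol_ball_def
  by (auto intro: holomorphic_Cn_on_cong simp: cut_ball_def)

section \<open>The reproducing formula\<close>

text \<open>A discrete mean value property: the mean of the k-th powers of the (m+1)-st roots of
  unity is 1 for \<open>k = 0\<close> and 0 for \<open>0 < k \<le> m\<close>. Since
  \<open>R > 1\<close>, the Taylor coefficients are absolutely summable and Tannery's theorem gives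
  the limit. Unlike an integral over the circle, a finite mean commutes with integration over the
  ball by additivity alone.\<close>

lemma mean_over_roots_of_unity:
  assumes hol: "\<phi> holomorphic_on ball 0 R" and R: "R > 1"
  shows "(\<lambda>m. (\<Sum>l<Suc m. \<phi> (cis (2 * pi * real l / real (Suc m)))) / of_nat (Suc m)) \<longlonglongrightarrow> \<phi> 0"
proof -
  define c where "c = (\<lambda>k. (deriv ^^ k) \<phi> 0 / fact k)"
  have ps: "(\<lambda>k. c k * w ^ k) sums \<phi> w" if "w \<in> ball 0 R" for w
    using holomorphic_power_series[OF hol that] by (simp add: c_def)
  define \<rho> where "\<rho> = (1 + R) / 2"
  have \<rho>: "1 < \<rho>" "\<rho> < R" using R by (simp_all add: \<rho>_def)
  have "summable (\<lambda>k. c k * of_real \<rho> ^ k)" using ps[of "of_real \<rho>"] \<rho> by (auto simp: sums_iff)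
  hence "summable (\<lambda>k. norm (c k * 1 ^ k))" by (rule powser_insidea) (use \<rho> in simp)
  hence sc: "summable (\<lambda>k. norm (c k))" by simp
  define e where "e = (\<lambda>k m. (\<Sum>l<Suc m. cis (2 * pi * real l / real (Suc m)) ^ k) / of_nat (Suc m))"
  have e1: "norm (e k m) \<le> 1" for k m
  proof -
    have "norm (\<Sum>l<Suc m. cis (2 * pi * real l / real (Suc m)) ^ k) \<le> (\<Sum>l<Suc m. 1)"
      by (rule order_trans[OF norm_sum sum_mono]) (simp add: norm_power)
    thus ?thesis by (simp add: e_def norm_divide divide_simps del: sum.lessThan_Suc of_nat_Suc)
  qed
  have e0: "e k m = 0" if "0 < k" "k \<le> m" for k m
  proof -
    define \<omega> where "\<omega> = cis (2 * pi * real k / real (Suc m))"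
    have eq: "cis (2 * pi * real l / real (Suc m)) ^ k = \<omega> ^ l" for l
      unfolding \<omega>_def Complex.DeMoivre by (simp add: mult_ac)
    have "\<omega> ^ Suc m = cis (2 * pi * real k)"
      unfolding \<omega>_def Complex.DeMoivre by (simp del: of_nat_Suc)
    also have "\<dots> = 1" by (rule cis_multiple_2pi) simp
    finally have 1: "\<omega> ^ Suc m = 1" .
    have x: "0 < 2 * pi * real k / real (Suc m)" "2 * pi * real k / real (Suc m) < 2 * pi"
      using that by (simp_all add: divide_simps)
    have "\<omega> \<noteq> 1"
    proof
      assume "\<omega> = 1"
      hence "cos (2 * pi * real k / real (Suc m)) = 1" by (metis Re_complex_of_real \<omega>_def cis.sel(1) of_real_1)
      then obtain n :: int where n: "2 * pi * real k / real (Suc m) = of_int n * 2 * pi"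
        using cos_one_2pi_int by blast
      hence "0 < of_int n * (2 * pi)" "of_int n * (2 * pi) < 1 * (2 * pi)" using x by simp_all
      hence "0 < n" "n < 1" by (simp_all add: zero_less_mult_iff mult_less_cancel_right)
      thus False by simp
    qed
    hence "(\<Sum>l<Suc m. \<omega> ^ l) = 0" using 1 geometric_sum[of \<omega> "Suc m"] by simp
    thus ?thesis unfolding e_def eq by simp
  qed
  have mean: "(\<lambda>k. c k * e k m) sums ((\<Sum>l<Suc m. \<phi> (cis (2 * pi * real l / real (Suc m)))) / of_nat (Suc m))" for m
  proof -
    have "(\<lambda>k. \<Sum>l<Suc m. c k * cis (2 * pi * real l / real (Suc m)) ^ k) sums
        (\<Sum>l<Suc m. \<phi> (cis (2 * pi * real l / real (Suc m))))"
      by (rule sums_sum, rule ps) (use R in simp)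
    from sums_divide[OF this, of "of_nat (Suc m)"]
    show ?thesis by (simp add: e_def sum_distrib_left del: sum.lessThan_Suc of_nat_Suc)
  qed
  have "((\<lambda>m. \<Sum>k. c k * e k m) \<longlongrightarrow> (\<Sum>k. if k = 0 then c k else 0)) sequentially"
  proof (rule tannerys_theorem[THEN conjunct2, THEN conjunct2])
    fix k
    show "(\<lambda>m. c k * e k m) \<longlonglongrightarrow> (if k = 0 then c k else 0)"
    proof (cases "k = 0")
      case True
      have "e 0 m = of_nat (Suc m) / of_nat (Suc m)" for m by (simp add: e_def del: of_nat_Suc sum.lessThan_Suc)
      hence "e 0 m = 1" for m by (simp del: of_nat_Suc)
      thus ?thesis using True by simp
    next
      case False
      have "eventually (\<lambda>m. c k * e k m = 0) sequentially"
        using eventually_ge_at_top[of k] by (rule eventually_mono) (use False e0 in simp)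
      thus ?thesis using False by (simp add: tendsto_eventually)
    qed
  next
    show "\<forall>\<^sub>F (k, m) in sequentially \<times>\<^sub>F sequentially. norm (c k * e k m) \<le> norm (c k)"
      by (rule always_eventually) (auto simp: norm_mult intro!: mult_left_le e1)
  qed (use sc in simp_all)
  also have "(\<lambda>m. \<Sum>k. c k * e k m) = (\<lambda>m. (\<Sum>l<Suc m. \<phi> (cis (2 * pi * real l / real (Suc m)))) / of_nat (Suc m))"
    using mean by (simp add: sums_iff)
  also have "(\<Sum>k. if k = 0 then c k else 0) = c 0"
    using sums_single[of 0 c] by (simp add: sums_iff)
  also have "c 0 = \<phi> 0" by (simp add: c_def)
  finally show ?thesis .
qed

lemma norm_herm_lt: "z \<in> ball 0 1 \<Longrightarrow> a \<in> ball 0 1 \<Longrightarrow> norm (herm z a) < 1"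
  using norm_herm_le[of z a] mult_strict_mono[of "norm z" 1 "norm a" 1] by auto

lemma norm_one_minus_herm_ge:
  assumes "z \<in> ball 0 1"
  shows "1 - norm a \<le> norm (1 - herm z a)"
proof -
  have "norm (herm z a) \<le> norm z * norm a" by (rule norm_herm_le)
  also have "\<dots> \<le> norm a" using assms by (simp add: mult_left_le_one_le)
  finally show ?thesis using norm_triangle_ineq2[of 1 "herm z a"] by simp
qed

lemma norm_kern_herm_le:
  assumes "z \<in> ball 0 1" "a \<in> ball 0 1" "s \<ge> 0"
  shows "norm (kern s (herm z a)) \<le> (1 - norm a) powr (- s)"
  unfolding norm_kern using norm_one_minus_herm_ge[OF assms(1), of a] assms
  by (intro powr_mono2') auto

lemma norm_one_minus_herm_commute: "norm (1 - herm z w) = norm (1 - herm w z)"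
  by (metis cnj_herm complex_cnj_diff complex_cnj_one complex_mod_cnj)

lemma kern_herm_cnj: "z \<in> ball 0 1 \<Longrightarrow> a \<in> ball 0 1 \<Longrightarrow> kern s (herm a z) = cnj (kern s (herm z a))"
  by (simp add: cnj_kern norm_herm_lt cnj_herm)

lemma norm_kern_herm_commute: "norm (kern s (herm a z)) = norm (kern s (herm z a))"
  unfolding norm_kern norm_one_minus_herm_commute[of a z] ..

lemma borel_measurable_herm_right [measurable]: "(\<lambda>z. herm a (z::complex^'n)) \<in> borel_measurable borel"
  by (intro borel_measurable_continuous_onI continuous_intros)

lemma bounded_on_cball:
  assumes "holomorphic_Cn_on f (ball 0 R)" "R > 1"
  obtains B where "\<And>z. norm (z::complex^'n) \<le> 1 \<Longrightarrow> norm (f z) \<le> B"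
proof -
  have "continuous_on (cball 0 1) f"
    using assms by (intro holomorphic_Cn_on_imp_continuous_on holomorphic_Cn_on_subset[OF assms(1)]) auto
  hence "compact (f ` cball 0 1)" by (intro compact_continuous_image) auto
  hence "bounded (f ` cball 0 1)" by (rule compact_imp_bounded)
  then obtain B where "\<forall>z\<in>cball 0 1. norm (f z) \<le> B" by (auto simp: bounded_iff)
  thus ?thesis using that[of B] by simp
qed

text \<open>Averaging over the rotations \<^term>\<open>twist u\<close> reduces to functions of \<open>herm z u\<close>, for which
  the power series of both factors are multiplied out.\<close>

theorem reproducing_formula:
  fixes f :: "complex^'n \<Rightarrow> complex"
  assumes \<alpha>: "\<alpha> > -1" and [measurable]: "f \<in> borel_measurable borel"
    and hol: "holomorphic_Cn_on f (ball 0 R)" and R: "R > 1" and a: "a \<in> ball 0 1"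
  shows "(\<integral>z. f z * kern (real CARD('n) + 1 + \<alpha>) (herm a z) \<partial>nu \<alpha>) = f a"
proof -
  let ?N = "real CARD('n) + 1 + \<alpha>"
  have N: "?N > 0" using \<alpha> by (simp add: add_pos_nonneg)
  obtain u where u: "norm u = 1" "a = norm a *\<^sub>R u" by (rule unit_vector_polar)
  define \<rho> where "\<rho> = norm a"
  have \<rho>: "0 \<le> \<rho>" "\<rho> < 1" using a by (simp_all add: \<rho>_def)
  define h where "h = (\<lambda>z. kern ?N (herm a z))"
  have [measurable]: "h \<in> borel_measurable borel" unfolding h_def by measurable
  have ha: "herm a z = of_real \<rho> * cnj (herm z u)" for z
    by (subst u(2)) (simp add: herm_scaleR_left \<rho>_def cnj_herm)
  have ht: "h (twist u c z) = h z" for c z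
    by (simp add: h_def ha herm_twist[OF u(1)])
  define H where "H = (1 - norm a) powr (- ?N)"
  have hB: "norm (h z) \<le> H" if "z \<in> ball 0 1" for z
    unfolding h_def norm_kern_herm_commute[of _ a] H_def using N by (intro norm_kern_herm_le that a) simp
  obtain B where B: "\<And>z. norm z \<le> 1 \<Longrightarrow> norm (f z) \<le> B"
    using bounded_on_cball[OF hol R] by blast
  define A where "A = (\<lambda>m z. (\<Sum>l<Suc m. f (twist u (cis (2 * pi * real l / real (Suc m))) z)) / of_nat (Suc m))"
  have [measurable]: "twist u c \<in> borel_measurable borel" for c
    by (intro borel_measurable_continuous_onI linear_continuous_on linear_conv_bounded_linear[THEN iffD1] linear_twist)
  have [measurable]: "A m \<in> borel_measurable borel" for m unfolding A_def by measurable
  have int: "integrable (nu \<alpha>) (\<lambda>z. f (twist u c z) * h z)" if "norm c = 1" for c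
  proof (rule integrable_nu_bounded[OF \<alpha>])
    fix z :: "complex^'n" assume z: "z \<in> ball 0 1"
    show "norm (f (twist u c z) * h z) \<le> B * H"
      unfolding norm_mult using z norm_twist[OF u(1) that]
      by (intro mult_mono B hB order_trans[OF norm_ge_zero B[of z]]) auto
  qed measurable
  have avg: "(\<integral>z. A m z * h z \<partial>nu \<alpha>) = (\<integral>z. f z * h z \<partial>nu \<alpha>)" for m
  proof -
    have 1: "(\<integral>z. f (twist u c z) * h z \<partial>nu \<alpha>) = (\<integral>z. f z * h z \<partial>nu \<alpha>)" if "norm c = 1" for c
      using integral_nu_isometry[OF \<alpha> linear_twist, of u c "\<lambda>z. f z * h z"] norm_twist[OF u(1) that]
      by (simp add: ht)
    have "(\<integral>z. A m z * h z \<partial>nu \<alpha>)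
        = (\<integral>z. (\<Sum>l<Suc m. f (twist u (cis (2 * pi * real l / real (Suc m))) z) * h z) / of_nat (Suc m) \<partial>nu \<alpha>)"
      by (simp only: A_def sum_distrib_right times_divide_eq_left)
    also have "\<dots> = (\<Sum>l<Suc m. \<integral>z. f (twist u (cis (2 * pi * real l / real (Suc m))) z) * h z \<partial>nu \<alpha>) / of_nat (Suc m)"
      using int by (subst Bochner_Integration.integral_sum[symmetric]) (simp_all del: of_nat_Suc sum.lessThan_Suc)
    also have "\<dots> = (\<integral>z. f z * h z \<partial>nu \<alpha>)"
      by (simp add: 1 del: of_nat_Suc sum.lessThan_Suc)
    finally show ?thesis .
  qed
  define \<phi> where "\<phi> = (\<lambda>t. f (t *s u))"
  have conv: "(\<lambda>m. A m z) \<longlonglongrightarrow> \<phi> (herm z u)" if z: "z \<in> ball 0 1" for z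
  proof -
    define q where "q = z - herm z u *s u"
    have tw: "twist u t z = herm z u *s u + t *s q" for t by (simp add: twist_def q_def)
    \<comment> \<open>The mean value property in \<open>t\<close> needs the disc of radius
      \<open>R\<close> to be mapped into the domain of \<open>f\<close>. For
      \<open>|t| \<le> 1\<close> the twist does not increase the norm, and for larger
      \<open>t\<close> it increases it by at most the factor \<open>|t|\<close>.\<close>
    have "norm (twist u t z) < R" if t: "norm t < R" for t
    proof (cases "norm t \<le> 1")
      case True
      have "(norm (twist u t z))\<^sup>2 \<le> (norm (herm z u))\<^sup>2 + 1 * ((norm z)\<^sup>2 - (norm (herm z u))\<^sup>2)"
        unfolding norm_twist_sq[OF u(1)]
        using True norm_herm_unit_le[OF z u(1)] by (intro add_left_mono mult_right_mono) (auto simp: power_le_one)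
      hence "(norm (twist u t z))\<^sup>2 \<le> (norm z)\<^sup>2" by simp
      hence "norm (twist u t z) \<le> norm z" by (rule power2_le_imp_le) simp
      thus ?thesis using z R by simp
    next
      case False
      have "(norm (herm z u))\<^sup>2 * 1 \<le> (norm (herm z u))\<^sup>2 * (norm t)\<^sup>2"
        using False by (intro mult_left_mono) auto
      hence "(norm (twist u t z))\<^sup>2 \<le> (norm t * norm z)\<^sup>2"
        unfolding norm_twist_sq[OF u(1)] by (simp add: power_mult_distrib algebra_simps)
      hence "norm (twist u t z) \<le> norm t * norm z" by (rule power2_le_imp_le) simp
      also have "\<dots> \<le> norm t" using z by (simp add: mult_left_le)
      finally show ?thesis using t by simp
    qed
    hence "(\<lambda>t. f (herm z u *s u + t *s q)) holomorphic_on ball 0 R"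
      by (intro holomorphic_slice[OF hol]) (simp add: tw)
    from mean_over_roots_of_unity[OF this R] show ?thesis
      by (simp only: A_def tw \<phi>_def vector_smult_lzero add_0_right)
  qed
  have \<phi>hol: "\<phi> holomorphic_on ball 0 R"
    using holomorphic_slice[OF hol, of "ball 0 R" 0 u] u(1) by (simp add: \<phi>_def norm_vscale)
  have m\<phi>: "(\<lambda>z. \<phi> (herm z u)) \<in> borel_measurable borel"
  proof -
    have [measurable]: "(\<lambda>t. t *s u) \<in> borel_measurable borel"
      by (intro borel_measurable_continuous_onI continuous_intros)
    show ?thesis unfolding \<phi>_def by measurable
  qed
  note [measurable] = m\<phi>
  have "(\<lambda>m. \<integral>z. A m z * h z \<partial>nu \<alpha>) \<longlonglongrightarrow> (\<integral>z. \<phi> (herm z u) * h z \<partial>nu \<alpha>)"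
  proof (rule integral_dominated_convergence)
    interpret finite_measure "nu \<alpha> :: (complex^'n) measure" by (rule finite_measure_nu[OF \<alpha>])
    show "integrable (nu \<alpha> :: (complex^'n) measure) (\<lambda>_. B * H)" by simp
    show "AE z in nu \<alpha>. (\<lambda>m. A m z * h z) \<longlonglongrightarrow> \<phi> (herm z u) * h z"
      by (rule AE_nuI) (intro tendsto_mult conv tendsto_const)
    show "AE z in nu \<alpha>. norm (A m z * h z) \<le> B * H" for m
    proof (rule AE_nuI)
      fix z :: "complex^'n" assume z: "z \<in> ball 0 1"
      have "norm (\<Sum>l<Suc m. f (twist u (cis (2 * pi * real l / real (Suc m))) z)) \<le> (\<Sum>l<Suc m. B)"
        by (rule order_trans[OF norm_sum sum_mono]) (use z norm_twist[OF u(1)] in \<open>auto intro!: B\<close>)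
      hence AB: "norm (A m z) \<le> B" by (simp add: A_def norm_divide divide_simps mult.commute del: sum.lessThan_Suc of_nat_Suc)
      show "norm (A m z * h z) \<le> B * H"
        unfolding norm_mult by (intro mult_mono hB z AB order_trans[OF norm_ge_zero AB]) simp
    qed
  qed measurable
  hence 1: "(\<integral>z. f z * h z \<partial>nu \<alpha>) = (\<integral>z. \<phi> (herm z u) * h z \<partial>nu \<alpha>)"
    by (simp add: avg LIMSEQ_const_iff)
  define c where "c = (\<lambda>k. (deriv ^^ k) \<phi> 0 / fact k)"
  have ps: "(\<lambda>k. c k * w ^ k) sums \<phi> w" if "w \<in> ball 0 R" for w
    using holomorphic_power_series[OF \<phi>hol that] by (simp add: c_def)
  define \<sigma> where "\<sigma> = (1 + R) / 2"
  have \<sigma>: "1 < \<sigma>" "\<sigma> < R" using R by (simp_all add: \<sigma>_def)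
  have "summable (\<lambda>k. c k * of_real \<sigma> ^ k)" using ps[of "of_real \<sigma>"] \<sigma> by (auto simp: sums_iff)
  hence "summable (\<lambda>k. norm (c k * 1 ^ k))" by (rule powser_insidea) (use \<sigma> in simp)
  hence sc: "summable (\<lambda>k. norm (c k))" by simp
  define b where "b = (\<lambda>j. complex_of_real (pochhammer ?N j / fact j * \<rho> ^ j))"
  have bpos: "pochhammer ?N j / fact j * \<rho> ^ j \<ge> 0" for j
    using N \<rho> by (simp add: pochhammer_nonneg)
  have sb: "summable (\<lambda>j. norm (b j))"
    unfolding b_def norm_of_real abs_of_nonneg[OF bpos] by (rule kern_coeff_summable[OF N \<rho>])
  have lt1: "norm (herm z u) < 1" if "z \<in> ball 0 1" for z
    using norm_herm_unit_le[OF that u(1)] that by simp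
  have hser: "h z = cnj (\<Sum>j. b j * herm z u ^ j)" if z: "z \<in> ball 0 1" for z
  proof -
    have "(\<lambda>j. of_real (pochhammer ?N j / fact j) * herm z a ^ j) sums kern ?N (herm z a)"
      by (rule kern_sums[OF norm_herm_lt[OF z a]])
    moreover have "of_real (pochhammer ?N j / fact j) * herm z a ^ j = b j * herm z u ^ j" for j
      by (subst u(2)) (simp add: b_def herm_scaleR_right power_mult_distrib \<rho>_def)
    ultimately have "(\<Sum>j. b j * herm z u ^ j) = kern ?N (herm z a)" by (simp add: sums_iff)
    thus ?thesis by (simp add: h_def kern_herm_cnj[OF z a])
  qed
  have "(\<lambda>j. c j * cnj (b j) * of_real (fact j / pochhammer ?N j)) sums
    (\<integral>z. (\<Sum>j. c j * herm z u ^ j) * cnj (\<Sum>j. b j * herm z u ^ j) \<partial>nu \<alpha>)"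
    by (rule integral_nu_power_series_product[OF \<alpha> u(1) sc sb])
  also have "(\<integral>z. (\<Sum>j. c j * herm z u ^ j) * cnj (\<Sum>j. b j * herm z u ^ j) \<partial>nu \<alpha>)
     = (\<integral>z. \<phi> (herm z u) * h z \<partial>nu \<alpha>)"
  proof (rule integral_nu_cong)
    fix z :: "complex^'n" assume z: "z \<in> ball 0 1"
    have "(\<Sum>j. c j * herm z u ^ j) = \<phi> (herm z u)"
      using ps[of "herm z u"] lt1[OF z] R by (simp add: sums_iff)
    thus "(\<Sum>j. c j * herm z u ^ j) * cnj (\<Sum>j. b j * herm z u ^ j) = \<phi> (herm z u) * h z"
      by (simp add: hser[OF z])
  qed measurable
  \<comment> \<open>The coefficients of \<open>kern N\<close> are the reciprocals of the squared
    norms of the powers, so the Parseval sum collapses to the power series of \<phi> at \<rho>. This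
    is what makes the kernel reproducing.\<close>
  also have "(\<lambda>j. c j * cnj (b j) * of_real (fact j / pochhammer ?N j)) = (\<lambda>j. c j * of_real \<rho> ^ j)"
  proof
    fix j
    have "pochhammer ?N j > 0" using N by (rule pochhammer_pos)
    hence "cnj (b j) * of_real (fact j / pochhammer ?N j) = of_real (\<rho> ^ j)"
      unfolding b_def complex_cnj_complex_of_real of_real_mult[symmetric] by simp
    thus "c j * cnj (b j) * of_real (fact j / pochhammer ?N j) = c j * of_real \<rho> ^ j"
      by (simp only: mult.assoc of_real_power)
  qed
  finally have "(\<integral>z. \<phi> (herm z u) * h z \<partial>nu \<alpha>) = \<phi> (of_real \<rho>)"
    using ps[of "of_real \<rho>"] \<rho> R sums_unique2 by fastforce
  also have "\<phi> (of_real \<rho>) = f a"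
    using u(2) by (simp add: \<phi>_def \<rho>_def scaleR_eq_vscale[symmetric])
  finally show ?thesis using 1 by (simp add: h_def)
qed

section \<open>Dilates and the reproducing formula for unbounded functions\<close>

definition rseq :: "nat \<Rightarrow> real" where
  "rseq i = 1 - 1 / (real i + 2)"

lemma rseq: "0 < rseq i" "rseq i < 1"
  by (simp_all add: rseq_def divide_simps)

lemma rseq_tendsto: "rseq \<longlonglongrightarrow> 1"
  unfolding rseq_def[abs_def] by real_asymp

lemma dilate_in_ball: "z \<in> ball 0 1 \<Longrightarrow> 0 \<le> r \<Longrightarrow> r \<le> 1 \<Longrightarrow> r *\<^sub>R z \<in> ball (0::'a::real_normed_vector) 1"
  by (simp add: mult_le_one le_less_trans[OF mult_left_le_one_le])

lemma holomorphic_dilate_ball: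
  assumes "holomorphic_Cn_on f (ball 0 1)" "0 < r" "r < 1"
  shows "holomorphic_Cn_on (\<lambda>z. f (r *\<^sub>R z)) (ball 0 (1 / r))" "1 / r > 1"
  using assms by (auto intro!: holomorphic_Cn_on_dilate[OF assms(1)] simp: divide_simps mult.commute)

lemma tendsto_dilate_hol_ball:
  assumes "f \<in> hol_ball" "z \<in> ball 0 1" "(r \<longlongrightarrow> 1) F"
  shows "((\<lambda>i. f (r i *\<^sub>R z)) \<longlongrightarrow> f z) F"
proof -
  have "isCont f z"
    using holomorphic_Cn_on_imp_continuous_on[OF hol_ballD[OF assms(1)]] assms(2)
    by (simp add: continuous_on_eq_continuous_at)
  moreover have "((\<lambda>i. r i *\<^sub>R z) \<longlongrightarrow> 1 *\<^sub>R z) F" by (intro tendsto_intros assms)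
  ultimately show ?thesis by (auto intro: isCont_tendsto_compose)
qed

lemma integrable_nu_powr:
  assumes "\<alpha> > -1" "\<alpha> + s > -1"
  shows "integrable (nu \<alpha>) (\<lambda>z::complex^'n. (1 - (norm z)\<^sup>2) powr s)"
  by (rule integrableI_bounded) (use nn_integral_nu_powr_finite[OF assms, where 'n = 'n] in simp_all)

lemma one_minus_norm_sq_dilate:
  assumes "z \<in> ball 0 1" "0 \<le> r" "r \<le> 1"
  shows "1 - (norm z)\<^sup>2 \<le> 1 - (norm (r *\<^sub>R z))\<^sup>2"
proof -
  have "norm (r *\<^sub>R z) \<le> norm z" using assms by (simp add: mult_left_le_one_le)
  thus ?thesis by (simp add: power_mono)
qed

text \<open>Each dilate satisfies the formula for functions holomorphic beyond the closed ball. The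
  growth bound majorises all dilates at once, and \<open>\<epsilon> < \<alpha> + 1\<close> makes the
  majorant integrable. The intended use is weight \<alpha> + k with exponent
  \<open>k\<close>.\<close>

lemma reproducing_formula_growth:
  fixes f :: "complex^'n \<Rightarrow> complex"
  assumes \<alpha>: "\<alpha> > -1" and f: "f \<in> hol_ball" and e: "0 \<le> \<epsilon>" "\<epsilon> < \<alpha> + 1"
    and B: "\<And>z. z \<in> ball 0 1 \<Longrightarrow> norm (f z) \<le> B * (1 - (norm z)\<^sup>2) powr (- \<epsilon>)" and a: "a \<in> ball 0 1"
  shows "(\<integral>z. f z * kern (real CARD('n) + 1 + \<alpha>) (herm a z) \<partial>nu \<alpha>) = f a"
proof -
  let ?N = "real CARD('n) + 1 + \<alpha>"
  have N: "?N > 0" using \<alpha> by (simp add: add_pos_nonneg)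
  have [measurable]: "f \<in> borel_measurable borel" by (rule borel_measurable_hol_ball[OF f])
  have B0: "B \<ge> 0" using order_trans[OF norm_ge_zero B[of 0]] by simp
  define H where "H = (1 - norm a) powr (- ?N)"
  have hB: "norm (kern ?N (herm a z)) \<le> H" if "z \<in> ball 0 1" for z
    unfolding norm_kern_herm_commute[of _ a] H_def using N by (intro norm_kern_herm_le that a) simp
  have "(\<lambda>i. \<integral>z. f (rseq i *\<^sub>R z) * kern ?N (herm a z) \<partial>nu \<alpha>) \<longlonglongrightarrow> (\<integral>z. f z * kern ?N (herm a z) \<partial>nu \<alpha>)"
  proof (rule integral_dominated_convergence[where w = "\<lambda>z. B * (1 - (norm z)\<^sup>2) powr (- \<epsilon>) * H"])
    show "integrable (nu \<alpha> :: (complex^'n) measure) (\<lambda>z. B * (1 - (norm z)\<^sup>2) powr (- \<epsilon>) * H)"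
      using integrable_nu_powr[OF \<alpha>, of "- \<epsilon>", where 'n = 'n] e by simp
    show "AE z in nu \<alpha>. (\<lambda>i. f (rseq i *\<^sub>R z) * kern ?N (herm a z)) \<longlonglongrightarrow> f z * kern ?N (herm a z)"
      by (rule AE_nuI) (intro tendsto_mult tendsto_const tendsto_dilate_hol_ball[OF f _ rseq_tendsto])
    show "AE z in nu \<alpha>. norm (f (rseq i *\<^sub>R z) * kern ?N (herm a z)) \<le> B * (1 - (norm z)\<^sup>2) powr (- \<epsilon>) * H" for i
    proof (rule AE_nuI)
      fix z :: "complex^'n" assume z: "z \<in> ball 0 1"
      have rz: "rseq i *\<^sub>R z \<in> ball 0 1" using dilate_in_ball[OF z] rseq[of i] by simp
      have "norm (f (rseq i *\<^sub>R z)) \<le> B * (1 - (norm (rseq i *\<^sub>R z))\<^sup>2) powr (- \<epsilon>)" by (rule B[OF rz])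
      also have "\<dots> \<le> B * (1 - (norm z)\<^sup>2) powr (- \<epsilon>)"
        using B0 e one_minus_norm_sq_pos[OF z] one_minus_norm_sq_dilate[OF z] rseq[of i]
        by (intro mult_left_mono powr_mono2') auto
      finally show "norm (f (rseq i *\<^sub>R z) * kern ?N (herm a z)) \<le> B * (1 - (norm z)\<^sup>2) powr (- \<epsilon>) * H"
        unfolding norm_mult by (intro mult_mono hB z) (use B0 in auto)
    qed
  qed measurable
  also have "(\<lambda>i. \<integral>z. f (rseq i *\<^sub>R z) * kern ?N (herm a z) \<partial>nu \<alpha>) = (\<lambda>i. f (rseq i *\<^sub>R a))"
    using holomorphic_dilate_ball[OF hol_ballD[OF f]] rseq
    by (intro ext reproducing_formula[OF \<alpha> _ _ _ a]) auto
  finally have "(\<lambda>i. f (rseq i *\<^sub>R a)) \<longlonglongrightarrow> (\<integral>z. f z * kern ?N (herm a z) \<partial>nu \<alpha>)" .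
  with tendsto_dilate_hol_ball[OF f a rseq_tendsto] show ?thesis using LIMSEQ_unique by blast
qed

section \<open>Functionals on bounded holomorphic functions\<close>

lemma holomorphic_Cn_on_kern_herm:
  assumes "w \<in> ball 0 1"
  shows "holomorphic_Cn_on (\<lambda>z. kern s (herm z w)) (ball 0 1)"
  using norm_herm_lt[OF _ assms]
  by (intro holomorphic_Cn_on_compose[where \<phi> = "kern s" and \<phi>' = "\<lambda>x. of_real s * kern (s + 1) x"]
      holomorphic_Cn_on_herm DERIV_kern) auto

lemma kern_shift: "x \<noteq> 1 \<Longrightarrow> kern (s + 1) x * x = kern (s + 1) x - kern s x"
  using kern_mult[of x "s + 1" "-1"] by (simp add: kern_def algebra_simps)

text \<open>The i-th derivative of \<open>kern s\<close> is \<open>pochhammer s i\<close> times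
  \<open>kern (s + i)\<close>, bounded on the disc of radius \<open>r\<close>. A remainder uniform
  in \<open>x\<close> and \<open>y\<close> permits differentiation under a functional that is
  controlled by the supremum norm only.\<close>

lemma kern_Taylor:
  assumes s: "s > 0" and r: "0 \<le> r" "r < 1" and x: "norm x \<le> r" "norm y \<le> r"
  shows "norm (kern s y - kern s x - of_real s * kern (s + 1) x * (y - x))
    \<le> s * (s + 1) * (1 - r) powr (- (s + 2)) * (norm (y - x))\<^sup>2"
proof -
  define f where "f = (\<lambda>i x. of_real (pochhammer s i) * kern (s + real i) x)"
  have "norm (f 0 y - (\<Sum>i\<le>1. f i x * (y - x) ^ i / fact i))
      \<le> s * (s + 1) * (1 - r) powr (- (s + 2)) * norm (y - x) ^ Suc 1 / fact 1"
  proof (rule complex_Taylor[where S = "cball 0 r"])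
    fix i t assume "t \<in> cball (0::complex) r"
    hence t: "norm t < 1" using r by simp
    have "(f i has_field_derivative (of_real (pochhammer s i) * (of_real (s + real i) * kern (s + real i + 1) t))) (at t within cball 0 r)"
      unfolding f_def by (rule DERIV_cmult[OF has_field_derivative_at_within[OF DERIV_kern[OF t]]])
    also have "of_real (pochhammer s i) * (of_real (s + real i) * kern (s + real i + 1) t) = f (Suc i) t"
      by (simp add: f_def pochhammer_Suc add.assoc add.commute[of 1 "real i"])
    finally show "(f i has_field_derivative f (Suc i) t) (at t within cball 0 r)" .
  next
    fix t assume "t \<in> cball (0::complex) r"
    hence t: "norm t \<le> r" by simp
    have "norm (kern (s + 2) t) \<le> (1 - r) powr (- (s + 2))"
      unfolding norm_kern using t r s norm_triangle_ineq2[of 1 t] by (intro powr_mono2') auto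
    thus "norm (f (Suc 1) t) \<le> s * (s + 1) * (1 - r) powr (- (s + 2))"
    proof -
      have e: "f (Suc 1) t = of_real (s * (s + 1)) * kern (s + 2) t"
        by (simp add: f_def pochhammer_Suc)
      assume "norm (kern (s + 2) t) \<le> (1 - r) powr (- (s + 2))"
      thus ?thesis using s unfolding e norm_mult norm_of_real by (intro mult_mono) auto
    qed
  qed (use x in auto)
  thus ?thesis by (simp add: f_def power2_eq_square algebra_simps)
qed

definition bounded_hol :: "(complex^'n \<Rightarrow> complex) set" where
  "bounded_hol = {f \<in> hol_ball. \<exists>B. \<forall>z. norm (f z) \<le> B}"

lemma bounded_hol_cutI:
  assumes "holomorphic_Cn_on f (ball 0 1)" "\<And>z. z \<in> ball 0 1 \<Longrightarrow> norm (f z) \<le> B"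
  shows "cut_ball f \<in> bounded_hol"
  unfolding bounded_hol_def using cut_ball_hol[OF assms(1)] assms(2)
  by (auto simp: cut_ball_def intro!: exI[of _ "max B 0"]) (auto simp: le_max_iff_disj)

lemma bounded_hol_imp_hol_ball: "f \<in> bounded_hol \<Longrightarrow> f \<in> hol_ball"
  by (simp add: bounded_hol_def)

lemma hol_ball_add: "f \<in> hol_ball \<Longrightarrow> g \<in> hol_ball \<Longrightarrow> (\<lambda>z. f z + g z) \<in> hol_ball"
  and hol_ball_cmult: "f \<in> hol_ball \<Longrightarrow> (\<lambda>z. c * f z) \<in> hol_ball"
  by (auto simp: hol_ball_def holomorphic_Cn_on_add holomorphic_Cn_on_cmult)

lemma bounded_hol_add: "f \<in> bounded_hol \<Longrightarrow> g \<in> bounded_hol \<Longrightarrow> (\<lambda>z. f z + g z) \<in> bounded_hol"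
  unfolding bounded_hol_def by (auto intro!: hol_ball_add intro: norm_triangle_mono)

lemma bounded_hol_cmult: "f \<in> bounded_hol \<Longrightarrow> (\<lambda>z. c * f z) \<in> bounded_hol"
  unfolding bounded_hol_def
  by (auto intro!: hol_ball_cmult simp: norm_mult) (metis mult_left_mono norm_ge_zero)

lemma bounded_hol_diff: "f \<in> bounded_hol \<Longrightarrow> g \<in> bounded_hol \<Longrightarrow> (\<lambda>z. f z - g z) \<in> bounded_hol"
  using bounded_hol_add[of f "\<lambda>z. (-1) * g z"] bounded_hol_cmult[of g "-1"] by simp

text \<open>Linear functionals on bounded holomorphic functions, continuous for the supremum norm.
  The setting covers bounded functionals on the Orlicz space, restricted to bounded functions, as
  well as integration against a bounded function, which serves to study \<open>radial_deriv\<close>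
  itself.\<close>

locale sup_functional =
  fixes T :: "(complex^'n \<Rightarrow> complex) \<Rightarrow> complex" and C :: real
  assumes T_add: "f \<in> bounded_hol \<Longrightarrow> g \<in> bounded_hol \<Longrightarrow> T (\<lambda>z. f z + g z) = T f + T g"
    and T_cmult: "f \<in> bounded_hol \<Longrightarrow> T (\<lambda>z. c * f z) = c * T f"
    and T_bound: "f \<in> bounded_hol \<Longrightarrow> (\<And>z. z \<in> ball 0 1 \<Longrightarrow> norm (f z) \<le> B) \<Longrightarrow> norm (T f) \<le> C * B"
begin

lemma T_diff: "f \<in> bounded_hol \<Longrightarrow> g \<in> bounded_hol \<Longrightarrow> T (\<lambda>z. f z - g z) = T f - T g"
  using T_add[of f "\<lambda>z. (-1) * g z"] T_cmult[of g "-1"] bounded_hol_cmult[of g "-1"] by simp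

lemma T_sum:
  assumes "finite I" "\<And>i. i \<in> I \<Longrightarrow> f i \<in> bounded_hol"
  shows "(\<lambda>z. \<Sum>i\<in>I. f i z) \<in> bounded_hol \<and> T (\<lambda>z. \<Sum>i\<in>I. f i z) = (\<Sum>i\<in>I. T (f i))"
  using assms
proof (induction rule: finite_induct)
  case empty
  have 0: "cut_ball (\<lambda>_. 0) \<in> (bounded_hol :: (complex^'n \<Rightarrow> complex) set)"
    by (rule bounded_hol_cutI[where B = 0]) (auto intro: holomorphic_Cn_on_const)
  have e: "cut_ball (\<lambda>_. 0) = (\<lambda>_::complex^'n. 0)" by (auto simp: cut_ball_def)
  show ?case using T_cmult[OF 0, of 0] 0 by (simp add: e)
next
  case (insert i I)
  thus ?case using bounded_hol_add[of "f i" "\<lambda>z. \<Sum>i\<in>I. f i z"] T_add[of "f i" "\<lambda>z. \<Sum>i\<in>I. f i z"] by simp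
qed

text \<open>The conjugate turns antiholomorphic dependence on \<open>w\<close> into holomorphic
  dependence. The symbol is the case \<open>s = N\<close>; the other exponents are needed because
  radial differentiation raises \<open>s\<close>.\<close>

definition G :: "real \<Rightarrow> complex^'n \<Rightarrow> complex" where
  "G s w = (if w \<in> ball 0 1 then cnj (T (cut_ball (\<lambda>z. kern s (herm z w)))) else 0)"

lemma kern_bounded_hol: "w \<in> ball 0 1 \<Longrightarrow> s \<ge> 0 \<Longrightarrow> cut_ball (\<lambda>z. kern s (herm z w)) \<in> bounded_hol"
  by (rule bounded_hol_cutI[OF holomorphic_Cn_on_kern_herm norm_kern_herm_le])

lemma kern_herm_bound:
  assumes "w \<in> ball 0 1" "s \<ge> 0" "z \<in> ball 0 1"
  shows "norm (kern s (herm z w) * herm z h) \<le> (1 - norm w) powr (- s) * norm h"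
proof -
  have "norm (herm z h) \<le> norm z * norm h" by (rule norm_herm_le)
  also have "\<dots> \<le> norm h" using assms by (simp add: mult_left_le_one_le)
  finally have "norm (herm z h) \<le> norm h" .
  thus ?thesis unfolding norm_mult by (intro mult_mono norm_kern_herm_le assms) auto
qed

lemma kern_herm_bounded_hol:
  "w \<in> ball 0 1 \<Longrightarrow> s \<ge> 0 \<Longrightarrow> cut_ball (\<lambda>z. kern s (herm z w) * herm z h) \<in> bounded_hol"
  by (rule bounded_hol_cutI[OF holomorphic_Cn_on_mult[OF holomorphic_Cn_on_kern_herm holomorphic_Cn_on_herm] kern_herm_bound])

text \<open>Differentiation under \<open>T\<close>: by \<open>kern_Taylor\<close> the remainder of
  \<open>kern s (herm z y)\<close> is quadratic in \<open>y - w\<close>, uniformly in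
  \<open>z\<close>, as long as \<open>y\<close> stays in a ball of radius \<open>r < 1\<close>;
  \<open>T_bound\<close> carries this estimate over to \<open>T\<close>.\<close>

lemma G_has_derivative:
  assumes w: "w \<in> ball 0 1" and s: "s > 0"
  shows "(G s has_derivative (\<lambda>h. cnj (of_real s * T (cut_ball (\<lambda>z. kern (s + 1) (herm z w) * herm z h))))) (at w)"
    (is "(_ has_derivative ?D) _")
proof -
  let ?K = "\<lambda>h. cut_ball (\<lambda>z. kern (s + 1) (herm z w) * herm z h)"
  have bK: "?K h \<in> bounded_hol" for h using kern_herm_bounded_hol[OF w, of "s + 1"] s by simp
  have C0: "C \<ge> 0" using order_trans[OF norm_ge_zero T_bound[OF kern_bounded_hol[of 0 0], of 1]] by (simp add: kern_def)
  define r where "r = (1 + norm w) / 2"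
  have r: "norm w < r" "r < 1" "0 \<le> r" using w by (simp_all add: r_def)
  define M where "M = s * (s + 1) * (1 - r) powr (- (s + 2))"
  have M: "M \<ge> 0" using s by (simp add: M_def)
  have K_add: "?K (h + h') = (\<lambda>z. ?K h z + ?K h' z)" for h h'
    by (auto simp: cut_ball_def herm_add_right algebra_simps)
  have K_scale: "?K (t *\<^sub>R h) = (\<lambda>z. of_real t * ?K h z)" for h t
    by (auto simp: cut_ball_def herm_scaleR_right)
  show ?thesis
  proof (rule has_derivativeI_sandwich[where e = "r - norm w" and H = "\<lambda>y. C * M * norm (y - w)"])
    show "0 < r - norm w" using r by simp
    show "bounded_linear ?D"
    proof (rule bounded_linear_intro[where K = "s * C * (1 - norm w) powr (- (s + 1))"])
      show "?D (h + h') = ?D h + ?D h'" for h h'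
        unfolding K_add T_add[OF bK bK] by (simp add: algebra_simps)
      show "?D (t *\<^sub>R h) = t *\<^sub>R ?D h" for t h
        unfolding K_scale T_cmult[OF bK] by (simp add: scaleR_conv_of_real)
      fix h
      have "norm (T (?K h)) \<le> C * ((1 - norm w) powr (- (s + 1)) * norm h)"
        by (rule T_bound[OF bK]) (use kern_herm_bound[OF w, of "s + 1"] s in simp)
      hence "s * norm (T (?K h)) \<le> s * (C * ((1 - norm w) powr (- (s + 1)) * norm h))"
        using s by (intro mult_left_mono) auto
      thus "norm (?D h) \<le> norm h * (s * C * (1 - norm w) powr (- (s + 1)))"
        using s by (simp add: norm_mult mult_ac)
    qed
    have "((\<lambda>y. C * M * norm (y - w)) \<longlongrightarrow> C * M * norm (w - w)) (at w)"
      by (intro tendsto_intros)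
    thus "((\<lambda>y. C * M * norm (y - w)) \<longlongrightarrow> 0) (at w)" by simp
  next
    fix y assume y: "y \<noteq> w" "dist y w < r - norm w"
    have ny: "norm y < r" using y(2) norm_triangle_ineq2[of y w] by (simp add: dist_norm)
    hence yb: "y \<in> ball 0 1" using r by simp
    let ?Q = "\<lambda>z. cut_ball (\<lambda>z. kern s (herm z y)) z - cut_ball (\<lambda>z. kern s (herm z w)) z - of_real s * ?K (y - w) z"
    have bQ: "?Q \<in> bounded_hol"
      using s by (intro bounded_hol_diff bounded_hol_cmult bK kern_bounded_hol yb w) auto
    have "norm (T ?Q) \<le> C * (M * (norm (y - w))\<^sup>2)"
    proof (rule T_bound[OF bQ])
      fix z :: "complex^'n" assume z: "z \<in> ball 0 1"
      have le: "norm (herm z v) \<le> norm v" for v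
        using norm_herm_le[of z v] z mult_left_le_one_le[of "norm v" "norm z"] by simp
      have "norm (?Q z) = norm (kern s (herm z y) - kern s (herm z w) - of_real s * kern (s + 1) (herm z w) * (herm z y - herm z w))"
        using z by (simp add: herm_diff_right mult.assoc)
      also have "\<dots> \<le> M * (norm (herm z y - herm z w))\<^sup>2"
        unfolding M_def using s r ny by (intro kern_Taylor) (auto intro: order_trans[OF le])
      also have "\<dots> \<le> M * (norm (y - w))\<^sup>2"
        using le[of "y - w"] M by (intro mult_left_mono power_mono) (auto simp: herm_diff_right)
      finally show "norm (?Q z) \<le> M * (norm (y - w))\<^sup>2" .
    qed
    moreover have "T ?Q = T (cut_ball (\<lambda>z. kern s (herm z y))) - T (cut_ball (\<lambda>z. kern s (herm z w))) - of_real s * T (?K (y - w))"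
    proof -
      have b: "cut_ball (\<lambda>z. kern s (herm z y)) \<in> bounded_hol" "cut_ball (\<lambda>z. kern s (herm z w)) \<in> bounded_hol"
        using s kern_bounded_hol[OF yb, of s] kern_bounded_hol[OF w, of s] by simp_all
      show ?thesis
        by (simp only: T_diff[OF bounded_hol_diff[OF b] bounded_hol_cmult[OF bK]] T_diff[OF b] T_cmult[OF bK])
    qed
    hence "G s y - G s w - ?D (y - w) = cnj (T ?Q)"
      using yb w by (simp add: G_def)
    ultimately have "norm (G s y - G s w - ?D (y - w)) \<le> C * (M * (norm (y - w))\<^sup>2)" by simp
    thus "norm (G s y - G s w - ?D (y - w)) / norm (y - w) \<le> C * M * norm (y - w)"
      using y by (simp add: divide_simps power2_eq_square mult_ac)
  qed
qed

lemma G_derivative_complex_linear: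
  assumes w: "w \<in> ball 0 1" and s: "s > 0"
  shows "cnj (of_real s * T (cut_ball (\<lambda>z. kern (s + 1) (herm z w) * herm z (c *s h))))
    = c * cnj (of_real s * T (cut_ball (\<lambda>z. kern (s + 1) (herm z w) * herm z h)))"
proof -
  have "cut_ball (\<lambda>z. kern (s + 1) (herm z w) * herm z (c *s h)) = (\<lambda>z. cnj c * cut_ball (\<lambda>z. kern (s + 1) (herm z w) * herm z h) z)"
    by (auto simp: cut_ball_def herm_scale_right)
  thus ?thesis using T_cmult[OF kern_herm_bounded_hol[OF w, of "s + 1" h], of "cnj c"] s by (simp add: mult_ac)
qed

lemma G_hol: "s > 0 \<Longrightarrow> G s \<in> hol_ball"
  unfolding hol_ball_def holomorphic_Cn_on_def
proof (intro CollectI conjI ballI)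
  fix z :: "complex^'n" assume "s > 0" "z \<in> ball 0 1"
  thus "\<exists>D. (G s has_derivative D) (at z) \<and> (\<forall>c v. D (c *s v) = c * D v)"
    using G_has_derivative[of z s] G_derivative_complex_linear[of z s] by blast
qed (simp add: G_def)

text \<open>In the direction \<open>w\<close> the derivative of the kernel carries the factor
  \<open>herm z w\<close>, and \<open>kern_shift\<close> splits the product into two kernels.
  Equivalently \<open>(R + s) G s = s G (s + 1)\<close>, which is the origin of
  \<open>shifted_radial\<close>.\<close>

lemma radial_deriv_G:
  assumes w: "w \<in> ball 0 1" and s: "s > 0"
  shows "radial_deriv (G s) w = of_real s * (G (s + 1) w - G s w)"
proof -
  have "radial_deriv (G s) w = cnj (of_real s * T (cut_ball (\<lambda>z. kern (s + 1) (herm z w) * herm z w)))"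
    by (rule radial_deriv_eq[OF G_has_derivative[OF w s] G_derivative_complex_linear[OF w s]])
  also have "cut_ball (\<lambda>z. kern (s + 1) (herm z w) * herm z w)
    = (\<lambda>z. cut_ball (\<lambda>z. kern (s + 1) (herm z w)) z - cut_ball (\<lambda>z. kern s (herm z w)) z)"
  proof
    fix z
    have "herm z w \<noteq> 1" if "z \<in> ball 0 1" using norm_herm_lt[OF that w] by auto
    thus "cut_ball (\<lambda>z. kern (s + 1) (herm z w) * herm z w) z = cut_ball (\<lambda>z. kern (s + 1) (herm z w)) z - cut_ball (\<lambda>z. kern s (herm z w)) z"
      by (simp add: cut_ball_def kern_shift)
  qed
  also have "T \<dots> = T (cut_ball (\<lambda>z. kern (s + 1) (herm z w))) - T (cut_ball (\<lambda>z. kern s (herm z w)))"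
    using s by (intro T_diff kern_bounded_hol w) auto
  finally show ?thesis unfolding G_def using w by simp
qed

end

section \<open>Linearity of the radial derivative and preservation of holomorphy\<close>

lemma radial_deriv_add:
  assumes "holomorphic_Cn_on f S" "holomorphic_Cn_on g S" "z \<in> S"
  shows "radial_deriv (\<lambda>z. f z + g z) z = radial_deriv f z + radial_deriv g z"
proof -
  obtain D E where D: "(f has_derivative D) (at z)" "\<And>c v. D (c *s v) = c * D v"
    and E: "(g has_derivative E) (at z)" "\<And>c v. E (c *s v) = c * E v"
    using assms unfolding holomorphic_Cn_on_def by meson
  have "radial_deriv (\<lambda>z. f z + g z) z = D z + E z"
    by (rule radial_deriv_eq[OF has_derivative_add[OF D(1) E(1)]]) (simp add: D E algebra_simps)
  thus ?thesis using radial_deriv_eq[OF D] radial_deriv_eq[OF E] by simp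
qed

lemma radial_deriv_cmult:
  assumes "holomorphic_Cn_on f S" "z \<in> S"
  shows "radial_deriv (\<lambda>z. c * f z) z = c * radial_deriv f z"
proof -
  obtain D where D: "(f has_derivative D) (at z)" "\<And>c v. D (c *s v) = c * D v"
    using assms unfolding holomorphic_Cn_on_def by meson
  have "radial_deriv (\<lambda>z. c * f z) z = c * D z"
    by (rule radial_deriv_eq[OF has_derivative_mult_right[OF D(1)]]) (simp add: D algebra_simps)
  thus ?thesis using radial_deriv_eq[OF D] by simp
qed

lemma radial_deriv_sum:
  assumes "finite I" "\<And>i. i \<in> I \<Longrightarrow> holomorphic_Cn_on (f i) S" "z \<in> S"
  shows "radial_deriv (\<lambda>z. \<Sum>i\<in>I. f i z) z = (\<Sum>i\<in>I. radial_deriv (f i) z)"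
  using assms
proof (induction rule: finite_induct)
  case empty
  show ?case by simp (rule radial_deriv_eq, auto)
next
  case (insert i I)
  thus ?case by (simp add: radial_deriv_add[of "f i" S "\<lambda>z. \<Sum>i\<in>I. f i z"] holomorphic_Cn_on_sum)
qed

lemma sup_functional_integral:
  fixes F :: "complex^'n \<Rightarrow> complex"
  assumes \<alpha>: "\<alpha> > -1" and [measurable]: "F \<in> borel_measurable borel" and B: "\<And>z. z \<in> ball 0 1 \<Longrightarrow> norm (F z) \<le> B"
  shows "sup_functional (\<lambda>f. \<integral>z. f z * cnj (F z) \<partial>nu \<alpha>) B"
proof
  interpret finite_measure "nu \<alpha> :: (complex^'n) measure" by (rule finite_measure_nu[OF \<alpha>])
  have B0: "B \<ge> 0" using order_trans[OF norm_ge_zero B[of 0]] by simp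
  have int: "integrable (nu \<alpha>) (\<lambda>z. f z * cnj (F z))" if f: "f \<in> bounded_hol" for f
  proof -
    have [measurable]: "f \<in> borel_measurable borel"
      using that by (simp add: borel_measurable_hol_ball bounded_hol_imp_hol_ball)
    obtain A where A: "\<forall>z. norm (f z) \<le> A" using f unfolding bounded_hol_def by blast
    show ?thesis
    proof (rule integrable_nu_bounded[OF \<alpha>])
      fix z :: "complex^'n" assume "z \<in> ball 0 1"
      thus "norm (f z * cnj (F z)) \<le> A * B"
        unfolding norm_mult
        using order_trans[OF norm_ge_zero A[THEN spec, of z]] by (intro mult_mono A[THEN spec]) (auto intro: B)
    qed measurable
  qed
  show "(\<integral>z. (f z + g z) * cnj (F z) \<partial>nu \<alpha>) = (\<integral>z. f z * cnj (F z) \<partial>nu \<alpha>) + (\<integral>z. g z * cnj (F z) \<partial>nu \<alpha>)"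
    if "f \<in> bounded_hol" "g \<in> bounded_hol" for f g
    using int[OF that(1)] int[OF that(2)] by (simp add: distrib_right)
  show "(\<integral>z. c * f z * cnj (F z) \<partial>nu \<alpha>) = c * (\<integral>z. f z * cnj (F z) \<partial>nu \<alpha>)" for f c
    by (simp add: mult.assoc)
  fix f :: "complex^'n \<Rightarrow> complex" and A assume f: "f \<in> bounded_hol" and A: "\<And>z. z \<in> ball 0 1 \<Longrightarrow> norm (f z) \<le> A"
  have "norm (\<integral>z. f z * cnj (F z) \<partial>nu \<alpha>) \<le> (\<integral>z. norm (f z * cnj (F z)) \<partial>nu \<alpha>)"
    by (rule integral_norm_bound)
  also have "\<dots> \<le> (\<integral>z. B * A \<partial>(nu \<alpha> :: (complex^'n) measure))"
  proof (rule integral_mono_AE)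
    show "AE z in nu \<alpha>. norm (f z * cnj (F z)) \<le> B * A"
    proof (rule AE_nuI)
      fix z :: "complex^'n" assume z: "z \<in> ball 0 1"
      have "norm (F z) * norm (f z) \<le> B * A" by (intro mult_mono A B z B0) simp
      thus "norm (f z * cnj (F z)) \<le> B * A" by (simp add: norm_mult mult.commute)
    qed
  qed (use int[OF f] in auto)
  also have "\<dots> = B * A" by (simp add: measure_def emeasure_nu_UNIV[OF \<alpha>])
  finally show "norm (\<integral>z. f z * cnj (F z) \<partial>nu \<alpha>) \<le> B * A" .
qed

text \<open>By the reproducing formula a dilate of \<open>f\<close> is of the form \<open>sup_functional.G\<close>, whose radial
  derivative is known.\<close>

lemma holomorphic_radial_deriv:
  fixes f :: "complex^'n \<Rightarrow> complex"
  assumes hol: "holomorphic_Cn_on f (ball 0 1)"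
  shows "holomorphic_Cn_on (radial_deriv f) (ball 0 1)"
  unfolding holomorphic_Cn_on_def
proof
  fix z0 :: "complex^'n" assume z0: "z0 \<in> ball 0 1"
  define r where "r = (1 + norm z0) / 2"
  have r: "norm z0 < r" "r < 1" "0 < r" using z0 by (simp_all add: r_def add_pos_nonneg)
  define F where "F = (\<lambda>z. cut_ball f (r *\<^sub>R z))"
  have cf: "cut_ball f \<in> hol_ball" by (rule cut_ball_hol[OF hol])
  have [measurable]: "F \<in> borel_measurable borel"
    unfolding F_def using borel_measurable_hol_ball[OF cf] by measurable
  have Fhol: "holomorphic_Cn_on F (ball 0 (1 / r))" "1 / r > 1"
    unfolding F_def using holomorphic_dilate_ball[OF hol_ballD[OF cf]] r by auto
  obtain B where B: "\<And>z. norm z \<le> 1 \<Longrightarrow> norm (F z) \<le> B" using bounded_on_cball[OF Fhol] by blast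
  \<comment> \<open>Weight 0 is a convenient choice: the reproducing exponent is then
    \<open>n + 1\<close>.\<close>
  interpret sup_functional "\<lambda>f. \<integral>z. f z * cnj (F z) \<partial>nu 0" B
    by (rule sup_functional_integral) (auto intro: B)
  let ?N = "real CARD('n) + 1"
  have FG: "F w = G ?N w" if w: "w \<in> ball 0 1" for w
  proof -
    have "F w = (\<integral>z. F z * kern (?N + 0) (herm w z) \<partial>nu 0)"
      by (rule reproducing_formula[OF _ _ Fhol w, symmetric]) auto
    also have "\<dots> = (\<integral>z. cnj (cut_ball (\<lambda>z. kern ?N (herm z w)) z * cnj (F z)) \<partial>nu 0)"
    proof (rule integral_nu_cong)
      have [measurable]: "cut_ball (\<lambda>z. kern ?N (herm z w)) \<in> borel_measurable borel"
        by (intro borel_measurable_hol_ball cut_ball_hol holomorphic_Cn_on_kern_herm w)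
      show "(\<lambda>z. cnj (cut_ball (\<lambda>z. kern ?N (herm z w)) z * cnj (F z))) \<in> borel_measurable borel"
        by measurable
      show "F z * kern (?N + 0) (herm w z) = cnj (cut_ball (\<lambda>z. kern ?N (herm z w)) z * cnj (F z))"
        if "z \<in> ball 0 1" for z
        using kern_herm_cnj[OF that w, of ?N] that by (simp add: mult.commute)
    qed measurable
    also have "\<dots> = cnj (\<integral>z. cut_ball (\<lambda>z. kern ?N (herm z w)) z * cnj (F z) \<partial>nu 0)"
      by (rule Bochner_Integration.integral_cnj)
    finally show ?thesis using w by (simp add: G_def)
  qed
  define H where "H = (\<lambda>w. of_real ?N * (G (?N + 1) w - G ?N w))"
  have Hhol: "holomorphic_Cn_on H (ball 0 1)"
    unfolding H_def by (intro holomorphic_Cn_on_cmult holomorphic_Cn_on_diff hol_ballD G_hol) simp_all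
  have RF: "radial_deriv F w = H w" if "w \<in> ball 0 1" for w
  proof -
    have "radial_deriv F w = radial_deriv (G ?N) w"
      by (rule radial_deriv_cong[OF open_ball that FG])
    also have "\<dots> = H w" unfolding H_def by (rule radial_deriv_G[OF that]) simp
    finally show ?thesis .
  qed
  have eq: "H ((1 / r) *\<^sub>R z) = radial_deriv f z" if z: "z \<in> ball 0 r" for z
  proof -
    have zb: "(1 / r) *\<^sub>R z \<in> ball 0 1" using z r by (simp add: divide_simps)
    have zb1: "z \<in> ball 0 1" using z r by simp
    obtain D where D: "(cut_ball f has_derivative D) (at z)" "\<And>c v. D (c *s v) = c * D v"
      using hol_ballD[OF cf] zb1 unfolding holomorphic_Cn_on_def by meson
    have "((\<lambda>z. r *\<^sub>R z) has_derivative (\<lambda>v. r *\<^sub>R v)) (at ((1 / r) *\<^sub>R z))" by (auto intro!: derivative_eq_intros)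
    moreover have "(cut_ball f has_derivative D) (at (r *\<^sub>R (1 / r) *\<^sub>R z))" using D(1) r by simp
    ultimately have "(F has_derivative (\<lambda>v. D (r *\<^sub>R v))) (at ((1 / r) *\<^sub>R z))"
      unfolding F_def by (rule has_derivative_compose)
    hence "radial_deriv F ((1 / r) *\<^sub>R z) = D (r *\<^sub>R (1 / r) *\<^sub>R z)"
      by (rule radial_deriv_eq) (simp add: D(2) scaleR_eq_vscale)
    also have "\<dots> = D z" using r by simp
    also have "D z = radial_deriv (cut_ball f) z" by (rule radial_deriv_eq[OF D, symmetric])
    also have "\<dots> = radial_deriv f z" by (rule radial_deriv_cong[OF open_ball zb1]) simp
    finally show ?thesis using RF[OF zb] by simp
  qed
  have "holomorphic_Cn_on (\<lambda>z. H ((1 / r) *\<^sub>R z)) (ball 0 r)"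
    by (rule holomorphic_Cn_on_dilate[OF Hhol]) (use r in \<open>simp add: divide_simps\<close>)
  hence "holomorphic_Cn_on (radial_deriv f) (ball 0 r)"
    by (rule holomorphic_Cn_on_cong[OF _ open_ball eq])
  thus "\<exists>D. (radial_deriv f has_derivative D) (at z0) \<and> (\<forall>c v. D (c *s v) = c * D v)"
    using r unfolding holomorphic_Cn_on_def by simp
qed

lemma holomorphic_radial_deriv_funpow:
  "holomorphic_Cn_on f (ball 0 1) \<Longrightarrow> holomorphic_Cn_on ((radial_deriv ^^ k) f) (ball 0 1)"
  by (induction k) (auto intro: holomorphic_radial_deriv)

section \<open>Growth functions\<close>

locale growth_fn =
  fixes \<Phi> :: "real \<Rightarrow> real" and p :: real
  assumes p: "0 < p" "p \<le> 1" and \<Phi>: "\<Phi> \<in> growth_class p"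
begin

lemma Phi_mono: "0 \<le> s \<Longrightarrow> s \<le> t \<Longrightarrow> \<Phi> s \<le> \<Phi> t"
  using \<Phi> by (auto simp: growth_class_def growth_function_def mono_on_def)

lemma Phi_surj: "\<Phi> ` {0..} = {0..}"
  using \<Phi> by (simp add: growth_class_def growth_function_def)

lemma Phi_nonneg: "0 \<le> t \<Longrightarrow> 0 \<le> \<Phi> t"
  using Phi_surj by auto

lemma Phi_0 [simp]: "\<Phi> 0 = 0"
proof -
  have "0 \<in> \<Phi> ` {0..}" by (simp add: Phi_surj)
  then obtain t where "t \<ge> 0" "\<Phi> t = 0" by auto
  thus ?thesis using Phi_mono[of 0 t] Phi_nonneg[of 0] by simp
qed

lemma Phi_ratio:
  assumes "0 \<le> s" "s \<le> t"
  shows "s * \<Phi> t \<le> t * \<Phi> s"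
proof (cases "s = 0")
  case False
  have "antimono_on {0<..} (\<lambda>t. \<Phi> t / t)" using \<Phi> by (simp add: growth_class_def)
  hence "\<Phi> t / t \<le> \<Phi> s / s"
    using assms False by (auto simp: monotone_on_def)
  thus ?thesis using False assms by (simp add: field_simps)
qed simp

lemma Phi_scale: "1 \<le> c \<Longrightarrow> 0 \<le> t \<Longrightarrow> \<Phi> (c * t) \<le> c * \<Phi> t"
  using Phi_ratio[of t "c * t"] by (cases "t = 0") (auto simp: mult_le_cancel_right1 mult.assoc)

text \<open>The ratio inequalities of \<open>s\<close> and of \<open>t\<close> against
  \<open>s + t\<close> add up to the claim multiplied by \<open>s + t\<close>. This subadditivity
  takes the place of concavity.\<close>

lemma Phi_add: "0 \<le> s \<Longrightarrow> 0 \<le> t \<Longrightarrow> \<Phi> (s + t) \<le> \<Phi> s + \<Phi> t"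
proof -
  assume st: "0 \<le> s" "0 \<le> t"
  have "s * \<Phi> (s + t) \<le> (s + t) * \<Phi> s" "t * \<Phi> (s + t) \<le> (s + t) * \<Phi> t"
    using st by (auto intro: Phi_ratio)
  hence "(s + t) * \<Phi> (s + t) \<le> (s + t) * (\<Phi> s + \<Phi> t)" by (simp add: algebra_simps)
  thus ?thesis using st Phi_nonneg[of 0]
    by (cases "s + t = 0") (auto simp: mult_le_cancel_left add_nonneg_eq_0_iff)
qed

text \<open>A lower type constant, fixed once and taken at least 1 so that
  \<open>L powr (1 / p)\<close> is at least 1 as well and can be inserted as a factor.\<close>

definition L where
  "L = (SOME C. C \<ge> 1 \<and> (\<forall>s>0. \<forall>t. 0 < t \<and> t \<le> 1 \<longrightarrow> \<Phi> (s * t) \<le> C * t powr p * \<Phi> s))"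

lemma L: "L \<ge> 1" and Phi_lower: "0 \<le> s \<Longrightarrow> 0 \<le> t \<Longrightarrow> t \<le> 1 \<Longrightarrow> \<Phi> (s * t) \<le> L * t powr p * \<Phi> s"
proof -
  have "lower_type p \<Phi>" using \<Phi> by (simp add: growth_class_def)
  then obtain C where C: "C > 0" "\<forall>s>0. \<forall>t. 0 < t \<and> t \<le> 1 \<longrightarrow> \<Phi> (s * t) \<le> C * t powr p * \<Phi> s"
    unfolding lower_type_def by blast
  have "max C 1 \<ge> 1 \<and> (\<forall>s>0. \<forall>t. 0 < t \<and> t \<le> 1 \<longrightarrow> \<Phi> (s * t) \<le> max C 1 * t powr p * \<Phi> s)"
  proof (intro conjI allI impI)
    fix s t :: real assume st: "s > 0" "0 < t \<and> t \<le> 1"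
    hence "\<Phi> (s * t) \<le> C * (t powr p * \<Phi> s)" using C by (simp add: mult.assoc)
    also have "\<dots> \<le> max C 1 * (t powr p * \<Phi> s)"
      using st Phi_nonneg[of s] by (intro mult_right_mono) auto
    finally show "\<Phi> (s * t) \<le> max C 1 * t powr p * \<Phi> s" by (simp add: mult.assoc)
  qed simp
  from someI[of "\<lambda>C. C \<ge> 1 \<and> (\<forall>s>0. \<forall>t. 0 < t \<and> t \<le> 1 \<longrightarrow> \<Phi> (s * t) \<le> C * t powr p * \<Phi> s)", OF this]
  have *: "L \<ge> 1" "\<forall>s>0. \<forall>t. 0 < t \<and> t \<le> 1 \<longrightarrow> \<Phi> (s * t) \<le> L * t powr p * \<Phi> s"
    unfolding L_def[symmetric] by auto
  show "L \<ge> 1" by (rule *)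
  show "\<Phi> (s * t) \<le> L * t powr p * \<Phi> s" if "0 \<le> s" "0 \<le> t" "t \<le> 1"
    using * that by (cases "s = 0 \<or> t = 0") auto
qed

text \<open>Only a right inverse: on a plateau of \<Phi> it selects one preimage. The arguments
  therefore use \<open>Phi_q\<close> and \<open>less_qI\<close> and never cancel \<open>q\<close>
  against \<Phi> from the left.\<close>

definition q :: "real \<Rightarrow> real" where
  "q y = inv_into {0..} \<Phi> y"

lemma q_nonneg: "y \<ge> 0 \<Longrightarrow> q y \<ge> 0"
  unfolding q_def using inv_into_into[of y \<Phi> "{0..}"] by (simp add: Phi_surj)

lemma Phi_q: "y \<ge> 0 \<Longrightarrow> \<Phi> (q y) = y"
  unfolding q_def by (rule f_inv_into_f) (simp add: Phi_surj)

lemma less_qI: "0 \<le> t \<Longrightarrow> 0 \<le> y \<Longrightarrow> \<Phi> t < y \<Longrightarrow> t < q y"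
  using Phi_mono[of "q y" t] Phi_q[of y] q_nonneg[of y] by (cases "q y \<le> t") auto

lemma q_mono: "0 \<le> x \<Longrightarrow> x \<le> y \<Longrightarrow> q x \<le> q y"
  using less_qI[of "q x" y] Phi_q[of x] q_nonneg[of x] by (cases "x = y") auto

lemma q_pos: "0 < y \<Longrightarrow> 0 < q y"
  using less_qI[of 0 y] by simp

text \<open>Lower type read for the inverse: \<open>q y\<close> is \<open>t\<close> times
  \<open>q (\<tau> * y)\<close> with \<open>t \<le> 1\<close>, and the inequality is solved for
  \<open>t\<close>. The power \<open>\<tau> powr (1 / p)\<close> is the source of the upper type
  \<open>1 / p - 1\<close> of \<rho>.\<close>

lemma q_scale:
  assumes "1 \<le> \<tau>" "0 < y"
  shows "q (\<tau> * y) \<le> (L * \<tau>) powr (1 / p) * q y"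
proof -
  have s: "q (\<tau> * y) > 0" "q y > 0" using assms by (auto intro: q_pos)
  define t where "t = q y / q (\<tau> * y)"
  have t: "0 < t" "t \<le> 1" using s q_mono[of y "\<tau> * y"] assms by (auto simp: t_def)
  have "y = \<Phi> (q (\<tau> * y) * t)" using s assms Phi_q[of y] by (simp add: t_def)
  also have "\<dots> \<le> L * t powr p * \<Phi> (q (\<tau> * y))" using s t by (intro Phi_lower) auto
  also have "\<dots> = L * t powr p * (\<tau> * y)" using assms by (simp add: Phi_q)
  finally have "1 \<le> L * \<tau> * t powr p" using assms by (simp add: mult_ac mult_le_cancel_left1)
  hence "1 powr (1 / p) \<le> (L * \<tau> * t powr p) powr (1 / p)" using p by (intro powr_mono2) auto
  also have "\<dots> = (L * \<tau>) powr (1 / p) * t" using L assms p t by (simp add: powr_mult powr_powr)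
  finally show ?thesis using s by (simp add: t_def field_simps)
qed

lemma continuous_on_Phi_max: "continuous_on UNIV (\<lambda>t. \<Phi> (max t 0))"
proof -
  have "continuous_on {0..} \<Phi>" using \<Phi> by (simp add: growth_class_def growth_function_def)
  thus ?thesis by (rule continuous_on_compose2) (auto intro!: continuous_intros)
qed

lemma borel_measurable_Phi:
  assumes [measurable]: "f \<in> borel_measurable M" and "\<And>x. f x \<ge> 0"
  shows "(\<lambda>x. \<Phi> (f x)) \<in> borel_measurable M"
proof -
  have [measurable]: "(\<lambda>t. \<Phi> (max t 0)) \<in> borel_measurable borel"
    by (rule borel_measurable_continuous_onI[OF continuous_on_Phi_max])
  have "(\<lambda>x. \<Phi> (max (f x) 0)) \<in> borel_measurable M" by measurable
  thus ?thesis using assms(2) by (simp add: max_absorb1)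
qed

lemma borel_measurable_Phi_norm [measurable]:
  fixes f :: "'a \<Rightarrow> 'b::{real_normed_vector, second_countable_topology}"
  assumes [measurable]: "f \<in> borel_measurable M"
  shows "(\<lambda>x. \<Phi> (norm (f x))) \<in> borel_measurable M"
  by (rule borel_measurable_Phi) auto

lemma tendsto_Phi_norm:
  fixes f :: "'a \<Rightarrow> 'b::real_normed_vector"
  assumes "(f \<longlongrightarrow> l) F"
  shows "((\<lambda>x. \<Phi> (norm (f x))) \<longlongrightarrow> \<Phi> (norm l)) F"
proof -
  have "isCont (\<lambda>t. \<Phi> (max t 0)) (norm l)"
    using continuous_on_Phi_max by (simp add: continuous_on_eq_continuous_at)
  from isCont_tendsto_compose[OF this tendsto_norm[OF assms]]
  show ?thesis by simp
qed

end

section \<open>Pointwise bounds\<close>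

lemma one_minus_norm_sq_le_two:
  assumes z: "z \<in> ball 0 1" and a: "a \<in> ball 0 1"
  shows "1 - (norm a)\<^sup>2 \<le> 2 * norm (1 - herm z a)" "1 - (norm z)\<^sup>2 \<le> 2 * norm (1 - herm z a)"
proof -
  have *: "1 - (norm a)\<^sup>2 \<le> 2 * norm (1 - herm z a)" if "z \<in> ball 0 1" "a \<in> ball 0 1" for z a :: "complex^'n"
  proof -
    have "1 - (norm a)\<^sup>2 = (1 - norm a) * (1 + norm a)" by (simp add: power2_eq_square algebra_simps)
    also have "\<dots> \<le> (1 - norm a) * 2" using that by (intro mult_left_mono) auto
    also have "\<dots> \<le> 2 * norm (1 - herm z a)" using norm_one_minus_herm_ge[OF that(1), of a] by simp
    finally show ?thesis .
  qed
  show "1 - (norm a)\<^sup>2 \<le> 2 * norm (1 - herm z a)" by (rule *[OF z a])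
  show "1 - (norm z)\<^sup>2 \<le> 2 * norm (1 - herm z a)"
    using *[OF a z] by (simp add: norm_one_minus_herm_commute)
qed

text \<open>For \<open>\<sigma> \<ge> 0\<close> the density decreases with the norm, so its value at
  \<open>r *\<^sub>R z\<close> is at least that at \<open>z\<close>. The change of variables costs
  \<open>r powr (- 2 n)\<close>, at most \<open>2 ^ (2 n)\<close> for
  \<open>r \<ge> 1 / 2\<close>.\<close>

lemma nn_integral_nu_dilate:
  fixes u :: "complex^'n \<Rightarrow> ennreal"
  assumes s: "\<sigma> \<ge> 0" and [measurable]: "u \<in> borel_measurable borel" and r: "1 / 2 \<le> r" "r < 1"
  shows "(\<integral>\<^sup>+z. u (r *\<^sub>R z) \<partial>nu \<sigma>) \<le> ennreal (2 ^ (2 * CARD('n))) * (\<integral>\<^sup>+z. u z \<partial>nu \<sigma>)"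
proof -
  obtain K where K: "K > 0" "\<And>f. f \<in> borel_measurable borel \<Longrightarrow> (\<integral>\<^sup>+z. f z \<partial>nu \<sigma>)
      = ennreal (1 / K) * (\<integral>\<^sup>+z. f z * ennreal ((1 - (norm z)\<^sup>2) powr \<sigma>) * indicator (ball 0 1) (z::complex^'n) \<partial>lborel)"
  proof -
    have "\<sigma> > -1" using s by simp
    from nn_integral_nu[OF this, where 'n = 'n] show ?thesis using that by blast
  qed
  have [measurable]: "(\<lambda>z. u (r *\<^sub>R z)) \<in> borel_measurable borel" by measurable
  let ?g = "\<lambda>z. u z * ennreal ((1 - (norm z)\<^sup>2) powr \<sigma>) * indicator (ball 0 1) (z::complex^'n)"
  have "(\<integral>\<^sup>+z. u (r *\<^sub>R z) * ennreal ((1 - (norm z)\<^sup>2) powr \<sigma>) * indicator (ball 0 1) z \<partial>lborel)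
      \<le> (\<integral>\<^sup>+z. ?g (0 + r *\<^sub>R z) \<partial>lborel)"
  proof (rule nn_integral_mono)
    fix z :: "complex^'n"
    show "u (r *\<^sub>R z) * ennreal ((1 - (norm z)\<^sup>2) powr \<sigma>) * indicator (ball 0 1) z \<le> ?g (0 + r *\<^sub>R z)"
    proof (cases "z \<in> ball 0 1")
      case True
      have "(1 - (norm z)\<^sup>2) powr \<sigma> \<le> (1 - (norm (r *\<^sub>R z))\<^sup>2) powr \<sigma>"
        using one_minus_norm_sq_dilate[OF True, of r] one_minus_norm_sq_pos[OF True] r s by (intro powr_mono2) auto
      moreover have "r *\<^sub>R z \<in> ball 0 1" using dilate_in_ball[OF True] r by simp
      ultimately show ?thesis using True by (auto intro!: mult_left_mono ennreal_leI)
    qed simp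
  qed
  also have "(\<integral>\<^sup>+z. ?g (0 + r *\<^sub>R z) \<partial>lborel) \<le> ennreal (2 ^ (2 * CARD('n))) * (\<integral>\<^sup>+z. ?g z \<partial>lborel)"
  proof -
    have "(\<integral>\<^sup>+z. ?g z \<partial>lborel) = ennreal (\<bar>r\<bar> ^ DIM(complex^'n)) * (\<integral>\<^sup>+z. ?g (0 + r *\<^sub>R z) \<partial>lborel)"
      by (rule nn_integral_lborel_affine) (use r in auto)
    hence "ennreal (2 ^ (2 * CARD('n))) * (\<integral>\<^sup>+z. ?g z \<partial>lborel)
       = ennreal (2 ^ (2 * CARD('n)) * r ^ (2 * CARD('n))) * (\<integral>\<^sup>+z. ?g (0 + r *\<^sub>R z) \<partial>lborel)"
      using r by (simp add: ennreal_mult' mult.assoc mult.commute[of _ 2])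
    moreover have "1 \<le> 2 ^ (2 * CARD('n)) * r ^ (2 * CARD('n))"
      using r unfolding power_mult_distrib[symmetric] by (intro one_le_power) simp
    hence "1 * (\<integral>\<^sup>+z. ?g (0 + r *\<^sub>R z) \<partial>lborel)
       \<le> ennreal (2 ^ (2 * CARD('n)) * r ^ (2 * CARD('n))) * (\<integral>\<^sup>+z. ?g (0 + r *\<^sub>R z) \<partial>lborel)"
      by (intro mult_right_mono) (auto simp flip: ennreal_1 intro: ennreal_leI)
    ultimately show ?thesis by simp
  qed
  finally have "(\<integral>\<^sup>+z. u (r *\<^sub>R z) * ennreal ((1 - (norm z)\<^sup>2) powr \<sigma>) * indicator (ball 0 1) z \<partial>lborel)
    \<le> ennreal (2 ^ (2 * CARD('n))) * (\<integral>\<^sup>+z. ?g z \<partial>lborel)" .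
  hence "ennreal (1 / K) * (\<integral>\<^sup>+z. u (r *\<^sub>R z) * ennreal ((1 - (norm z)\<^sup>2) powr \<sigma>) * indicator (ball 0 1) z \<partial>lborel)
    \<le> ennreal (1 / K) * (ennreal (2 ^ (2 * CARD('n))) * (\<integral>\<^sup>+z. ?g z \<partial>lborel))"
    by (rule mult_left_mono) simp
  thus ?thesis by (subst (1 2) K(2)) (simp_all add: mult_ac)
qed

lemma norm_kern_self: "a \<in> ball 0 1 \<Longrightarrow> norm (kern s (herm a a)) = (1 - (norm a)\<^sup>2) powr (- s)"
proof -
  assume a: "a \<in> ball 0 1"
  have "1 - herm a a = of_real (1 - (norm a)\<^sup>2)" by (simp add: herm_self)
  hence "norm (1 - herm a a) = \<bar>1 - (norm a)\<^sup>2\<bar>" by (simp only: norm_of_real)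
  thus ?thesis using one_minus_norm_sq_pos[OF a] by (simp add: norm_kern)
qed

text \<open>Both factors are holomorphic in the ball of radius \<open>1 / max r (norm a)\<close>, so
  the reproducing formula for functions holomorphic beyond the closed ball applies to the
  product.\<close>

lemma holomorphic_dilate_kern:
  fixes f :: "complex^'n \<Rightarrow> complex"
  assumes f: "f \<in> hol_ball" and r: "0 < r" "r < 1" and a: "a \<in> ball 0 1"
  obtains R where "R > 1" "holomorphic_Cn_on (\<lambda>z. f (r *\<^sub>R z) * kern s (herm z a)) (ball 0 R)"
proof -
  define m where "m = max r (norm a)"
  have m: "0 < m" "m < 1" "r \<le> m" "norm a \<le> m" using r a by (auto simp: m_def)
  have "holomorphic_Cn_on (\<lambda>z. f (r *\<^sub>R z)) (ball 0 (1 / m))"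
  proof (rule holomorphic_Cn_on_dilate[OF hol_ballD[OF f]])
    fix z :: "complex^'n" assume "z \<in> ball 0 (1 / m)"
    hence "m * norm z < 1" using m by (simp add: field_simps)
    moreover have "r * norm z \<le> m * norm z" using m by (intro mult_right_mono) auto
    ultimately show "r *\<^sub>R z \<in> ball 0 1" using r by simp
  qed
  moreover have "holomorphic_Cn_on (\<lambda>z. kern s (herm z a)) (ball 0 (1 / m))"
  proof (intro holomorphic_Cn_on_compose[where \<phi> = "kern s" and \<phi>' = "\<lambda>x. of_real s * kern (s + 1) x"]
      holomorphic_Cn_on_herm DERIV_kern)
    fix z :: "complex^'n" assume "z \<in> ball 0 (1 / m)"
    hence "norm z * m < 1" using m by (simp add: field_simps)
    moreover have "norm z * norm a \<le> norm z * m" using m by (intro mult_left_mono) auto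
    ultimately show "norm (herm z a) < 1" using norm_herm_le[of z a] by linarith
  qed
  ultimately show ?thesis using m by (intro that[of "1 / m"] holomorphic_Cn_on_mult) auto
qed

context growth_fn
begin

text \<open>\<open>q\<close> grows at most like a power, so a high power of the kernel absorbs it.\<close>

lemma q_kernel_bound:
  assumes N: "N > 0" and A: "A > 0" and x: "0 < x" "x \<le> 2 * d" and y: "0 < y" "y \<le> 2 * d" and m: "N / p \<le> m"
  shows "q (A * x powr (- N)) * x powr m * y powr m * d powr (- (2 * m))
    \<le> L powr (1 / p) * 2 powr (2 * m) * q (A * y powr (- N))"
proof -
  have d: "d > 0" using x by linarith
  have m0: "m \<ge> 0" using N p m by (meson divide_nonneg_pos less_imp_le order_trans)
  have L1: "1 \<le> L powr (1 / p)" using L p by (simp add: ge_one_powr_ge_zero)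
  have dd: "(2 * d) powr (2 * m) * d powr (- (2 * m)) = 2 powr (2 * m)"
    using d by (simp add: powr_mult mult.assoc powr_add[symmetric])
  have qy: "q (A * y powr (- N)) \<ge> 0" using A y by (intro q_nonneg) auto
  show ?thesis
  proof (cases "y \<le> x")
    case True
    have "x powr (- N) \<le> y powr (- N)" using True y N by (intro powr_mono2') auto
    hence "q (A * x powr (- N)) \<le> q (A * y powr (- N))" using A x by (intro q_mono) auto
    moreover have "x powr m * y powr m \<le> (2 * d) powr m * (2 * d) powr m"
      using x y m0 by (intro mult_mono powr_mono2) auto
    hence "x powr m * y powr m \<le> (2 * d) powr (2 * m)" by (simp add: powr_add[symmetric])
    ultimately have "q (A * x powr (- N)) * (x powr m * y powr m) * d powr (- (2 * m))
      \<le> q (A * y powr (- N)) * (2 * d) powr (2 * m) * d powr (- (2 * m))"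
      using qy by (intro mult_right_mono mult_mono) auto
    also have "\<dots> = 1 * (2 powr (2 * m) * q (A * y powr (- N)))" by (simp add: mult.assoc dd)
    also have "\<dots> \<le> L powr (1 / p) * (2 powr (2 * m) * q (A * y powr (- N)))"
      using L1 qy by (intro mult_right_mono) auto
    finally show ?thesis by (simp add: mult.assoc)
  next
    case False
    \<comment> \<open>The argument of \<open>q\<close> at \<open>x\<close> is \<tau> times the one
      at \<open>y\<close>. \<open>q_scale\<close> costs the power \<open>N / p\<close> of
      \<open>y / x\<close>; its singularity in \<open>x\<close> is absorbed by
      \<open>x powr m\<close> because \<open>m \<ge> N / p\<close>.\<close>
    define \<tau> where "\<tau> = (y / x) powr N"
    have t: "1 \<le> \<tau>" using False x y N by (simp add: \<tau>_def ge_one_powr_ge_zero)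
    have e: "A * x powr (- N) = \<tau> * (A * y powr (- N))"
      using x y by (simp add: \<tau>_def powr_divide powr_minus field_simps)
    have "\<tau> powr (1 / p) = y powr (N / p) / x powr (N / p)"
      using x y by (simp add: \<tau>_def powr_powr powr_divide)
    hence e2: "(L * \<tau>) powr (1 / p) = L powr (1 / p) * (y powr (N / p) * x powr (- (N / p)))"
      using L t by (simp add: powr_mult powr_minus divide_inverse)
    have "q (A * x powr (- N)) \<le> (L * \<tau>) powr (1 / p) * q (A * y powr (- N))"
      unfolding e using A y t by (intro q_scale) auto
    also note e2
    finally have 1: "q (A * x powr (- N)) \<le> L powr (1 / p) * (y powr (N / p) * x powr (- (N / p))) * q (A * y powr (- N))" .
    have "q (A * x powr (- N)) * (x powr m * y powr m * d powr (- (2 * m)))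
      \<le> L powr (1 / p) * (y powr (N / p) * x powr (- (N / p))) * q (A * y powr (- N)) * (x powr m * y powr m * d powr (- (2 * m)))"
      by (intro mult_right_mono 1) simp
    also have "\<dots> = L powr (1 / p) * q (A * y powr (- N)) * (x powr (m - N / p) * y powr (m + N / p) * d powr (- (2 * m)))"
      using x y by (simp add: powr_diff powr_add powr_minus divide_inverse mult_ac)
    also have "\<dots> \<le> L powr (1 / p) * q (A * y powr (- N)) * ((2 * d) powr (m - N / p) * (2 * d) powr (m + N / p) * d powr (- (2 * m)))"
      using x y m m0 qy N p by (intro mult_left_mono mult_right_mono mult_mono powr_mono2) auto
    also have "(2 * d) powr (m - N / p) * (2 * d) powr (m + N / p) = (2 * d) powr (2 * m)"
      by (simp add: powr_add[symmetric])
    also note dd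
    finally show ?thesis by (simp add: mult_ac)
  qed
qed

text \<open>Let \<open>\<omega> z = q (A (1 - |z|\<^sup>2) powr (- N))\<close> and let \<open>M\<close> be the supremum of \<open>|f (r z)| / \<omega> z\<close>.
  If \<open>M > 1\<close> then \<open>|f| \<le> \<Phi> |f| * M \<omega> / \<Phi> \<omega>\<close>, and the reproducing formula yields \<open>M \<le> M / 2\<close> for a
  suitable \<open>A\<close>.\<close>

lemma pointwise_bound_nonneg_weight:
  assumes s: "\<sigma> \<ge> 0"
  obtains C where "C > 0"
    "\<And>(f::complex^'n \<Rightarrow> complex) a. f \<in> hol_ball \<Longrightarrow> a \<in> ball 0 1 \<Longrightarrow>
      ennreal (\<Phi> (norm (f a))) \<le> ennreal (C * (1 - (norm a)\<^sup>2) powr (- (real CARD('n) + 1 + \<sigma>)))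
        * (\<integral>\<^sup>+z. ennreal (\<Phi> (norm (f z))) \<partial>nu \<sigma>)"
proof -
  define N where "N = real CARD('n) + 1 + \<sigma>"
  have N: "N > 0" using s by (simp add: N_def add_pos_nonneg)
  \<comment> \<open>The reproducing exponent \<open>m\<close> of weight \<beta> becomes
    \<open>N + N / p\<close>, large enough for \<open>q_kernel_bound\<close>.\<close>
  define \<beta> where "\<beta> = \<sigma> + N / p"
  define m where "m = N + N / p"
  have m: "m = real CARD('n) + 1 + \<beta>" "m > 0" "N / p \<le> m" "m = \<beta> - \<sigma> + N" using N p by (simp_all add: m_def \<beta>_def N_def add_pos_pos)
  have s1: "\<sigma> > -1" using s by simp
  have Np: "N / p > 0" using N p by simp
  have b1: "\<beta> > -1" "\<sigma> + (\<beta> - \<sigma>) > -1" using s Np by (simp_all add: \<beta>_def)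
  obtain K where K: "K > 0" "\<And>f. f \<in> borel_measurable borel \<Longrightarrow> (\<integral>\<^sup>+z. f z \<partial>nu \<beta>)
      = ennreal K * (\<integral>\<^sup>+z. ennreal ((1 - (norm z)\<^sup>2) powr (\<beta> - \<sigma>)) * f (z::complex^'n) \<partial>nu \<sigma>)"
    using nn_integral_nu_shift[OF s1 b1(2), where 'n = 'n] by auto
  define C1 where "C1 = L powr (1 / p) * 2 powr (2 * m)"
  have C1: "C1 > 0" using L by (simp add: C1_def)
  \<comment> \<open>\<open>K\<close> comes from the change of weight, \<open>C1\<close> from
    \<open>q_kernel_bound\<close> and \<open>2 ^ (2 n)\<close> from the dilation; the factor 2 turns
    the final estimate into \<open>M / 2\<close>.\<close>
  define C2 where "C2 = 2 * K * C1 * 2 ^ (2 * CARD('n))"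
  have C2: "C2 > 0" using K C1 by (simp add: C2_def)
  have main: "\<Phi> (norm (f a)) \<le> C2 * I * (1 - (norm a)\<^sup>2) powr (- N)"
    if f: "f \<in> hol_ball" and a0: "a \<in> ball 0 1" and I: "I > 0" "(\<integral>\<^sup>+z. ennreal (\<Phi> (norm (f z))) \<partial>nu \<sigma>) \<le> ennreal I"
    for f :: "complex^'n \<Rightarrow> complex" and a I
  proof -
    have mf [measurable]: "f \<in> borel_measurable borel" by (rule borel_measurable_hol_ball[OF f])
    define A where "A = C2 * I"
    have A: "A > 0" using C2 I by (simp add: A_def)
    define \<omega> where "\<omega> = (\<lambda>z::complex^'n. q (A * (1 - (norm z)\<^sup>2) powr (- N)))"
    have w1: "\<omega> z \<ge> q A" "\<Phi> (\<omega> z) = A * (1 - (norm z)\<^sup>2) powr (- N)" if z: "z \<in> ball 0 1" for z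
    proof -
      have "1 \<le> (1 - (norm z)\<^sup>2) powr (- N)"
        using powr_mono2'[of "- N" "1 - (norm z)\<^sup>2" 1] one_minus_norm_sq_pos[OF z] N by simp
      thus "\<omega> z \<ge> q A" unfolding \<omega>_def using A by (intro q_mono) auto
      show "\<Phi> (\<omega> z) = A * (1 - (norm z)\<^sup>2) powr (- N)" unfolding \<omega>_def using A by (intro Phi_q) simp
    qed
    have qA: "q A > 0" by (rule q_pos[OF A])
    have wpos: "\<omega> z > 0" if "z \<in> ball 0 1" for z using w1(1)[OF that] qA by linarith
    \<comment> \<open>A dilate is bounded on the ball, so the supremum of the quotients is finite.
      The resulting bound contains no trace of \<open>r\<close>, which allows \<open>r\<close> to
      tend to 1.\<close>
    have dil: "norm (f (r *\<^sub>R a)) \<le> \<omega> a" if r: "1 / 2 \<le> r" "r < 1" and a: "a \<in> ball 0 1" for r a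
    proof -
      have r0: "0 < r" using r by simp
      obtain B where B: "\<And>z. norm z \<le> 1 \<Longrightarrow> norm (f (r *\<^sub>R z)) \<le> B"
        using bounded_on_cball[OF holomorphic_dilate_ball[OF hol_ballD[OF f] r0 r(2)]] by blast
      have B0: "B \<ge> 0" using order_trans[OF norm_ge_zero B[of 0]] by simp
      define S where "S = (\<lambda>z. norm (f (r *\<^sub>R z)) / \<omega> z)"
      define M where "M = (SUP z\<in>ball 0 1. S z)"
      have bdd: "bdd_above (S ` ball 0 1)"
      proof (rule bdd_aboveI2)
        fix z :: "complex^'n" assume z: "z \<in> ball 0 1"
        have "S z \<le> B / q A" unfolding S_def
          using z B[of z] w1(1)[OF z] qA by (intro frac_le order_trans[OF norm_ge_zero B[of z]]) auto
        thus "S z \<le> B / q A" .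
      qed
      have SM: "norm (f (r *\<^sub>R z)) \<le> M * \<omega> z" if z: "z \<in> ball 0 1" for z
      proof -
        have "S z \<le> M" unfolding M_def by (rule cSUP_upper[OF z bdd])
        thus ?thesis using wpos[OF z] by (simp add: S_def divide_simps)
      qed
      have "M \<le> 1"
      proof (rule ccontr)
        assume "\<not> M \<le> 1"
        hence M: "M > 1" by simp
        have half: "norm (f (r *\<^sub>R b)) \<le> M / 2 * \<omega> b" if b: "b \<in> ball 0 1" for b
        proof -
          define y where "y = 1 - (norm b)\<^sup>2"
          have y: "y > 0" unfolding y_def by (rule one_minus_norm_sq_pos[OF b])
          obtain R where R: "R > 1" "holomorphic_Cn_on (\<lambda>z. f (r *\<^sub>R z) * kern m (herm z b)) (ball 0 R)"
            using holomorphic_dilate_kern[OF f r0 r(2) b] by blast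
          \<comment> \<open>Reproducing the product of the dilate with
            \<open>kern m (herm z b)\<close> at the point \<open>b\<close> gives kernels of total
            modulus \<open>d powr (- (2 * m))\<close>, while \<open>kern m (herm b b)\<close>
            contributes \<open>y powr (- m)\<close>: the combination in \<open>x\<close>,
            \<open>y\<close>, \<open>d\<close> that \<open>q_kernel_bound\<close> handles.\<close>
          define g where "g = (\<lambda>z. f (r *\<^sub>R z) * kern m (herm z b) * kern m (herm b z))"
          have [measurable]: "g \<in> borel_measurable borel" unfolding g_def by measurable
          have "(\<integral>z. g z \<partial>nu \<beta>) = f (r *\<^sub>R b) * kern m (herm b b)"
            using reproducing_formula[OF b1(1) _ R(2,1) b] unfolding g_def m(1)[symmetric] by simp
          hence "norm (f (r *\<^sub>R b)) * y powr (- m) = norm (\<integral>z. g z \<partial>nu \<beta>)"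
            by (simp add: norm_mult norm_kern_self[OF b] y_def)
          hence "norm (f (r *\<^sub>R b)) = y powr m * norm (\<integral>z. g z \<partial>nu \<beta>)"
            using y by (simp add: powr_minus field_simps)
          hence "ennreal (norm (f (r *\<^sub>R b))) = ennreal (y powr m) * ennreal (norm (\<integral>z. g z \<partial>nu \<beta>))"
            by (simp add: ennreal_mult')
          also have "\<dots> \<le> ennreal (y powr m) * (\<integral>\<^sup>+z. ennreal (norm (g z)) \<partial>nu \<beta>)"
          proof (intro mult_left_mono integral_norm_bound_ennreal)
            show "integrable (nu \<beta>) g"
            proof (rule integrable_nu_bounded[OF b1(1)])
              fix z :: "complex^'n" assume z: "z \<in> ball 0 1"
              have "norm (f (r *\<^sub>R z)) \<le> B" using B z by simp
              moreover have "norm (kern m (herm z b)) \<le> (1 - norm b) powr (- m)"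
                using m by (intro norm_kern_herm_le z b) simp
              ultimately show "norm (g z) \<le> B * (1 - norm b) powr (- m) * (1 - norm b) powr (- m)"
                unfolding g_def norm_mult norm_kern_herm_commute[of _ b z]
                by (intro mult_mono) (auto simp: B0)
            qed measurable
          qed simp
          also have "(\<integral>\<^sup>+z. ennreal (norm (g z)) \<partial>nu \<beta>)
             = ennreal K * (\<integral>\<^sup>+z. ennreal ((1 - (norm z)\<^sup>2) powr (\<beta> - \<sigma>)) * ennreal (norm (g z)) \<partial>nu \<sigma>)"
            by (rule K(2)) measurable
          also have "ennreal (y powr m) * (ennreal K * (\<integral>\<^sup>+z. ennreal ((1 - (norm z)\<^sup>2) powr (\<beta> - \<sigma>)) * ennreal (norm (g z)) \<partial>nu \<sigma>))
             = ennreal K * (\<integral>\<^sup>+z. ennreal (y powr m) * (ennreal ((1 - (norm z)\<^sup>2) powr (\<beta> - \<sigma>)) * ennreal (norm (g z))) \<partial>nu \<sigma>)"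
            by (subst nn_integral_cmult) (measurable, simp add: mult_ac)
          also have "\<dots> \<le> ennreal K * (\<integral>\<^sup>+z. ennreal (M / A * C1 * \<omega> b) * ennreal (\<Phi> (norm (f (r *\<^sub>R z)))) \<partial>nu \<sigma>)"
          proof (intro mult_left_mono nn_integral_nu_mono)
            fix z :: "complex^'n" assume z: "z \<in> ball 0 1"
            define x where "x = 1 - (norm z)\<^sup>2"
            define d where "d = norm (1 - herm z b)"
            define t where "t = norm (f (r *\<^sub>R z))"
            have x: "x > 0" unfolding x_def by (rule one_minus_norm_sq_pos[OF z])
            have xy: "x \<le> 2 * d" "y \<le> 2 * d"
              using one_minus_norm_sq_le_two[OF z b] by (simp_all add: x_def y_def d_def)
            have d: "d > 0" using x xy by linarith
            have wz: "\<omega> z > 0" by (rule wpos[OF z])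
            have gz: "norm (g z) = t * d powr (- (2 * m))"
              by (simp add: g_def norm_mult norm_kern norm_one_minus_herm_commute[of b z] d_def t_def powr_add[symmetric] mult.assoc)
            \<comment> \<open>\<open>M > 1\<close> allows passing from \<open>\<omega> z\<close> to
              \<open>M * \<omega> z\<close>. Since \<open>t\<close> is at most the latter, the ratio
              inequality then replaces \<open>t\<close> by \<open>\<Phi> t\<close>.\<close>
            have "t * (A * x powr (- N)) \<le> t * \<Phi> (M * \<omega> z)"
              using w1(2)[OF z] M wz Phi_mono[of "\<omega> z" "M * \<omega> z"] by (intro mult_left_mono) (auto simp: x_def t_def)
            also have "\<dots> \<le> M * \<omega> z * \<Phi> t" using SM[OF z] by (intro Phi_ratio) (auto simp: t_def)
            finally have "t \<le> M / A * \<Phi> t * (\<omega> z * x powr N)"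
              using x A by (simp add: powr_minus field_simps)
            hence "y powr m * (x powr (\<beta> - \<sigma>) * norm (g z)) \<le> y powr m * (x powr (\<beta> - \<sigma>) * (M / A * \<Phi> t * (\<omega> z * x powr N) * d powr (- (2 * m))))"
              unfolding gz by (intro mult_left_mono mult_right_mono) auto
            also have "\<dots> = M / A * \<Phi> t * (\<omega> z * x powr m * y powr m * d powr (- (2 * m)))"
              by (simp add: m(4) powr_add mult_ac)
            also have "\<dots> \<le> M / A * \<Phi> t * (C1 * \<omega> b)"
              unfolding C1_def \<omega>_def x_def[symmetric] y_def[symmetric]
              using M A by (intro mult_left_mono q_kernel_bound[OF N A x xy(1) y xy(2) m(3)] mult_nonneg_nonneg Phi_nonneg) (auto simp: t_def)
            finally have le: "y powr m * (x powr (\<beta> - \<sigma>) * norm (g z)) \<le> M / A * C1 * \<omega> b * \<Phi> t" by (simp add: mult_ac)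
            have nn: "0 \<le> M / A * C1 * \<omega> b" using M A C1 wpos[OF b] by simp
            show "ennreal (y powr m) * (ennreal ((1 - (norm z)\<^sup>2) powr (\<beta> - \<sigma>)) * ennreal (norm (g z)))
              \<le> ennreal (M / A * C1 * \<omega> b) * ennreal (\<Phi> (norm (f (r *\<^sub>R z))))"
              using ennreal_leI[OF le] ennreal_mult'[OF nn, of "\<Phi> t"]
              by (simp add: ennreal_mult' x_def[symmetric] t_def[symmetric] del: times_divide_eq_left times_divide_eq_right)
          qed simp
          also have "\<dots> = ennreal K * (ennreal (M / A * C1 * \<omega> b) * (\<integral>\<^sup>+z. ennreal (\<Phi> (norm (f (r *\<^sub>R z)))) \<partial>nu \<sigma>))"
            by (subst nn_integral_cmult) measurable
          also have "\<dots> \<le> ennreal K * (ennreal (M / A * C1 * \<omega> b) * (ennreal (2 ^ (2 * CARD('n))) * ennreal I))"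
          proof (intro mult_left_mono)
            have "(\<integral>\<^sup>+z. ennreal (\<Phi> (norm (f (r *\<^sub>R z)))) \<partial>nu \<sigma>) \<le> ennreal (2 ^ (2 * CARD('n))) * (\<integral>\<^sup>+z. ennreal (\<Phi> (norm (f z))) \<partial>nu \<sigma>)"
              by (rule nn_integral_nu_dilate[OF s _ r]) measurable
            also have "\<dots> \<le> ennreal (2 ^ (2 * CARD('n))) * ennreal I" by (intro mult_left_mono I) simp
            finally show "(\<integral>\<^sup>+z. ennreal (\<Phi> (norm (f (r *\<^sub>R z)))) \<partial>nu \<sigma>) \<le> ennreal (2 ^ (2 * CARD('n))) * ennreal I" .
          qed simp_all
          also have "\<dots> = ennreal (K * (M / A * C1 * \<omega> b * (2 ^ (2 * CARD('n)) * I)))"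
          proof -
            have "0 \<le> M / A * C1 * \<omega> b" "0 \<le> K" using K(1) M A C1 wpos[OF b] by simp_all
            thus ?thesis by (simp only: ennreal_mult' zero_le_power zero_le_numeral)
          qed
          also have "K * (M / A * C1 * \<omega> b * (2 ^ (2 * CARD('n)) * I)) = M / 2 * \<omega> b"
            using A K C1 I by (simp add: A_def C2_def field_simps)
          finally have "ennreal (norm (f (r *\<^sub>R b))) \<le> ennreal (M / 2 * \<omega> b)" .
          thus ?thesis using M wpos[OF b] by simp
        qed
        have "M \<le> M / 2" unfolding M_def
        proof (rule cSUP_least)
          fix z :: "complex^'n" assume z: "z \<in> ball 0 1"
          have "S z \<le> M / 2"
            using half[OF z] wpos[OF z] by (simp add: S_def divide_simps)
          thus "S z \<le> (SUP z\<in>ball 0 1. S z) / 2" by (simp only: M_def)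
        qed simp
        thus False using M by simp
      qed
      hence "M * \<omega> a \<le> 1 * \<omega> a" using wpos[OF a] by (intro mult_right_mono) auto
      thus ?thesis using SM[OF a] by simp
    qed
    have "\<Phi> (norm (f a)) \<le> A * (1 - (norm a)\<^sup>2) powr (- N)"
    proof (rule LIMSEQ_le_const2)
      show "(\<lambda>i. \<Phi> (norm (f (rseq i *\<^sub>R a)))) \<longlonglongrightarrow> \<Phi> (norm (f a))"
        by (intro tendsto_Phi_norm tendsto_dilate_hol_ball[OF f a0 rseq_tendsto])
      have "\<Phi> (norm (f (rseq i *\<^sub>R a))) \<le> A * (1 - (norm a)\<^sup>2) powr (- N)" for i
      proof -
        \<comment> \<open>The offset 2 in \<open>rseq\<close> puts the smallest term at
          \<open>1 / 2\<close>, the least dilation that \<open>dil\<close> allows.\<close>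
        have "1 / 2 \<le> rseq i" by (simp add: rseq_def divide_simps)
        from dil[OF this rseq(2) a0] have "\<Phi> (norm (f (rseq i *\<^sub>R a))) \<le> \<Phi> (\<omega> a)" by (intro Phi_mono) auto
        thus ?thesis using w1(2)[OF a0] by simp
      qed
      thus "\<exists>N'. \<forall>n\<ge>N'. \<Phi> (norm (f (rseq n *\<^sub>R a))) \<le> A * (1 - (norm a)\<^sup>2) powr (- N)" by blast
    qed
    thus ?thesis by (simp add: A_def)
  qed
  have "ennreal (\<Phi> (norm (f a))) \<le> ennreal (C2 * (1 - (norm a)\<^sup>2) powr (- N)) * (\<integral>\<^sup>+z. ennreal (\<Phi> (norm (f z))) \<partial>nu \<sigma>)"
    if f: "f \<in> hol_ball" and a: "a \<in> ball 0 1" for f :: "complex^'n \<Rightarrow> complex" and a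
  proof (cases "(\<integral>\<^sup>+z. ennreal (\<Phi> (norm (f z))) \<partial>nu \<sigma>)")
    case (real v)
    define D where "D = C2 * (1 - (norm a)\<^sup>2) powr (- N)"
    have D: "D > 0" using C2 one_minus_norm_sq_pos[OF a] by (simp add: D_def)
    \<comment> \<open>\<open>main\<close> asks for a positive bound \<open>I\<close>, whereas the
      integral \<open>v\<close> may vanish; hence the enlargement by \<open>e / D\<close>.\<close>
    have "\<Phi> (norm (f a)) \<le> D * v"
    proof (rule field_le_epsilon)
      fix e :: real assume e: "e > 0"
      have "\<Phi> (norm (f a)) \<le> C2 * (v + e / D) * (1 - (norm a)\<^sup>2) powr (- N)"
        by (rule main[OF f a]) (use real e D in \<open>auto intro!: add_nonneg_pos ennreal_leI\<close>)
      also have "\<dots> = D * (v + e / D)" by (simp add: D_def)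
      also have "\<dots> = D * v + e" using D by (simp add: distrib_left)
      finally show "\<Phi> (norm (f a)) \<le> D * v + e" .
    qed
    hence "ennreal (\<Phi> (norm (f a))) \<le> ennreal (D * v)" by (rule ennreal_leI)
    also have "\<dots> = ennreal D * ennreal v" using D by (simp add: ennreal_mult')
    finally show ?thesis using real by (simp add: D_def)
  next
    case top
    define D where "D = C2 * (1 - (norm a)\<^sup>2) powr (- N)"
    have D: "D > 0" using C2 one_minus_norm_sq_pos[OF a] by (simp add: D_def)
    show ?thesis unfolding top D_def[symmetric] using D by (simp add: ennreal_mult_top)
  qed
  thus ?thesis using C2 that[of C2] unfolding N_def by blast
qed

end

context growth_fn
begin

text \<open>The pointwise bound in the non-negative weight \<alpha> + 1 is applied to
  \<open>f\<close> times \<open>kern s\<close>, scaled so that the modulus at \<open>a\<close> is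
  unchanged. With \<open>s = b / p\<close>, where \<open>b = n + 2 + \<alpha>\<close>, lower type
  turns the decay of the factor into the power \<open>b\<close>. The factor \<open>1 - |z|^2\<close>
  is the difference of the weights; it makes the kernel uniformly integrable in
  \<open>a\<close>.\<close>

lemma kernel_weighted_bound:
  assumes \<alpha>: "\<alpha> > -1"
  obtains C where "C > 0"
    "\<And>(f::complex^'n \<Rightarrow> complex) a. f \<in> hol_ball \<Longrightarrow> a \<in> ball 0 1 \<Longrightarrow>
      ennreal (\<Phi> (norm (f a))) \<le> ennreal C * (\<integral>\<^sup>+z. ennreal (\<Phi> (norm (f z))) *
        ennreal ((1 - (norm z)\<^sup>2) * norm (1 - herm z a) powr (- (real CARD('n) + 2 + \<alpha>))) \<partial>nu \<alpha>)"
proof -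
  let ?b = "real CARD('n) + 2 + \<alpha>"
  have b: "?b > 0" using \<alpha> by (simp add: add_pos_nonneg)
  define s where "s = ?b / p"
  have s: "s > 0" using b p by (simp add: s_def)
  have \<alpha>1: "\<alpha> + 1 \<ge> 0" "\<alpha> + 1 > -1" using \<alpha> by simp_all
  obtain C where C: "C > 0" "\<And>(f::complex^'n \<Rightarrow> complex) a. f \<in> hol_ball \<Longrightarrow> a \<in> ball 0 1 \<Longrightarrow>
      ennreal (\<Phi> (norm (f a))) \<le> ennreal (C * (1 - (norm a)\<^sup>2) powr (- (real CARD('n) + 1 + (\<alpha> + 1))))
        * (\<integral>\<^sup>+z. ennreal (\<Phi> (norm (f z))) \<partial>nu (\<alpha> + 1))"
    using pointwise_bound_nonneg_weight[OF \<alpha>1(1), where 'n = 'n] by blast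
  obtain K where K: "K > 0" "\<And>f. f \<in> borel_measurable borel \<Longrightarrow> (\<integral>\<^sup>+z. f z \<partial>nu (\<alpha> + 1))
      = ennreal K * (\<integral>\<^sup>+z. ennreal ((1 - (norm z)\<^sup>2) powr 1) * f (z::complex^'n) \<partial>nu \<alpha>)"
    using nn_integral_nu_shift[OF \<alpha> \<alpha>1(2), where 'n = 'n] by auto
  define C' where "C' = C * (L * 2 powr s * 2 powr (- ?b)) * K"
  have C': "C' > 0" using C K L by (simp add: C'_def)
  have "ennreal (\<Phi> (norm (f a))) \<le> ennreal C' * (\<integral>\<^sup>+z. ennreal (\<Phi> (norm (f z))) *
        ennreal ((1 - (norm z)\<^sup>2) * norm (1 - herm z a) powr (- ?b)) \<partial>nu \<alpha>)"
    if f: "f \<in> hol_ball" and a: "a \<in> ball 0 1" for f :: "complex^'n \<Rightarrow> complex" and a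
  proof -
    have [measurable]: "f \<in> borel_measurable borel" by (rule borel_measurable_hol_ball[OF f])
    define y where "y = 1 - (norm a)\<^sup>2"
    have y: "y > 0" unfolding y_def by (rule one_minus_norm_sq_pos[OF a])
    define F where "F = cut_ball (\<lambda>z. f z * (of_real (y powr s) * kern s (herm z a)))"
    have F: "F \<in> hol_ball"
      unfolding F_def
      by (intro cut_ball_hol holomorphic_Cn_on_mult holomorphic_Cn_on_const holomorphic_Cn_on_kern_herm a hol_ballD f)
    have [measurable]: "F \<in> borel_measurable borel" by (rule borel_measurable_hol_ball[OF F])
    have "norm (F a) = norm (f a) * (y powr s * y powr (- s))"
      using a by (simp add: F_def norm_mult norm_kern_self[OF a] y_def)
    also have "\<dots> = norm (f a)" using y by (simp add: powr_add[symmetric])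
    finally have Fa: "norm (F a) = norm (f a)" .
    have le: "\<Phi> (norm (F z)) \<le> L * 2 powr s * 2 powr (- ?b) * y powr ?b * (\<Phi> (norm (f z)) * norm (1 - herm z a) powr (- ?b))"
      if z: "z \<in> ball 0 1" for z
    proof -
      define d where "d = norm (1 - herm z a)"
      have yd: "y \<le> 2 * d" using one_minus_norm_sq_le_two[OF z a] by (simp add: y_def d_def)
      hence d: "d > 0" using y by linarith
      define \<tau> where "\<tau> = (y / (2 * d)) powr s"
      have \<tau>: "0 \<le> \<tau>" "\<tau> \<le> 1" using y d yd s by (auto simp: \<tau>_def intro!: powr_le1)
      have \<tau>p: "\<tau> powr p = 2 powr (- ?b) * y powr ?b * d powr (- ?b)"
      proof -
        have "\<tau> powr p = (y / (2 * d)) powr ?b" using p by (simp add: \<tau>_def s_def powr_powr)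
        also have "\<dots> = y powr ?b / (2 powr ?b * d powr ?b)" using y d by (simp only: powr_divide powr_mult)
        finally show ?thesis by (simp only: powr_minus divide_inverse inverse_mult_distrib mult_ac)
      qed
      have "norm (F z) = norm (f z) * (y powr s * d powr (- s))"
        using z by (simp add: F_def norm_mult norm_kern d_def)
      also have "\<dots> = (2 powr s * norm (f z)) * \<tau>"
      proof -
        have "\<tau> = y powr s / (2 powr s * d powr s)" using y d by (simp only: \<tau>_def powr_divide powr_mult)
        thus ?thesis by (simp add: powr_minus divide_inverse)
      qed
      finally have "\<Phi> (norm (F z)) = \<Phi> ((2 powr s * norm (f z)) * \<tau>)" by simp
      also have "\<dots> \<le> L * \<tau> powr p * \<Phi> (2 powr s * norm (f z))"
        using \<tau> by (intro Phi_lower) auto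
      also have "\<dots> \<le> L * \<tau> powr p * (2 powr s * \<Phi> (norm (f z)))"
        using L s by (intro mult_left_mono Phi_scale) (auto simp: ge_one_powr_ge_zero)
      also have "\<dots> = L * 2 powr s * 2 powr (- ?b) * y powr ?b * (\<Phi> (norm (f z)) * d powr (- ?b))"
        unfolding \<tau>p by (simp only: mult_ac)
      finally show ?thesis by (simp add: d_def)
    qed
    let ?J = "\<integral>\<^sup>+z. ennreal (\<Phi> (norm (f z))) * ennreal ((1 - (norm z)\<^sup>2) * norm (1 - herm z a) powr (- ?b)) \<partial>nu \<alpha>"
    have "(\<integral>\<^sup>+z. ennreal (\<Phi> (norm (F z))) \<partial>nu (\<alpha> + 1))
      \<le> (\<integral>\<^sup>+z. ennreal (L * 2 powr s * 2 powr (- ?b) * y powr ?b) * ennreal (\<Phi> (norm (f z)) * norm (1 - herm z a) powr (- ?b)) \<partial>nu (\<alpha> + 1))"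
    proof (rule nn_integral_nu_mono)
      fix z :: "complex^'n" assume z: "z \<in> ball 0 1"
      show "ennreal (\<Phi> (norm (F z))) \<le> ennreal (L * 2 powr s * 2 powr (- ?b) * y powr ?b) * ennreal (\<Phi> (norm (f z)) * norm (1 - herm z a) powr (- ?b))"
        using ennreal_leI[OF le[OF z]] L by (subst ennreal_mult'[symmetric]) auto
    qed
    also have "\<dots> = ennreal (L * 2 powr s * 2 powr (- ?b) * y powr ?b) * (\<integral>\<^sup>+z. ennreal (\<Phi> (norm (f z)) * norm (1 - herm z a) powr (- ?b)) \<partial>nu (\<alpha> + 1))"
      by (rule nn_integral_cmult) measurable
    also have "(\<integral>\<^sup>+z. ennreal (\<Phi> (norm (f z)) * norm (1 - herm z a) powr (- ?b)) \<partial>nu (\<alpha> + 1))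
       = ennreal K * (\<integral>\<^sup>+z. ennreal ((1 - (norm z)\<^sup>2) powr 1) * ennreal (\<Phi> (norm (f z)) * norm (1 - herm z a) powr (- ?b)) \<partial>nu \<alpha>)"
      by (rule K(2)) measurable
    also have "(\<integral>\<^sup>+z. ennreal ((1 - (norm z)\<^sup>2) powr 1) * ennreal (\<Phi> (norm (f z)) * norm (1 - herm z a) powr (- ?b)) \<partial>nu \<alpha>) = ?J"
    proof (rule nn_integral_cong_AE, rule AE_nuI)
      fix z :: "complex^'n" assume z: "z \<in> ball 0 1"
      show "ennreal ((1 - (norm z)\<^sup>2) powr 1) * ennreal (\<Phi> (norm (f z)) * norm (1 - herm z a) powr (- ?b))
        = ennreal (\<Phi> (norm (f z))) * ennreal ((1 - (norm z)\<^sup>2) * norm (1 - herm z a) powr (- ?b))"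
        using one_minus_norm_sq_pos[OF z] Phi_nonneg[of "norm (f z)"]
        by (simp add: ennreal_mult'[symmetric] mult_ac)
    qed
    finally have "ennreal (C * y powr (- ?b)) * (\<integral>\<^sup>+z. ennreal (\<Phi> (norm (F z))) \<partial>nu (\<alpha> + 1))
      \<le> ennreal (C * y powr (- ?b)) * (ennreal (L * 2 powr s * 2 powr (- ?b) * y powr ?b) * (ennreal K * ?J))"
      by (rule mult_left_mono) simp
    also have "\<dots> = ennreal (C * y powr (- ?b) * (L * 2 powr s * 2 powr (- ?b) * y powr ?b) * K) * ?J"
      using C K L by (simp add: ennreal_mult' mult.assoc)
    also have "C * y powr (- ?b) * (L * 2 powr s * 2 powr (- ?b) * y powr ?b) * K = C'"
    proof -
      have "y powr (- ?b) * y powr ?b = 1" using y by (simp add: powr_add[symmetric])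
      thus ?thesis by (simp add: C'_def mult_ac)
    qed
    finally show ?thesis using C(2)[OF F a] unfolding Fa y_def by (simp add: add_ac)
  qed
  thus ?thesis using C' that by blast
qed

text \<open>The kernel is bounded in \<open>z\<close>: \<open>1 - |z|^2\<close> is at most
  \<open>2 * d\<close> and \<open>d\<close> is at least \<open>y / 2\<close>. The detour through
  weight \<alpha> + 1 extends the bound to negative \<alpha>.\<close>

lemma pointwise_bound:
  assumes \<alpha>: "\<alpha> > -1"
  obtains C where "C > 0"
    "\<And>(f::complex^'n \<Rightarrow> complex) a. f \<in> hol_ball \<Longrightarrow> a \<in> ball 0 1 \<Longrightarrow>
      ennreal (\<Phi> (norm (f a))) \<le> ennreal (C * (1 - (norm a)\<^sup>2) powr (- (real CARD('n) + 1 + \<alpha>)))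
        * (\<integral>\<^sup>+z. ennreal (\<Phi> (norm (f z))) \<partial>nu \<alpha>)"
proof -
  let ?N = "real CARD('n) + 1 + \<alpha>"
  have N: "?N > 0" using \<alpha> by (simp add: add_pos_nonneg)
  obtain C where C: "C > 0" "\<And>(f::complex^'n \<Rightarrow> complex) a. f \<in> hol_ball \<Longrightarrow> a \<in> ball 0 1 \<Longrightarrow>
      ennreal (\<Phi> (norm (f a))) \<le> ennreal C * (\<integral>\<^sup>+z. ennreal (\<Phi> (norm (f z))) *
        ennreal ((1 - (norm z)\<^sup>2) * norm (1 - herm z a) powr (- (real CARD('n) + 2 + \<alpha>))) \<partial>nu \<alpha>)"
    using kernel_weighted_bound[OF \<alpha>, where 'n = 'n] by blast
  define D where "D = C * (2 * 2 powr ?N)"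
  have "ennreal (\<Phi> (norm (f a))) \<le> ennreal (D * (1 - (norm a)\<^sup>2) powr (- ?N)) * (\<integral>\<^sup>+z. ennreal (\<Phi> (norm (f z))) \<partial>nu \<alpha>)"
    if f: "f \<in> hol_ball" and a: "a \<in> ball 0 1" for f :: "complex^'n \<Rightarrow> complex" and a
  proof -
    have [measurable]: "f \<in> borel_measurable borel" by (rule borel_measurable_hol_ball[OF f])
    define y where "y = 1 - (norm a)\<^sup>2"
    have y: "y > 0" unfolding y_def by (rule one_minus_norm_sq_pos[OF a])
    have "(\<integral>\<^sup>+z. ennreal (\<Phi> (norm (f z))) * ennreal ((1 - (norm z)\<^sup>2) * norm (1 - herm z a) powr (- (real CARD('n) + 2 + \<alpha>))) \<partial>nu \<alpha>)
      \<le> (\<integral>\<^sup>+z. ennreal (\<Phi> (norm (f z))) * ennreal (2 * 2 powr ?N * y powr (- ?N)) \<partial>nu \<alpha>)"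
    proof (intro nn_integral_nu_mono mult_left_mono ennreal_leI)
      fix z :: "complex^'n" assume z: "z \<in> ball 0 1"
      define d where "d = norm (1 - herm z a)"
      have le: "y \<le> 2 * d" "1 - (norm z)\<^sup>2 \<le> 2 * d" using one_minus_norm_sq_le_two[OF z a] by (simp_all add: y_def d_def)
      have d: "d > 0" using y le by linarith
      have "(1 - (norm z)\<^sup>2) * d powr (- (real CARD('n) + 2 + \<alpha>)) \<le> (2 * d) * d powr (- (real CARD('n) + 2 + \<alpha>))"
        by (intro mult_right_mono le) simp
      also have "\<dots> = 2 * d powr (- ?N)"
      proof -
        have "- ?N = 1 + - (real CARD('n) + 2 + \<alpha>)" by simp
        hence "d powr (- ?N) = d powr 1 * d powr (- (real CARD('n) + 2 + \<alpha>))" by (simp only: powr_add)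
        thus ?thesis using d by simp
      qed
      also have "\<dots> \<le> 2 * (y / 2) powr (- ?N)" using y le N by (intro mult_left_mono powr_mono2') auto
      also have "(y / 2) powr (- ?N) = 2 powr ?N * y powr (- ?N)"
        using powr_divide[of y 2 "- ?N"] powr_minus[of 2 ?N] by (simp only: divide_inverse inverse_inverse_eq mult_ac)
      finally show "(1 - (norm z)\<^sup>2) * norm (1 - herm z a) powr (- (real CARD('n) + 2 + \<alpha>)) \<le> 2 * 2 powr ?N * y powr (- ?N)"
        by (simp only: d_def mult.assoc)
    qed simp
    also have "\<dots> = (\<integral>\<^sup>+z. ennreal (\<Phi> (norm (f z))) \<partial>nu \<alpha>) * ennreal (2 * 2 powr ?N * y powr (- ?N))"
      by (rule nn_integral_multc) measurable
    finally have "ennreal C * (\<integral>\<^sup>+z. ennreal (\<Phi> (norm (f z))) * ennreal ((1 - (norm z)\<^sup>2) * norm (1 - herm z a) powr (- (real CARD('n) + 2 + \<alpha>))) \<partial>nu \<alpha>)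
      \<le> ennreal C * ((\<integral>\<^sup>+z. ennreal (\<Phi> (norm (f z))) \<partial>nu \<alpha>) * ennreal (2 * 2 powr ?N * y powr (- ?N)))"
      by (rule mult_left_mono) simp
    also have "\<dots> = (ennreal C * ennreal (2 * 2 powr ?N * y powr (- ?N))) * (\<integral>\<^sup>+z. ennreal (\<Phi> (norm (f z))) \<partial>nu \<alpha>)"
      by (simp only: mult_ac)
    also have "ennreal C * ennreal (2 * 2 powr ?N * y powr (- ?N)) = ennreal (D * y powr (- ?N))"
      using C by (simp add: ennreal_mult'[symmetric] D_def mult.assoc)
    finally show ?thesis using C(2)[OF f a] by (simp add: y_def)
  qed
  moreover have "D > 0" using C by (simp add: D_def)
  ultimately show ?thesis using that by blast
qed

section \<open>Convergence of dilates\<close>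

lemma bergman_orliczD:
  assumes "f \<in> bergman_orlicz \<alpha> \<Phi>"
  shows "f \<in> hol_ball" "(\<integral>\<^sup>+z. ennreal (\<Phi> (norm (f z))) \<partial>nu \<alpha>) < \<infinity>"
  using assms by (auto simp: bergman_orlicz_def)

lemma herm_scaleR_swap: "herm z (r *\<^sub>R a) = herm (r *\<^sub>R z) a"
  by (simp add: herm_scaleR_left herm_scaleR_right)

lemma borel_measurable_herm_pair [measurable]:
  "(\<lambda>p. herm (fst p) (r *\<^sub>R snd p)) \<in> borel_measurable (borel \<Otimes>\<^sub>M (borel :: (complex^'n) measure))"
proof -
  have "(\<lambda>p. herm (fst p) (r *\<^sub>R snd p)) \<in> borel_measurable (borel :: ((complex^'n) \<times> (complex^'n)) measure)"
    by (intro borel_measurable_continuous_onI continuous_intros)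
  thus ?thesis by (simp add: borel_prod)
qed

text \<open>The part of \<open>\<Phi> |f (r a)|\<close> that comes from \<open>|z| > R\<close> in \<open>kernel_weighted_bound\<close>.\<close>

lemma dilate_tail:
  assumes \<alpha>: "\<alpha> > -1"
  obtains C where "C > 0"
    "\<And>(f::complex^'n \<Rightarrow> complex) r R. f \<in> bergman_orlicz \<alpha> \<Phi> \<Longrightarrow> 0 < r \<Longrightarrow> r < 1 \<Longrightarrow> R < 1 \<Longrightarrow>
      \<exists>g K. g \<in> borel_measurable borel \<and>
        (\<forall>a\<in>ball 0 1. ennreal (\<Phi> (norm (f (r *\<^sub>R a)))) \<le> g a + ennreal (C * (1 - R) powr (- (real CARD('n) + 2 + \<alpha>)) * K)) \<and>
        (\<integral>\<^sup>+z. ennreal (\<Phi> (norm (f z))) \<partial>nu \<alpha>) = ennreal K \<and> K \<ge> 0 \<and>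
        (\<integral>\<^sup>+a. g a \<partial>nu \<alpha>) \<le> ennreal C * (\<integral>\<^sup>+z. ennreal (\<Phi> (norm (f z))) * indicator {z. norm z > R} z \<partial>nu \<alpha>)"
proof -
  let ?b = "real CARD('n) + 2 + \<alpha>"
  have b: "?b > 0" using \<alpha> by (simp add: add_pos_nonneg)
  obtain C where C: "C > 0" "\<And>(f::complex^'n \<Rightarrow> complex) a. f \<in> hol_ball \<Longrightarrow> a \<in> ball 0 1 \<Longrightarrow>
      ennreal (\<Phi> (norm (f a))) \<le> ennreal C * (\<integral>\<^sup>+z. ennreal (\<Phi> (norm (f z))) *
        ennreal ((1 - (norm z)\<^sup>2) * norm (1 - herm z a) powr (- ?b)) \<partial>nu \<alpha>)"
    using kernel_weighted_bound[OF \<alpha>, where 'n = 'n] by blast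
  have "?b > real CARD('n) + 1 + \<alpha>" by simp
  then obtain D where D: "D > 0" "\<And>w::complex^'n. w \<in> ball 0 1 \<Longrightarrow> (\<integral>\<^sup>+z. ennreal (norm (1 - herm z w) powr (- ?b)) \<partial>nu \<alpha>)
       \<le> ennreal (D * (1 - (norm w)\<^sup>2) powr (real CARD('n) + 1 + \<alpha> - ?b))"
    using forelli_rudin[OF \<alpha>, of ?b, where 'n = 'n] by blast
  define E where "E = max C (C * D)"
  have E: "E > 0" "C \<le> E" "C * D \<le> E" using C by (auto simp: E_def)
  interpret finite_measure "nu \<alpha> :: (complex^'n) measure" by (rule finite_measure_nu[OF \<alpha>])
  interpret P: pair_sigma_finite "nu \<alpha> :: (complex^'n) measure" "nu \<alpha> :: (complex^'n) measure" ..
  have "\<exists>g K. g \<in> borel_measurable borel \<and>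
        (\<forall>a\<in>ball 0 1. ennreal (\<Phi> (norm (f (r *\<^sub>R a)))) \<le> g a + ennreal (E * (1 - R) powr (- ?b) * K)) \<and>
        (\<integral>\<^sup>+z. ennreal (\<Phi> (norm (f z))) \<partial>nu \<alpha>) = ennreal K \<and> K \<ge> 0 \<and>
        (\<integral>\<^sup>+a. g a \<partial>nu \<alpha>) \<le> ennreal E * (\<integral>\<^sup>+z. ennreal (\<Phi> (norm (f z))) * indicator {z. norm z > R} z \<partial>nu \<alpha>)"
    if f: "f \<in> bergman_orlicz \<alpha> \<Phi>" and r: "0 < r" "r < 1" and R: "R < 1" for f :: "complex^'n \<Rightarrow> complex" and r R
  proof -
    have fh: "f \<in> hol_ball" by (rule bergman_orliczD[OF f])
    have [measurable]: "f \<in> borel_measurable borel" by (rule borel_measurable_hol_ball[OF fh])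
    obtain K where K: "(\<integral>\<^sup>+z. ennreal (\<Phi> (norm (f z))) \<partial>nu \<alpha>) = ennreal K" "K \<ge> 0"
      using bergman_orliczD(2)[OF f] by (cases "(\<integral>\<^sup>+z. ennreal (\<Phi> (norm (f z))) \<partial>nu \<alpha>)") auto
    define k where "k = (\<lambda>(a::complex^'n) (z::complex^'n). (1 - (norm z)\<^sup>2) * norm (1 - herm z (r *\<^sub>R a)) powr (- ?b))"
    have [measurable]: "k a \<in> borel_measurable borel" for a
      unfolding k_def by measurable
    define h where "h = (\<lambda>z::complex^'n. ennreal (\<Phi> (norm (f z))) * (if norm z > R then 1 else 0))"
    have [measurable]: "h \<in> borel_measurable borel" unfolding h_def by measurable
    define g where "g = (\<lambda>a. ennreal C * (\<integral>\<^sup>+z. h z * ennreal (k a z) \<partial>nu \<alpha>))"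
    have mhk: "(\<lambda>(z, a). h z * ennreal (k a z)) \<in> borel_measurable (nu \<alpha> \<Otimes>\<^sub>M nu \<alpha>)"
      unfolding k_def split_beta' by measurable
    have "(\<lambda>(a, z). h z * ennreal (k a z)) \<in> borel_measurable (nu \<alpha> \<Otimes>\<^sub>M nu \<alpha>)"
      using measurable_compose[OF measurable_pair_swap' mhk] by (simp add: split_beta')
    hence mi [measurable]: "(\<lambda>a. \<integral>\<^sup>+z. h z * ennreal (k a z) \<partial>nu \<alpha>) \<in> borel_measurable (nu \<alpha>)"
      by (rule borel_measurable_nn_integral)
    have mg: "g \<in> borel_measurable borel"
      using mi unfolding g_def by simp
    have 1: "ennreal (\<Phi> (norm (f (r *\<^sub>R a)))) \<le> g a + ennreal (E * (1 - R) powr (- ?b) * K)" if a: "a \<in> ball 0 1" for a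
    proof -
      have ra: "r *\<^sub>R a \<in> ball 0 1" using dilate_in_ball[OF a] r by simp
      have "(\<integral>\<^sup>+z. ennreal (\<Phi> (norm (f z))) * ennreal (k a z) \<partial>nu \<alpha>)
        \<le> (\<integral>\<^sup>+z. h z * ennreal (k a z) + ennreal (\<Phi> (norm (f z))) * ennreal ((1 - R) powr (- ?b)) \<partial>nu \<alpha>)"
      proof (rule nn_integral_nu_mono)
        fix z :: "complex^'n" assume z: "z \<in> ball 0 1"
        show "ennreal (\<Phi> (norm (f z))) * ennreal (k a z) \<le> h z * ennreal (k a z) + ennreal (\<Phi> (norm (f z))) * ennreal ((1 - R) powr (- ?b))"
        proof (cases "norm z > R")
          case False
          have "1 - R \<le> norm (1 - herm z (r *\<^sub>R a))"
            using norm_one_minus_herm_ge[OF ra, of z] False by (simp add: norm_one_minus_herm_commute)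
          hence "norm (1 - herm z (r *\<^sub>R a)) powr (- ?b) \<le> (1 - R) powr (- ?b)"
            using R b by (intro powr_mono2') auto
          hence "k a z \<le> 1 * (1 - R) powr (- ?b)"
            unfolding k_def using one_minus_norm_sq_pos[OF z] by (intro mult_mono) auto
          hence "ennreal (\<Phi> (norm (f z))) * ennreal (k a z) \<le> ennreal (\<Phi> (norm (f z))) * ennreal ((1 - R) powr (- ?b))"
            by (intro mult_left_mono ennreal_leI) auto
          thus ?thesis by (simp add: add_increasing)
        qed (simp add: h_def)
      qed
      also have "\<dots> = (\<integral>\<^sup>+z. h z * ennreal (k a z) \<partial>nu \<alpha>) + ennreal K * ennreal ((1 - R) powr (- ?b))"
        by (subst nn_integral_add) (simp_all add: nn_integral_multc K)
      finally have "ennreal C * (\<integral>\<^sup>+z. ennreal (\<Phi> (norm (f z))) * ennreal (k a z) \<partial>nu \<alpha>)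
        \<le> ennreal C * ((\<integral>\<^sup>+z. h z * ennreal (k a z) \<partial>nu \<alpha>) + ennreal K * ennreal ((1 - R) powr (- ?b)))"
        by (rule mult_left_mono) simp
      also have "\<dots> = g a + ennreal (C * (1 - R) powr (- ?b) * K)"
        using C K by (simp add: g_def distrib_left ennreal_mult' mult_ac)
      also have "\<dots> \<le> g a + ennreal (E * (1 - R) powr (- ?b) * K)"
        using E K by (intro add_left_mono ennreal_leI mult_right_mono) auto
      finally show ?thesis using C(2)[OF fh ra] by (simp add: k_def)
    qed
    have 2: "(\<integral>\<^sup>+a. g a \<partial>nu \<alpha>) \<le> ennreal E * (\<integral>\<^sup>+z. h z \<partial>nu \<alpha>)"
    proof -
      have "(\<integral>\<^sup>+a. g a \<partial>nu \<alpha>) = ennreal C * (\<integral>\<^sup>+a. (\<integral>\<^sup>+z. h z * ennreal (k a z) \<partial>nu \<alpha>) \<partial>nu \<alpha>)"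
        unfolding g_def by (rule nn_integral_cmult[OF mi])
      also have "(\<integral>\<^sup>+a. (\<integral>\<^sup>+z. h z * ennreal (k a z) \<partial>nu \<alpha>) \<partial>nu \<alpha>) = (\<integral>\<^sup>+z. (\<integral>\<^sup>+a. h z * ennreal (k a z) \<partial>nu \<alpha>) \<partial>nu \<alpha>)"
        by (rule P.Fubini'[OF mhk])
      \<comment> \<open>Once the dilation has been moved from \<open>a\<close> to \<open>z\<close>,
        the Forelli-Rudin estimate in \<open>a\<close> with exponent \<open>N + 1\<close> gives the
        power -1 of \<open>1 - |r z|^2\<close>. The factor \<open>1 - |z|^2\<close> compensates it,
        uniformly in \<open>r\<close>.\<close>
      also have "\<dots> \<le> (\<integral>\<^sup>+z. h z * ennreal D \<partial>nu \<alpha>)"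
      proof (rule nn_integral_nu_mono)
        fix z :: "complex^'n" assume z: "z \<in> ball 0 1"
        define x where "x = 1 - (norm z)\<^sup>2"
        have x: "x > 0" unfolding x_def by (rule one_minus_norm_sq_pos[OF z])
        have rz: "r *\<^sub>R z \<in> ball 0 1" using dilate_in_ball[OF z] r by simp
        have "(\<integral>\<^sup>+a. h z * ennreal (k a z) \<partial>nu \<alpha>) = (\<integral>\<^sup>+a. (h z * ennreal x) * ennreal (norm (1 - herm a (r *\<^sub>R z)) powr (- ?b)) \<partial>nu \<alpha>)"
          using x by (intro nn_integral_cong)
            (simp add: k_def x_def[symmetric] herm_scaleR_swap norm_one_minus_herm_commute[of "r *\<^sub>R z"] ennreal_mult' mult.assoc)
        also have "\<dots> = h z * ennreal x * (\<integral>\<^sup>+a. ennreal (norm (1 - herm a (r *\<^sub>R z)) powr (- ?b)) \<partial>nu \<alpha>)"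
          by (rule nn_integral_cmult) measurable
        also have "\<dots> \<le> h z * ennreal x * ennreal (D * (1 - (norm (r *\<^sub>R z))\<^sup>2) powr (real CARD('n) + 1 + \<alpha> - ?b))"
          by (intro mult_left_mono D rz) simp
        also have "\<dots> = h z * ennreal (x * (D * (1 - (norm (r *\<^sub>R z))\<^sup>2) powr (- 1)))"
        proof -
          have "real CARD('n) + 1 + \<alpha> - ?b = - 1" by simp
          thus ?thesis using ennreal_mult'[of x] x by (simp only: mult.assoc less_imp_le)
        qed
        also have "\<dots> \<le> h z * ennreal D"
        proof (intro mult_left_mono ennreal_leI)
          have le: "x \<le> 1 - (norm (r *\<^sub>R z))\<^sup>2" unfolding x_def using one_minus_norm_sq_dilate[OF z] r by simp
          hence "x * (1 - (norm (r *\<^sub>R z))\<^sup>2) powr (- 1) \<le> 1" using x by (simp add: powr_minus_divide)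
          hence "D * (x * (1 - (norm (r *\<^sub>R z))\<^sup>2) powr (- 1)) \<le> D * 1" using D by (intro mult_left_mono) auto
          thus "x * (D * (1 - (norm (r *\<^sub>R z))\<^sup>2) powr (- 1)) \<le> D" by (simp only: mult_ac mult_1_right)
        qed simp
        finally show "(\<integral>\<^sup>+a. h z * ennreal (k a z) \<partial>nu \<alpha>) \<le> h z * ennreal D" .
      qed
      also have "\<dots> = (\<integral>\<^sup>+z. h z \<partial>nu \<alpha>) * ennreal D" by (rule nn_integral_multc) measurable
      finally have "(\<integral>\<^sup>+a. g a \<partial>nu \<alpha>) \<le> ennreal C * ((\<integral>\<^sup>+z. h z \<partial>nu \<alpha>) * ennreal D)"
        by (simp add: mult_left_mono)
      also have "\<dots> = ennreal (C * D) * (\<integral>\<^sup>+z. h z \<partial>nu \<alpha>)" using C by (simp add: ennreal_mult' mult_ac)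
      also have "\<dots> \<le> ennreal E * (\<integral>\<^sup>+z. h z \<partial>nu \<alpha>)" by (intro mult_right_mono ennreal_leI E) simp
      finally show ?thesis .
    qed
    have 3: "(\<integral>\<^sup>+z. h z \<partial>nu \<alpha>) = (\<integral>\<^sup>+z. ennreal (\<Phi> (norm (f z))) * indicator {z. norm z > R} z \<partial>nu \<alpha>)"
      by (rule nn_integral_cong) (simp add: h_def)
    show ?thesis
      by (intro exI[of _ g] exI[of _ K] conjI ballI mg K 1 2[unfolded 3])
  qed
  thus ?thesis using E(1) that by blast
qed

text \<open>The dilates are not dominated by one integrable function. \<open>dilate_tail\<close>
  bounds the difference by \<open>g + H\<close>, where \<open>g\<close> depends on the dilation but
  has a uniformly small integral and \<open>H\<close> is fixed and integrable. Dominated convergence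
  is then applied to the minimum of the difference and \<open>H\<close>.\<close>

lemma dilates_converge:
  fixes f :: "complex^'n \<Rightarrow> complex"
  assumes \<alpha>: "\<alpha> > -1" and f: "f \<in> bergman_orlicz \<alpha> \<Phi>"
    and S: "\<And>i. 0 < S i" "\<And>i. S i < 1" "S \<longlonglongrightarrow> 1"
  shows "(\<lambda>i. \<integral>\<^sup>+z. ennreal (\<Phi> (norm (f (S i *\<^sub>R z) - f z))) \<partial>nu \<alpha>) \<longlonglongrightarrow> 0"
proof -
  let ?b = "real CARD('n) + 2 + \<alpha>"
  have fh: "f \<in> hol_ball" by (rule bergman_orliczD[OF f])
  have [measurable]: "f \<in> borel_measurable borel" by (rule borel_measurable_hol_ball[OF fh])
  obtain C where C: "C > 0"
    "\<And>(f::complex^'n \<Rightarrow> complex) r R. f \<in> bergman_orlicz \<alpha> \<Phi> \<Longrightarrow> 0 < r \<Longrightarrow> r < 1 \<Longrightarrow> R < 1 \<Longrightarrow>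
      \<exists>g K. g \<in> borel_measurable borel \<and>
        (\<forall>a\<in>ball 0 1. ennreal (\<Phi> (norm (f (r *\<^sub>R a)))) \<le> g a + ennreal (C * (1 - R) powr (- (real CARD('n) + 2 + \<alpha>)) * K)) \<and>
        (\<integral>\<^sup>+z. ennreal (\<Phi> (norm (f z))) \<partial>nu \<alpha>) = ennreal K \<and> K \<ge> 0 \<and>
        (\<integral>\<^sup>+a. g a \<partial>nu \<alpha>) \<le> ennreal C * (\<integral>\<^sup>+z. ennreal (\<Phi> (norm (f z))) * indicator {z. norm z > R} z \<partial>nu \<alpha>)"
    using dilate_tail[OF \<alpha>, where 'n = 'n] by blast
  obtain K where K: "(\<integral>\<^sup>+z. ennreal (\<Phi> (norm (f z))) \<partial>nu \<alpha>) = ennreal K" "K \<ge> 0"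
    using bergman_orliczD(2)[OF f] by (cases "(\<integral>\<^sup>+z. ennreal (\<Phi> (norm (f z))) \<partial>nu \<alpha>)") auto
  have tail: "(\<lambda>m. \<integral>\<^sup>+z. ennreal (\<Phi> (norm (f z))) * (if norm z > rseq m then 1 else 0) \<partial>nu \<alpha>) \<longlonglongrightarrow> (\<integral>\<^sup>+z. 0 \<partial>(nu \<alpha> :: (complex^'n) measure))"
  proof (rule nn_integral_dominated_convergence[where w = "\<lambda>z. ennreal (\<Phi> (norm (f z)))"])
    show "AE z in nu \<alpha>. (\<lambda>m. ennreal (\<Phi> (norm (f z))) * (if norm z > rseq m then 1 else 0)) \<longlonglongrightarrow> 0"
    proof (rule AE_nuI)
      fix z :: "complex^'n" assume "z \<in> ball 0 1"
      hence "eventually (\<lambda>m. norm z < rseq m) sequentially"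
        by (intro order_tendstoD(1)[OF rseq_tendsto]) simp
      hence "eventually (\<lambda>m. ennreal (\<Phi> (norm (f z))) * (if norm z > rseq m then 1 else 0) = 0) sequentially"
        by (rule eventually_mono) auto
      thus "(\<lambda>m. ennreal (\<Phi> (norm (f z))) * (if norm z > rseq m then 1 else 0)) \<longlonglongrightarrow> 0"
        by (rule tendsto_eventually)
    qed
  qed (use K in auto)
  show ?thesis
  proof (rule order_tendstoI)
    fix a :: ennreal assume "a < 0" thus "eventually (\<lambda>i. a < (\<integral>\<^sup>+z. ennreal (\<Phi> (norm (f (S i *\<^sub>R z) - f z))) \<partial>nu \<alpha>)) sequentially" by simp
  next
    fix a :: ennreal assume a: "0 < a"
    have "\<exists>e'>0. ennreal e' \<le> a"
    proof (cases a)
      case (real e')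
      thus ?thesis using a by (intro exI[of _ e']) auto
    next
      case top
      thus ?thesis by (intro exI[of _ 1]) auto
    qed
    then obtain e' where e': "0 < e'" "ennreal e' \<le> a" by blast
    define e where "e = e' / 2"
    have "ennreal e < ennreal e'" using e' by (simp add: e_def ennreal_lessI)
    hence e: "0 < e" "ennreal e < a" using e' by (auto simp: e_def)
    define t where "t = e / (2 * (C + 1))"
    have t: "t > 0" using e C by (simp add: t_def)
    have "eventually (\<lambda>m. (\<integral>\<^sup>+z. ennreal (\<Phi> (norm (f z))) * (if norm z > rseq m then 1 else 0) \<partial>nu \<alpha>) < ennreal t) sequentially"
      using order_tendstoD(2)[OF tail, of "ennreal t"] t by simp
    then obtain m where m: "(\<integral>\<^sup>+z. ennreal (\<Phi> (norm (f z))) * (if norm z > rseq m then 1 else 0) \<partial>nu \<alpha>) < ennreal t"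
      by (auto simp: eventually_sequentially)
    define Q where "Q = C * (1 - rseq m) powr (- ?b) * K"
    have Q: "Q \<ge> 0" using C K by (simp add: Q_def)
    define H where "H = (\<lambda>z. ennreal (Q + \<Phi> (norm (f z))))"
    have [measurable]: "H \<in> borel_measurable borel" unfolding H_def by measurable
    have Hfin: "(\<integral>\<^sup>+z. H z \<partial>nu \<alpha>) < \<infinity>"
    proof -
      have "(\<integral>\<^sup>+z. H z \<partial>nu \<alpha>) = (\<integral>\<^sup>+z. ennreal Q + ennreal (\<Phi> (norm (f z))) \<partial>nu \<alpha>)"
        unfolding H_def using Q by (simp add: Phi_nonneg)
      also have "\<dots> = ennreal Q + ennreal K"
        by (subst nn_integral_add) (simp_all add: K emeasure_nu_UNIV[OF \<alpha>])
      finally show ?thesis by simp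
    qed
    define D where "D = (\<lambda>i z. ennreal (\<Phi> (norm (f (S i *\<^sub>R z) - f z))))"
    have [measurable]: "D i \<in> borel_measurable borel" for i unfolding D_def by measurable
    have "(\<lambda>i. \<integral>\<^sup>+z. min (D i z) (H z) \<partial>nu \<alpha>) \<longlonglongrightarrow> (\<integral>\<^sup>+z. 0 \<partial>(nu \<alpha> :: (complex^'n) measure))"
    proof (rule nn_integral_dominated_convergence[where w = H])
      show "AE z in nu \<alpha>. (\<lambda>i. min (D i z) (H z)) \<longlonglongrightarrow> 0"
      proof (rule AE_nuI)
        fix z :: "complex^'n" assume z: "z \<in> ball 0 1"
        have "(\<lambda>i. f (S i *\<^sub>R z) - f z) \<longlonglongrightarrow> f z - f z"
          by (intro tendsto_diff tendsto_dilate_hol_ball[OF fh z S(3)] tendsto_const)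
        hence "(\<lambda>i. \<Phi> (norm (f (S i *\<^sub>R z) - f z))) \<longlonglongrightarrow> \<Phi> (norm (f z - f z))" by (rule tendsto_Phi_norm)
        hence "(\<lambda>i. D i z) \<longlonglongrightarrow> ennreal 0" unfolding D_def by (intro tendsto_ennrealI) simp
        hence "(\<lambda>i. min (D i z) (H z)) \<longlonglongrightarrow> min (ennreal 0) (H z)" by (intro tendsto_min tendsto_const)
        thus "(\<lambda>i. min (D i z) (H z)) \<longlonglongrightarrow> 0" by simp
      qed
    qed (use Hfin in auto)
    hence "eventually (\<lambda>i. (\<integral>\<^sup>+z. min (D i z) (H z) \<partial>nu \<alpha>) < ennreal (e / 2)) sequentially"
      using e by (intro order_tendstoD) auto
    thus "eventually (\<lambda>i. (\<integral>\<^sup>+z. ennreal (\<Phi> (norm (f (S i *\<^sub>R z) - f z))) \<partial>nu \<alpha>) < a) sequentially"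
    proof (rule eventually_mono)
      fix i assume i: "(\<integral>\<^sup>+z. min (D i z) (H z) \<partial>nu \<alpha>) < ennreal (e / 2)"
      obtain g K' where g: "g \<in> borel_measurable borel"
        "\<forall>a\<in>ball 0 1. ennreal (\<Phi> (norm (f (S i *\<^sub>R a)))) \<le> g a + ennreal (C * (1 - rseq m) powr (- ?b) * K')"
        "ennreal K = ennreal K'" "K' \<ge> 0"
        "(\<integral>\<^sup>+a. g a \<partial>nu \<alpha>) \<le> ennreal C * (\<integral>\<^sup>+z. ennreal (\<Phi> (norm (f z))) * indicator {z. norm z > rseq m} z \<partial>nu \<alpha>)"
        using C(2)[OF f S(1)[of i] S(2)[of i] rseq(2)[of m]] unfolding K(1) by blast
      note [measurable] = g(1)
      have "K' = K" using g K by simp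
      have "(\<integral>\<^sup>+z. D i z \<partial>nu \<alpha>) \<le> (\<integral>\<^sup>+z. g z + min (D i z) (H z) \<partial>nu \<alpha>)"
      proof (rule nn_integral_nu_mono)
        fix z :: "complex^'n" assume z: "z \<in> ball 0 1"
        have "D i z \<le> ennreal (\<Phi> (norm (f (S i *\<^sub>R z)) + norm (f z)))"
          unfolding D_def by (intro ennreal_leI Phi_mono norm_triangle_ineq4) simp
        also have "\<dots> \<le> ennreal (\<Phi> (norm (f (S i *\<^sub>R z))) + \<Phi> (norm (f z)))"
          by (intro ennreal_leI Phi_add) auto
        also have "\<dots> = ennreal (\<Phi> (norm (f (S i *\<^sub>R z)))) + ennreal (\<Phi> (norm (f z)))"
          by (simp add: Phi_nonneg)
        also have "\<dots> \<le> (g z + ennreal Q) + ennreal (\<Phi> (norm (f z)))"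
          using g(2) z unfolding \<open>K' = K\<close> Q_def by (intro add_right_mono) auto
        also have "\<dots> = g z + H z" using Q by (simp add: H_def Phi_nonneg add.assoc)
        finally have le: "D i z \<le> g z + H z" .
        show "D i z \<le> g z + min (D i z) (H z)"
          using le by (cases "D i z \<le> H z") (auto simp: min_def add_increasing)
      qed
      also have "\<dots> = (\<integral>\<^sup>+z. g z \<partial>nu \<alpha>) + (\<integral>\<^sup>+z. min (D i z) (H z) \<partial>nu \<alpha>)"
        by (rule nn_integral_add) measurable
      also have "\<dots> \<le> ennreal (e / 2) + ennreal (e / 2)"
      proof -
        have "(\<integral>\<^sup>+z. ennreal (\<Phi> (norm (f z))) * indicator {z. norm z > rseq m} z \<partial>nu \<alpha>)
          = (\<integral>\<^sup>+z. ennreal (\<Phi> (norm (f z))) * (if norm z > rseq m then 1 else 0) \<partial>nu \<alpha>)"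
          by (rule nn_integral_cong) simp
        hence "(\<integral>\<^sup>+z. g z \<partial>nu \<alpha>) \<le> ennreal C * ennreal t"
          using g(5) m by (simp add: order_trans[OF _ mult_left_mono] less_imp_le)
        also have "\<dots> = ennreal (C * t)" using C by (simp add: ennreal_mult')
        also have "\<dots> \<le> ennreal (e / 2)"
          using C e by (intro ennreal_leI) (simp add: t_def divide_simps)
        finally have "(\<integral>\<^sup>+z. g z \<partial>nu \<alpha>) \<le> ennreal (e / 2)" .
        thus ?thesis using i by (intro add_mono) auto
      qed
      also have "\<dots> = ennreal e" using e by (subst ennreal_plus[symmetric]) auto
      finally show "(\<integral>\<^sup>+z. ennreal (\<Phi> (norm (f (S i *\<^sub>R z) - f z))) \<partial>nu \<alpha>) < a"
        using e(2) by (simp add: D_def)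
    qed
  qed
qed

end

section \<open>Integration along rays\<close>

lemma vector_derivative_along_ray:
  assumes hol: "holomorphic_Cn_on h (ball 0 1)" and t: "t > 0" and tz: "t *\<^sub>R z \<in> ball 0 1"
  shows "((\<lambda>t. h (t *\<^sub>R z)) has_vector_derivative (radial_deriv h (t *\<^sub>R z) / of_real t)) (at t)"
proof -
  obtain D where D: "(h has_derivative D) (at (t *\<^sub>R z))" "\<And>c v. D (c *s v) = c * D v"
    using hol tz unfolding holomorphic_Cn_on_def by meson
  have lin: "D (r *\<^sub>R v) = of_real r * D v" for r v by (simp add: scaleR_eq_vscale D(2))
  have "((\<lambda>t. t *\<^sub>R z) has_derivative (\<lambda>s. s *\<^sub>R z)) (at t)" by (auto intro!: derivative_eq_intros)
  from has_derivative_compose[OF this D(1)]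
  have "((\<lambda>t. h (t *\<^sub>R z)) has_vector_derivative D z) (at t)"
    unfolding has_vector_derivative_def lin scaleR_conv_of_real[where 'a = complex] .
  moreover have "radial_deriv h (t *\<^sub>R z) = of_real t * D z" using radial_deriv_eq[OF D] by (simp add: lin)
  ultimately show ?thesis using t by simp
qed

text \<open>The derivative along the ray is \<open>radial_deriv h\<close> divided by
  \<open>t\<close>. Starting at \<open>1 / 2\<close> keeps this division harmless, at the price of
  the factor 2; the value at the starting point is left to compactness.\<close>

lemma norm_diff_along_ray:
  assumes hol: "holomorphic_Cn_on h (ball 0 1)" and z: "z \<in> ball 0 1"
    and \<phi>: "\<And>t. 1 / 2 \<le> t \<Longrightarrow> t \<le> 1 \<Longrightarrow> (\<phi> has_real_derivative \<phi>' t) (at t)"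
    and b: "\<And>t. 1 / 2 \<le> t \<Longrightarrow> t \<le> 1 \<Longrightarrow> 2 * norm (radial_deriv h (t *\<^sub>R z)) \<le> \<phi>' t"
  shows "norm (h z) \<le> norm (h ((1 / 2) *\<^sub>R z)) + (\<phi> 1 - \<phi> (1 / 2))"
proof -
  have tz: "t *\<^sub>R z \<in> ball 0 1" if "1 / 2 \<le> t" "t \<le> 1" for t
    using dilate_in_ball[OF z, of t] that by simp
  have d: "((\<lambda>t. h (t *\<^sub>R z)) has_vector_derivative (radial_deriv h (t *\<^sub>R z) / of_real t)) (at t)"
    if "1 / 2 \<le> t" "t \<le> 1" for t
    using vector_derivative_along_ray[OF hol _ tz] that by simp
  have "norm (h (1 *\<^sub>R z) - h ((1 / 2) *\<^sub>R z)) \<le> \<phi> 1 - \<phi> (1 / 2)"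
  proof (rule differentiable_bound_general[where f' = "\<lambda>t. radial_deriv h (t *\<^sub>R z) / of_real t" and \<phi>' = \<phi>'])
    show "continuous_on {1 / 2..1} (\<lambda>t. h (t *\<^sub>R z))"
      by (intro continuous_at_imp_continuous_on ballI has_vector_derivative_continuous[OF d]) auto
    show "continuous_on {1 / 2..1} \<phi>"
      by (intro continuous_at_imp_continuous_on ballI DERIV_isCont[OF \<phi>]) auto
    fix t :: real assume t: "1 / 2 < t" "t < 1"
    show "((\<lambda>t. h (t *\<^sub>R z)) has_vector_derivative (radial_deriv h (t *\<^sub>R z) / of_real t)) (at t)"
      using d t by simp
    show "(\<phi> has_vector_derivative \<phi>' t) (at t)"
      using \<phi>[of t] t by (simp add: has_real_derivative_iff_has_vector_derivative)
    have "norm (radial_deriv h (t *\<^sub>R z)) / t \<le> norm (radial_deriv h (t *\<^sub>R z)) / (1 / 2)"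
      using t by (intro divide_left_mono) auto
    also have "\<dots> \<le> \<phi>' t" using b[of t] t by simp
    finally show "norm (radial_deriv h (t *\<^sub>R z) / of_real t) \<le> \<phi>' t" using t by (simp add: norm_divide)
  qed simp
  thus ?thesis using norm_triangle_ineq2[of "h z" "h ((1 / 2) *\<^sub>R z)"] by simp
qed

lemma bounded_on_half_ball:
  assumes "holomorphic_Cn_on h (ball 0 1)"
  obtains M where "M \<ge> 0" "\<And>z. norm (z::complex^'n) \<le> 1 / 2 \<Longrightarrow> norm (h z) \<le> M"
proof -
  have "continuous_on (cball 0 (1 / 2)) h"
    by (rule holomorphic_Cn_on_imp_continuous_on[OF holomorphic_Cn_on_subset[OF assms]]) auto
  hence "compact (h ` cball 0 (1 / 2))" by (intro compact_continuous_image) auto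
  hence "bounded (h ` cball 0 (1 / 2))" by (rule compact_imp_bounded)
  then obtain B where B: "\<forall>z\<in>cball 0 (1 / 2). norm (h z) \<le> B" by (auto simp: bounded_iff)
  have "B \<ge> 0" using order_trans[OF norm_ge_zero, of "h 0" B] B by auto
  thus ?thesis using that[of B] B by simp
qed

text \<open>\<phi> is a primitive of the majorant
  \<open>2 * B * (1 - t * norm z) powr (- s)\<close>, and integrating it gains one power because
  \<open>s > 1\<close>.\<close>

lemma growth_of_radial_primitive:
  fixes h :: "complex^'n \<Rightarrow> complex"
  assumes hol: "holomorphic_Cn_on h (ball 0 1)" and s: "s > 1"
    and B: "\<And>z. z \<in> ball 0 1 \<Longrightarrow> norm (radial_deriv h z) \<le> B * (1 - (norm z)\<^sup>2) powr (- s)"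
  obtains B' where "\<And>z. z \<in> ball 0 1 \<Longrightarrow> norm (h z) \<le> B' * (1 - (norm z)\<^sup>2) powr (- (s - 1))"
proof -
  obtain M where M: "M \<ge> 0" "\<And>z. norm z \<le> 1 / 2 \<Longrightarrow> norm (h z) \<le> M"
    using bounded_on_half_ball[OF hol] by blast
  have B0: "B \<ge> 0" using order_trans[OF norm_ge_zero B[of 0]] by simp
  define B' where "B' = M + 4 * B / (s - 1) * 2 powr (s - 1)"
  have B': "M \<le> B'" using B0 s by (simp add: B'_def)
  have "norm (h z) \<le> B' * (1 - (norm z)\<^sup>2) powr (- (s - 1))" if z: "z \<in> ball 0 1" for z
  proof -
    define x where "x = 1 - (norm z)\<^sup>2"
    have x: "0 < x" "x \<le> 1" unfolding x_def using one_minus_norm_sq_pos[OF z] by auto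
    have x1: "1 \<le> x powr (- (s - 1))" using powr_mono2'[of "- (s - 1)" x 1] x s by simp
    show ?thesis
    proof (cases "norm z \<le> 1 / 2")
      case True
      have "norm (h z) \<le> M * 1" using M(2)[OF True] by simp
      also have "\<dots> \<le> B' * x powr (- (s - 1))" using M B' x1 by (intro mult_mono) auto
      finally show ?thesis by (simp add: x_def)
    next
      case False
      define n where "n = norm z"
      have n: "1 / 2 < n" "n < 1" using False z by (auto simp: n_def)
      define \<phi> where "\<phi> = (\<lambda>t. 2 * B / ((s - 1) * n) * (1 - t * n) powr (1 - s))"
      have tn: "t * n < 1" if "1 / 2 \<le> t" "t \<le> 1" for t
        using mult_right_mono[of t 1 n] that n by linarith
      have "norm (h z) \<le> norm (h ((1 / 2) *\<^sub>R z)) + (\<phi> 1 - \<phi> (1 / 2))"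
      proof (rule norm_diff_along_ray[OF hol z, where \<phi>' = "\<lambda>t. 2 * B * (1 - t * n) powr (- s)"])
        fix t :: real assume t: "1 / 2 \<le> t" "t \<le> 1"
        have "(\<phi> has_real_derivative (2 * B / ((s - 1) * n) * ((1 - s) * (1 - t * n) powr (1 - s - 1) * (- n)))) (at t)"
          unfolding \<phi>_def using tn[OF t] n s by (auto intro!: derivative_eq_intros)
        also have "2 * B / ((s - 1) * n) * ((1 - s) * (1 - t * n) powr (1 - s - 1) * (- n)) = 2 * B * (1 - t * n) powr (- s)"
        proof -
          have "2 * B / ((s - 1) * n) * ((1 - s) * P * (- n)) = 2 * B * P" for P
            using s n by (simp add: field_simps)
          thus ?thesis by simp
        qed
        finally show "(\<phi> has_real_derivative 2 * B * (1 - t * n) powr (- s)) (at t)" .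
        have tz: "t *\<^sub>R z \<in> ball 0 1" using dilate_in_ball[OF z, of t] t by simp
        have "1 - t * n \<le> 1 - (norm (t *\<^sub>R z))\<^sup>2"
          using tn[OF t] t n power_le_one[of "t * n" 1] mult_left_le[of "t * n" "t * n"]
          by (simp add: n_def[symmetric] power2_eq_square)
        hence "(1 - (norm (t *\<^sub>R z))\<^sup>2) powr (- s) \<le> (1 - t * n) powr (- s)"
          using tn[OF t] s by (intro powr_mono2') auto
        hence "B * (1 - (norm (t *\<^sub>R z))\<^sup>2) powr (- s) \<le> B * (1 - t * n) powr (- s)" by (rule mult_left_mono[OF _ B0])
        thus "2 * norm (radial_deriv h (t *\<^sub>R z)) \<le> 2 * B * (1 - t * n) powr (- s)"
          using B[OF tz] by simp
      qed
      also have "norm (h ((1 / 2) *\<^sub>R z)) \<le> M" using z by (intro M) simp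
      also have "\<phi> 1 - \<phi> (1 / 2) \<le> \<phi> 1" using B0 s n by (simp add: \<phi>_def)
      also have "\<phi> 1 \<le> 4 * B / (s - 1) * 2 powr (s - 1) * x powr (- (s - 1))"
      proof -
        have "x = (1 - n) * (1 + n)" by (simp add: x_def n_def power2_eq_square algebra_simps)
        also have "\<dots> \<le> (1 - n) * 2" using n by (intro mult_left_mono) auto
        finally have "x / 2 \<le> 1 - n" by simp
        hence "(1 - n) powr (1 - s) \<le> (x / 2) powr (1 - s)" using x s by (intro powr_mono2') auto
        also have "\<dots> = 2 powr (s - 1) * x powr (- (s - 1))"
        proof -
          have "2 powr (1 - s) = inverse (2 powr (s - 1))" using powr_minus[of 2 "s - 1"] by simp
          hence "inverse (2 powr (1 - s)) = 2 powr (s - 1)" by (simp only: inverse_inverse_eq)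
          moreover have "- (s - 1) = 1 - s" by simp
          ultimately show ?thesis
            using powr_divide[of x 2 "1 - s"] by (simp only: divide_inverse mult.commute)
        qed
        finally have 1: "(1 - n) powr (1 - s) \<le> 2 powr (s - 1) * x powr (- (s - 1))" .
        have "2 * B / ((s - 1) * n) \<le> 2 * B / ((s - 1) * (1 / 2))"
          using B0 s n by (intro divide_left_mono mult_left_mono) auto
        hence "2 * B / ((s - 1) * n) \<le> 4 * B / (s - 1)" by simp
        hence "\<phi> 1 \<le> 4 * B / (s - 1) * (2 powr (s - 1) * x powr (- (s - 1)))"
          unfolding \<phi>_def mult_1 using B0 s by (intro mult_mono 1) auto
        thus ?thesis by (simp only: mult.assoc)
      qed
      also have "M \<le> M * x powr (- (s - 1))" using M x1 by (simp add: mult_le_cancel_left1)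
      finally show ?thesis by (simp add: B'_def x_def distrib_right)
    qed
  qed
  thus ?thesis using that by blast
qed

text \<open>In contrast to \<open>growth_of_radial_primitive\<close> the weight is kept: as
  \<open>W\<close> is almost decreasing, the derivative along the whole segment is bounded by the
  weight at its end point. This brings a bound for \<open>R^k g\<close> down to the lower
  derivatives.\<close>

lemma weighted_bound_of_radial_primitive:
  fixes h :: "complex^'n \<Rightarrow> complex"
  assumes hol: "holomorphic_Cn_on h (ball 0 1)"
    and W: "\<And>x. 0 < x \<Longrightarrow> W x > 0" "\<And>x x'. 0 < x \<Longrightarrow> x \<le> x' \<Longrightarrow> x' \<le> 1 \<Longrightarrow> W x' \<le> c * W x"
    and B: "\<And>z. z \<in> ball 0 1 \<Longrightarrow> norm (radial_deriv h z) \<le> B * W (1 - (norm z)\<^sup>2)"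
  obtains B' where "\<And>z. z \<in> ball 0 1 \<Longrightarrow> norm (h z) \<le> B' * W (1 - (norm z)\<^sup>2)"
proof -
  obtain M where M: "M \<ge> 0" "\<And>z. norm z \<le> 1 / 2 \<Longrightarrow> norm (h z) \<le> M"
    using bounded_on_half_ball[OF hol] by blast
  have B0: "B \<ge> 0" using order_trans[OF norm_ge_zero B[of 0]] W(1)[of 1] by (simp add: zero_le_mult_iff)
  have "norm (h z) \<le> (M * c / W 1 + B * c) * W (1 - (norm z)\<^sup>2)" if z: "z \<in> ball 0 1" for z
  proof -
    define x where "x = 1 - (norm z)\<^sup>2"
    have x: "0 < x" "x \<le> 1" unfolding x_def using one_minus_norm_sq_pos[OF z] by auto
    define b where "b = B * (c * W x)"
    have "norm (h z) \<le> norm (h ((1 / 2) *\<^sub>R z)) + ((2 * b) * 1 - (2 * b) * (1 / 2))"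
    proof (rule norm_diff_along_ray[OF hol z, where \<phi>' = "\<lambda>t. 2 * b"])
      fix t :: real assume t: "1 / 2 \<le> t" "t \<le> 1"
      show "((*) (2 * b) has_real_derivative 2 * b) (at t)" by (auto intro!: derivative_eq_intros)
      have tz: "t *\<^sub>R z \<in> ball 0 1" using dilate_in_ball[OF z, of t] t by simp
      have "x \<le> 1 - (norm (t *\<^sub>R z))\<^sup>2" unfolding x_def using one_minus_norm_sq_dilate[OF z, of t] t by simp
      hence "W (1 - (norm (t *\<^sub>R z))\<^sup>2) \<le> c * W x" by (rule W(2)[OF x(1)]) (rule one_minus_norm_sq_le)
      hence "B * W (1 - (norm (t *\<^sub>R z))\<^sup>2) \<le> b" unfolding b_def by (rule mult_left_mono[OF _ B0])
      thus "2 * norm (radial_deriv h (t *\<^sub>R z)) \<le> 2 * b" using B[OF tz] by simp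
    qed
    also have "norm (h ((1 / 2) *\<^sub>R z)) \<le> M" using z by (intro M) simp
    also have "M \<le> M * (c * W x / W 1)"
    proof -
      have "1 \<le> c * W x / W 1" using W(2)[OF x(1,2)] W(1)[of 1] by (simp add: divide_simps)
      from mult_left_mono[OF this M(1)] show ?thesis by simp
    qed
    finally show ?thesis by (simp add: b_def x_def algebra_simps)
  qed
  thus ?thesis using that by blast
qed

lemma dilate_bounded_hol:
  assumes f: "f \<in> hol_ball" and r: "0 < r" "r < 1"
  shows "cut_ball (\<lambda>z::complex^'n. f (r *\<^sub>R z)) \<in> bounded_hol"
proof -
  note h = holomorphic_dilate_ball[OF hol_ballD[OF f] r]
  obtain B where B: "\<And>z. norm z \<le> 1 \<Longrightarrow> norm (f (r *\<^sub>R z)) \<le> B"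
    using bounded_on_cball[OF h] by blast
  show ?thesis
    by (rule bounded_hol_cutI[OF holomorphic_Cn_on_subset[OF h(1)], of B]) (use B h(2) in auto)
qed

section \<open>The weight \<open>\<rho>\<close> and the Luxemburg norm\<close>

context growth_fn
begin

lemma rho_of_powr:
  assumes "x > 0"
  shows "rho_of \<Phi> (x powr N) = x powr (- N) / q (x powr (- N))"
  using assms by (simp add: rho_of_def q_def powr_minus_divide)

text \<open>The ratio inequality between \<open>q 1\<close> and \<open>q y\<close> gives
  \<open>q 1 * y \<le> q y\<close> for \<open>y \<ge> 1\<close>: the inverse of \<Phi> grows at
  least linearly.\<close>

lemma rho_bounded:
  assumes "0 < x" "x \<le> 1" "N > 0"
  shows "0 < rho_of \<Phi> (x powr N)" "rho_of \<Phi> (x powr N) \<le> 1 / q 1"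
proof -
  define y where "y = x powr (- N)"
  have y: "y \<ge> 1" using powr_mono2'[of "- N" x 1] assms by (simp add: y_def)
  have q: "q 1 > 0" "q 1 \<le> q y" "q y > 0" using y by (auto intro: q_pos q_mono)
  have "q 1 * y \<le> q y * 1"
    using Phi_ratio[of "q 1" "q y"] q y by (simp add: Phi_q)
  hence "y / q y \<le> 1 / q 1" using q by (simp add: divide_simps mult.commute)
  thus "rho_of \<Phi> (x powr N) \<le> 1 / q 1" using assms by (simp add: rho_of_powr y_def)
  show "0 < rho_of \<Phi> (x powr N)" using assms q y by (simp add: rho_of_powr y_def[symmetric])
qed

text \<open>The upper type of \<rho> in multiplicative form. \<open>q_scale\<close> with
  \<open>\<tau> = (x' / x) powr N\<close> leaves the exponent \<open>N / p - k - N\<close> on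
  \<open>x' / x\<close>, and the condition on \<open>k\<close> makes it negative.\<close>

lemma weight_almost_decreasing:
  assumes N: "N > 0" and k: "k > (1 / p - 1) * N" and x: "0 < x" "x \<le> x'"
  shows "x' powr (- k) * rho_of \<Phi> (x' powr N) \<le> L powr (1 / p) * (x powr (- k) * rho_of \<Phi> (x powr N))"
proof -
  have x': "x' > 0" using x by simp
  define \<tau> where "\<tau> = (x' / x) powr N"
  have t: "1 \<le> \<tau>" using x N by (simp add: \<tau>_def ge_one_powr_ge_zero)
  have e: "x powr (- N) = \<tau> * x' powr (- N)"
    using x x' by (simp add: \<tau>_def powr_divide powr_minus field_simps)
  have q: "q (x powr (- N)) > 0" "q (x' powr (- N)) > 0" using x x' by (auto intro!: q_pos)
  have "q (x powr (- N)) \<le> (L * \<tau>) powr (1 / p) * q (x' powr (- N))"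
    unfolding e using x' t by (intro q_scale) auto
  also have "(L * \<tau>) powr (1 / p) = L powr (1 / p) * (x' / x) powr (N / p)"
    using L t by (simp add: powr_mult \<tau>_def powr_powr)
  finally have "1 / q (x' powr (- N)) \<le> L powr (1 / p) * (x' / x) powr (N / p) / q (x powr (- N))"
    using q by (simp add: divide_simps mult_ac)
  hence "x' powr (- k - N) * (1 / q (x' powr (- N))) \<le> x' powr (- k - N) * (L powr (1 / p) * (x' / x) powr (N / p) / q (x powr (- N)))"
    by (rule mult_left_mono) simp
  also have "\<dots> = L powr (1 / p) * ((x' / x) powr (N / p - k - N) * x powr (- k - N)) / q (x powr (- N))"
  proof -
    have "(x' / x) powr (N / p - k - N) = (x' / x) powr (N / p) * (x' / x) powr (- k - N)"
      by (simp add: powr_add[symmetric] add_diff_eq)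
    moreover have "(x' / x) powr (- k - N) * x powr (- k - N) = x' powr (- k - N)"
      using x x' by (simp add: powr_mult[symmetric])
    ultimately show ?thesis by (simp add: mult_ac)
  qed
  also have "\<dots> \<le> L powr (1 / p) * (1 * x powr (- k - N)) / q (x powr (- N))"
  proof -
    have "N / p - k - N \<le> 0" using k by (simp add: algebra_simps)
    hence "(x' / x) powr (N / p - k - N) \<le> 1"
      using x powr_mono2'[of "N / p - k - N" 1 "x' / x"] by simp
    thus ?thesis using q by (intro divide_right_mono mult_left_mono mult_right_mono) auto
  qed
  finally show ?thesis using x x' by (simp add: rho_of_powr powr_diff powr_minus divide_inverse mult_ac)
qed

text \<open>Let \<open>y = (1 - |z|^2) powr (- N)\<close>. The pointwise bound gives
  \<open>|f| / l \<le> Q * q y\<close>, and then the ratio inequality gives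
  \<open>(|f| / l) * y \<le> Q * q y * \<Phi> (|f| / l)\<close>. The weight in question is
  \<open>y / q y\<close>.\<close>

lemma orlicz_weighted_L1_bound:
  assumes \<alpha>: "\<alpha> > -1"
  obtains C where "C > 0"
    "\<And>(f::complex^'n \<Rightarrow> complex) l. f \<in> hol_ball \<Longrightarrow> l > 0 \<Longrightarrow> (\<integral>\<^sup>+z. ennreal (\<Phi> (norm (f z) / l)) \<partial>nu \<alpha>) \<le> 1 \<Longrightarrow>
      (\<integral>\<^sup>+z. ennreal (norm (f z) * rho_of \<Phi> ((1 - (norm z)\<^sup>2) powr (real CARD('n) + 1 + \<alpha>))) \<partial>nu \<alpha>) \<le> ennreal (C * l)"
proof -
  let ?N = "real CARD('n) + 1 + \<alpha>"
  have N: "?N > 0" using \<alpha> by (simp add: add_pos_nonneg)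
  obtain C where C: "C > 0" "\<And>(f::complex^'n \<Rightarrow> complex) a. f \<in> hol_ball \<Longrightarrow> a \<in> ball 0 1 \<Longrightarrow>
      ennreal (\<Phi> (norm (f a))) \<le> ennreal (C * (1 - (norm a)\<^sup>2) powr (- ?N)) * (\<integral>\<^sup>+z. ennreal (\<Phi> (norm (f z))) \<partial>nu \<alpha>)"
    using pointwise_bound[OF \<alpha>, where 'n = 'n] by blast
  \<comment> \<open>\<open>C + 1\<close> in place of \<open>C\<close> gives the strict inequality
    that \<open>less_qI\<close> needs and a factor of at least 1 for \<open>q_scale\<close>.\<close>
  define Q where "Q = (L * (C + 1)) powr (1 / p)"
  have "1 * 1 \<le> L * (C + 1)" using L C by (intro mult_mono) auto
  hence Q: "Q \<ge> 1" using p by (simp add: Q_def ge_one_powr_ge_zero)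
  have "(\<integral>\<^sup>+z. ennreal (norm (f z) * rho_of \<Phi> ((1 - (norm z)\<^sup>2) powr ?N)) \<partial>nu \<alpha>) \<le> ennreal (Q * l)"
    if f: "f \<in> hol_ball" and l: "l > 0" and le1: "(\<integral>\<^sup>+z. ennreal (\<Phi> (norm (f z) / l)) \<partial>nu \<alpha>) \<le> 1"
    for f :: "complex^'n \<Rightarrow> complex" and l
  proof -
    define g where "g = (\<lambda>z. of_real (1 / l) * f z)"
    have g: "g \<in> hol_ball" unfolding g_def by (rule hol_ball_cmult[OF f])
    have [measurable]: "g \<in> borel_measurable borel" by (rule borel_measurable_hol_ball[OF g])
    have ng: "norm (g z) = norm (f z) / l" for z using l by (simp add: g_def norm_divide)
    have "norm (f z) * rho_of \<Phi> ((1 - (norm z)\<^sup>2) powr ?N) \<le> Q * l * \<Phi> (norm (g z))" if z: "z \<in> ball 0 1" for z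
    proof -
      define x where "x = 1 - (norm z)\<^sup>2"
      have x: "0 < x" unfolding x_def by (rule one_minus_norm_sq_pos[OF z])
      define y where "y = x powr (- ?N)"
      have y: "y > 0" using x by (simp add: y_def)
      have "ennreal (\<Phi> (norm (g z))) \<le> ennreal (C * y) * (\<integral>\<^sup>+z. ennreal (\<Phi> (norm (f z) / l)) \<partial>nu \<alpha>)"
        using C(2)[OF g z] by (simp add: ng y_def x_def)
      also have "\<dots> \<le> ennreal (C * y) * 1" by (intro mult_left_mono le1) simp
      finally have "\<Phi> (norm (g z)) \<le> C * y" using C y by simp
      also have "\<dots> < (C + 1) * y" using y by simp
      finally have "norm (g z) < q ((C + 1) * y)" using C y by (intro less_qI) auto
      also have "\<dots> \<le> Q * q y" unfolding Q_def using C y by (intro q_scale) auto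
      finally have "norm (g z) \<le> Q * q y" by simp
      hence "norm (g z) * \<Phi> (Q * q y) \<le> Q * q y * \<Phi> (norm (g z))" by (intro Phi_ratio) auto
      moreover have "norm (g z) * y \<le> norm (g z) * \<Phi> (Q * q y)"
        using Phi_mono[of "q y" "Q * q y"] Phi_q[of y] q_pos[OF y] Q y by (intro mult_left_mono) auto
      ultimately have "norm (g z) * (y / q y) \<le> Q * \<Phi> (norm (g z))"
        using q_pos[OF y] by (simp add: divide_simps mult_ac)
      hence "l * (norm (g z) * (y / q y)) \<le> l * (Q * \<Phi> (norm (g z)))" using l by (intro mult_left_mono) auto
      moreover have "norm (f z) = l * norm (g z)" using l by (simp add: ng)
      ultimately show ?thesis unfolding x_def[symmetric] rho_of_powr[OF x] y_def[symmetric] by (simp only: mult_ac)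
    qed
    hence "(\<integral>\<^sup>+z. ennreal (norm (f z) * rho_of \<Phi> ((1 - (norm z)\<^sup>2) powr ?N)) \<partial>nu \<alpha>)
      \<le> (\<integral>\<^sup>+z. ennreal (Q * l) * ennreal (\<Phi> (norm (g z))) \<partial>nu \<alpha>)"
      using Q l by (intro nn_integral_nu_mono) (subst ennreal_mult'[symmetric], auto intro!: ennreal_leI)
    also have "\<dots> = ennreal (Q * l) * (\<integral>\<^sup>+z. ennreal (\<Phi> (norm (g z))) \<partial>nu \<alpha>)"
      by (rule nn_integral_cmult) measurable
    also have "\<dots> \<le> ennreal (Q * l) * 1" unfolding ng by (intro mult_left_mono le1) simp
    finally show ?thesis by simp
  qed
  moreover have "Q > 0" using Q by simp
  ultimately show ?thesis using that by blast
qed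

section \<open>The Luxemburg norm and the linear structure of the space\<close>

lemma lux_norm_leI: "l > 0 \<Longrightarrow> (\<integral>\<^sup>+z. ennreal (\<Phi> (norm (f z) / l)) \<partial>nu \<alpha>) \<le> 1 \<Longrightarrow> lux_norm \<alpha> \<Phi> f \<le> l"
  unfolding lux_norm_def by (rule cInf_lower) (auto intro: bdd_belowI[of _ 0])

lemma lux_norm_witness:
  assumes f: "f \<in> bergman_orlicz \<alpha> \<Phi>"
  shows "\<exists>l>0. (\<integral>\<^sup>+z. ennreal (\<Phi> (norm (f z) / l)) \<partial>nu \<alpha>) \<le> 1"
proof -
  have [measurable]: "f \<in> borel_measurable borel" by (rule borel_measurable_hol_ball[OF bergman_orliczD(1)[OF f]])
  obtain K where K: "(\<integral>\<^sup>+z. ennreal (\<Phi> (norm (f z))) \<partial>nu \<alpha>) = ennreal K" "K \<ge> 0"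
    using bergman_orliczD(2)[OF f] by (cases "(\<integral>\<^sup>+z. ennreal (\<Phi> (norm (f z))) \<partial>nu \<alpha>)") auto
  \<comment> \<open>Chosen so that \<open>l powr p = L * (K + 1)\<close>: lower type then divides
    the integral by \<open>K + 1\<close>. Adding 1 also ensures \<open>l \<ge> 1\<close>.\<close>
  define l where "l = (L * (K + 1)) powr (1 / p)"
  have "1 * 1 \<le> L * (K + 1)" using L K by (intro mult_mono) auto
  hence l1: "L * (K + 1) \<ge> 1" by simp
  hence l: "l \<ge> 1" using p by (simp add: l_def ge_one_powr_ge_zero)
  have lp: "l powr p = L * (K + 1)" using l1 p by (simp add: l_def powr_powr)
  have "\<Phi> (norm (f z) / l) \<le> 1 / (K + 1) * \<Phi> (norm (f z))" for z
  proof -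
    have "\<Phi> (norm (f z) * (1 / l)) \<le> L * (1 / l) powr p * \<Phi> (norm (f z))" using l by (intro Phi_lower) auto
    also have "(1 / l) powr p = 1 / (L * (K + 1))" using l by (simp add: powr_divide lp)
    finally show ?thesis using L by simp
  qed
  hence "(\<integral>\<^sup>+z. ennreal (\<Phi> (norm (f z) / l)) \<partial>nu \<alpha>) \<le> (\<integral>\<^sup>+z. ennreal (1 / (K + 1)) * ennreal (\<Phi> (norm (f z))) \<partial>nu \<alpha>)"
    using K by (intro nn_integral_mono) (subst ennreal_mult'[symmetric], auto intro!: ennreal_leI)
  also have "\<dots> = ennreal (1 / (K + 1)) * ennreal K"
    by (subst nn_integral_cmult) (auto simp: K)
  also have "\<dots> = ennreal (K / (K + 1))" using K by (subst ennreal_mult'[symmetric]) auto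
  also have "\<dots> \<le> 1" using K by (simp flip: ennreal_1 add: ennreal_leI)
  finally show ?thesis using l by (intro exI[of _ l]) auto
qed

lemma le_lux_normI:
  assumes f: "f \<in> bergman_orlicz \<alpha> \<Phi>" and C: "C > 0"
    and v: "\<And>l. l > 0 \<Longrightarrow> (\<integral>\<^sup>+z. ennreal (\<Phi> (norm (f z) / l)) \<partial>nu \<alpha>) \<le> 1 \<Longrightarrow> v \<le> C * l"
  shows "v \<le> C * lux_norm \<alpha> \<Phi> f"
proof -
  have "v / C \<le> lux_norm \<alpha> \<Phi> f" unfolding lux_norm_def
  proof (rule cInf_greatest)
    show "{l. l > 0 \<and> (\<integral>\<^sup>+z. ennreal (\<Phi> (norm (f z) / l)) \<partial>nu \<alpha>) \<le> 1} \<noteq> {}"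
      using lux_norm_witness[OF f] by blast
    fix l assume "l \<in> {l. l > 0 \<and> (\<integral>\<^sup>+z. ennreal (\<Phi> (norm (f z) / l)) \<partial>nu \<alpha>) \<le> 1}"
    thus "v / C \<le> l" using v[of l] C by (simp add: divide_simps mult.commute)
  qed
  thus ?thesis using C by (simp add: divide_simps mult.commute)
qed

lemma lux_norm_nonneg: "f \<in> bergman_orlicz \<alpha> \<Phi> \<Longrightarrow> 0 \<le> lux_norm \<alpha> \<Phi> f"
  using le_lux_normI[of f \<alpha> 1 0] by simp

lemma bergman_orlicz_add:
  assumes f: "f \<in> bergman_orlicz \<alpha> \<Phi>" and g: "g \<in> bergman_orlicz \<alpha> \<Phi>"
  shows "(\<lambda>z. f z + g z) \<in> bergman_orlicz \<alpha> \<Phi>"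
proof -
  note [measurable] = borel_measurable_hol_ball[OF bergman_orliczD(1)[OF f]]
    borel_measurable_hol_ball[OF bergman_orliczD(1)[OF g]]
  have "(\<integral>\<^sup>+z. ennreal (\<Phi> (norm (f z + g z))) \<partial>nu \<alpha>) \<le> (\<integral>\<^sup>+z. ennreal (\<Phi> (norm (f z))) + ennreal (\<Phi> (norm (g z))) \<partial>nu \<alpha>)"
  proof (rule nn_integral_mono)
    fix z
    have "\<Phi> (norm (f z + g z)) \<le> \<Phi> (norm (f z) + norm (g z))" by (intro Phi_mono norm_triangle_ineq) simp
    also have "\<dots> \<le> \<Phi> (norm (f z)) + \<Phi> (norm (g z))" by (intro Phi_add) auto
    finally show "ennreal (\<Phi> (norm (f z + g z))) \<le> ennreal (\<Phi> (norm (f z))) + ennreal (\<Phi> (norm (g z)))"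
      by (simp add: ennreal_plus[symmetric] Phi_nonneg ennreal_leI del: ennreal_plus)
  qed
  also have "\<dots> = (\<integral>\<^sup>+z. ennreal (\<Phi> (norm (f z))) \<partial>nu \<alpha>) + (\<integral>\<^sup>+z. ennreal (\<Phi> (norm (g z))) \<partial>nu \<alpha>)"
    by (rule nn_integral_add) measurable
  also have "\<dots> < \<infinity>" using bergman_orliczD(2)[OF f] bergman_orliczD(2)[OF g] by simp
  finally show ?thesis using hol_ball_add[OF bergman_orliczD(1)[OF f] bergman_orliczD(1)[OF g]]
    by (simp add: bergman_orlicz_def)
qed

lemma bergman_orlicz_cmult:
  assumes f: "f \<in> bergman_orlicz \<alpha> \<Phi>"
  shows "(\<lambda>z. c * f z) \<in> bergman_orlicz \<alpha> \<Phi>"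
proof -
  note [measurable] = borel_measurable_hol_ball[OF bergman_orliczD(1)[OF f]]
  define m where "m = max 1 (norm c)"
  have m: "m \<ge> 1" "norm c \<le> m" by (auto simp: m_def)
  have "(\<integral>\<^sup>+z. ennreal (\<Phi> (norm (c * f z))) \<partial>nu \<alpha>) \<le> (\<integral>\<^sup>+z. ennreal m * ennreal (\<Phi> (norm (f z))) \<partial>nu \<alpha>)"
  proof (rule nn_integral_mono)
    fix z
    have "\<Phi> (norm (c * f z)) \<le> \<Phi> (m * norm (f z))" using m by (intro Phi_mono) (auto simp: norm_mult mult_right_mono)
    also have "\<dots> \<le> m * \<Phi> (norm (f z))" using m by (intro Phi_scale) auto
    finally show "ennreal (\<Phi> (norm (c * f z))) \<le> ennreal m * ennreal (\<Phi> (norm (f z)))"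
      using m by (subst ennreal_mult'[symmetric]) (auto intro: ennreal_leI)
  qed
  also have "\<dots> = ennreal m * (\<integral>\<^sup>+z. ennreal (\<Phi> (norm (f z))) \<partial>nu \<alpha>)" by (rule nn_integral_cmult) measurable
  also have "\<dots> < \<infinity>" using bergman_orliczD(2)[OF f] by (simp add: ennreal_mult_less_top)
  finally show ?thesis using hol_ball_cmult[OF bergman_orliczD(1)[OF f]] by (simp add: bergman_orlicz_def)
qed

lemma bergman_orlicz_diff:
  "f \<in> bergman_orlicz \<alpha> \<Phi> \<Longrightarrow> g \<in> bergman_orlicz \<alpha> \<Phi> \<Longrightarrow> (\<lambda>z. f z - g z) \<in> bergman_orlicz \<alpha> \<Phi>"
  using bergman_orlicz_add[of f \<alpha> "\<lambda>z. (-1) * g z"] bergman_orlicz_cmult[of g \<alpha> "-1"] by simp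

lemma nn_integral_nu_le_const:
  assumes "\<alpha> > -1" "\<And>z. z \<in> ball 0 1 \<Longrightarrow> u z \<le> c"
  shows "(\<integral>\<^sup>+z. u z \<partial>(nu \<alpha> :: (complex^'n) measure)) \<le> c"
proof -
  have "(\<integral>\<^sup>+z. u z \<partial>(nu \<alpha> :: (complex^'n) measure)) \<le> (\<integral>\<^sup>+z. c \<partial>(nu \<alpha> :: (complex^'n) measure))"
    by (rule nn_integral_nu_mono) (rule assms)
  thus ?thesis by (simp add: emeasure_nu_UNIV[OF assms(1)])
qed

lemma bounded_hol_bergman_orlicz:
  assumes \<alpha>: "\<alpha> > -1" and f: "f \<in> bounded_hol"
  shows "f \<in> bergman_orlicz \<alpha> \<Phi>"
proof -
  obtain B where B: "\<forall>z. norm (f z) \<le> B" using f unfolding bounded_hol_def by blast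
  have "(\<integral>\<^sup>+z. ennreal (\<Phi> (norm (f z))) \<partial>nu \<alpha>) \<le> ennreal (\<Phi> B)"
    by (rule nn_integral_nu_le_const[OF \<alpha>]) (use B in \<open>auto intro!: ennreal_leI Phi_mono\<close>)
  also have "\<dots> < \<infinity>" by simp
  finally show ?thesis using f by (simp add: bergman_orlicz_def bounded_hol_def)
qed

lemma lux_norm_bounded_hol:
  fixes f :: "complex^'n \<Rightarrow> complex"
  assumes \<alpha>: "\<alpha> > -1" and f: "f \<in> bounded_hol" and B: "\<And>z. z \<in> ball 0 1 \<Longrightarrow> norm (f z) \<le> B"
  shows "lux_norm \<alpha> \<Phi> f \<le> B / q 1"
proof (rule field_le_epsilon)
  fix e :: real assume e: "e > 0"
  have q: "q 1 > 0" by (rule q_pos) simp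
  have B0: "B \<ge> 0" using order_trans[OF norm_ge_zero B[of 0]] by simp
  \<comment> \<open>The summand \<open>e\<close> keeps \<open>l\<close> positive when
    \<open>B = 0\<close>.\<close>
  define l where "l = B / q 1 + e"
  have l: "l > 0" "B \<le> l * q 1" using e q B0 by (simp_all add: l_def add_nonneg_pos field_simps)
  show "lux_norm \<alpha> \<Phi> f \<le> B / q 1 + e" unfolding l_def[symmetric]
  proof (rule lux_norm_leI[OF l(1)])
    show "(\<integral>\<^sup>+z. ennreal (\<Phi> (norm (f z) / l)) \<partial>nu \<alpha>) \<le> 1"
    proof (rule nn_integral_nu_le_const[OF \<alpha>])
      fix z :: "complex^'n" assume z: "z \<in> ball 0 1"
      have "norm (f z) / l \<le> q 1" using order_trans[OF B[OF z] l(2)] l(1) by (simp add: divide_simps mult.commute)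
      hence "\<Phi> (norm (f z) / l) \<le> \<Phi> (q 1)" using l by (intro Phi_mono) auto
      thus "ennreal (\<Phi> (norm (f z) / l)) \<le> 1" by (simp add: Phi_q)
    qed
  qed
qed

section \<open>Bounded functionals on the Orlicz space, on bounded functions and on dilates\<close>

lemma bounded_functional_imp_sup_functional:
  assumes \<alpha>: "\<alpha> > -1" and T: "bounded_functional \<alpha> \<Phi> (T :: (complex^'n \<Rightarrow> complex) \<Rightarrow> complex)"
  obtains C where "sup_functional T C"
proof -
  obtain C where C: "\<And>f. f \<in> bergman_orlicz \<alpha> \<Phi> \<Longrightarrow> norm (T f) \<le> C * lux_norm \<alpha> \<Phi> f"
    using T unfolding bounded_functional_def by blast
  have q: "q 1 > 0" by (rule q_pos) simp
  \<comment> \<open>The constant in \<open>bounded_functional\<close> carries no sign condition,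
    hence \<open>max C 0\<close>; the factor \<open>1 / q 1\<close> compares the Luxemburg norm with
    the supremum.\<close>
  have "sup_functional T (max C 0 / q 1)"
  proof (rule sup_functional.intro)
    fix f g :: "complex^'n \<Rightarrow> complex" assume "f \<in> bounded_hol" "g \<in> bounded_hol"
    thus "T (\<lambda>z. f z + g z) = T f + T g"
      using T bounded_hol_bergman_orlicz[OF \<alpha>] unfolding bounded_functional_def by blast
  next
    fix f :: "complex^'n \<Rightarrow> complex" and c assume "f \<in> bounded_hol"
    thus "T (\<lambda>z. c * f z) = c * T f"
      using T bounded_hol_bergman_orlicz[OF \<alpha>] unfolding bounded_functional_def by blast
  next
    fix f :: "complex^'n \<Rightarrow> complex" and B assume f: "f \<in> bounded_hol" and B: "\<And>z. z \<in> ball 0 1 \<Longrightarrow> norm (f z) \<le> B"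
    have fo: "f \<in> bergman_orlicz \<alpha> \<Phi>" by (rule bounded_hol_bergman_orlicz[OF \<alpha> f])
    have "norm (T f) \<le> C * lux_norm \<alpha> \<Phi> f" by (rule C[OF fo])
    also have "\<dots> \<le> max C 0 * lux_norm \<alpha> \<Phi> f" by (intro mult_right_mono lux_norm_nonneg fo) simp
    also have "\<dots> \<le> max C 0 * (B / q 1)" by (intro mult_left_mono lux_norm_bounded_hol[OF \<alpha> f B]) auto
    finally show "norm (T f) \<le> max C 0 / q 1 * B" by simp
  qed
  thus ?thesis using that by blast
qed

text \<open>From convergence of the integrals of \<Phi> to convergence in norm: for
  \<open>e \<le> 1\<close> dividing the argument by \<open>e\<close> multiplies \<Phi> by at most
  \<open>1 / e\<close>, so an integral below \<open>e\<close> forces the Luxemburg norm to be at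
  most \<open>e\<close>.\<close>

lemma functional_dilates_converge:
  fixes f :: "complex^'n \<Rightarrow> complex"
  assumes \<alpha>: "\<alpha> > -1" and T: "bounded_functional \<alpha> \<Phi> T" and f: "f \<in> bergman_orlicz \<alpha> \<Phi>"
    and S: "\<And>i. 0 < S i" "\<And>i. S i < 1" "S \<longlonglongrightarrow> 1"
  shows "(\<lambda>i. T (cut_ball (\<lambda>z. f (S i *\<^sub>R z)))) \<longlonglongrightarrow> T f"
proof -
  obtain C where C: "\<And>f. f \<in> bergman_orlicz \<alpha> \<Phi> \<Longrightarrow> norm (T f) \<le> C * lux_norm \<alpha> \<Phi> f"
    using T unfolding bounded_functional_def by blast
  have fh: "f \<in> hol_ball" by (rule bergman_orliczD[OF f])
  have [measurable]: "f \<in> borel_measurable borel" by (rule borel_measurable_hol_ball[OF fh])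
  define D where "D = (\<lambda>i (z::complex^'n). cut_ball (\<lambda>z. f (S i *\<^sub>R z)) z - f z)"
  have fi: "cut_ball (\<lambda>z. f (S i *\<^sub>R z)) \<in> bergman_orlicz \<alpha> \<Phi>" for i
    by (intro bounded_hol_bergman_orlicz[OF \<alpha>] dilate_bounded_hol fh S)
  have D: "D i \<in> bergman_orlicz \<alpha> \<Phi>" for i
    unfolding D_def by (rule bergman_orlicz_diff[OF fi f])
  have TD: "T (cut_ball (\<lambda>z. f (S i *\<^sub>R z))) - T f = T (D i)" for i
  proof -
    have "T (\<lambda>z. D i z + f z) = T (D i) + T f" using T D f unfolding bounded_functional_def by blast
    thus ?thesis by (simp add: D_def)
  qed
  have lux0: "(\<lambda>i. lux_norm \<alpha> \<Phi> (D i)) \<longlonglongrightarrow> 0"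
  proof (rule order_tendstoI)
    fix a :: real assume "a < 0"
    thus "eventually (\<lambda>i. a < lux_norm \<alpha> \<Phi> (D i)) sequentially"
      by (intro always_eventually allI less_le_trans[OF _ lux_norm_nonneg[OF D]])
  next
    fix a :: real assume a: "0 < a"
    define e where "e = min (a / 2) 1"
    have e: "0 < e" "e \<le> 1" "e < a" using a by (auto simp: e_def)
    have "eventually (\<lambda>i. (\<integral>\<^sup>+z. ennreal (\<Phi> (norm (f (S i *\<^sub>R z) - f z))) \<partial>nu \<alpha>) < ennreal e) sequentially"
      using dilates_converge[OF \<alpha> f S] e by (intro order_tendstoD) auto
    thus "eventually (\<lambda>i. lux_norm \<alpha> \<Phi> (D i) < a) sequentially"
    proof (rule eventually_mono)
      fix i assume i: "(\<integral>\<^sup>+z. ennreal (\<Phi> (norm (f (S i *\<^sub>R z) - f z))) \<partial>nu \<alpha>) < ennreal e"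
      have "lux_norm \<alpha> \<Phi> (D i) \<le> e"
      proof (rule lux_norm_leI[OF e(1)])
        have "(\<integral>\<^sup>+z. ennreal (\<Phi> (norm (D i z) / e)) \<partial>nu \<alpha>) \<le> (\<integral>\<^sup>+z. ennreal (1 / e) * ennreal (\<Phi> (norm (f (S i *\<^sub>R z) - f z))) \<partial>nu \<alpha>)"
        proof (rule nn_integral_nu_mono)
          fix z :: "complex^'n" assume z: "z \<in> ball 0 1"
          have "\<Phi> (norm (D i z) / e) \<le> 1 / e * \<Phi> (norm (D i z))"
            using Phi_scale[of "1 / e" "norm (D i z)"] e by simp
          also have "D i z = f (S i *\<^sub>R z) - f z" using z by (simp add: D_def)
          finally show "ennreal (\<Phi> (norm (D i z) / e)) \<le> ennreal (1 / e) * ennreal (\<Phi> (norm (f (S i *\<^sub>R z) - f z)))"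
            using e by (subst ennreal_mult'[symmetric]) (auto intro: ennreal_leI simp: \<open>D i z = f (S i *\<^sub>R z) - f z\<close>)
        qed
        also have "\<dots> = ennreal (1 / e) * (\<integral>\<^sup>+z. ennreal (\<Phi> (norm (f (S i *\<^sub>R z) - f z))) \<partial>nu \<alpha>)"
          by (rule nn_integral_cmult) measurable
        also have "\<dots> \<le> ennreal (1 / e) * ennreal e" using i by (intro mult_left_mono) auto
        also have "\<dots> = 1" using e by (subst ennreal_mult'[symmetric]) auto
        finally show "(\<integral>\<^sup>+z. ennreal (\<Phi> (norm (D i z) / e)) \<partial>nu \<alpha>) \<le> 1" .
      qed
      thus "lux_norm \<alpha> \<Phi> (D i) < a" using e by simp
    qed
  qed
  have "(\<lambda>i. T (cut_ball (\<lambda>z. f (S i *\<^sub>R z))) - T f) \<longlonglongrightarrow> 0"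
  proof (rule tendsto_norm_zero_cancel, rule tendsto_sandwich[OF _ _ tendsto_const])
    show "\<forall>\<^sub>F i in sequentially. norm (T (cut_ball (\<lambda>z. f (S i *\<^sub>R z))) - T f) \<le> C * lux_norm \<alpha> \<Phi> (D i)"
      unfolding TD by (intro always_eventually allI C D)
    show "(\<lambda>i. C * lux_norm \<alpha> \<Phi> (D i)) \<longlonglongrightarrow> 0" using tendsto_mult_right_zero[OF lux0] by simp
  qed simp
  thus ?thesis by (simp add: LIM_zero_iff)
qed

end

section \<open>The symbol of a bounded functional\<close>

text \<open>The balls of radius \<eta> about a finite net, made disjoint by giving each point to the
  first ball that contains it. The indicators are complex-valued because they multiply complex
  integrands.\<close>

lemma finite_measurable_partition:
  assumes \<eta>: "\<eta> > 0"
  obtains m :: nat and x :: "nat \<Rightarrow> complex^'n" and \<theta> :: "nat \<Rightarrow> complex^'n \<Rightarrow> complex"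
  where "\<And>i. i < m \<Longrightarrow> x i \<in> cball 0 1" "\<And>i. \<theta> i \<in> borel_measurable borel"
    "\<And>i w. \<theta> i w \<in> {0, 1}" "\<And>i w. \<theta> i w \<noteq> 0 \<Longrightarrow> dist (x i) w < \<eta>"
    "\<And>w. w \<in> ball 0 1 \<Longrightarrow> (\<Sum>i<m. \<theta> i w) = 1"
    "\<And>w. (\<Sum>i<m. norm (\<theta> i w)) \<le> 1"
proof -
  obtain P where P: "P \<subseteq> cball 0 1" "finite P" "cball (0::complex^'n) 1 \<subseteq> (\<Union>c\<in>P. ball c \<eta>)"
    by (rule compactE_image[of "cball (0::complex^'n) 1" "cball 0 1" "\<lambda>c. ball c \<eta>"]) (use \<eta> in auto)
  obtain xs where xs: "set xs = P" using finite_list[OF P(2)] by blast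
  define m where "m = length xs"
  define x where "x = (\<lambda>i. xs ! i)"
  define \<theta> where "\<theta> = (\<lambda>i w. if dist (x i) w < \<eta> \<and> (\<forall>j<i. \<not> dist (x j) w < \<eta>) then 1 else 0 :: complex)"
  have one: "\<theta> i w = 0 \<or> \<theta> j w = 0" if "i \<noteq> j" for i j w
    using that by (cases i j rule: linorder_cases) (auto simp: \<theta>_def)
  have sum_le: "(\<Sum>i<m. norm (\<theta> i w)) \<le> 1" for w
  proof (cases "\<exists>i<m. \<theta> i w \<noteq> 0")
    case True
    then obtain i where i: "i < m" "\<theta> i w \<noteq> 0" by blast
    have "(\<Sum>i<m. norm (\<theta> i w)) = (\<Sum>j\<in>{i}. norm (\<theta> j w))"
      by (rule sum.mono_neutral_right) (use i one in auto)
    thus ?thesis by (simp add: \<theta>_def)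
  next
    case False
    hence "(\<Sum>i<m. norm (\<theta> i w)) = 0" by (intro sum.neutral) auto
    thus ?thesis by simp
  qed
  have sum_1: "(\<Sum>i<m. \<theta> i w) = 1" if "w \<in> ball 0 1" for w
  proof -
    have "w \<in> cball 0 1" using that by simp
    then obtain c where "c \<in> P" "dist c w < \<eta>" using P(3) by auto
    hence "\<exists>i. i < m \<and> dist (x i) w < \<eta>"
      using xs unfolding m_def x_def by (metis in_set_conv_nth)
    then obtain i where i: "i < m" "dist (x i) w < \<eta>" "\<And>j. j < i \<Longrightarrow> \<not> (j < m \<and> dist (x j) w < \<eta>)"
      using exists_least_iff[of "\<lambda>i. i < m \<and> dist (x i) w < \<eta>"] by auto
    hence "\<theta> i w = 1" by (auto simp: \<theta>_def)
    moreover have "(\<Sum>i<m. \<theta> i w) = (\<Sum>j\<in>{i}. \<theta> j w)"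
    proof (rule sum.mono_neutral_right)
      show "\<forall>j\<in>{..<m} - {i}. \<theta> j w = 0" using one[of i _ w] \<open>\<theta> i w = 1\<close> by force
    qed (use i(1) in auto)
    ultimately show ?thesis by simp
  qed
  have meas: "\<theta> i \<in> borel_measurable borel" for i unfolding \<theta>_def by measurable
  show ?thesis
  proof (rule that[of m x \<theta>])
    show "x i \<in> cball 0 1" if "i < m" for i
    proof -
      have "xs ! i \<in> P" using xs that nth_mem[of i xs] by (simp add: m_def)
      thus ?thesis using P(1) by (auto simp: x_def)
    qed
  qed (use meas sum_1 sum_le in \<open>auto simp: \<theta>_def split: if_splits\<close>)
qed

text \<open>As the \<theta> sum to 1, the error is the integral of \<open>c\<close> times the sum of
  \<open>\<theta> i * (h - v i)\<close>. The values \<open>v i\<close> are abstract so that the same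
  Riemann sum can be used for kernel values at a fixed point and for the values of a functional on
  kernels.\<close>

lemma riemann_sum_error:
  fixes c h :: "complex^'n \<Rightarrow> complex"
  assumes \<alpha>: "\<alpha> > -1" and mc [measurable]: "c \<in> borel_measurable borel" and mh [measurable]: "h \<in> borel_measurable borel"
    and c: "\<And>w. w \<in> ball 0 1 \<Longrightarrow> norm (c w) \<le> B" and h: "\<And>w. w \<in> ball 0 1 \<Longrightarrow> norm (h w) \<le> H"
    and m\<theta>: "\<And>i. \<theta> i \<in> borel_measurable borel" and \<theta>01: "\<And>i w. \<theta> i w \<in> {0, 1}"
    and sum_1: "\<And>w. w \<in> ball 0 1 \<Longrightarrow> (\<Sum>i<m. \<theta> i w) = 1" and sum_le: "\<And>w. (\<Sum>i<m. norm (\<theta> i w)) \<le> 1"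
    and close: "\<And>i w. i < m \<Longrightarrow> w \<in> ball 0 1 \<Longrightarrow> \<theta> i w \<noteq> 0 \<Longrightarrow> norm (h w - v i) \<le> \<kappa>" and \<kappa>: "\<kappa> \<ge> 0"
  shows "norm ((\<integral>w. c w * h w \<partial>nu \<alpha>) - (\<Sum>i<m. (\<integral>w. c w * \<theta> i w \<partial>nu \<alpha>) * v i)) \<le> B * \<kappa>"
proof -
  note m\<theta> [measurable]
  have B0: "B \<ge> 0" using order_trans[OF norm_ge_zero c[of 0]] by simp
  have \<theta>le: "norm (\<theta> i w) \<le> 1" for i w using \<theta>01[of i w] by auto
  have i1: "integrable (nu \<alpha>) (\<lambda>w. c w * h w)"
    by (rule integrable_nu_bounded[OF \<alpha>, of _ "B * H"]) (measurable, auto simp: norm_mult intro!: mult_mono c h B0)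
  have i2: "integrable (nu \<alpha>) (\<lambda>w. c w * \<theta> i w)" for i
    by (rule integrable_nu_bounded[OF \<alpha>, of _ "B * 1"]) (measurable, auto simp only: norm_mult intro!: mult_mono c \<theta>le B0 norm_ge_zero)
  have "(\<integral>w. c w * h w \<partial>nu \<alpha>) - (\<Sum>i<m. (\<integral>w. c w * \<theta> i w \<partial>nu \<alpha>) * v i)
     = (\<integral>w. c w * h w - (\<Sum>i<m. c w * \<theta> i w * v i) \<partial>nu \<alpha>)"
    using i1 i2 by (simp add: Bochner_Integration.integral_sum)
  also have "norm \<dots> \<le> B * \<kappa>"
  proof -
    let ?u = "\<lambda>w. c w * h w - (\<Sum>i<m. c w * \<theta> i w * v i)"
    have int: "integrable (nu \<alpha>) ?u" using i1 i2 by simp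
    have le: "norm (?u w) \<le> B * \<kappa>" if w: "w \<in> ball 0 1" for w
    proof -
      have "?u w = c w * ((\<Sum>i<m. \<theta> i w) * h w - (\<Sum>i<m. \<theta> i w * v i))"
        using sum_1[OF w] by (simp add: algebra_simps sum_distrib_left)
      also have "\<dots> = c w * (\<Sum>i<m. \<theta> i w * (h w - v i))"
        by (simp add: sum_distrib_right sum_subtractf right_diff_distrib)
      finally have eq: "?u w = c w * (\<Sum>i<m. \<theta> i w * (h w - v i))" .
      have "norm (\<Sum>i<m. \<theta> i w * (h w - v i)) \<le> (\<Sum>i<m. norm (\<theta> i w) * \<kappa>)"
      proof (rule order_trans[OF norm_sum sum_mono])
        fix i assume "i \<in> {..<m}"
        thus "norm (\<theta> i w * (h w - v i)) \<le> norm (\<theta> i w) * \<kappa>"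
          using close[of i w] w \<kappa> by (cases "\<theta> i w = 0") (auto simp: norm_mult intro!: mult_left_mono)
      qed
      also have "\<dots> = (\<Sum>i<m. norm (\<theta> i w)) * \<kappa>" by (simp add: sum_distrib_right)
      also have "\<dots> \<le> 1 * \<kappa>" by (intro mult_right_mono sum_le \<kappa>)
      finally show ?thesis unfolding eq norm_mult by (intro mult_mono c w B0) auto
    qed
    have "norm (\<integral>w. ?u w \<partial>nu \<alpha>) \<le> (\<integral>w. norm (?u w) \<partial>nu \<alpha>)" by (rule integral_norm_bound)
    also have "\<dots> \<le> (\<integral>w. B * \<kappa> \<partial>(nu \<alpha> :: (complex^'n) measure))"
    proof (rule integral_mono_AE)
      interpret finite_measure "nu \<alpha> :: (complex^'n) measure" by (rule finite_measure_nu[OF \<alpha>])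
      show "integrable (nu \<alpha> :: (complex^'n) measure) (\<lambda>w. B * \<kappa>)" by simp
      show "AE w in nu \<alpha>. norm (?u w) \<le> B * \<kappa>" by (rule AE_nuI[OF le])
    qed (use int in auto)
    also have "\<dots> = B * \<kappa>" by (simp add: measure_def emeasure_nu_UNIV[OF \<alpha>])
    finally show ?thesis .
  qed
  finally show ?thesis .
qed

lemma kern_herm_Lipschitz:
  assumes s: "s > 0" and r: "0 < r" "r < 1" and z: "z \<in> ball 0 1" and v: "v \<in> cball 0 1" and w: "w \<in> cball 0 1"
  shows "norm (kern s (herm z (r *\<^sub>R v)) - kern s (herm z (r *\<^sub>R w))) \<le> s * (1 - r) powr (- (s + 1)) * norm (v - w)"
proof -
  have le: "norm (herm z (r *\<^sub>R u)) \<le> r" if "u \<in> cball 0 1" for u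
  proof -
    have "norm (herm z (r *\<^sub>R u)) \<le> norm z * norm (r *\<^sub>R u)" by (rule norm_herm_le)
    also have "\<dots> \<le> 1 * (r * 1)" using z that r by (intro mult_mono) auto
    finally show ?thesis by simp
  qed
  have "norm (kern s (herm z (r *\<^sub>R v)) - kern s (herm z (r *\<^sub>R w)))
     \<le> s * (1 - r) powr (- (s + 1)) * norm (herm z (r *\<^sub>R v) - herm z (r *\<^sub>R w))"
  proof (rule field_differentiable_bound[where S = "cball 0 r" and f' = "\<lambda>x. of_real s * kern (s + 1) x"])
    fix x :: complex assume "x \<in> cball 0 r"
    hence x: "norm x \<le> r" by simp
    show "(kern s has_field_derivative of_real s * kern (s + 1) x) (at x within cball 0 r)"
      by (rule has_field_derivative_at_within[OF DERIV_kern]) (use x r in simp)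
    have "norm (kern (s + 1) x) \<le> (1 - r) powr (- (s + 1))"
      unfolding norm_kern using x r s norm_triangle_ineq2[of 1 x] by (intro powr_mono2') auto
    thus "norm (of_real s * kern (s + 1) x) \<le> s * (1 - r) powr (- (s + 1))"
      using s by (simp add: norm_mult)
  qed (use le v w in auto)
  also have "norm (herm z (r *\<^sub>R v) - herm z (r *\<^sub>R w)) \<le> norm (v - w)"
  proof -
    have "norm (herm z (r *\<^sub>R (v - w))) \<le> norm z * norm (r *\<^sub>R (v - w))" by (rule norm_herm_le)
    also have "\<dots> \<le> 1 * (1 * norm (v - w))" using z r by (intro mult_mono) (auto simp: mult_left_le_one_le)
    finally show ?thesis by (simp add: scaleR_diff_right herm_diff_right)
  qed
  finally show ?thesis using s by (simp add: mult_left_mono)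
qed

context sup_functional
begin

lemma C_nonneg: "C \<ge> 0"
  using order_trans[OF norm_ge_zero T_bound[OF kern_bounded_hol[of 0 0], of 1]] by (simp add: kern_def)

text \<open>\<open>T\<close> is not assumed to commute with integrals, only with finite sums: the integral is a
  uniform limit of Riemann sums.\<close>

lemma functional_of_kernel_integral:
  assumes \<alpha>: "\<alpha> > -1" and s: "s > 0" and r: "0 < r" "r < 1"
    and mc [measurable]: "c \<in> borel_measurable borel" and c: "\<And>w. w \<in> ball 0 1 \<Longrightarrow> norm (c w) \<le> B"
    and F: "F \<in> bounded_hol" "\<And>z. z \<in> ball 0 1 \<Longrightarrow> F z = (\<integral>w. c w * kern s (herm z (r *\<^sub>R w)) \<partial>nu \<alpha>)"
  shows "T F = (\<integral>w. c w * cnj (G s (r *\<^sub>R w)) \<partial>nu \<alpha>)"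
proof -
  have B0: "B \<ge> 0" using order_trans[OF norm_ge_zero c[of 0]] by simp
  define K where "K = (\<lambda>w::complex^'n. cut_ball (\<lambda>z. kern s (herm z (r *\<^sub>R w))))"
  have rw: "r *\<^sub>R w \<in> ball 0 1" if "w \<in> cball 0 1" for w :: "complex^'n"
  proof -
    have "r * norm w \<le> r * 1" using that r by (intro mult_left_mono) auto
    hence "r * norm w < 1" using r by linarith
    thus ?thesis using r by simp
  qed
  have K: "K w \<in> bounded_hol" if "w \<in> cball 0 1" for w
    unfolding K_def by (rule kern_bounded_hol[OF rw[OF that]]) (use s in simp)
  have TK: "cnj (G s (r *\<^sub>R w)) = T (K w)" if "w \<in> cball 0 1" for w
    using rw[OF that] by (simp add: G_def K_def)
  define M where "M = s * (1 - r) powr (- (s + 1))"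
  have M: "M \<ge> 0" using s by (simp add: M_def)
  have lip: "norm (K v z - K w z) \<le> M * norm (v - w)" if "v \<in> cball 0 1" "w \<in> cball 0 1" "z \<in> ball 0 1" for v w z
    using kern_herm_Lipschitz[OF s r that(3,1,2)] that(3) by (simp add: K_def M_def)
  have lipT: "norm (T (K v) - T (K w)) \<le> C * (M * norm (v - w))" if "v \<in> cball 0 1" "w \<in> cball 0 1" for v w
    using T_bound[OF bounded_hol_diff[OF K[OF that(1)] K[OF that(2)]] lip[OF that]] T_diff[OF K[OF that(1)] K[OF that(2)]] by simp
  have mG [measurable]: "(\<lambda>w. cnj (G s (r *\<^sub>R w))) \<in> borel_measurable borel"
    using borel_measurable_hol_ball[OF G_hol[OF s]] by measurable
  have mK [measurable]: "(\<lambda>w. kern s (herm z (r *\<^sub>R w))) \<in> borel_measurable borel" for z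
    by measurable
  have main: "norm (T F - (\<integral>w. c w * cnj (G s (r *\<^sub>R w)) \<partial>nu \<alpha>)) \<le> (2 * C * B * M) * \<eta>" if \<eta>: "\<eta> > 0" for \<eta>
  proof -
    obtain m and x :: "nat \<Rightarrow> complex^'n" and \<theta> :: "nat \<Rightarrow> complex^'n \<Rightarrow> complex" where
      x: "\<And>i. i < m \<Longrightarrow> x i \<in> cball 0 1" and \<theta>: "\<And>i. \<theta> i \<in> borel_measurable borel" "\<And>i w. \<theta> i w \<in> {0, 1}"
      "\<And>i w. \<theta> i w \<noteq> 0 \<Longrightarrow> dist (x i) w < \<eta>" "\<And>w. w \<in> ball 0 1 \<Longrightarrow> (\<Sum>i<m. \<theta> i w) = 1"
      "\<And>w. (\<Sum>i<m. norm (\<theta> i w)) \<le> 1"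
    proof (rule finite_measurable_partition[OF \<eta>, where 'n = 'n])
      fix m and x :: "nat \<Rightarrow> complex^'n" and \<theta> :: "nat \<Rightarrow> complex^'n \<Rightarrow> complex"
      assume *: "\<And>i. i < m \<Longrightarrow> x i \<in> cball 0 1" "\<And>i. \<theta> i \<in> borel_measurable borel" "\<And>i w. \<theta> i w \<in> {0, 1}"
        "\<And>i w. \<theta> i w \<noteq> 0 \<Longrightarrow> dist (x i) w < \<eta>" "\<And>w. w \<in> ball 0 1 \<Longrightarrow> (\<Sum>i<m. \<theta> i w) = 1"
        "\<And>w. (\<Sum>i<m. norm (\<theta> i w)) \<le> 1"
      show thesis by (rule that[of m x \<theta>, OF *])
    qed
    \<comment> \<open>The integral of \<open>c\<close> over the i-th cell. With these coefficients
      \<open>Q\<close> is a finite combination of kernels: it approximates \<open>F\<close>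
      uniformly, and \<open>T Q\<close>, known by linearity, approximates the integral on the
      right.\<close>
    define \<mu> where "\<mu> = (\<lambda>i. \<integral>w. c w * \<theta> i w \<partial>nu \<alpha>)"
    define Q where "Q = (\<lambda>z. \<Sum>i<m. \<mu> i * K (x i) z)"
    have KX: "(\<lambda>z. \<mu> i * K (x i) z) \<in> bounded_hol" if "i \<in> {..<m}" for i
      using x that by (intro bounded_hol_cmult K) simp
    have Q: "Q \<in> bounded_hol" "T Q = (\<Sum>i<m. \<mu> i * T (K (x i)))"
    proof -
      from T_sum[OF finite_lessThan KX] show "Q \<in> bounded_hol" by (simp add: Q_def)
      from T_sum[OF finite_lessThan KX] have "T Q = (\<Sum>i<m. T (\<lambda>z. \<mu> i * K (x i) z))" by (simp add: Q_def)
      also have "\<dots> = (\<Sum>i<m. \<mu> i * T (K (x i)))"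
        using x by (intro sum.cong refl T_cmult K) simp
      finally show "T Q = (\<Sum>i<m. \<mu> i * T (K (x i)))" .
    qed
    have near: "norm (w - x i) \<le> \<eta>" if "\<theta> i w \<noteq> 0" for i w
      using \<theta>(3)[OF that] by (simp add: dist_norm norm_minus_commute)
    have "norm (F z - Q z) \<le> B * (M * \<eta>)" if z: "z \<in> ball 0 1" for z
    proof -
      have "norm ((\<integral>w. c w * kern s (herm z (r *\<^sub>R w)) \<partial>nu \<alpha>) - (\<Sum>i<m. \<mu> i * K (x i) z)) \<le> B * (M * \<eta>)"
        unfolding \<mu>_def
      proof (rule riemann_sum_error[OF \<alpha> mc mK c _ \<theta>(1,2,4,5), where H = "(1 - r) powr (- s)"])
        fix w :: "complex^'n" assume w: "w \<in> ball 0 1"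
        hence w1: "w \<in> cball 0 1" by simp
        have "norm (kern s (herm z (r *\<^sub>R w))) \<le> (1 - norm (r *\<^sub>R w)) powr (- s)"
          using s by (intro norm_kern_herm_le z rw w1) simp
        also have "\<dots> \<le> (1 - r) powr (- s)"
          using s r w mult_left_le[of "norm w" r] by (intro powr_mono2') auto
        finally show "norm (kern s (herm z (r *\<^sub>R w))) \<le> (1 - r) powr (- s)" .
        fix i assume i: "i < m" "\<theta> i w \<noteq> 0"
        have "norm (K w z - K (x i) z) \<le> M * norm (w - x i)" by (rule lip[OF w1 x[OF i(1)] z])
        also have "\<dots> \<le> M * \<eta>" by (intro mult_left_mono near i M)
        finally show "norm (kern s (herm z (r *\<^sub>R w)) - K (x i) z) \<le> M * \<eta>" using z by (simp add: K_def)
      qed (use M \<eta> in auto)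
      thus ?thesis using F(2)[OF z] by (simp add: Q_def)
    qed
    hence "norm (T F - T Q) \<le> C * (B * (M * \<eta>))"
      using T_bound[OF bounded_hol_diff[OF F(1) Q(1)]] T_diff[OF F(1) Q(1)] by simp
    moreover have "norm ((\<integral>w. c w * cnj (G s (r *\<^sub>R w)) \<partial>nu \<alpha>) - T Q) \<le> B * (C * (M * \<eta>))"
      unfolding Q(2) \<mu>_def
    proof (rule riemann_sum_error[OF \<alpha> mc mG c _ \<theta>(1,2,4,5), where H = "C * (1 - r) powr (- s)"])
      fix w :: "complex^'n" assume w: "w \<in> ball 0 1"
      hence w1: "w \<in> cball 0 1" by simp
      show "norm (cnj (G s (r *\<^sub>R w))) \<le> C * (1 - r) powr (- s)" unfolding TK[OF w1]
      proof (rule T_bound[OF K[OF w1]])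
        fix z :: "complex^'n" assume z: "z \<in> ball 0 1"
        have "norm (kern s (herm z (r *\<^sub>R w))) \<le> (1 - norm (r *\<^sub>R w)) powr (- s)"
          using s by (intro norm_kern_herm_le z rw w1) simp
        also have "\<dots> \<le> (1 - r) powr (- s)"
          using s r w mult_left_le[of "norm w" r] by (intro powr_mono2') auto
        finally show "norm (K w z) \<le> (1 - r) powr (- s)" using z by (simp add: K_def)
      qed
      fix i assume i: "i < m" "\<theta> i w \<noteq> 0"
      have "norm (T (K w) - T (K (x i))) \<le> C * (M * norm (w - x i))" by (rule lipT[OF w1 x[OF i(1)]])
      also have "\<dots> \<le> C * (M * \<eta>)" by (intro mult_left_mono near i M C_nonneg)
      finally show "norm (cnj (G s (r *\<^sub>R w)) - T (K (x i))) \<le> C * (M * \<eta>)" unfolding TK[OF w1] .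
    qed (use M \<eta> C_nonneg in auto)
    ultimately have "norm ((T F - T Q) - ((\<integral>w. c w * cnj (G s (r *\<^sub>R w)) \<partial>nu \<alpha>) - T Q)) \<le> C * (B * (M * \<eta>)) + B * (C * (M * \<eta>))"
      using norm_triangle_ineq4 order_trans add_mono by meson
    thus ?thesis by (simp add: algebra_simps)
  qed
  have "norm (T F - (\<integral>w. c w * cnj (G s (r *\<^sub>R w)) \<partial>nu \<alpha>)) \<le> 0"
  proof (rule field_le_epsilon)
    fix e :: real assume e: "e > 0"
    define D where "D = 2 * C * B * M"
    have D: "D \<ge> 0" using C_nonneg B0 M by (simp add: D_def)
    have "norm (T F - (\<integral>w. c w * cnj (G s (r *\<^sub>R w)) \<partial>nu \<alpha>)) \<le> D * (e / (D + 1))"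
      unfolding D_def by (rule main) (use e D in \<open>simp add: D_def add_nonneg_pos\<close>)
    also have "\<dots> \<le> 0 + e" using e D by (simp add: divide_simps mult_left_mono)
    finally show "norm (T F - (\<integral>w. c w * cnj (G s (r *\<^sub>R w)) \<partial>nu \<alpha>)) \<le> 0 + e" .
  qed
  thus ?thesis by simp
qed

text \<open>The dilation is split as \<open>r = s r'\<close> with \<open>r' < 1\<close>, so that all kernels are bounded, and
  then \<open>r'\<close> tends to 1.\<close>

lemma functional_of_dilate:
  assumes \<alpha>: "\<alpha> > -1" and f: "f \<in> hol_ball" and r: "0 < r" "r < 1"
    and \<epsilon>: "0 \<le> \<epsilon>" "\<epsilon> < \<alpha> + 1"
    and A: "\<And>z. z \<in> ball 0 1 \<Longrightarrow> norm (G (real CARD('n) + 1 + \<alpha>) z) \<le> A * (1 - (norm z)\<^sup>2) powr (- \<epsilon>)"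
  shows "integrable (nu \<alpha>) (\<lambda>z. f (r *\<^sub>R z) * cnj (G (real CARD('n) + 1 + \<alpha>) z))"
    "T (cut_ball (\<lambda>z. f (r *\<^sub>R z))) = (\<integral>z. f (r *\<^sub>R z) * cnj (G (real CARD('n) + 1 + \<alpha>) z) \<partial>nu \<alpha>)"
proof -
  let ?N = "real CARD('n) + 1 + \<alpha>"
  have N: "?N > 0" using \<alpha> by (simp add: add_pos_nonneg)
  have gh: "G ?N \<in> hol_ball" by (rule G_hol[OF N])
  have [measurable]: "G ?N \<in> borel_measurable borel" "f \<in> borel_measurable borel"
    by (intro borel_measurable_hol_ball gh f)+
  have A0: "A \<ge> 0" using order_trans[OF norm_ge_zero A[of 0]] by simp
  define \<rho> where "\<rho> = (1 + r) / 2"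
  have \<rho>: "r < \<rho>" "\<rho> < 1" "0 < \<rho>" using r by (simp_all add: \<rho>_def)
  obtain B where B: "\<And>z. norm z \<le> 1 \<Longrightarrow> norm (f (\<rho> *\<^sub>R z)) \<le> B"
    using bounded_on_cball[OF holomorphic_dilate_ball[OF hol_ballD[OF f] \<rho>(3,2)]] by blast
  have B0: "B \<ge> 0" using order_trans[OF norm_ge_zero B[of 0]] by simp
  have Bt: "norm (f (t *\<^sub>R z)) \<le> B" if "0 \<le> t" "t \<le> \<rho>" "z \<in> ball 0 1" for t z
  proof -
    have "norm ((t / \<rho>) *\<^sub>R z) \<le> 1 * 1" using that \<rho> unfolding norm_scaleR by (intro mult_mono) auto
    from B[of "(t / \<rho>) *\<^sub>R z"] this show ?thesis using \<rho> by simp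
  qed
  have iw: "integrable (nu \<alpha> :: (complex^'n) measure) (\<lambda>z. B * (A * (1 - (norm z)\<^sup>2) powr (- \<epsilon>)))"
    using integrable_nu_powr[OF \<alpha>, of "- \<epsilon>", where 'n = 'n] \<epsilon> by simp
  show "integrable (nu \<alpha>) (\<lambda>z. f (r *\<^sub>R z) * cnj (G ?N z))"
  proof (rule Bochner_Integration.integrable_bound[OF iw])
    show "AE z in nu \<alpha>. norm (f (r *\<^sub>R z) * cnj (G ?N z)) \<le> norm (B * (A * (1 - (norm z)\<^sup>2) powr (- \<epsilon>)))"
    proof (rule AE_nuI)
      fix z :: "complex^'n" assume z: "z \<in> ball 0 1"
      have "norm (f (r *\<^sub>R z)) * norm (G ?N z) \<le> B * (A * (1 - (norm z)\<^sup>2) powr (- \<epsilon>))"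
        using r \<rho> by (intro mult_mono Bt A z B0) auto
      thus "norm (f (r *\<^sub>R z) * cnj (G ?N z)) \<le> norm (B * (A * (1 - (norm z)\<^sup>2) powr (- \<epsilon>)))"
        by (simp add: norm_mult)
    qed
  qed measurable
  define S where "S = (\<lambda>i. r / rseq i)"
  have Spos: "S i > 0" for i using r rseq[of i] by (simp add: S_def)
  have Slim: "S \<longlonglongrightarrow> r" unfolding S_def using tendsto_divide[OF tendsto_const rseq_tendsto, of r] by simp
  have ev: "eventually (\<lambda>i. S i < \<rho>) sequentially" by (rule order_tendstoD(2)[OF Slim \<rho>(1)])
  let ?g = "\<lambda>i w. f (S i *\<^sub>R w) * cnj (G ?N (rseq i *\<^sub>R w))"
  have eq: "T (cut_ball (\<lambda>z. f (r *\<^sub>R z))) = (\<integral>w. ?g i w \<partial>nu \<alpha>)" if i: "S i < \<rho>" for i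
  proof (rule functional_of_kernel_integral[OF \<alpha> N rseq(1) rseq(2), where B = B])
    have S1: "S i < 1" using i \<rho> by simp
    show "cut_ball (\<lambda>z. f (r *\<^sub>R z)) \<in> bounded_hol" by (rule dilate_bounded_hol[OF f r])
    show "norm (f (S i *\<^sub>R w)) \<le> B" if "w \<in> ball 0 1" for w
      using Spos[of i] i by (intro Bt that) auto
    fix z :: "complex^'n" assume z: "z \<in> ball 0 1"
    have rz: "rseq i *\<^sub>R z \<in> ball 0 1" using dilate_in_ball[OF z] rseq[of i] by simp
    have "(\<integral>w. f (S i *\<^sub>R w) * kern ?N (herm (rseq i *\<^sub>R z) w) \<partial>nu \<alpha>) = f (S i *\<^sub>R rseq i *\<^sub>R z)"
      by (rule reproducing_formula[OF \<alpha> _ holomorphic_dilate_ball[OF hol_ballD[OF f] Spos S1] rz]) measurable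
    moreover have "S i * rseq i = r" using rseq[of i] by (simp add: S_def)
    hence "S i *\<^sub>R rseq i *\<^sub>R z = r *\<^sub>R z" by simp
    ultimately have "(\<integral>w. f (S i *\<^sub>R w) * kern ?N (herm (rseq i *\<^sub>R z) w) \<partial>nu \<alpha>) = f (r *\<^sub>R z)"
      by (simp only:)
    thus "cut_ball (\<lambda>z. f (r *\<^sub>R z)) z = (\<integral>w. f (S i *\<^sub>R w) * kern ?N (herm z (rseq i *\<^sub>R w)) \<partial>nu \<alpha>)"
      using z by (simp add: herm_scaleR_left herm_scaleR_right)
  qed measurable
  \<comment> \<open>\<open>S i < \<rho>\<close> holds only eventually. For the remaining indices the
    integrand is replaced by 0, so that one majorant serves the whole sequence.\<close>
  have "(\<lambda>i. \<integral>w. (if S i < \<rho> then ?g i w else 0) \<partial>nu \<alpha>) \<longlonglongrightarrow> (\<integral>w. f (r *\<^sub>R w) * cnj (G ?N w) \<partial>nu \<alpha>)"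
  proof (rule integral_dominated_convergence[OF _ _ iw])
    show "AE w in nu \<alpha>. (\<lambda>i. if S i < \<rho> then ?g i w else 0) \<longlonglongrightarrow> f (r *\<^sub>R w) * cnj (G ?N w)"
    proof (rule AE_nuI)
      fix w :: "complex^'n" assume w: "w \<in> ball 0 1"
      have rw: "r *\<^sub>R w \<in> ball 0 1" using dilate_in_ball[OF w] r by simp
      have "isCont f (r *\<^sub>R w)"
        using holomorphic_Cn_on_imp_continuous_on[OF hol_ballD[OF f]] rw by (simp add: continuous_on_eq_continuous_at)
      moreover have "(\<lambda>i. S i *\<^sub>R w) \<longlonglongrightarrow> r *\<^sub>R w" by (intro tendsto_intros Slim)
      ultimately have "(\<lambda>i. f (S i *\<^sub>R w)) \<longlonglongrightarrow> f (r *\<^sub>R w)" by (rule isCont_tendsto_compose)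
      hence "(\<lambda>i. ?g i w) \<longlonglongrightarrow> f (r *\<^sub>R w) * cnj (G ?N w)"
        by (intro tendsto_mult tendsto_cnj tendsto_dilate_hol_ball[OF gh w rseq_tendsto])
      thus "(\<lambda>i. if S i < \<rho> then ?g i w else 0) \<longlonglongrightarrow> f (r *\<^sub>R w) * cnj (G ?N w)"
        by (rule Lim_transform_eventually) (use ev in \<open>auto elim: eventually_mono\<close>)
    qed
    show "AE w in nu \<alpha>. norm (if S i < \<rho> then ?g i w else 0) \<le> B * (A * (1 - (norm w)\<^sup>2) powr (- \<epsilon>))" for i
    proof (rule AE_nuI)
      fix w :: "complex^'n" assume w: "w \<in> ball 0 1"
      have rw: "rseq i *\<^sub>R w \<in> ball 0 1" using dilate_in_ball[OF w] rseq[of i] by simp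
      have "norm (G ?N (rseq i *\<^sub>R w)) \<le> A * (1 - (norm (rseq i *\<^sub>R w))\<^sup>2) powr (- \<epsilon>)" by (rule A[OF rw])
      also have "\<dots> \<le> A * (1 - (norm w)\<^sup>2) powr (- \<epsilon>)"
        using A0 \<epsilon> one_minus_norm_sq_pos[OF w] one_minus_norm_sq_dilate[OF w] rseq[of i]
        by (intro mult_left_mono powr_mono2') auto
      finally have 1: "norm (G ?N (rseq i *\<^sub>R w)) \<le> A * (1 - (norm w)\<^sup>2) powr (- \<epsilon>)" .
      have "norm (f (S i *\<^sub>R w)) * norm (G ?N (rseq i *\<^sub>R w)) \<le> B * (A * (1 - (norm w)\<^sup>2) powr (- \<epsilon>))" if "S i < \<rho>"
        using Spos[of i] that by (intro mult_mono 1 Bt w B0) auto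
      thus "norm (if S i < \<rho> then ?g i w else 0) \<le> B * (A * (1 - (norm w)\<^sup>2) powr (- \<epsilon>))"
        using A0 B0 by (auto simp: norm_mult)
    qed
  qed measurable
  moreover have "(\<lambda>i. \<integral>w. (if S i < \<rho> then ?g i w else 0) \<partial>nu \<alpha>) \<longlonglongrightarrow> T (cut_ball (\<lambda>z. f (r *\<^sub>R z)))"
    by (rule tendsto_eventually) (use ev eq in \<open>auto elim!: eventually_mono\<close>)
  ultimately show "T (cut_ball (\<lambda>z. f (r *\<^sub>R z))) = (\<integral>z. f (r *\<^sub>R z) * cnj (G ?N z) \<partial>nu \<alpha>)"
    using LIMSEQ_unique by blast
qed

text \<open>Iteration of \<open>radial_deriv_G\<close>: each step contributes the exponent already
  present and the next one. The existence of coefficients is enough, as they only enter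
  constants.\<close>

lemma radial_deriv_funpow_G:
  assumes s: "s > 0"
  shows "\<exists>c. \<forall>w\<in>ball 0 1. (radial_deriv ^^ k) (G s) w = (\<Sum>i\<le>k. c i * G (s + real i) w)"
proof (induction k)
  case 0
  show ?case by (intro exI[of _ "\<lambda>_. 1"]) simp
next
  case (Suc k)
  then obtain c where c: "\<And>w. w \<in> ball 0 1 \<Longrightarrow> (radial_deriv ^^ k) (G s) w = (\<Sum>i\<le>k. c i * G (s + real i) w)" by blast
  define d where "d = (\<lambda>i. (if i = 0 then 0 else c (i - 1) * of_real (s + real (i - 1))) - (if i \<le> k then c i * of_real (s + real i) else 0))"
  have hol: "holomorphic_Cn_on (\<lambda>w. c i * G (s + real i) w) (ball 0 1)" for i
    using s by (intro holomorphic_Cn_on_cmult hol_ballD G_hol) simp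
  have "(radial_deriv ^^ Suc k) (G s) w = (\<Sum>i\<le>Suc k. d i * G (s + real i) w)" if w: "w \<in> ball 0 1" for w
  proof -
    have "(radial_deriv ^^ Suc k) (G s) w = radial_deriv (\<lambda>w. \<Sum>i\<le>k. c i * G (s + real i) w) w"
      by (simp, rule radial_deriv_cong[OF open_ball w c])
    also have "\<dots> = (\<Sum>i\<le>k. radial_deriv (\<lambda>w. c i * G (s + real i) w) w)"
      by (rule radial_deriv_sum[OF _ hol w]) simp
    also have "\<dots> = (\<Sum>i\<le>k. c i * (of_real (s + real i) * (G (s + real i + 1) w - G (s + real i) w)))"
    proof (rule sum.cong[OF refl])
      fix i
      have si: "s + real i > 0" using s by simp
      show "radial_deriv (\<lambda>w. c i * G (s + real i) w) w = c i * (of_real (s + real i) * (G (s + real i + 1) w - G (s + real i) w))"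
        by (simp only: radial_deriv_cmult[OF hol_ballD[OF G_hol[OF si]] w] radial_deriv_G[OF w si])
    qed
    also have "\<dots> = (\<Sum>i\<le>k. c i * of_real (s + real i) * G (s + real (Suc i)) w) - (\<Sum>i\<le>k. c i * of_real (s + real i) * G (s + real i) w)"
      by (simp add: sum_subtractf[symmetric] algebra_simps)
    also have "(\<Sum>i\<le>k. c i * of_real (s + real i) * G (s + real (Suc i)) w)
      = (\<Sum>i\<le>Suc k. (if i = 0 then 0 else c (i - 1) * of_real (s + real (i - 1))) * G (s + real i) w)"
      by (subst sum.atMost_Suc_shift) simp
    also have "(\<Sum>i\<le>k. c i * of_real (s + real i) * G (s + real i) w)
      = (\<Sum>i\<le>Suc k. (if i \<le> k then c i * of_real (s + real i) else 0) * G (s + real i) w)"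
      by simp
    finally show ?thesis by (simp only: d_def sum_subtractf[symmetric] left_diff_distrib)
  qed
  thus ?case by blast
qed

end

section \<open>The operators \<open>(R + s) (R + s + 1) \<dots> (R + s + k - 1)\<close>\<close>

text \<open>Homogeneous polynomials of degree \<open>j\<close> are multiplied by
  \<open>pochhammer (s + j) k\<close>. In contrast to a power of \<open>R\<close>, this operator
  sends \<open>G s\<close> to a multiple of the single function \<open>G (s + k)\<close>.\<close>

primrec shifted_radial :: "real \<Rightarrow> nat \<Rightarrow> (complex^'n \<Rightarrow> complex) \<Rightarrow> complex^'n \<Rightarrow> complex" where
  "shifted_radial s 0 f = f"
| "shifted_radial s (Suc i) f = (\<lambda>z. radial_deriv (shifted_radial s i f) z + of_real (s + real i) * shifted_radial s i f z)"

lemma holomorphic_shifted_radial: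
  "holomorphic_Cn_on f (ball 0 1) \<Longrightarrow> holomorphic_Cn_on (shifted_radial s k f) (ball 0 1)"
  by (induction k) (auto intro!: holomorphic_Cn_on_add holomorphic_Cn_on_cmult holomorphic_radial_deriv)

lemma shifted_radial_expand:
  assumes f: "holomorphic_Cn_on f (ball 0 1)"
  shows "\<exists>c. \<forall>z\<in>ball 0 1. shifted_radial s k f z = (\<Sum>m\<le>k. c m * (radial_deriv ^^ m) f z)"
proof (induction k)
  case 0
  show ?case by (intro exI[of _ "\<lambda>_. 1"]) simp
next
  case (Suc k)
  then obtain c where c: "\<And>z. z \<in> ball 0 1 \<Longrightarrow> shifted_radial s k f z = (\<Sum>m\<le>k. c m * (radial_deriv ^^ m) f z)" by blast
  define d where "d = (\<lambda>m. (if m = 0 then 0 else c (m - 1)) + (if m \<le> k then of_real (s + real k) * c m else 0))"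
  note hol = holomorphic_radial_deriv_funpow[OF f]
  have "shifted_radial s (Suc k) f z = (\<Sum>m\<le>Suc k. d m * (radial_deriv ^^ m) f z)" if z: "z \<in> ball 0 1" for z
  proof -
    have "radial_deriv (shifted_radial s k f) z = radial_deriv (\<lambda>z. \<Sum>m\<le>k. c m * (radial_deriv ^^ m) f z) z"
      by (rule radial_deriv_cong[OF open_ball z c])
    also have "\<dots> = (\<Sum>m\<le>k. radial_deriv (\<lambda>z. c m * (radial_deriv ^^ m) f z) z)"
      by (rule radial_deriv_sum[OF _ holomorphic_Cn_on_cmult[OF hol] z]) simp
    also have "\<dots> = (\<Sum>m\<le>k. c m * (radial_deriv ^^ Suc m) f z)"
      by (rule sum.cong[OF refl]) (simp add: radial_deriv_cmult[OF hol z])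
    also have "\<dots> = (\<Sum>m\<le>Suc k. (if m = 0 then 0 else c (m - 1)) * (radial_deriv ^^ m) f z)"
      by (subst sum.atMost_Suc_shift) simp
    finally have 1: "radial_deriv (shifted_radial s k f) z = \<dots>" .
    have 2: "of_real (s + real k) * shifted_radial s k f z = (\<Sum>m\<le>Suc k. (if m \<le> k then of_real (s + real k) * c m else 0) * (radial_deriv ^^ m) f z)"
      unfolding c[OF z] by (simp add: sum_distrib_left mult.assoc)
    show ?thesis
      unfolding shifted_radial.simps 1 2 by (simp only: d_def sum.distrib[symmetric] distrib_right)
  qed
  thus ?case by blast
qed

text \<open>Along a ray \<open>t powr c * e (t z)\<close> is constant, and it tends to \<open>0\<close> with \<open>t\<close>.\<close>

lemma radial_deriv_eigen_trivial:
  fixes e :: "complex^'n \<Rightarrow> complex"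
  assumes hol: "holomorphic_Cn_on e (ball 0 1)" and c: "c > 0"
    and eq: "\<And>z. z \<in> ball 0 1 \<Longrightarrow> radial_deriv e z + of_real c * e z = 0" and z: "z \<in> ball 0 1"
  shows "e z = 0"
proof -
  obtain M where M: "M \<ge> 0" "\<And>z. norm z \<le> 1 / 2 \<Longrightarrow> norm (e z) \<le> M"
    using bounded_on_half_ball[OF hol] by blast
  have tz: "t *\<^sub>R z \<in> ball 0 1" if "0 < t" "t \<le> 1" for t
    using dilate_in_ball[OF z, of t] that by simp
  define \<psi> where "\<psi> = (\<lambda>t. of_real (t powr c) * e (t *\<^sub>R z))"
  have d: "(\<psi> has_vector_derivative 0) (at t)" if t: "0 < t" "t \<le> 1" for t
  proof -
    have "((\<lambda>t. t powr c) has_real_derivative (c * t powr (c - 1))) (at t)"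
      using t by (auto intro!: derivative_eq_intros)
    hence "((\<lambda>t. complex_of_real (t powr c)) has_vector_derivative of_real (c * t powr (c - 1))) (at t)"
      by (intro has_vector_derivative_of_real) (simp add: has_real_derivative_iff_has_vector_derivative)
    from has_vector_derivative_mult[OF this vector_derivative_along_ray[OF hol t(1) tz[OF t]]]
    have "(\<psi> has_vector_derivative (of_real (t powr c) * (radial_deriv e (t *\<^sub>R z) / of_real t) + of_real (c * t powr (c - 1)) * e (t *\<^sub>R z))) (at t)"
      unfolding \<psi>_def .
    also have "of_real (t powr c) * (radial_deriv e (t *\<^sub>R z) / of_real t) + of_real (c * t powr (c - 1)) * e (t *\<^sub>R z)
      = of_real (t powr (c - 1)) * (radial_deriv e (t *\<^sub>R z) + of_real c * e (t *\<^sub>R z))"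
    proof -
      have "t powr c = t * t powr (c - 1)" using t by (simp add: powr_diff)
      hence "complex_of_real (t powr c) = of_real t * of_real (t powr (c - 1))" by (simp only: of_real_mult)
      thus ?thesis using t by (simp add: algebra_simps)
    qed
    also have "\<dots> = 0" using eq[OF tz[OF t]] by simp
    finally show ?thesis .
  qed
  have le: "norm (e z) \<le> \<delta> powr c * M" if \<delta>: "0 < \<delta>" "\<delta> \<le> 1 / 2" for \<delta>
  proof -
    have "norm (\<psi> 1 - \<psi> \<delta>) \<le> 0 - (0::real)"
    proof (rule differentiable_bound_general[where f' = "\<lambda>_. 0" and \<phi>' = "\<lambda>_. 0" and \<phi> = "\<lambda>_. 0"])
      show "continuous_on {\<delta>..1} \<psi>"
        using \<delta> by (intro continuous_at_imp_continuous_on ballI has_vector_derivative_continuous[OF d]) auto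
    qed (use \<delta> d in auto)
    hence "e z = of_real (\<delta> powr c) * e (\<delta> *\<^sub>R z)" by (simp add: \<psi>_def)
    hence "norm (e z) = \<delta> powr c * norm (e (\<delta> *\<^sub>R z))" by (simp add: norm_mult)
    also have "norm (\<delta> *\<^sub>R z) \<le> 1 / 2 * 1" using z \<delta> unfolding norm_scaleR by (intro mult_mono) auto
    hence "\<delta> powr c * norm (e (\<delta> *\<^sub>R z)) \<le> \<delta> powr c * M" by (intro mult_left_mono M) auto
    finally show ?thesis .
  qed
  have "(\<lambda>i. (1 / (real i + 2)) powr c * M) \<longlonglongrightarrow> 0" using c by real_asymp
  moreover have "norm (e z) \<le> (1 / (real i + 2)) powr c * M" for i by (rule le) (auto simp: divide_simps)
  ultimately have "norm (e z) \<le> 0" by (intro LIMSEQ_le_const) auto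
  thus ?thesis by simp
qed

text \<open>The factors are removed from the outermost inwards: each is \<open>R + c\<close> with
  \<open>c > 0\<close>, whose holomorphic kernel on the ball is trivial.\<close>

lemma shifted_radial_inj:
  assumes f: "f \<in> hol_ball" and g: "g \<in> hol_ball" and s: "s > 0"
    and eq: "\<And>z. z \<in> ball 0 1 \<Longrightarrow> shifted_radial s k f z = shifted_radial s k g z"
  shows "f = g"
proof -
  have "\<forall>z\<in>ball 0 1. f z = g z"
    using eq
  proof (induction k)
    case (Suc k)
    let ?e = "\<lambda>z. shifted_radial s k f z - shifted_radial s k g z"
    note hf = holomorphic_shifted_radial[OF hol_ballD[OF f], of s k]
    note hg = holomorphic_shifted_radial[OF hol_ballD[OF g], of s k]
    have "?e z = 0" if z: "z \<in> ball 0 1" for z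
    proof (rule radial_deriv_eigen_trivial[where c = "s + real k"])
      show "holomorphic_Cn_on ?e (ball 0 1)" by (rule holomorphic_Cn_on_diff[OF hf hg])
      show "s + real k > 0" using s by simp
      fix z :: "complex^'a" assume z: "z \<in> ball 0 1"
      have "radial_deriv (\<lambda>z. shifted_radial s k f z + (- 1) * shifted_radial s k g z) z
        = radial_deriv (shifted_radial s k f) z + radial_deriv (\<lambda>z. (- 1) * shifted_radial s k g z) z"
        by (rule radial_deriv_add[OF hf holomorphic_Cn_on_cmult[OF hg] z])
      hence r: "radial_deriv ?e z = radial_deriv (shifted_radial s k f) z - radial_deriv (shifted_radial s k g) z"
        using radial_deriv_cmult[OF hg z, of "-1"] by simp
      have "radial_deriv (shifted_radial s k f) z + of_real (s + real k) * shifted_radial s k f z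
        = radial_deriv (shifted_radial s k g) z + of_real (s + real k) * shifted_radial s k g z"
        using Suc.prems[OF z] by (simp only: shifted_radial.simps)
      thus "radial_deriv ?e z + of_real (s + real k) * ?e z = 0"
        unfolding r right_diff_distrib by (simp only: add_diff_add[symmetric] right_minus_eq)
    qed (rule z)
    hence "shifted_radial s k f z = shifted_radial s k g z" if "z \<in> ball 0 1" for z
      using that by (simp only: right_minus_eq)
    thus ?case using Suc.IH by blast
  qed simp
  thus ?thesis using f g by (auto simp: hol_ball_def fun_eq_iff)
qed

lemma (in sup_functional) shifted_radial_G:
  assumes s: "s > 0"
  shows "w \<in> ball 0 1 \<Longrightarrow> shifted_radial s k (G s) w = of_real (pochhammer s k) * G (s + real k) w"
proof (induction k arbitrary: w)
  case (Suc k)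
  have sk: "s + real k > 0" using s by simp
  have "radial_deriv (shifted_radial s k (G s)) w = radial_deriv (\<lambda>w. of_real (pochhammer s k) * G (s + real k) w) w"
    by (rule radial_deriv_cong[OF open_ball Suc.prems Suc.IH])
  also have "\<dots> = of_real (pochhammer s k) * (of_real (s + real k) * (G (s + real k + 1) w - G (s + real k) w))"
    by (simp only: radial_deriv_cmult[OF hol_ballD[OF G_hol[OF sk]] Suc.prems] radial_deriv_G[OF Suc.prems sk])
  finally show ?case using Suc.IH[OF Suc.prems]
    by (simp add: pochhammer_Suc algebra_simps)
qed simp

section \<open>Duality\<close>

context growth_fn
begin

text \<open>With \<open>b = p * (N + k)\<close> lower type bounds
  \<open>\<Phi> (|\<phi>| / l)\<close> by a constant times \<open>y powr (b - N)\<close> times the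
  kernel modulus to the power \<open>- b\<close>, and the Forelli-Rudin estimate cancels the power
  of \<open>y\<close>. The hypothesis on \<open>k\<close> says exactly that \<open>b > N\<close>.
  The function \<phi> only has to be dominated by the kernel, which admits smaller exponents
  too.\<close>

lemma kernel_lux_norm_bound:
  assumes \<alpha>: "\<alpha> > -1" and k: "real k > (1 / p - 1) * (real CARD('n) + 1 + \<alpha>)" and E: "E > 0"
  obtains D where "D > 0"
    "\<And>(w::complex^'n) \<phi>. w \<in> ball 0 1 \<Longrightarrow>
      (\<And>z. z \<in> ball 0 1 \<Longrightarrow> norm (\<phi> z) \<le> E * norm (1 - herm z w) powr (- (real CARD('n) + 1 + \<alpha> + real k))) \<Longrightarrow>
      lux_norm \<alpha> \<Phi> \<phi> \<le> D * ((1 - (norm w)\<^sup>2) powr (- real k) * rho_of \<Phi> ((1 - (norm w)\<^sup>2) powr (real CARD('n) + 1 + \<alpha>)))"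
proof -
  define N where "N = real CARD('n) + 1 + \<alpha>"
  have N: "N > 0" using \<alpha> by (simp add: N_def add_pos_nonneg)
  define m where "m = N + real k"
  have m: "m > 0" using N by (simp add: m_def)
  define b where "b = p * m"
  have "p * ((1 / p - 1) * N) < p * real k" using k p by (intro mult_strict_left_mono) (auto simp: N_def)
  hence b: "b > N" using p by (simp add: b_def m_def algebra_simps)
  obtain F where F: "F > 0" "\<And>w::complex^'n. w \<in> ball 0 1 \<Longrightarrow> (\<integral>\<^sup>+z. ennreal (norm (1 - herm z w) powr (- b)) \<partial>nu \<alpha>)
       \<le> ennreal (F * (1 - (norm w)\<^sup>2) powr (N - b))"
    using forelli_rudin[OF \<alpha> b[unfolded N_def]] unfolding N_def by blast
  \<comment> \<open>Makes \<open>L * \<delta> powr p * F \<le> 1\<close>, so that the integral is at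
    most 1 and not merely bounded; the minimum with 1 keeps lower type applicable.\<close>
  define \<delta> where "\<delta> = min 1 ((1 / (L * F)) powr (1 / p))"
  have LF: "L * F > 0" using L F by simp
  have \<delta>: "0 < \<delta>" "\<delta> \<le> 1" using LF by (auto simp: \<delta>_def)
  have "\<delta> powr p \<le> ((1 / (L * F)) powr (1 / p)) powr p" using \<delta> p by (intro powr_mono2) (auto simp: \<delta>_def)
  also have "\<dots> = 1 / (L * F)" using LF p by (simp add: powr_powr)
  finally have "L * F * \<delta> powr p \<le> L * F * (1 / (L * F))" using LF by (intro mult_left_mono) auto
  also have "\<dots> = 1"
    by (simp only: times_divide_eq_right mult_1_right divide_self[OF less_imp_neq[OF LF, symmetric]])
  finally have \<delta>p: "L * \<delta> powr p * F \<le> 1" by (simp only: mult_ac)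
  define D where "D = E * 2 powr m / \<delta>"
  have D: "D > 0" using E \<delta> by (simp add: D_def)
  have "lux_norm \<alpha> \<Phi> \<phi> \<le> D * ((1 - (norm w)\<^sup>2) powr (- real k) * rho_of \<Phi> ((1 - (norm w)\<^sup>2) powr N))"
    if w: "w \<in> ball 0 1" and \<phi>: "\<And>z. z \<in> ball 0 1 \<Longrightarrow> norm (\<phi> z) \<le> E * norm (1 - herm z w) powr (- m)"
    for w :: "complex^'n" and \<phi>
  proof -
    define y where "y = 1 - (norm w)\<^sup>2"
    have y: "y > 0" unfolding y_def by (rule one_minus_norm_sq_pos[OF w])
    define Q where "Q = q (y powr (- N))"
    have Q: "Q > 0" unfolding Q_def using y by (intro q_pos) simp
    define l where "l = D * (y powr (- real k) * rho_of \<Phi> (y powr N))"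
    have ld: "l = D * y powr (- m) / Q"
    proof -
      have "- m = - real k + - N" by (simp add: m_def)
      hence "y powr (- m) = y powr (- real k) * y powr (- N)" by (simp only: powr_add)
      thus ?thesis using y by (simp add: l_def rho_of_powr Q_def)
    qed
    have l: "l > 0" unfolding ld using D y Q by simp
    have pt: "\<Phi> (norm (\<phi> z) / l) \<le> L * \<delta> powr p * y powr (b - N) * norm (1 - herm z w) powr (- b)" if z: "z \<in> ball 0 1" for z
    proof -
      define d where "d = norm (1 - herm z w)"
      have yd: "y \<le> 2 * d" using one_minus_norm_sq_le_two[OF z w] by (simp add: y_def d_def)
      hence d: "d > 0" using y by linarith
      define \<tau> where "\<tau> = (y / (2 * d)) powr m"
      have \<tau>: "0 \<le> \<tau>" "\<tau> \<le> 1" using y d yd m by (auto simp: \<tau>_def intro!: powr_le1)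
      have \<tau>e: "\<tau> = y powr m / (2 powr m * d powr m)" using y d by (simp only: \<tau>_def powr_divide powr_mult)
      have "norm (\<phi> z) / l \<le> E * d powr (- m) / l" using \<phi>[OF z] l by (intro divide_right_mono) (auto simp: d_def)
      also have "\<dots> = Q * (\<delta> * \<tau>)"
      proof -
        have "d powr m > 0" "y powr m > 0" using d y by simp_all
        thus ?thesis unfolding ld \<tau>e D_def powr_minus using E \<delta> Q by (simp add: field_simps)
      qed
      finally have "\<Phi> (norm (\<phi> z) / l) \<le> \<Phi> (Q * (\<delta> * \<tau>))" using l by (intro Phi_mono) auto
      also have "\<dots> \<le> L * (\<delta> * \<tau>) powr p * \<Phi> Q" using Q \<delta> \<tau> by (intro Phi_lower) (auto intro: mult_le_one)
      also have "\<Phi> Q = y powr (- N)" unfolding Q_def by (intro Phi_q) simp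
      also have "L * (\<delta> * \<tau>) powr p * y powr (- N) = L * \<delta> powr p * (\<tau> powr p * y powr (- N))"
        using \<delta> \<tau> by (simp add: powr_mult)
      also have "\<tau> powr p = y powr b / (2 powr b * d powr b)"
        using y d by (simp add: \<tau>_def b_def powr_powr powr_divide powr_mult mult.commute)
      also have "y powr b / (2 powr b * d powr b) * y powr (- N) = y powr (b - N) * d powr (- b) / 2 powr b"
        using y d by (simp add: powr_diff powr_minus field_simps)
      also have "L * \<delta> powr p * (y powr (b - N) * d powr (- b) / 2 powr b) \<le> L * \<delta> powr p * (y powr (b - N) * d powr (- b) / 1)"
        using L b N by (intro mult_left_mono divide_left_mono) (auto simp: ge_one_powr_ge_zero)
      finally show ?thesis by (simp add: d_def mult_ac)
    qed
    have "(\<integral>\<^sup>+z. ennreal (\<Phi> (norm (\<phi> z) / l)) \<partial>nu \<alpha>)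
      \<le> (\<integral>\<^sup>+z. ennreal (L * \<delta> powr p * y powr (b - N)) * ennreal (norm (1 - herm z w) powr (- b)) \<partial>nu \<alpha>)"
    proof (rule nn_integral_nu_mono)
      fix z :: "complex^'n" assume "z \<in> ball 0 1"
      from ennreal_leI[OF pt[OF this]]
      show "ennreal (\<Phi> (norm (\<phi> z) / l)) \<le> ennreal (L * \<delta> powr p * y powr (b - N)) * ennreal (norm (1 - herm z w) powr (- b))"
        using L by (subst ennreal_mult'[symmetric]) auto
    qed
    also have "\<dots> = ennreal (L * \<delta> powr p * y powr (b - N)) * (\<integral>\<^sup>+z. ennreal (norm (1 - herm z w) powr (- b)) \<partial>nu \<alpha>)"
      by (rule nn_integral_cmult) measurable
    also have "\<dots> \<le> ennreal (L * \<delta> powr p * y powr (b - N)) * ennreal (F * y powr (N - b))"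
      using F(2)[OF w] unfolding y_def by (rule mult_left_mono) simp
    also have "\<dots> = ennreal (L * \<delta> powr p * y powr (b - N) * (F * y powr (N - b)))"
      using L by (subst ennreal_mult'[symmetric]) auto
    also have "L * \<delta> powr p * y powr (b - N) * (F * y powr (N - b)) = L * \<delta> powr p * F * (y powr (b - N) * y powr (N - b))"
      by (simp only: mult_ac)
    also have "y powr (b - N) * y powr (N - b) = 1" using y by (simp add: powr_add[symmetric])
    also have "ennreal (L * \<delta> powr p * F * 1) \<le> 1" using \<delta>p by simp
    finally show ?thesis unfolding y_def[symmetric] l_def[symmetric] by (rule lux_norm_leI[OF l])
  qed
  thus ?thesis using that[OF D] unfolding N_def m_def by blast
qed

text \<open>As \<rho> is bounded, \<open>R^k g\<close> grows at most like the power
  \<open>- k\<close>, and each integration along rays gains one power. The slack \<epsilon> keeps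
  the exponent above 1 in the last integration, where a logarithm would otherwise appear.\<close>

lemma Gamma_space_growth:
  fixes g :: "complex^'n \<Rightarrow> complex"
  assumes \<alpha>: "\<alpha> > -1" and g: "g \<in> Gamma_space \<alpha> (1 / p - 1) (rho_of \<Phi>)" and \<epsilon>: "\<epsilon> > 0"
  obtains A where "\<And>z. z \<in> ball 0 1 \<Longrightarrow> norm (g z) \<le> A * (1 - (norm z)\<^sup>2) powr (- \<epsilon>)"
proof -
  let ?N = "real CARD('n) + 1 + \<alpha>"
  have N: "?N > 0" using \<alpha> by (simp add: add_pos_nonneg)
  obtain k C where C: "C > 0" "\<And>z. z \<in> ball 0 1 \<Longrightarrow> norm ((radial_deriv ^^ k) g z)
      \<le> C * (1 - (norm z)\<^sup>2) powr (- real k) * rho_of \<Phi> ((1 - (norm z)\<^sup>2) powr ?N)"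
    and gh: "g \<in> hol_ball"
    using g unfolding Gamma_space_def mem_Collect_eq by blast
  have "\<exists>B. \<forall>z\<in>ball 0 1. norm ((radial_deriv ^^ (k - j)) g z) \<le> B * (1 - (norm z)\<^sup>2) powr (- (real (k - j) + \<epsilon>))" for j
  proof (induction j)
    case 0
    have "norm ((radial_deriv ^^ k) g z) \<le> C / q 1 * (1 - (norm z)\<^sup>2) powr (- (real k + \<epsilon>))" if z: "z \<in> ball 0 1" for z
    proof -
      define x where "x = 1 - (norm z)\<^sup>2"
      have x: "0 < x" "x \<le> 1" unfolding x_def using one_minus_norm_sq_pos[OF z] by auto
      have "norm ((radial_deriv ^^ k) g z) \<le> C * x powr (- real k) * rho_of \<Phi> (x powr ?N)" using C(2)[OF z] by (simp add: x_def)
      also have "\<dots> \<le> C * x powr (- (real k + \<epsilon>)) * (1 / q 1)"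
        using C x rho_bounded[OF x N] \<epsilon> by (intro mult_mono powr_mono') auto
      finally show ?thesis by (simp add: x_def)
    qed
    thus ?case by (intro exI[of _ "C / q 1"] ballI) simp
  next
    case (Suc j)
    show ?case
    proof (cases "j < k")
      case True
      have kj: "k - j = Suc (k - Suc j)" using True by simp
      from Suc obtain B where B: "\<And>z. z \<in> ball 0 1 \<Longrightarrow> norm ((radial_deriv ^^ (k - j)) g z) \<le> B * (1 - (norm z)\<^sup>2) powr (- (real (k - j) + \<epsilon>))"
        by blast
      obtain B' where B': "\<And>z. z \<in> ball 0 1 \<Longrightarrow> norm ((radial_deriv ^^ (k - Suc j)) g z) \<le> B' * (1 - (norm z)\<^sup>2) powr (- ((real (k - j) + \<epsilon>) - 1))"
      proof (rule growth_of_radial_primitive[OF holomorphic_radial_deriv_funpow[OF hol_ballD[OF gh]]])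
        show "real (k - j) + \<epsilon> > 1" using kj \<epsilon> by simp
        show "norm (radial_deriv ((radial_deriv ^^ (k - Suc j)) g) z) \<le> B * (1 - (norm z)\<^sup>2) powr (- (real (k - j) + \<epsilon>))"
          if "z \<in> ball 0 1" for z
          using B[OF that] unfolding kj by simp
      qed blast
      have "real (k - j) + \<epsilon> - 1 = real (k - Suc j) + \<epsilon>" using kj by simp
      thus ?thesis using B' by (intro exI[of _ B'] ballI) (simp only:)
    next
      case False
      thus ?thesis using Suc by simp
    qed
  qed
  from this[of k] obtain B where "\<forall>z\<in>ball 0 1. norm (g z) \<le> B * (1 - (norm z)\<^sup>2) powr (- \<epsilon>)" by auto
  thus ?thesis using that[of B] by blast
qed

lemma symbol_in_Gamma_space:
  assumes \<alpha>: "\<alpha> > -1" and T: "bounded_functional \<alpha> \<Phi> (T :: (complex^'n \<Rightarrow> complex) \<Rightarrow> complex)" and S: "sup_functional T C"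
  shows "sup_functional.G T (real CARD('n) + 1 + \<alpha>) \<in> Gamma_space \<alpha> (1 / p - 1) (rho_of \<Phi>)"
proof -
  interpret sup_functional T C by (rule S)
  let ?N = "real CARD('n) + 1 + \<alpha>"
  have N: "?N > 0" using \<alpha> by (simp add: add_pos_nonneg)
  obtain A where A: "\<And>f. f \<in> bergman_orlicz \<alpha> \<Phi> \<Longrightarrow> norm (T f) \<le> A * lux_norm \<alpha> \<Phi> f"
    using T unfolding bounded_functional_def by blast
  obtain k :: nat where k: "real k > (1 / p - 1) * ?N" using reals_Archimedean2 by blast
  obtain D where D: "D > 0"
    "\<And>(w::complex^'n) \<phi>. w \<in> ball 0 1 \<Longrightarrow>
      (\<And>z. z \<in> ball 0 1 \<Longrightarrow> norm (\<phi> z) \<le> 2 ^ k * norm (1 - herm z w) powr (- (?N + real k))) \<Longrightarrow>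
      lux_norm \<alpha> \<Phi> \<phi> \<le> D * ((1 - (norm w)\<^sup>2) powr (- real k) * rho_of \<Phi> ((1 - (norm w)\<^sup>2) powr ?N))"
    by (rule kernel_lux_norm_bound[OF \<alpha> k, of "2 ^ k"]) auto
  obtain c where c: "\<And>w. w \<in> ball 0 1 \<Longrightarrow> (radial_deriv ^^ k) (G ?N) w = (\<Sum>i\<le>k. c i * G (?N + real i) w)"
    using radial_deriv_funpow_G[OF N] by blast
  define W where "W = (\<lambda>w::complex^'n. (1 - (norm w)\<^sup>2) powr (- real k) * rho_of \<Phi> ((1 - (norm w)\<^sup>2) powr ?N))"
  \<comment> \<open>All exponents up to \<open>N + k\<close> are treated at once:
    \<open>|1 - herm z w| \<le> 2\<close> bounds the kernels of smaller exponent by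
    \<open>2 ^ k\<close> times the one of exponent \<open>N + k\<close>.\<close>
  have Gb: "norm (G (?N + real i) w) \<le> max A 0 * (D * W w)" if i: "i \<le> k" and w: "w \<in> ball 0 1" for i w
  proof -
    let ?\<phi> = "cut_ball (\<lambda>z. kern (?N + real i) (herm z w))"
    have \<phi>: "?\<phi> \<in> bergman_orlicz \<alpha> \<Phi>"
      by (rule bounded_hol_bergman_orlicz[OF \<alpha> kern_bounded_hol[OF w]]) (use N in simp)
    have "lux_norm \<alpha> \<Phi> ?\<phi> \<le> D * W w" unfolding W_def
    proof (rule D(2)[OF w])
      fix z :: "complex^'n" assume z: "z \<in> ball 0 1"
      define d where "d = norm (1 - herm z w)"
      have d: "0 < d" "d \<le> 2"
      proof -
        show "0 < d" using one_minus_norm_sq_le_two(1)[OF z w] one_minus_norm_sq_pos[OF w] unfolding d_def by linarith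
        show "d \<le> 2" using norm_triangle_ineq4[of 1 "herm z w"] norm_herm_lt[OF z w] by (simp add: d_def)
      qed
      have e: "- (?N + real i) = real (k - i) + - (?N + real k)" using i by (simp add: of_nat_diff)
      have "norm (?\<phi> z) = d powr (- (?N + real i))" using z by (simp add: norm_kern d_def)
      also have "\<dots> = d powr (real (k - i)) * d powr (- (?N + real k))" unfolding e by (rule powr_add)
      also have "\<dots> \<le> 2 powr (real k) * d powr (- (?N + real k))"
      proof (rule mult_right_mono)
        have "d powr (real (k - i)) \<le> 2 powr (real (k - i))" using d by (intro powr_mono2) auto
        also have "\<dots> \<le> 2 powr (real k)" by (intro powr_mono) auto
        finally show "d powr (real (k - i)) \<le> 2 powr (real k)" .
      qed simp
      finally show "norm (?\<phi> z) \<le> 2 ^ k * norm (1 - herm z w) powr (- (?N + real k))"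
        by (simp add: powr_realpow d_def)
    qed
    moreover have "norm (G (?N + real i) w) \<le> max A 0 * lux_norm \<alpha> \<Phi> ?\<phi>"
      using A[OF \<phi>] mult_right_mono[OF max.cobounded1[of A 0] lux_norm_nonneg[OF \<phi>]] w by (simp add: G_def)
    ultimately show ?thesis by (meson max.cobounded2 mult_left_mono order_trans)
  qed
  define C' where "C' = (\<Sum>i\<le>k. norm (c i)) * (max A 0 * D) + 1"
  have C': "C' > 0" using D by (simp add: C'_def add_nonneg_pos sum_nonneg)
  have "norm ((radial_deriv ^^ k) (G ?N) w) \<le> C' * (1 - (norm w)\<^sup>2) powr (- real k) * rho_of \<Phi> ((1 - (norm w)\<^sup>2) powr ?N)"
    if w: "w \<in> ball 0 1" for w
  proof -
    have x: "0 < 1 - (norm w)\<^sup>2" by (rule one_minus_norm_sq_pos[OF w])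
    have Wp: "W w \<ge> 0" using rho_bounded(1)[OF x _ N] by (simp add: W_def)
    have "norm ((radial_deriv ^^ k) (G ?N) w) \<le> (\<Sum>i\<le>k. norm (c i * G (?N + real i) w))"
      unfolding c[OF w] by (rule norm_sum)
    also have "\<dots> \<le> (\<Sum>i\<le>k. norm (c i) * (max A 0 * (D * W w)))"
      unfolding norm_mult by (intro sum_mono mult_left_mono Gb w) auto
    also have "\<dots> = (\<Sum>i\<le>k. norm (c i)) * (max A 0 * D) * W w" by (simp only: sum_distrib_right mult.assoc)
    also have "\<dots> \<le> C' * W w" using Wp by (intro mult_right_mono) (auto simp: C'_def)
    finally show ?thesis by (simp add: W_def mult.assoc)
  qed
  thus ?thesis unfolding Gamma_space_def using G_hol[OF N] k C' by blast
qed

lemma pairing_with_symbol: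
  assumes \<alpha>: "\<alpha> > -1" and T: "bounded_functional \<alpha> \<Phi> (T :: (complex^'n \<Rightarrow> complex) \<Rightarrow> complex)" and S: "sup_functional T C"
    and f: "f \<in> bergman_orlicz \<alpha> \<Phi>"
  shows "pairing_exists \<alpha> f (sup_functional.G T (real CARD('n) + 1 + \<alpha>))"
    "T f = pairing \<alpha> f (sup_functional.G T (real CARD('n) + 1 + \<alpha>))"
proof -
  interpret sup_functional T C by (rule S)
  let ?N = "real CARD('n) + 1 + \<alpha>"
  have fh: "f \<in> hol_ball" by (rule bergman_orliczD[OF f])
  \<comment> \<open>Any value strictly between 0 and \<alpha> + 1 serves: positive for
    \<open>Gamma_space_growth\<close>, and below \<alpha> + 1 for integrability against
    \<open>nu \<alpha>\<close>.\<close>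
  define \<epsilon> where "\<epsilon> = (\<alpha> + 1) / 2"
  have \<epsilon>: "0 < \<epsilon>" "0 \<le> \<epsilon>" "\<epsilon> < \<alpha> + 1" using \<alpha> by (simp_all add: \<epsilon>_def)
  obtain A where A: "\<And>z. z \<in> ball 0 1 \<Longrightarrow> norm (G ?N z) \<le> A * (1 - (norm z)\<^sup>2) powr (- \<epsilon>)"
    using Gamma_space_growth[OF \<alpha> symbol_in_Gamma_space[OF \<alpha> T S] \<epsilon>(1)] by blast
  have int: "integrable (nu \<alpha>) (\<lambda>z. f (r *\<^sub>R z) * cnj (G ?N z))"
    and eq: "T (cut_ball (\<lambda>z. f (r *\<^sub>R z))) = dilated_pairing \<alpha> f (G ?N) r" if "0 < r" "r < 1" for r
    using functional_of_dilate[OF \<alpha> fh that \<epsilon>(2,3) A] by (simp_all add: dilated_pairing_def)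
  have lim: "(dilated_pairing \<alpha> f (G ?N) \<longlongrightarrow> T f) (at_left 1)"
  proof (rule tendsto_at_left_sequentially[of 0])
    fix X :: "nat \<Rightarrow> real" assume X: "\<And>n. X n < 1" "\<And>n. 0 < X n" "X \<longlonglongrightarrow> 1"
    from functional_dilates_converge[OF \<alpha> T f X(2,1,3)]
    show "(\<lambda>n. dilated_pairing \<alpha> f (G ?N) (X n)) \<longlonglongrightarrow> T f"
      using eq[OF X(2,1)] by simp
  qed simp
  show "pairing_exists \<alpha> f (G ?N)"
    unfolding pairing_exists_def using int lim by auto
  show "T f = pairing \<alpha> f (G ?N)"
    unfolding pairing_def by (rule tendsto_Lim[OF _ lim, symmetric]) (rule trivial_limit_at_left_real)
qed

text \<open>The functional is \<open>f \<mapsto> \<integral> f cnj (D g) d\<nu>\<close> with weight \<open>\<alpha> + k\<close>, where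
  \<open>D = (R + N) \<dots> (R + N + k - 1)\<close>. Its symbol has the same image under \<open>D\<close> as \<open>g\<close>.\<close>

lemma Gamma_space_imp_symbol:
  fixes g :: "complex^'n \<Rightarrow> complex"
  assumes \<alpha>: "\<alpha> > -1" and g: "g \<in> Gamma_space \<alpha> (1 / p - 1) (rho_of \<Phi>)"
  obtains T C where "bounded_functional \<alpha> \<Phi> T" "sup_functional T C"
    "g = sup_functional.G T (real CARD('n) + 1 + \<alpha>)"
proof -
  define N where "N = real CARD('n) + 1 + \<alpha>"
  have N: "N > 0" using \<alpha> by (simp add: N_def add_pos_nonneg)
  obtain k C0 where k: "real k > (1 / p - 1) * N" and C0: "C0 > 0" "\<And>z. z \<in> ball 0 1 \<Longrightarrow> norm ((radial_deriv ^^ k) g z)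
      \<le> C0 * (1 - (norm z)\<^sup>2) powr (- real k) * rho_of \<Phi> ((1 - (norm z)\<^sup>2) powr N)"
    and gh: "g \<in> hol_ball"
    using g unfolding Gamma_space_def N_def by auto
  define W where "W = (\<lambda>x. x powr (- real k) * rho_of \<Phi> (x powr N))"
  have W1: "W x > 0" if "0 < x" for x
    using that q_pos[of "x powr (- N)"] by (simp add: W_def rho_of_powr)
  have W2: "W x' \<le> L powr (1 / p) * W x" if "0 < x" "x \<le> x'" "x' \<le> 1" for x x'
    unfolding W_def by (rule weight_almost_decreasing[OF N k that(1,2)])
  \<comment> \<open>\<open>shifted_radial N k g\<close> involves all \<open>R^m g\<close> with
    \<open>m \<le> k\<close>, so the bound by \<open>W\<close> is carried down from
    \<open>m = k\<close>.\<close>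
  have lower: "\<exists>B. \<forall>z\<in>ball 0 1. norm ((radial_deriv ^^ (k - j)) g z) \<le> B * W (1 - (norm z)\<^sup>2)" for j
  proof (induction j)
    case 0
    show ?case
      by (intro exI[of _ C0] ballI) (use C0(2) in \<open>simp add: W_def mult.assoc\<close>)
  next
    case (Suc j)
    show ?case
    proof (cases "j < k")
      case True
      have kj: "k - j = Suc (k - Suc j)" using True by simp
      from Suc obtain B where B: "\<And>z. z \<in> ball 0 1 \<Longrightarrow> norm ((radial_deriv ^^ (k - j)) g z) \<le> B * W (1 - (norm z)\<^sup>2)"
        by blast
      have B1: "norm (radial_deriv ((radial_deriv ^^ (k - Suc j)) g) z) \<le> B * W (1 - (norm z)\<^sup>2)" if "z \<in> ball 0 1" for z
        using B[OF that] unfolding kj by simp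
      obtain B' where "\<And>z. z \<in> ball 0 1 \<Longrightarrow> norm ((radial_deriv ^^ (k - Suc j)) g z) \<le> B' * W (1 - (norm z)\<^sup>2)"
        using weighted_bound_of_radial_primitive[OF holomorphic_radial_deriv_funpow[OF hol_ballD[OF gh]] W1 W2 B1] by blast
      thus ?thesis by blast
    next
      case False
      thus ?thesis using Suc by simp
    qed
  qed
  have "\<forall>m. \<exists>B. m \<le> k \<longrightarrow> (\<forall>z\<in>ball 0 1. norm ((radial_deriv ^^ m) g z) \<le> B * W (1 - (norm z)\<^sup>2))"
  proof
    fix m show "\<exists>B. m \<le> k \<longrightarrow> (\<forall>z\<in>ball 0 1. norm ((radial_deriv ^^ m) g z) \<le> B * W (1 - (norm z)\<^sup>2))"
      using lower[of "k - m"] by (cases "m \<le> k") auto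
  qed
  then obtain B where B: "\<And>m z. m \<le> k \<Longrightarrow> z \<in> ball 0 1 \<Longrightarrow> norm ((radial_deriv ^^ m) g z) \<le> B m * W (1 - (norm z)\<^sup>2)"
    by metis
  obtain c where c: "\<And>z. z \<in> ball 0 1 \<Longrightarrow> shifted_radial N k g z = (\<Sum>m\<le>k. c m * (radial_deriv ^^ m) g z)"
    using shifted_radial_expand[OF hol_ballD[OF gh]] by blast
  define u where "u = cut_ball (shifted_radial N k g)"
  have u: "u \<in> hol_ball" unfolding u_def by (intro cut_ball_hol holomorphic_shifted_radial hol_ballD gh)
  have mu [measurable]: "u \<in> borel_measurable borel" by (rule borel_measurable_hol_ball[OF u])
  define A where "A = max (\<Sum>m\<le>k. norm (c m) * B m) 0 + 1"
  have A: "A > 0" by (simp add: A_def add_nonneg_pos)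
  have uA: "norm (u z) \<le> A * W (1 - (norm z)\<^sup>2)" if z: "z \<in> ball 0 1" for z
  proof -
    have w0: "W (1 - (norm z)\<^sup>2) \<ge> 0" using W1[OF one_minus_norm_sq_pos[OF z]] by simp
    have "norm (u z) \<le> (\<Sum>m\<le>k. norm (c m * (radial_deriv ^^ m) g z))"
      using z unfolding u_def by (simp add: c norm_sum)
    also have "\<dots> \<le> (\<Sum>m\<le>k. norm (c m) * (B m * W (1 - (norm z)\<^sup>2)))"
      unfolding norm_mult by (intro sum_mono mult_left_mono B z) auto
    also have "\<dots> = (\<Sum>m\<le>k. norm (c m) * B m) * W (1 - (norm z)\<^sup>2)" by (simp add: sum_distrib_right mult.assoc)
    also have "\<dots> \<le> A * W (1 - (norm z)\<^sup>2)" by (intro mult_right_mono w0) (simp add: A_def)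
    finally show ?thesis .
  qed
  have ak: "\<alpha> + real k > -1" using \<alpha> by simp
  obtain K where K: "K > 0" "\<And>f. f \<in> borel_measurable borel \<Longrightarrow> (\<integral>\<^sup>+z. f z \<partial>nu (\<alpha> + real k))
      = ennreal K * (\<integral>\<^sup>+z. ennreal ((1 - (norm z)\<^sup>2) powr real k) * f (z::complex^'n) \<partial>nu \<alpha>)"
    using nn_integral_nu_shift[OF \<alpha> ak, where 'n = 'n] by blast
  obtain C1 where C1: "C1 > 0"
    "\<And>(f::complex^'n \<Rightarrow> complex) l. f \<in> hol_ball \<Longrightarrow> l > 0 \<Longrightarrow> (\<integral>\<^sup>+z. ennreal (\<Phi> (norm (f z) / l)) \<partial>nu \<alpha>) \<le> 1 \<Longrightarrow>
      (\<integral>\<^sup>+z. ennreal (norm (f z) * rho_of \<Phi> ((1 - (norm z)\<^sup>2) powr N)) \<partial>nu \<alpha>) \<le> ennreal (C1 * l)"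
    using orlicz_weighted_L1_bound[OF \<alpha>, where 'n = 'n] unfolding N_def by blast
  have bound: "(\<integral>\<^sup>+z. ennreal (norm (f z * cnj (u z))) \<partial>nu (\<alpha> + real k)) \<le> ennreal (K * (A * (C1 * l)))"
    if f: "f \<in> hol_ball" and l: "l > 0" "(\<integral>\<^sup>+z. ennreal (\<Phi> (norm (f z) / l)) \<partial>nu \<alpha>) \<le> 1" for f l
  proof -
    have [measurable]: "f \<in> borel_measurable borel" by (rule borel_measurable_hol_ball[OF f])
    have "(\<integral>\<^sup>+z. ennreal (norm (f z * cnj (u z))) \<partial>nu (\<alpha> + real k))
      = ennreal K * (\<integral>\<^sup>+z. ennreal ((1 - (norm z)\<^sup>2) powr real k) * ennreal (norm (f z * cnj (u z))) \<partial>nu \<alpha>)"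
      by (rule K(2)) measurable
    also have "\<dots> \<le> ennreal K * (ennreal A * (\<integral>\<^sup>+z. ennreal (norm (f z) * rho_of \<Phi> ((1 - (norm z)\<^sup>2) powr N)) \<partial>nu \<alpha>))"
    proof (rule mult_left_mono)
      have "(\<integral>\<^sup>+z. ennreal ((1 - (norm z)\<^sup>2) powr real k) * ennreal (norm (f z * cnj (u z))) \<partial>nu \<alpha>)
        \<le> (\<integral>\<^sup>+z. ennreal A * ennreal (norm (f z) * rho_of \<Phi> ((1 - (norm z)\<^sup>2) powr N)) \<partial>nu \<alpha>)"
      proof (rule nn_integral_nu_mono)
        fix z :: "complex^'n" assume z: "z \<in> ball 0 1"
        define x where "x = 1 - (norm z)\<^sup>2"
        have x: "x > 0" unfolding x_def by (rule one_minus_norm_sq_pos[OF z])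
        have "x powr real k * (norm (f z) * norm (u z)) \<le> x powr real k * (norm (f z) * (A * W x))"
          using uA[OF z] by (intro mult_left_mono) (auto simp: x_def)
        also have "\<dots> = A * (norm (f z) * rho_of \<Phi> (x powr N)) * (x powr real k * x powr (- real k))"
          by (simp add: W_def mult_ac)
        also have "x powr real k * x powr (- real k) = 1" using x by (simp add: powr_minus)
        finally have "x powr real k * norm (f z * cnj (u z)) \<le> A * (norm (f z) * rho_of \<Phi> (x powr N))"
          by (simp add: norm_mult)
        from ennreal_leI[OF this]
        show "ennreal ((1 - (norm z)\<^sup>2) powr real k) * ennreal (norm (f z * cnj (u z)))
          \<le> ennreal A * ennreal (norm (f z) * rho_of \<Phi> ((1 - (norm z)\<^sup>2) powr N))"
          using A by (simp add: ennreal_mult' x_def)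
      qed
      also have "\<dots> = ennreal A * (\<integral>\<^sup>+z. ennreal (norm (f z) * rho_of \<Phi> ((1 - (norm z)\<^sup>2) powr N)) \<partial>nu \<alpha>)"
      proof (rule nn_integral_cmult)
        \<comment> \<open>\<open>q\<close> may jump at plateaus of \<Phi>, so measurability of
          \<rho> is derived from monotonicity. Only arguments in \<open>{0..}\<close> are
          controlled, hence the \<open>max\<close>.\<close>
        have "mono (\<lambda>t. q (max t 0))" by (rule monoI) (auto intro: q_mono)
        hence [measurable]: "(\<lambda>t. q (max t 0)) \<in> borel_measurable borel" by (rule borel_measurable_mono)
        have "(\<lambda>z::complex^'n. norm (f z) * (1 / ((1 - (norm z)\<^sup>2) powr N * q (max (1 / (1 - (norm z)\<^sup>2) powr N) 0)))) \<in> borel_measurable borel"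
          by measurable
        thus "(\<lambda>z. ennreal (norm (f z) * rho_of \<Phi> ((1 - (norm z)\<^sup>2) powr N))) \<in> borel_measurable (nu \<alpha>)"
          by (simp add: rho_of_def q_def max_absorb1)
      qed
      finally show "(\<integral>\<^sup>+z. ennreal ((1 - (norm z)\<^sup>2) powr real k) * ennreal (norm (f z * cnj (u z))) \<partial>nu \<alpha>)
        \<le> ennreal A * (\<integral>\<^sup>+z. ennreal (norm (f z) * rho_of \<Phi> ((1 - (norm z)\<^sup>2) powr N)) \<partial>nu \<alpha>)" .
    qed simp
    also have "\<dots> \<le> ennreal K * (ennreal A * ennreal (C1 * l))"
      by (intro mult_left_mono C1 f l) simp_all
    also have "\<dots> = ennreal (K * (A * (C1 * l)))"
      using K(1) A by (simp add: ennreal_mult')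
    finally show ?thesis .
  qed
  have int: "integrable (nu (\<alpha> + real k)) (\<lambda>z. f z * cnj (u z))" if f: "f \<in> bergman_orlicz \<alpha> \<Phi>" for f
  proof (rule integrableI_bounded)
    have [measurable]: "f \<in> borel_measurable borel" by (rule borel_measurable_hol_ball[OF bergman_orliczD(1)[OF f]])
    show "(\<lambda>z. f z * cnj (u z)) \<in> borel_measurable (nu (\<alpha> + real k))" by measurable
    obtain l where "l > 0" "(\<integral>\<^sup>+z. ennreal (\<Phi> (norm (f z) / l)) \<partial>nu \<alpha>) \<le> 1" using lux_norm_witness[OF f] by blast
    from bound[OF bergman_orliczD(1)[OF f] this]
    show "(\<integral>\<^sup>+z. ennreal (norm (f z * cnj (u z))) \<partial>nu (\<alpha> + real k)) < \<infinity>"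
      by (rule le_less_trans) simp
  qed
  \<comment> \<open>The factor by which \<open>shifted_radial N k\<close> multiplies in passing from
    \<open>G N\<close> to \<open>G (N + k)\<close>; dividing by it in \<open>T\<close> makes the
    image of the symbol equal to \<open>u\<close> itself.\<close>
  define P where "P = pochhammer N k"
  have P: "P > 0" unfolding P_def using N by (rule pochhammer_pos)
  define T where "T = (\<lambda>f. of_real (1 / P) * (\<integral>z. f z * cnj (u z) \<partial>nu (\<alpha> + real k)))"
  have T: "bounded_functional \<alpha> \<Phi> T"
    unfolding bounded_functional_def
  proof (intro conjI ballI allI)
    fix f h :: "complex^'n \<Rightarrow> complex" assume "f \<in> bergman_orlicz \<alpha> \<Phi>" "h \<in> bergman_orlicz \<alpha> \<Phi>"
    thus "T (\<lambda>z. f z + h z) = T f + T h"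
      by (simp add: T_def distrib_right int distrib_left add_divide_distrib)
  next
    fix c and f :: "complex^'n \<Rightarrow> complex"
    show "T (\<lambda>z. c * f z) = c * T f" by (simp add: T_def mult.assoc)
  next
    show "\<exists>C. \<forall>f\<in>bergman_orlicz \<alpha> \<Phi>. norm (T f) \<le> C * lux_norm \<alpha> \<Phi> f"
    proof (intro exI[of _ "1 / P * (K * (A * C1))"] ballI)
      fix f :: "complex^'n \<Rightarrow> complex" assume f: "f \<in> bergman_orlicz \<alpha> \<Phi>"
      show "norm (T f) \<le> 1 / P * (K * (A * C1)) * lux_norm \<alpha> \<Phi> f"
      proof (rule le_lux_normI[OF f])
        show "1 / P * (K * (A * C1)) > 0" using P K(1) A C1(1) by simp
        fix l assume l: "l > 0" "(\<integral>\<^sup>+z. ennreal (\<Phi> (norm (f z) / l)) \<partial>nu \<alpha>) \<le> 1"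
        have "ennreal (norm (\<integral>z. f z * cnj (u z) \<partial>nu (\<alpha> + real k))) \<le> ennreal (K * (A * (C1 * l)))"
          by (rule order_trans[OF integral_norm_bound_ennreal[OF int[OF f]] bound[OF bergman_orliczD(1)[OF f] l]])
        hence "norm (\<integral>z. f z * cnj (u z) \<partial>nu (\<alpha> + real k)) \<le> K * (A * (C1 * l))"
          using K(1) A C1(1) l by simp
        hence "1 / P * norm (\<integral>z. f z * cnj (u z) \<partial>nu (\<alpha> + real k)) \<le> 1 / P * (K * (A * (C1 * l)))"
          using P by (intro mult_left_mono) auto
        thus "norm (T f) \<le> 1 / P * (K * (A * C1)) * l"
          using P by (simp add: T_def norm_mult norm_divide mult.assoc)
      qed
    qed
  qed
  obtain C where S: "sup_functional T C" using bounded_functional_imp_sup_functional[OF \<alpha> T] by blast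
  interpret sup_functional T C by (rule S)
  have "shifted_radial N k (G N) w = shifted_radial N k g w" if w: "w \<in> ball 0 1" for w
  proof -
    have "shifted_radial N k (G N) w = of_real P * G (N + real k) w"
      unfolding P_def by (rule shifted_radial_G[OF N w])
    also have "\<dots> = cnj (\<integral>z. cut_ball (\<lambda>z. kern (N + real k) (herm z w)) z * cnj (u z) \<partial>nu (\<alpha> + real k))"
      unfolding G_def using w P by (simp add: T_def)
    also have "\<dots> = (\<integral>z. cnj (cut_ball (\<lambda>z. kern (N + real k) (herm z w)) z * cnj (u z)) \<partial>nu (\<alpha> + real k))"
      by (rule Bochner_Integration.integral_cnj[symmetric])
    also have "\<dots> = (\<integral>z. u z * kern (N + real k) (herm w z) \<partial>nu (\<alpha> + real k))"
    proof (rule integral_nu_cong)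
      have [measurable]: "cut_ball (\<lambda>z. kern (N + real k) (herm z w)) \<in> borel_measurable borel"
        by (intro borel_measurable_hol_ball cut_ball_hol holomorphic_Cn_on_kern_herm w)
      show "(\<lambda>z. cnj (cut_ball (\<lambda>z. kern (N + real k) (herm z w)) z * cnj (u z))) \<in> borel_measurable borel"
        by measurable
      show "cnj (cut_ball (\<lambda>z. kern (N + real k) (herm z w)) z * cnj (u z)) = u z * kern (N + real k) (herm w z)"
        if "z \<in> ball 0 1" for z
        using kern_herm_cnj[OF that w, of "N + real k"] that by (simp add: mult.commute)
    qed measurable
    \<comment> \<open>\<open>kern (N + k)\<close> is the reproducing kernel of weight \<alpha> + k,
      and \<open>u\<close> grows at most like the power \<open>- k\<close>, which is admissible
      because \<open>k < \<alpha> + k + 1\<close>.\<close>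
    also have "\<dots> = u w"
    proof -
      have e: "N + real k = real CARD('n) + 1 + (\<alpha> + real k)" by (simp add: N_def)
      show ?thesis unfolding e
      proof (rule reproducing_formula_growth[OF ak u, of "real k" "A / q 1"])
        fix z :: "complex^'n" assume z: "z \<in> ball 0 1"
        define x where "x = 1 - (norm z)\<^sup>2"
        have x: "0 < x" "x \<le> 1" unfolding x_def using one_minus_norm_sq_pos[OF z] by auto
        have "norm (u z) \<le> A * W x" using uA[OF z] by (simp add: x_def)
        also have "\<dots> \<le> A * (x powr (- real k) * (1 / q 1))"
          unfolding W_def using A rho_bounded[OF x N] by (intro mult_left_mono) auto
        finally show "norm (u z) \<le> A / q 1 * (1 - (norm z)\<^sup>2) powr (- real k)" by (simp add: x_def)
      qed (use \<alpha> w in auto)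
    qed
    also have "u w = shifted_radial N k g w" using w by (simp add: u_def)
    finally show ?thesis .
  qed
  hence "G N = g" by (rule shifted_radial_inj[OF G_hol[OF N] gh N])
  thus ?thesis using that[OF T S] unfolding N_def by simp
qed

end

theorem theorem1p1:
  fixes \<alpha> p :: real and \<Phi> :: "real \<Rightarrow> real"
  assumes "\<alpha> > -1" and "0 < p" and "p \<le> 1" and "\<Phi> \<in> growth_class p"
  shows "(\<forall>g \<in> (Gamma_space \<alpha> (1 / p - 1) (rho_of \<Phi>) :: (complex^'n \<Rightarrow> complex) set).
            (\<forall>f \<in> bergman_orlicz \<alpha> \<Phi>. pairing_exists \<alpha> f g) \<and>
            bounded_functional \<alpha> \<Phi> (\<lambda>f. pairing \<alpha> f g)) \<and>
         (\<forall>T :: (complex^'n \<Rightarrow> complex) \<Rightarrow> complex. bounded_functional \<alpha> \<Phi> T \<longrightarrow>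
            (\<exists>!g. g \<in> Gamma_space \<alpha> (1 / p - 1) (rho_of \<Phi>) \<and>
                  (\<forall>f \<in> bergman_orlicz \<alpha> \<Phi>. T f = pairing \<alpha> f g)))"
proof (intro conjI ballI allI impI)
  interpret growth_fn \<Phi> p by unfold_locales (rule assms)+
  note \<alpha> = assms(1)
  {
    fix g :: "complex^'n \<Rightarrow> complex" assume g: "g \<in> Gamma_space \<alpha> (1 / p - 1) (rho_of \<Phi>)"
    obtain T C where T: "bounded_functional \<alpha> \<Phi> T" "sup_functional T C"
      "g = sup_functional.G T (real CARD('n) + 1 + \<alpha>)"
      using Gamma_space_imp_symbol[OF \<alpha> g] by blast
    note P = pairing_with_symbol[OF \<alpha> T(1,2), folded T(3)]
    show "pairing_exists \<alpha> f g" if "f \<in> bergman_orlicz \<alpha> \<Phi>" for f by (rule P(1)[OF that])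
    \<comment> \<open>Linearity and boundedness of the pairing are inherited from \<open>T\<close>;
      this uses that sums and multiples stay in the space.\<close>
    have "pairing \<alpha> f g = T f" if "f \<in> bergman_orlicz \<alpha> \<Phi>" for f using P(2)[OF that] by simp
    thus "bounded_functional \<alpha> \<Phi> (\<lambda>f. pairing \<alpha> f g)"
      using T(1) unfolding bounded_functional_def by (simp add: bergman_orlicz_add bergman_orlicz_cmult)
  }
  fix T :: "(complex^'n \<Rightarrow> complex) \<Rightarrow> complex" assume T: "bounded_functional \<alpha> \<Phi> T"
  obtain C where S: "sup_functional T C" using bounded_functional_imp_sup_functional[OF \<alpha> T] by blast
  let ?N = "real CARD('n) + 1 + \<alpha>"
  have N: "?N \<ge> 0" using \<alpha> by (simp add: add_nonneg_nonneg)
  show "\<exists>!g. g \<in> Gamma_space \<alpha> (1 / p - 1) (rho_of \<Phi>) \<and> (\<forall>f \<in> bergman_orlicz \<alpha> \<Phi>. T f = pairing \<alpha> f g)"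
  proof (rule ex1I[of _ "sup_functional.G T ?N"])
    show "sup_functional.G T ?N \<in> Gamma_space \<alpha> (1 / p - 1) (rho_of \<Phi>) \<and>
      (\<forall>f \<in> bergman_orlicz \<alpha> \<Phi>. T f = pairing \<alpha> f (sup_functional.G T ?N))"
      using symbol_in_Gamma_space[OF \<alpha> T S] pairing_with_symbol(2)[OF \<alpha> T S] by blast
  next
    fix g :: "complex^'n \<Rightarrow> complex"
    assume g: "g \<in> Gamma_space \<alpha> (1 / p - 1) (rho_of \<Phi>) \<and> (\<forall>f \<in> bergman_orlicz \<alpha> \<Phi>. T f = pairing \<alpha> f g)"
    \<comment> \<open>Uniqueness: a representing \<open>g\<close> is itself the symbol of some
      \<open>T'\<close> that agrees with \<open>T\<close> on the space, and a symbol is determined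
      by the values on kernels, which belong to the space.\<close>
    obtain T' C' where T': "bounded_functional \<alpha> \<Phi> T'" "sup_functional T' C'" "g = sup_functional.G T' ?N"
      using Gamma_space_imp_symbol[OF \<alpha>] g by blast
    have eq: "T' f = T f" if "f \<in> bergman_orlicz \<alpha> \<Phi>" for f
      using pairing_with_symbol(2)[OF \<alpha> T'(1,2) that] g that by (simp add: T'(3)[symmetric])
    have "sup_functional.G T' ?N w = sup_functional.G T ?N w" for w
    proof (cases "w \<in> ball 0 1")
      case True
      have "cut_ball (\<lambda>z. kern ?N (herm z w)) \<in> bergman_orlicz \<alpha> \<Phi>"
        by (rule bounded_hol_bergman_orlicz[OF \<alpha> sup_functional.kern_bounded_hol[OF S True N]])
      thus ?thesis by (simp add: sup_functional.G_def[OF S] sup_functional.G_def[OF T'(2)] eq)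
    qed (simp add: sup_functional.G_def[OF S] sup_functional.G_def[OF T'(2)])
    thus "g = sup_functional.G T ?N" by (simp add: T'(3) fun_eq_iff)
  qed
qed

end
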